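(* Let $S$ be a finite set of points in projective $n$-space $P^n(D)$ over a division ring $D$, with each point coloured red or blue or with both colours. Suppose that for any two distinct points $A,B\in S$ sharing a colour there is a third point $C\in S$, of the other colour, collinear with $A$ and $B$. If $S$ is not coplanar, then \begin{itemize} \item $|S|\geq 15$, with equality if and only if the characteristic of $D$ is $2$ and $S$ is isomorphic to the $3$-dimensional projective space of order $2$; \item $|S|\geq 27$ if the characteristic of $D$ is not $2$, with equality if and only if the characteristic of $D$ is $3$ and $S$ is isomorphic to the $3$-dimensional affine space of order $3$; \item $|S|\geq 51$ if the characteristic of $D$ is not $2$ or $3$. \end{itemize}
   Context: A division ring is an associative, not necessarily commutative, ring with identity in which every non-zero element is invertible. A point may carry one colour or both colours; "red" includes points carrying both colours, and likewise "blue". The hypothesis means: whenever $A\neq B$ in $S$ are both blue, there is a red point $C\in S\setminus\{A,B\}$ on the line $AB$; and whenever $A\neq B$ in $S$ are both red, there is a blue point $C\in S\setminus\{A,B\}$ on the line $AB$. (If $A,B$ share both colours, both requirements apply.) The point $C$ may carry both colours. Coplanar means contained in some $2$-dimensional flat. The set $S$ is regarded as a finite incidence geometry whose lines are the intersections with $S$ of lines of $P^n(D)$ containing at least two points of $S$; "isomorphic" means isomorphic as incidence geometries (a bijection of points mapping lines to lines). The $3$-dimensional projective space of order $2$ is $PG(3,2)=P^3(\mathbb{F}_2)$ and the $3$-dimensional affine space of order $3$ is $AG(3,3)=\mathbb{F}_3^3$. *)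

theory Defs
  imports "HOL-Analysis.Finite_Cartesian_Product" "HOL-Library.Z2"
begin

text \<open>
  Projective \<open>n\<close>-space over a division ring \<open>'a\<close> is the geometry of left subspaces of
  \<open>'a^'n\<close>, where \<open>CARD('n) = n + 1\<close>. The index type is nonempty, so \<open>n\<close> ranges over all
  natural numbers. The linear algebra of the library assumes commutative scalars, so
  spans and independence are spelled out here; in \<open>c *s v\<close> the scalar multiplies from the left.
\<close>

definition left_span :: "nat \<Rightarrow> (nat \<Rightarrow> 'a::division_ring^'n) \<Rightarrow> ('a^'n) set" where
  "left_span k b = range (\<lambda>c. \<Sum>i<k. c i *s b i)"

definition left_indep :: "nat \<Rightarrow> (nat \<Rightarrow> 'a::division_ring^'n) \<Rightarrow> bool" where
  "left_indep k b \<longleftrightarrow> (\<forall>c. (\<Sum>i<k. c i *s b i) = 0 \<longrightarrow> (\<forall>i<k. c i = 0))"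

text \<open>A point is a one-dimensional left subspace, as a set of vectors.\<close>

definition proj_points :: "('a::division_ring^'n) set set" where
  "proj_points = {range (\<lambda>c. c *s v) |v. v \<noteq> 0}"

text \<open>
  A flat of projective dimension \<open>k\<close> is the set of points of a left subspace of
  dimension \<open>k + 1\<close>.
\<close>

definition is_flat :: "nat \<Rightarrow> ('a::division_ring^'n) set set \<Rightarrow> bool" where
  "is_flat k F \<longleftrightarrow>
     (\<exists>b. left_indep (Suc k) b \<and> F = {P \<in> proj_points. P \<subseteq> left_span (Suc k) b})"

abbreviation is_line :: "('a::division_ring^'n) set set \<Rightarrow> bool" where
  "is_line \<equiv> is_flat 1"

definition proj_collinear :: "('a::division_ring^'n) set set \<Rightarrow> bool" where
  "proj_collinear X \<longleftrightarrow> (\<exists>l. is_line l \<and> X \<subseteq> l)"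

text \<open>
  The dimension is bounded by 2 rather than equal to 2, so that every set of points is
  coplanar when the whole space is a point or a line and has no two-dimensional flat. In spaces of
  dimension at least 2 both readings agree, as every smaller flat lies in a plane.
\<close>

definition proj_coplanar :: "('a::division_ring^'n) set set \<Rightarrow> bool" where
  "proj_coplanar X \<longleftrightarrow> (\<exists>k\<le>2. \<exists>F. is_flat k F \<and> X \<subseteq> F)"

text \<open>An incidence geometry is a pair of its set of points and its set of lines.\<close>

type_synonym 'p geometry = "'p set \<times> 'p set set"

definition geometry_iso :: "'p geometry \<Rightarrow> 'q geometry \<Rightarrow> bool" where
  "geometry_iso G H \<longleftrightarrow>
     (\<exists>f. bij_betw f (fst G) (fst H) \<and> (\<lambda>l. f ` l) ` snd G = snd H)"

definition induced_geometry ::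
  "('a::division_ring^'n) set set \<Rightarrow> ('a^'n) set geometry" where
  "induced_geometry S =
     (S, {l \<inter> S |l. is_line l \<and> (\<exists>A\<in>l \<inter> S. \<exists>B\<in>l \<inter> S. A \<noteq> B)})"

definition PG_3_2 :: "(bit^4) set geometry" where
  "PG_3_2 = (proj_points, {l. is_line l})"

text \<open>
  The numeral type \<open>3\<close> is the ring of integers modulo 3; the library declares it only as a
  commutative ring, but it is the field with three elements. The exponent in \<open>3^3\<close> is the
  three-element index type.
\<close>

definition AG_3_3 :: "(3^3) geometry" where
  "AG_3_3 = (UNIV, {range (\<lambda>t. p + t *s d) |p d. d \<noteq> 0})"

end

theory Submission imports Defs "HOL-Analysis.Cartesian_Space" begin

text \<open>
  Project from a point \<open>P\<close> of \<open>S\<close>: the lines through \<open>P\<close> are the points, and the planes through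
  \<open>P\<close> the lines, of a finite linear space. Give each line through \<open>P\<close> the number of points of
  \<open>S\<close> on it other than \<open>P\<close> as its weight; then the total weight is \<open>card S - 1\<close>, and all
  bounds are lower bounds for such weights. The planar input is that a point of a two-coloured
  plane set has degree at least 3, that degree 3 forces all points joined to it to carry both
  colours and its lines to have more than \<open>p\<close> points, where \<open>p\<close> is the characteristic
  (\<open>degree_three\<close>), and that a point of degree 4 whose lines have three points lies in a plane of
  nine points, all of whose lines have three points (\<open>degree_four_nine\<close>).

  The projective space enters through three consequences of Desargues' theorem, collected in
  \<open>desarguesian\<close>: Fano's configuration needs characteristic 2; three concurrent point sets
  closed under joining give translations of a finite set of scalars; and two sets of four points in
  perspective from many centres force characteristic 2.

  If no point carries both colours, counting the points of one colour already gives 42 and 52 points.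
  Otherwise project from a point with both colours. In characteristic 2 the space of lines through it
  has at least seven points of weight two, which gives 15; in other characteristics the
  weights sum to at least 26, which gives 27. In characteristics other than 2 and 3 the critical case is a plane
  of nine points as above: seen from a point outside, it is a set of nine points in the space of
  lines, and \<open>thick_four_card\<close> and \<open>weighted\<close> bound the size and weight of that space. Without such a
  plane all thin lines are heavy, and \<open>weighted_thick_four\<close> and \<open>thick_line_bound\<close> finish the count.

  In the extremal cases all lines have three points and all planes have 7 or 9 points. Representing
  vectors can then be scaled so that the three vectors of every line add up to zero (\<open>star7\<close>, \<open>star9\<close>),
  and four independent ones among them are coordinates for \<open>S\<close>.
\<close>

section \<open>Finite linear spaces\<close>

text \<open>A linear space is given by its points and the function taking two points to the line joining them,
  so a pencil is the image of that function with one argument fixed.\<close>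

definition pencil :: "'p set \<Rightarrow> ('p \<Rightarrow> 'p \<Rightarrow> 'p set) \<Rightarrow> 'p \<Rightarrow> 'p set set" where
  "pencil T L x = L x ` (T - {x})"

text \<open>The diagonal points of a quadrangle are collinear only in characteristic two. The letters
  \<open>a\<close>, \<open>b\<close>, \<open>c\<close>, \<open>d\<close> are the quadrangle and \<open>e\<close>, \<open>f\<close>, \<open>g\<close> its diagonal points.\<close>

definition fano_prop :: "nat \<Rightarrow> 'p set \<Rightarrow> ('p \<Rightarrow> 'p \<Rightarrow> 'p set) \<Rightarrow> bool" where
  "fano_prop p T L \<longleftrightarrow>
     (\<forall>a\<in>T. \<forall>b\<in>T. \<forall>c\<in>T. \<forall>d\<in>T. \<forall>e\<in>T. \<forall>f\<in>T. \<forall>g\<in>T.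
        a \<noteq> b \<longrightarrow> c \<notin> L a b \<longrightarrow> d \<notin> L a b \<longrightarrow> d \<notin> L a c \<longrightarrow> d \<notin> L b c \<longrightarrow>
        e \<in> L a b \<longrightarrow> e \<in> L c d \<longrightarrow> f \<in> L a c \<longrightarrow> f \<in> L b d \<longrightarrow> g \<in> L a d \<longrightarrow> g \<in> L b c \<longrightarrow>
        e \<noteq> f \<longrightarrow> g \<in> L e f \<longrightarrow> p = 2)"

text \<open>On three lines through \<open>q\<close> the points other than \<open>q\<close> have coordinates in the division ring for which collinearity
  means that the third coordinate is the sum of the first two. Two different points of \<open>B\<close> therefore give a translation under which
  the coordinates of \<open>A\<close> are closed, and a finite set closed under a translation has at least \<open>p > 0\<close> elements.\<close>

definition concurrent_prop :: "nat \<Rightarrow> 'p set \<Rightarrow> ('p \<Rightarrow> 'p \<Rightarrow> 'p set) \<Rightarrow> bool" where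
  "concurrent_prop p T L \<longleftrightarrow>
     (\<forall>q\<in>T. \<forall>a\<in>T - {q}. \<forall>b\<in>T - {q}. \<forall>c\<in>T - {q}. \<forall>A B C.
        L q a \<noteq> L q b \<longrightarrow> L q a \<noteq> L q c \<longrightarrow> L q b \<noteq> L q c \<longrightarrow>
        A \<subseteq> L q a - {q} \<longrightarrow> B \<subseteq> L q b - {q} \<longrightarrow> C \<subseteq> L q c - {q} \<longrightarrow>
        A \<noteq> {} \<longrightarrow> 2 \<le> card B \<longrightarrow>
        (\<forall>x\<in>A. \<forall>y\<in>B. \<exists>z\<in>C. z \<in> L x y) \<longrightarrow>
        (\<forall>y\<in>B. \<forall>z\<in>C. \<exists>x\<in>A. x \<in> L y z) \<longrightarrow> p \<noteq> 0 \<and> p \<le> card A)"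

lemma concurrentD:
  assumes "concurrent_prop p T L" "q \<in> T" "a \<in> T - {q}" "b \<in> T - {q}" "c \<in> T - {q}"
    and "L q a \<noteq> L q b" "L q a \<noteq> L q c" "L q b \<noteq> L q c"
    and "A \<subseteq> L q a - {q}" "B \<subseteq> L q b - {q}" "C \<subseteq> L q c - {q}" "A \<noteq> {}" "2 \<le> card B"
    and "\<And>x y. x \<in> A \<Longrightarrow> y \<in> B \<Longrightarrow> \<exists>z\<in>C. z \<in> L x y"
    and "\<And>y z. y \<in> B \<Longrightarrow> z \<in> C \<Longrightarrow> \<exists>x\<in>A. x \<in> L y z"
  shows "p \<noteq> 0 \<and> p \<le> card A"
  using assms(1)[unfolded concurrent_prop_def, THEN bspec, OF assms(2), THEN bspec, OF assms(3),
    THEN bspec, OF assms(4), THEN bspec, OF assms(5), THEN spec, of A, THEN spec, of B, THEN spec, of C]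
    assms(6-) by simp

text \<open>Projecting \<open>A\<close> to \<open>B\<close> from \<open>x\<close> and back from \<open>y\<close> is a similarity of the affine line carrying \<open>A\<close> that fixes \<open>a\<close>;
  a similarity permuting four points fixes their centroid, so if this happens for every \<open>a\<close>, all points of \<open>A\<close>
  agree up to division by four.\<close>

definition perspective_prop :: "nat \<Rightarrow> 'p set \<Rightarrow> ('p \<Rightarrow> 'p \<Rightarrow> 'p set) \<Rightarrow> bool" where
  "perspective_prop p T L \<longleftrightarrow>
     (\<forall>a1\<in>T. \<forall>a2\<in>T. \<forall>b1\<in>T. \<forall>b2\<in>T. \<forall>A B.
        a1 \<noteq> a2 \<longrightarrow> b1 \<noteq> b2 \<longrightarrow> A \<subseteq> L a1 a2 \<longrightarrow> B \<subseteq> L b1 b2 \<longrightarrow> card A = 4 \<longrightarrow> card B = 4 \<longrightarrow>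
        L a1 a2 \<inter> B = {} \<longrightarrow> L b1 b2 \<inter> A = {} \<longrightarrow>
        (\<forall>a\<in>A. \<exists>b\<in>B. \<exists>x\<in>T - L a1 a2 - L b1 b2. \<exists>y\<in>T - L a1 a2 - L b1 b2.
            x \<noteq> y \<and> x \<in> L a b \<and> y \<in> L a b \<and>
            (\<forall>u\<in>A. \<exists>v\<in>B. v \<in> L x u) \<and> (\<forall>u\<in>A. \<exists>v\<in>B. v \<in> L y u)) \<longrightarrow> p = 2)"

definition desarguesian :: "nat \<Rightarrow> 'p set \<Rightarrow> ('p \<Rightarrow> 'p \<Rightarrow> 'p set) \<Rightarrow> bool" where
  "desarguesian p T L \<longleftrightarrow>
     p \<noteq> 1 \<and> p \<noteq> 4 \<and> fano_prop p T L \<and> concurrent_prop p T L \<and> perspective_prop p T L"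

locale linspace =
  fixes T :: "'p set" and L :: "'p \<Rightarrow> 'p \<Rightarrow> 'p set"
  assumes fin: "finite T"
    and L_sub: "x \<in> T \<Longrightarrow> y \<in> T \<Longrightarrow> x \<noteq> y \<Longrightarrow> L x y \<subseteq> T"
    and L_l: "x \<in> T \<Longrightarrow> y \<in> T \<Longrightarrow> x \<noteq> y \<Longrightarrow> x \<in> L x y"
    and L_r: "x \<in> T \<Longrightarrow> y \<in> T \<Longrightarrow> x \<noteq> y \<Longrightarrow> y \<in> L x y"
    and L_eq: "x \<in> T \<Longrightarrow> y \<in> T \<Longrightarrow> x \<noteq> y \<Longrightarrow> u \<in> L x y \<Longrightarrow> v \<in> L x y \<Longrightarrow> u \<noteq> v \<Longrightarrow> L u v = L x y"
begin

abbreviation pen :: "'p \<Rightarrow> 'p set set" where "pen \<equiv> pencil T L"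
definition deg :: "'p \<Rightarrow> nat" where "deg x = card (pen x)"
definition nontriv :: bool where "nontriv \<longleftrightarrow> (\<exists>a\<in>T. \<exists>b\<in>T. \<exists>c\<in>T. a \<noteq> b \<and> c \<notin> L a b)"
definition thick :: "nat \<Rightarrow> bool" where "thick k \<longleftrightarrow> (\<forall>x\<in>T. \<forall>y\<in>T. x \<noteq> y \<longrightarrow> k \<le> card (L x y))"
definition lines :: "'p set set" where "lines = {L x y |x y. x \<in> T \<and> y \<in> T \<and> x \<noteq> y}"

lemma L_comm: "x \<in> T \<Longrightarrow> y \<in> T \<Longrightarrow> x \<noteq> y \<Longrightarrow> L y x = L x y"
  using L_eq[of x y y x] L_l L_r by blast

lemma L_mem: "x \<in> T \<Longrightarrow> y \<in> T \<Longrightarrow> x \<noteq> y \<Longrightarrow> z \<in> L x y \<Longrightarrow> z \<in> T"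
  using L_sub by blast

lemma L_unique:
  assumes "a \<in> T" "b \<in> T" "a \<noteq> b" "c \<in> T" "d \<in> T" "c \<noteq> d"
    and "u \<noteq> v" "u \<in> L a b" "v \<in> L a b" "u \<in> L c d" "v \<in> L c d"
  shows "L a b = L c d"
  using L_eq[of a b u v] L_eq[of c d u v] assms by simp

lemma lines_sub: "l \<in> lines \<Longrightarrow> l \<subseteq> T"
  unfolding lines_def using L_sub by blast

lemma lines_fin: "l \<in> lines \<Longrightarrow> finite l"
  using lines_sub fin finite_subset by blast

lemma finite_lines: "finite lines"
  by (rule finite_subset[of _ "Pow T"]) (use lines_sub fin in auto)

lemma L_lines: "x \<in> T \<Longrightarrow> y \<in> T \<Longrightarrow> x \<noteq> y \<Longrightarrow> L x y \<in> lines"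
  unfolding lines_def by blast

lemma lines_L: "l \<in> lines \<Longrightarrow> u \<noteq> v \<Longrightarrow> u \<in> l \<Longrightarrow> v \<in> l \<Longrightarrow> L u v = l"
  unfolding lines_def using L_eq by blast

lemma lines_unique: "l \<in> lines \<Longrightarrow> m \<in> lines \<Longrightarrow> u \<noteq> v \<Longrightarrow> u \<in> l \<Longrightarrow> v \<in> l \<Longrightarrow> u \<in> m \<Longrightarrow> v \<in> m \<Longrightarrow> l = m"
  using lines_L by metis

lemma pen_lines: "x \<in> T \<Longrightarrow> pen x = {l \<in> lines. x \<in> l}"
proof
  show "x \<in> T \<Longrightarrow> pen x \<subseteq> {l \<in> lines. x \<in> l}"
    unfolding pencil_def using L_l L_lines by fastforce
  show "{l \<in> lines. x \<in> l} \<subseteq> pen x"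
  proof
    fix l assume "l \<in> {l \<in> lines. x \<in> l}"
    then obtain a b where l: "l = L a b" "a \<in> T" "b \<in> T" "a \<noteq> b" "x \<in> l" "l \<in> lines"
      unfolding lines_def by auto
    obtain y where y: "y \<in> l" "y \<noteq> x" "y \<in> T" using l L_l L_r by metis
    then have "L x y = l" using lines_L l by metis
    then show "l \<in> pen x" unfolding pencil_def using y by blast
  qed
qed

lemma pen_memI: "x \<in> T \<Longrightarrow> y \<in> T \<Longrightarrow> x \<noteq> y \<Longrightarrow> L x y \<in> pen x"
  unfolding pencil_def by blast

lemma pen_ex: "l \<in> pen x \<Longrightarrow> \<exists>y\<in>T. y \<noteq> x \<and> l = L x y"
  unfolding pencil_def by blast

lemma fin_pen: "finite (pen x)"
  unfolding pencil_def using fin by auto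

lemma pen_disj: "x \<in> T \<Longrightarrow> l \<in> pen x \<Longrightarrow> m \<in> pen x \<Longrightarrow> l \<noteq> m \<Longrightarrow> u \<in> l \<Longrightarrow> u \<in> m \<Longrightarrow> u = x"
  using lines_unique pen_lines by blast

lemma sum_pen:
  fixes f :: "'p \<Rightarrow> 'b::comm_monoid_add"
  assumes x: "x \<in> T"
  shows "(\<Sum>y\<in>T - {x}. f y) = (\<Sum>l\<in>pen x. \<Sum>y\<in>l - {x}. f y)"
proof -
  have "T - {x} = (\<Union>l\<in>pen x. l - {x})"
  proof
    show "T - {x} \<subseteq> (\<Union>l\<in>pen x. l - {x})"
    proof
      fix y assume "y \<in> T - {x}"
      then have "L x y \<in> pen x" "y \<in> L x y - {x}" using L_r[OF x, of y] pen_memI[OF x] by auto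
      then show "y \<in> (\<Union>l\<in>pen x. l - {x})" by blast
    qed
    show "(\<Union>l\<in>pen x. l - {x}) \<subseteq> T - {x}" using pen_lines[OF x] lines_sub by fast
  qed
  moreover have "(\<Sum>y\<in>(\<Union>l\<in>pen x. l - {x}). f y) = (\<Sum>l\<in>pen x. \<Sum>y\<in>l - {x}. f y)"
  proof (rule sum.UNION_disjoint)
    show "finite (pen x)" by (rule fin_pen)
    show "\<forall>l\<in>pen x. finite (l - {x})" using pen_lines[OF x] lines_fin by auto
    show "\<forall>l\<in>pen x. \<forall>m\<in>pen x. l \<noteq> m \<longrightarrow> (l - {x}) \<inter> (m - {x}) = {}"
      using pen_disj[OF x] by blast
  qed
  ultimately show ?thesis by simp
qed

lemma card_pen:
  assumes x: "x \<in> T"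
  shows "card T = 1 + (\<Sum>l\<in>pen x. card l - 1)"
proof -
  have "card (T - {x}) = (\<Sum>l\<in>pen x. card (l - {x}))"
    using sum_pen[OF x, of "\<lambda>_. 1::nat"] by simp
  also have "\<dots> = (\<Sum>l\<in>pen x. card l - 1)"
    by (rule sum.cong) (use pen_lines[OF x] lines_fin in auto)
  finally show ?thesis using x fin by (simp add: card_Suc_Diff1[symmetric] del: card_Diff_insert)
qed

lemma inj_pen:
  assumes "x \<in> T" "l \<in> lines" "x \<notin> l"
  shows "inj_on (L x) l" "L x ` l \<subseteq> pen x"
proof -
  have lT: "l \<subseteq> T" using lines_sub assms by blast
  show "L x ` l \<subseteq> pen x" using lT assms pen_memI by blast
  show "inj_on (L x) l"
  proof (rule inj_onI, rule ccontr)
    fix u v assume uv: "u \<in> l" "v \<in> l" "L x u = L x v" "u \<noteq> v"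
    then have "u \<in> L x u" "v \<in> L x u" "L x u \<in> lines" "x \<in> L x u"
      using lT assms L_r L_l L_lines by (metis subsetD)+
    then show False using lines_unique[of l "L x u" u v] uv assms by blast
  qed
qed

lemma card_le_deg: "x \<in> T \<Longrightarrow> l \<in> lines \<Longrightarrow> x \<notin> l \<Longrightarrow> card l \<le> deg x"
  unfolding deg_def using inj_pen card_inj_on_le[of "L x" l "pen x"] fin_pen by blast

lemma off_line:
  assumes "x \<in> T" nontriv
  shows "\<exists>l\<in>lines. x \<notin> l"
proof -
  obtain a b c where *: "a \<in> T" "b \<in> T" "c \<in> T" "a \<noteq> b" "c \<notin> L a b"
    using assms(2) unfolding nontriv_def by blast
  have ca: "c \<noteq> a" "c \<noteq> b" using * L_l L_r by auto
  show ?thesis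
  proof (rule ccontr)
    assume "\<not> ?thesis"
    then have "x \<in> L a b" "x \<in> L a c" "x \<in> L b c" using * ca L_lines by auto
    then show False
      by (metis "*" ca L_l L_r L_unique)
  qed
qed

lemma thickD: "thick k \<Longrightarrow> l \<in> lines \<Longrightarrow> k \<le> card l"
  unfolding thick_def lines_def by auto

lemma deg_ge: "thick k \<Longrightarrow> nontriv \<Longrightarrow> x \<in> T \<Longrightarrow> k \<le> deg x"
  using off_line thickD card_le_deg le_trans by metis

lemma card_ge_deg:
  assumes "x \<in> T" "\<And>l. l \<in> pen x \<Longrightarrow> k + 1 \<le> card l"
  shows "card T \<ge> 1 + k * deg x"
proof -
  have "(\<Sum>l\<in>pen x. card l - 1) \<ge> (\<Sum>l\<in>pen x. k)"
    by (rule sum_mono) (use assms(2) in force)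
  then show ?thesis using card_pen[OF assms(1)] unfolding deg_def by (simp add: mult.commute)
qed

lemma nontriv_off: "nontriv \<Longrightarrow> l \<in> lines \<Longrightarrow> \<exists>x\<in>T. x \<notin> l"
proof (rule ccontr)
  assume n: nontriv and l: "l \<in> lines" and "\<not> (\<exists>x\<in>T. x \<notin> l)"
  then have "T \<subseteq> l" by blast
  with n show False unfolding nontriv_def using lines_L[OF l] by (metis subsetD)
qed

text \<open>When the degree of a point equals the minimal line size, every line not through it crosses
  all the lines of its pencil.\<close>

lemma tight_degree_crossing:
  assumes "x \<in> T" "thick (deg x)" "l \<in> lines" "x \<notin> l" "m \<in> pen x"
  shows "\<exists>u\<in>l. u \<in> m"
proof -
  have i: "inj_on (L x) l" "L x ` l \<subseteq> pen x" using inj_pen assms by blast+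
  have "card (L x ` l) = card l" using card_image i by blast
  also have "\<dots> \<ge> card (pen x)" using thickD assms unfolding deg_def by blast
  finally have "L x ` l = pen x" using card_seteq[OF fin_pen i(2)] by simp
  then obtain u where "u \<in> l" "m = L x u" using assms by blast
  then show ?thesis using L_r assms lines_sub by (metis subsetD)
qed

lemma tight_degree_card:
  assumes "x \<in> T" "thick (deg x)" "l \<in> lines" "x \<notin> l"
  shows "card l = deg x"
  using thickD card_le_deg assms by (metis le_antisym)

text \<open>If the degree of \<open>x\<close> equals the minimal size of a line, every line off \<open>x\<close> meets every line through \<open>x\<close>. Three
  lines of the pencil without \<open>x\<close> are then closed under joining, which is the situation of \<open>concurrent_prop\<close>.\<close>

lemma tight_degree_char:
  assumes "x \<in> T" "thick (deg x)" "3 \<le> deg x" "l \<in> pen x" "desarguesian p T L"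
  shows "p \<noteq> 0 \<and> p + 1 \<le> card l"
proof -
  have "\<exists>m n. m \<in> pen x \<and> n \<in> pen x \<and> m \<noteq> l \<and> n \<noteq> l \<and> m \<noteq> n"
  proof -
    have "card (pen x - {l}) \<ge> 2" using assms fin_pen unfolding deg_def by simp
    then obtain m n where "m \<noteq> n" "{m, n} \<subseteq> pen x - {l}"
      by (metis card_2_iff obtain_subset_with_card_n)
    then show ?thesis by blast
  qed
  then obtain m n where mn: "m \<in> pen x" "n \<in> pen x" "m \<noteq> l" "n \<noteq> l" "m \<noteq> n" by blast
  obtain a where a: "a \<in> T - {x}" "l = L x a" using pen_ex[OF assms(4)] by blast
  obtain b where b: "b \<in> T - {x}" "m = L x b" using pen_ex[OF mn(1)] by blast
  obtain c where c: "c \<in> T - {x}" "n = L x c" using pen_ex[OF mn(2)] by blast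
  have cross: "\<exists>z\<in>k' - {x}. z \<in> L u v"
    if "u \<in> i - {x}" "v \<in> j - {x}" "i \<in> pen x" "j \<in> pen x" "k' \<in> pen x" "i \<noteq> j" for u v i j k'
  proof -
    note k' = that(5)
    have ij: "i \<subseteq> T" "j \<subseteq> T" using that pen_lines[OF assms(1)] lines_sub by auto
    then have uv: "u \<in> T" "v \<in> T" using that by auto
    have "u \<noteq> v" using pen_disj[OF assms(1), of i j u] that by auto
    note uv = uv this
    have "x \<notin> L u v"
    proof
      assume "x \<in> L u v"
      then have p: "L u v \<in> pen x" using pen_lines[OF assms(1)] L_lines[OF uv] by simp
      have "L u v = i" using pen_disj[OF assms(1) p, of i u] that L_l[OF uv] by blast
      moreover have "L u v = j" using pen_disj[OF assms(1) p, of j v] that L_r[OF uv] by blast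
      ultimately show False using that by simp
    qed
    then obtain z where "z \<in> L u v" "z \<in> k'"
      using tight_degree_crossing[OF assms(1,2) L_lines[OF uv] _ k'] by blast
    then show ?thesis using \<open>x \<notin> L u v\<close> by blast
  qed
  have "finite m" using pen_lines[OF assms(1)] mn lines_fin by blast
  then have m2: "2 \<le> card (m - {x})" using thickD[OF assms(2), of m] assms(3) mn pen_lines[OF assms(1)] by auto
  have ne: "l - {x} \<noteq> {}" using a L_r[OF assms(1), of a] by blast
  have cp: "concurrent_prop p T L" using assms(5) unfolding desarguesian_def by blast
  have "p \<noteq> 0 \<and> p \<le> card (l - {x})"
  proof (rule concurrentD[OF cp assms(1) a(1) b(1) c(1)])
    show "L x a \<noteq> L x b" "L x a \<noteq> L x c" "L x b \<noteq> L x c" using mn a b c by auto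
    show "l - {x} \<subseteq> L x a - {x}" "m - {x} \<subseteq> L x b - {x}" "n - {x} \<subseteq> L x c - {x}" using a b c by auto
    show "\<exists>z\<in>n - {x}. z \<in> L u v" if "u \<in> l - {x}" "v \<in> m - {x}" for u v
      using cross[OF that assms(4) mn(1) mn(2)] mn by auto
    show "\<exists>z\<in>l - {x}. z \<in> L u v" if "u \<in> m - {x}" "v \<in> n - {x}" for u v
      using cross[OF that mn(1) mn(2) assms(4)] mn by auto
  qed (use ne m2 in auto)
  moreover have "card l = card (l - {x}) + 1"
    using pen_lines[OF assms(1)] assms(4) lines_fin card_Suc_Diff1[of l x] by auto
  ultimately show ?thesis by simp
qed

lemma pen_cross:
  assumes "q \<in> T" "m \<in> pen q" "n \<in> pen q" "m \<noteq> n" "y \<in> m - {q}" "z \<in> n - {q}"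
  shows "y \<in> T" "z \<in> T" "y \<noteq> z" "q \<notin> L y z" "\<And>u. u \<in> L y z \<Longrightarrow> u \<in> m \<Longrightarrow> u = y"
    "\<And>u. u \<in> L y z \<Longrightarrow> u \<in> n \<Longrightarrow> u = z"
proof -
  have ml: "m \<in> lines" "n \<in> lines" "q \<in> m" "q \<in> n" using assms pen_lines[OF assms(1)] by auto
  show yz: "y \<in> T" "z \<in> T" using ml lines_sub assms by auto
  show ne: "y \<noteq> z" using pen_disj[OF assms(1,2,3,4), of y] assms by auto
  note l = L_lines[OF yz ne] L_l[OF yz ne] L_r[OF yz ne]
  show q: "q \<notin> L y z"
  proof
    assume "q \<in> L y z"
    then have "L y z = m" "L y z = n"
      using lines_unique[OF l(1) ml(1), of q y] lines_unique[OF l(1) ml(2), of q z] l ml assms by auto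
    then show False using assms by simp
  qed
  show "u \<in> L y z \<Longrightarrow> u \<in> m \<Longrightarrow> u = y" for u
    using lines_unique[OF l(1) ml(1), of u y] l ml assms q by auto
  show "u \<in> L y z \<Longrightarrow> u \<in> n \<Longrightarrow> u = z" for u
    using lines_unique[OF l(1) ml(2), of u z] l ml assms q by auto
qed

lemma perspective_card:
  assumes q: "q \<in> T" "i \<in> pen q" "j \<in> pen q" "k \<in> pen q" "i \<noteq> j" "j \<noteq> k"
    and A: "A \<subseteq> i - {q}" and C: "C \<subseteq> k - {q}" and y: "y \<in> j - {q}"
    and ex: "\<And>x. x \<in> A \<Longrightarrow> \<exists>z\<in>C. z \<in> L x y"
  shows "card A \<le> card C" "card A = card C \<Longrightarrow> z \<in> C \<Longrightarrow> \<exists>x\<in>A. z \<in> L x y"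
proof -
  define f where "f x = (SOME z. z \<in> C \<and> z \<in> L x y)" for x
  have f: "f x \<in> C" "f x \<in> L x y" if "x \<in> A" for x
    using someI_ex[of "\<lambda>z. z \<in> C \<and> z \<in> L x y"] ex[OF that] unfolding f_def by blast+
  have "inj_on f A"
  proof (rule inj_onI)
    fix x x' assume xx: "x \<in> A" "x' \<in> A" "f x = f x'"
    have c: "x \<in> i - {q}" "x' \<in> i - {q}" using xx A by auto
    note p = pen_cross[OF q(1,2,3,5) c(1) y] and p' = pen_cross[OF q(1,2,3,5) c(2) y]
    have "f x \<noteq> y" using f[OF xx(1)] C pen_disj[OF q(1,3,4,6), of y] y by auto
    then have "L x y = L x' y"
      using lines_unique[OF L_lines[OF p(1-3)] L_lines[OF p'(1-3)], of "f x" y]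
        f[OF xx(1)] f[OF xx(2)] xx L_r[OF p(1-3)] L_r[OF p'(1-3)] by auto
    then show "x = x'" using p(5)[of x'] L_l[OF p'(1-3)] c by auto
  qed
  moreover have finC: "finite C"
    using C pen_lines[OF q(1)] q(4) lines_fin finite_subset[of C k] by blast
  moreover have "f ` A \<subseteq> C" using f by blast
  ultimately show "card A \<le> card C" using card_inj_on_le by blast
  assume "card A = card C" "z \<in> C"
  then have "f ` A = C" using card_image[OF \<open>inj_on f A\<close>] card_seteq[OF finC \<open>f ` A \<subseteq> C\<close>] by simp
  then show "\<exists>x\<in>A. z \<in> L x y" using f \<open>z \<in> C\<close> by blast
qed

lemma two_pencil_lines:
  assumes "x \<in> T" nontriv shows "\<exists>l\<in>pen x. \<exists>m\<in>pen x. l \<noteq> m"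
proof -
  obtain l where l: "l \<in> lines" "x \<notin> l" using off_line[OF assms] by blast
  then obtain a b where ab: "a \<in> T" "b \<in> T" "a \<noteq> b" "l = L a b" unfolding lines_def by blast
  then have "L x a \<noteq> L x b" using inj_pen(1)[OF assms(1) l] L_l L_r by (meson inj_onD)
  moreover have "L x a \<in> pen x" "L x b \<in> pen x" using ab l L_l L_r pen_memI[OF assms(1)] by blast+
  ultimately show ?thesis by blast
qed

lemma pairs_on_lines:
  assumes "X \<subseteq> T" "Y \<subseteq> T"
  shows "card {(x, y). x \<in> X \<and> y \<in> Y \<and> x \<noteq> y} = (\<Sum>l\<in>lines. card {(x, y). x \<in> X \<inter> l \<and> y \<in> Y \<inter> l \<and> x \<noteq> y})"
proof -
  let ?P = "\<lambda>l. {(x, y). x \<in> X \<inter> l \<and> y \<in> Y \<inter> l \<and> x \<noteq> y}"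
  have "{(x, y). x \<in> X \<and> y \<in> Y \<and> x \<noteq> y} = (\<Union>l\<in>lines. ?P l)"
  proof (intro equalityI subsetI)
    fix z assume "z \<in> {(x, y). x \<in> X \<and> y \<in> Y \<and> x \<noteq> y}"
    then obtain x y where z: "z = (x, y)" "x \<in> X" "y \<in> Y" "x \<noteq> y" by blast
    then have "x \<in> T" "y \<in> T" using assms by auto
    note l = L_lines[OF this z(4)] L_l[OF this z(4)] L_r[OF this z(4)]
    show "z \<in> (\<Union>l\<in>lines. ?P l)" using l z by blast
  qed auto
  moreover have "card (\<Union>l\<in>lines. ?P l) = (\<Sum>l\<in>lines. card (?P l))"
  proof (rule card_UN_disjoint[OF finite_lines])
    show "\<forall>l\<in>lines. finite (?P l)"
    proof
      fix l assume "l \<in> lines"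
      then show "finite (?P l)" by (intro finite_subset[of "?P l" "l \<times> l"]) (auto simp: lines_fin)
    qed
    show "\<forall>l\<in>lines. \<forall>m\<in>lines. l \<noteq> m \<longrightarrow> ?P l \<inter> ?P m = {}"
      using lines_unique by blast
  qed
  ultimately show ?thesis by simp
qed

lemma card_offdiag: "finite X \<Longrightarrow> card {(x, y). x \<in> X \<and> y \<in> X \<and> x \<noteq> y} = card X * (card X - 1)"
proof -
  assume f: "finite X"
  have e: "{(x, y). x \<in> X \<and> y \<in> X \<and> x \<noteq> y} = (SIGMA x:X. X - {x})" by auto
  have "card (SIGMA x:X. X - {x}) = (\<Sum>x\<in>X. card (X - {x}))" using f by (intro card_SigmaI) auto
  also have "\<dots> = (\<Sum>x\<in>X. card X - 1)" by (rule sum.cong) (use f in auto)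
  finally show ?thesis using e by simp
qed

lemma pairs_within: "X \<subseteq> T \<Longrightarrow> card X * (card X - 1) = (\<Sum>l\<in>lines. card (X \<inter> l) * (card (X \<inter> l) - 1))"
proof -
  assume X: "X \<subseteq> T"
  then have f: "finite X" using fin finite_subset by blast
  show ?thesis using pairs_on_lines[OF X X] card_offdiag[OF f] card_offdiag[OF finite_Int[OF disjI1[OF f]]] by simp
qed

lemma pairs_between:
  assumes "X \<subseteq> T" "Y \<subseteq> T" "X \<inter> Y = {}"
  shows "card X * card Y = (\<Sum>l\<in>lines. card (X \<inter> l) * card (Y \<inter> l))"
proof -
  have e: "{(x, y). x \<in> X \<and> y \<in> Y \<and> x \<noteq> y} = X \<times> Y"
    "{(x, y). x \<in> X \<inter> l \<and> y \<in> Y \<inter> l \<and> x \<noteq> y} = (X \<inter> l) \<times> (Y \<inter> l)" for l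
    using assms(3) by auto
  show ?thesis using pairs_on_lines[OF assms(1,2)] unfolding e by (simp add: card_cartesian_product)
qed

end

section \<open>Chromatic linear spaces\<close>

text \<open>A point may lie in both \<open>Red\<close> and \<open>Blue\<close>; such points are called purple below.\<close>

locale chromatic = linspace T L for T :: "'p set" and L +
  fixes Red Blue :: "'p set" and p :: nat
  assumes col: "T = Red \<union> Blue"
    and bb: "x \<in> Blue \<Longrightarrow> y \<in> Blue \<Longrightarrow> x \<noteq> y \<Longrightarrow> \<exists>z\<in>Red. z \<noteq> x \<and> z \<noteq> y \<and> z \<in> L x y"
    and rr: "x \<in> Red \<Longrightarrow> y \<in> Red \<Longrightarrow> x \<noteq> y \<Longrightarrow> \<exists>z\<in>Blue. z \<noteq> x \<and> z \<noteq> y \<and> z \<in> L x y"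
    and des: "desarguesian p T L"
begin

lemma swap: "chromatic T L Blue Red p"
  by unfold_locales (use col bb rr des in auto)

lemma Red_T: "x \<in> Red \<Longrightarrow> x \<in> T" and Blue_T: "x \<in> Blue \<Longrightarrow> x \<in> T"
  using col by auto

lemma mono_ge3:
  assumes "x \<in> Red \<and> y \<in> Red \<or> x \<in> Blue \<and> y \<in> Blue" "x \<noteq> y"
  shows "3 \<le> card (L x y)"
proof -
  have T: "x \<in> T" "y \<in> T" using assms col by auto
  obtain z where "z \<in> L x y" "z \<noteq> x" "z \<noteq> y" using assms bb rr by blast
  then have "{x, y, z} \<subseteq> L x y" "card {x, y, z} = 3" using L_l L_r T assms by auto
  then show ?thesis using lines_fin[OF L_lines[OF T assms(2)]] card_mono by metis
qed

lemma purple_pencil_ge3: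
  assumes "q \<in> Red" "q \<in> Blue" "l \<in> pen q" shows "3 \<le> card l"
proof -
  obtain y where "y \<in> T" "y \<noteq> q" "l = L q y" using pen_ex[OF assms(3)] by blast
  then show ?thesis using mono_ge3[of q y] assms col by auto
qed

lemma line_colours:
  assumes "l \<in> lines"
  shows "(\<exists>x\<in>l. x \<in> Red - Blue) \<and> (\<exists>x\<in>l. x \<in> Blue - Red) \<or> 3 \<le> card (l \<inter> (Red \<inter> Blue))"
proof (rule ccontr)
  assume n: "\<not> ?thesis"
  have key: False if c: "chromatic T L R B p" and nb: "\<not> (\<exists>x\<in>l. x \<in> B - R)" and
      few: "\<not> 3 \<le> card (l \<inter> (R \<inter> B))" and T: "T = R \<union> B" for R B
  proof -
    interpret c: chromatic T L R B p by (rule c)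
    have fl: "finite (l \<inter> (R \<inter> B))" using lines_fin[OF assms] by blast
    have lR: "l \<subseteq> R" using nb T lines_sub[OF assms] by blast
    obtain x y where xy: "x \<in> l" "y \<in> l" "x \<noteq> y" using assms L_l L_r unfolding lines_def by blast
    have blue: "\<exists>z\<in>l. z \<in> R \<inter> B \<and> z \<noteq> u \<and> z \<noteq> v" if "u \<in> l" "v \<in> l" "u \<noteq> v" for u v
      using c.rr[of u v] lR that lines_L[OF assms that(3,1,2)] by blast
    obtain a where a: "a \<in> l" "a \<in> R \<inter> B" using blue[OF xy] by blast
    obtain w where "w \<in> l" "w \<noteq> a" using xy by metis
    then obtain b where b: "b \<in> l" "b \<in> R \<inter> B" "b \<noteq> a" using blue[of w a] a by blast
    obtain c where cc: "c \<in> l" "c \<in> R \<inter> B" "c \<noteq> a" "c \<noteq> b" using blue[of a b] a b by blast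
    have "{a, b, c} \<subseteq> l \<inter> (R \<inter> B)" "card {a, b, c} = 3" using a b cc by auto
    then show False using few card_mono[OF fl] by metis
  qed
  show False using n key[OF chromatic_axioms] key[OF swap] col by (auto simp: Int_commute Un_commute)
qed

lemma red_pencil_blue:
  assumes "q \<in> Red" "l \<in> pen q" shows "\<exists>y\<in>l - {q}. y \<in> Blue"
proof -
  obtain y where y: "y \<in> T" "y \<noteq> q" "l = L q y" using pen_ex[OF assms(2)] by blast
  then show ?thesis using rr[of q y] L_r[of q y] assms col by blast
qed

lemma third_line:
  assumes q: "q \<in> T" and mn: "m \<in> pen q" "n \<in> pen q" "m \<noteq> n"
    and y: "y \<in> m - {q}" "y \<in> Blue" and z: "z \<in> n - {q}" "z \<in> Blue"
  shows "\<exists>r\<in>Red. r \<in> L y z \<and> r \<noteq> q \<and> r \<notin> m \<and> r \<notin> n \<and> L q r \<in> pen q \<and> r \<in> L q r \<and> L q r \<noteq> m \<and> L q r \<noteq> n"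
proof -
  note c = pen_cross[OF q mn y(1) z(1)]
  obtain r where r: "r \<in> Red" "r \<noteq> y" "r \<noteq> z" "r \<in> L y z" using bb[OF y(2) z(2) c(3)] by blast
  have "r \<noteq> q" "r \<notin> m" "r \<notin> n" "r \<in> T" using r c col by auto
  moreover have "L q r \<in> pen q" "r \<in> L q r" using pen_memI[OF q \<open>r \<in> T\<close>] L_r[OF q \<open>r \<in> T\<close>] \<open>r \<noteq> q\<close> by auto
  ultimately show ?thesis using r by blast
qed

lemma red_deg_ge3:
  assumes "q \<in> Red" nontriv shows "3 \<le> deg q"
proof -
  have q: "q \<in> T" using assms Red_T by blast
  obtain m n where mn: "m \<in> pen q" "n \<in> pen q" "m \<noteq> n" using two_pencil_lines[OF q assms(2)] by blast
  obtain y z where yz: "y \<in> m - {q}" "y \<in> Blue" "z \<in> n - {q}" "z \<in> Blue"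
    using red_pencil_blue[OF assms(1)] mn by meson
  obtain r where "L q r \<in> pen q" "L q r \<noteq> m" "L q r \<noteq> n"
    using third_line[OF q mn yz] by blast
  then have "{m, n, L q r} \<subseteq> pen q" "card {m, n, L q r} = 3" using mn by auto
  then show ?thesis unfolding deg_def using card_mono[OF fin_pen] by metis
qed

lemma deg_ge3: "q \<in> T \<Longrightarrow> nontriv \<Longrightarrow> 3 \<le> deg q"
  using red_deg_ge3 chromatic.red_deg_ge3[OF swap] col by blast

text \<open>Every line off \<open>q\<close> has at most three points, one on each line through \<open>q\<close>. Two points of one colour on different lines of
  the pencil therefore determine a point of the other colour on the third line. This makes all points other than \<open>q\<close>
  purple and the three lines closed under joining.\<close>

lemma degree_three_red:
  assumes q: "q \<in> Red" and nt: nontriv and d: "deg q = 3"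
  shows "\<exists>m\<ge>2. (\<forall>l\<in>pen q. card l = m + 1 \<and> l - {q} \<subseteq> Red \<inter> Blue) \<and> p \<noteq> 0 \<and> p \<le> m"
    and "\<And>l. l \<in> lines \<Longrightarrow> q \<notin> l \<Longrightarrow> card l = 3"
proof -
  have qT: "q \<in> T" using q Red_T by blast
  define B where "B l = {y \<in> l - {q}. y \<in> Blue}" for l
  define R where "R l = {y \<in> l - {q}. y \<in> Red}" for l
  have finl: "finite l" "l \<subseteq> T" "q \<in> l" if "l \<in> pen q" for l
    using that pen_lines[OF qT] lines_fin lines_sub by auto
  have third: "l = k" if "i \<in> pen q" "j \<in> pen q" "k \<in> pen q" "i \<noteq> j" "j \<noteq> k" "i \<noteq> k"
      "l \<in> pen q" "l \<noteq> i" "l \<noteq> j" for i j k l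
  proof (rule ccontr)
    assume "l \<noteq> k"
    then have "card {i, j, k, l} = 4" "{i, j, k, l} \<subseteq> pen q" using that by auto
    then have "4 \<le> deg q" unfolding deg_def using card_mono[OF fin_pen] by metis
    then show False using d by simp
  qed
  have bbr: "\<exists>z\<in>R k. z \<in> L x y"
    if ijk: "i \<in> pen q" "j \<in> pen q" "k \<in> pen q" "i \<noteq> j" "j \<noteq> k" "i \<noteq> k" and xy: "x \<in> B i" "y \<in> B j" for i j k x y
  proof -
    obtain r where r: "r \<in> Red" "r \<in> L x y" "r \<noteq> q" "L q r \<in> pen q" "r \<in> L q r" "L q r \<noteq> i" "L q r \<noteq> j"
      using third_line[OF qT ijk(1,2,4), of x y] xy unfolding B_def by blast
    have "L q r = k" using third[OF ijk r(4,6,7)] .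
    then show ?thesis using r unfolding R_def by blast
  qed
  have rrb: "\<exists>z\<in>B k. z \<in> L x y"
    if ijk: "i \<in> pen q" "j \<in> pen q" "k \<in> pen q" "i \<noteq> j" "j \<noteq> k" "i \<noteq> k" and xy: "x \<in> R i" "y \<in> R j" for i j k x y
  proof -
    obtain r where r: "r \<in> Blue" "r \<in> L x y" "r \<noteq> q" "L q r \<in> pen q" "r \<in> L q r" "L q r \<noteq> i" "L q r \<noteq> j"
      using chromatic.third_line[OF swap qT ijk(1,2,4), of x y] xy unfolding R_def by blast
    have "L q r = k" using third[OF ijk r(4,6,7)] .
    then show ?thesis using r unfolding B_def by blast
  qed
  have other: "\<exists>j\<in>pen q. j \<noteq> i \<and> j \<noteq> k" for i k
  proof -
    have "\<not> pen q \<subseteq> {i, k}"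
    proof
      assume "pen q \<subseteq> {i, k}"
      then have "deg q \<le> card {i, k}" unfolding deg_def by (rule card_mono[rotated]) simp
      also have "\<dots> \<le> 2" by (simp add: card_insert_if)
      finally show False using d by simp
    qed
    then show ?thesis by blast
  qed
  have Bne: "B l \<noteq> {}" if "l \<in> pen q" for l
    using red_pencil_blue[OF q that] unfolding B_def by blast
  have Rne: "R k \<noteq> {}" if "k \<in> pen q" for k
  proof -
    obtain i where i: "i \<in> pen q" "i \<noteq> k" using other[of k k] by blast
    obtain j where j: "j \<in> pen q" "j \<noteq> i" "j \<noteq> k" using other[of i k] by blast
    obtain x y where "x \<in> B i" "y \<in> B j" using Bne[OF i(1)] Bne[OF j(1)] by blast
    then show ?thesis using bbr[OF i(1) j(1) that j(2)[symmetric] j(3) i(2)] by blast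
  qed
  have subs: "B l \<subseteq> l - {q}" "R l \<subseteq> l - {q}" for l unfolding B_def R_def by auto
  have le1: "card (B i) \<le> card (R k)" if "i \<in> pen q" "k \<in> pen q" "i \<noteq> k" for i k
  proof -
    obtain j where j: "j \<in> pen q" "j \<noteq> i" "j \<noteq> k" using other[of i k] by blast
    obtain y where y: "y \<in> B j" using Bne[OF j(1)] by blast
    show ?thesis
    proof (rule perspective_card(1)[OF qT that(1) j(1) that(2) _ _ subs(1) subs(2)])
      show "y \<in> j - {q}" using y subs(1)[of j] by blast
      show "\<exists>z\<in>R k. z \<in> L x y" if "x \<in> B i" for x
        by (rule bbr[OF \<open>i \<in> pen q\<close> j(1) \<open>k \<in> pen q\<close> j(2)[symmetric] j(3) \<open>i \<noteq> k\<close> that y])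
    qed (use j in simp_all)
  qed
  have le2: "card (R i) \<le> card (B k)" if "i \<in> pen q" "k \<in> pen q" "i \<noteq> k" for i k
  proof -
    obtain j where j: "j \<in> pen q" "j \<noteq> i" "j \<noteq> k" using other[of i k] by blast
    obtain y where y: "y \<in> R j" using Rne[OF j(1)] by blast
    show ?thesis
    proof (rule perspective_card(1)[OF qT that(1) j(1) that(2) _ _ subs(2) subs(1)])
      show "y \<in> j - {q}" using y subs(2)[of j] by blast
      show "\<exists>z\<in>B k. z \<in> L x y" if "x \<in> R i" for x
        by (rule rrb[OF \<open>i \<in> pen q\<close> j(1) \<open>k \<in> pen q\<close> j(2)[symmetric] j(3) \<open>i \<noteq> k\<close> that y])
    qed (use j in simp_all)
  qed
  have eq: "card (B i) = card (R j)" if "i \<in> pen q" "j \<in> pen q" for i j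
  proof -
    obtain k where k: "k \<in> pen q" "k \<noteq> i" "k \<noteq> j" using other[of i j] by blast
    obtain k' where k': "k' \<in> pen q" "k' \<noteq> i" "k' \<noteq> k" using other[of i k] by blast
    note L1 = le1[OF that(1) k(1)] le1[OF k(1) that(1)] le2[OF that(1) k(1)] le2[OF k(1) that(1)]
      le1[OF that(1) k'(1)] le1[OF k'(1) that(1)] le2[OF that(1) k'(1)] le2[OF k'(1) that(1)]
      le1[OF k'(1) k(1)] le1[OF k(1) k'(1)] le2[OF k'(1) k(1)] le2[OF k(1) k'(1)]
    have "j = i \<or> j = k'" using third[OF that(1) k(1) k'(1) _ _ _ that(2)] k k' by metis
    then show ?thesis using L1 k k' by (metis le_antisym le_trans)
  qed
  have BR: "B i \<subseteq> R i" if i: "i \<in> pen q" for i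
  proof
    fix x assume x: "x \<in> B i"
    obtain j where j: "j \<in> pen q" "j \<noteq> i" using other[of i i] by blast
    obtain k where k: "k \<in> pen q" "k \<noteq> i" "k \<noteq> j" using other[of i j] by blast
    obtain z where z: "z \<in> R k" using Rne[OF k(1)] by blast
    have "\<exists>y\<in>B j. z \<in> L y x"
    proof (rule perspective_card(2)[OF qT j(1) i k(1) j(2) k(2)[symmetric] subs(1) subs(2) _ _ eq[OF j(1) k(1)] z])
      show "x \<in> i - {q}" using x subs(1)[of i] by blast
      show "\<exists>w\<in>R k. w \<in> L u x" if "u \<in> B j" for u
        by (rule bbr[OF j(1) i k(1) j(2) k(2)[symmetric] k(3)[symmetric] that x])
    qed
    then obtain y where y: "y \<in> B j" "z \<in> L y x" by blast
    have "\<exists>x'\<in>R i. y \<in> L x' z"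
    proof (rule perspective_card(2)[OF qT i k(1) j(1) k(2)[symmetric] k(3) subs(2) subs(1) _ _ eq[OF j(1) i, symmetric] y(1)])
      show "z \<in> k - {q}" using z subs(2)[of k] by blast
      show "\<exists>w\<in>B j. w \<in> L u z" if "u \<in> R i" for u
        by (rule rrb[OF i k(1) j(1) k(2)[symmetric] k(3) j(2)[symmetric] that z])
    qed
    then obtain x' where x': "x' \<in> R i" "y \<in> L x' z" by blast
    have m: "x \<in> i - {q}" "x' \<in> i - {q}" "y \<in> j - {q}" "z \<in> k - {q}" using x x' y z subs by auto
    note c1 = pen_cross[OF qT j(1) k(1) _ m(3,4)] and c2 = pen_cross[OF qT i k(1) _ m(2,4)]
      and c3 = pen_cross[OF qT j(1) i _ m(3,1)]
    have ji: "j \<noteq> i" "j \<noteq> k" "i \<noteq> k" using j k by auto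
    have yT: "y \<in> T" "x \<in> T" "x' \<in> T" "z \<in> T" "y \<noteq> x" "y \<noteq> z" "x' \<noteq> z"
      using c1(1-3)[OF ji(2)] c2(1-3)[OF ji(3)] c3(1-3)[OF ji(1)] by auto
    have "L y z = L y x" using L_eq[OF yT(1,2,5) L_l[OF yT(1,2,5)] y(2) yT(6)] .
    moreover have "L y z = L x' z" using L_eq[OF yT(3,4,7) x'(2) L_r[OF yT(3,4,7)] yT(6)] .
    ultimately have "x' \<in> L y x" using L_l[OF yT(3,4,7)] by simp
    then have "x' = x" using c3(6)[OF ji(1)] m(2) by auto
    then show "x \<in> R i" using x' by simp
  qed
  have RB: "R i = B i" if "i \<in> pen q" for i
  proof -
    have "finite (R i)" using finl(1)[OF that] unfolding R_def by simp
    then show ?thesis using card_seteq[of "R i" "B i"] BR[OF that] eq[OF that that] by simp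
  qed
  have pur: "l - {q} = B l" "l - {q} \<subseteq> Red \<inter> Blue" if "l \<in> pen q" for l
    using RB[OF that] finl[OF that] col unfolding R_def B_def by blast+
  show off: "card l = 3" if "l \<in> lines" "q \<notin> l" for l
  proof -
    obtain x y where xy: "x \<in> T" "y \<in> T" "x \<noteq> y" "l = L x y" using \<open>l \<in> lines\<close> unfolding lines_def by blast
    have "u \<in> Blue" if "u \<in> l" for u
    proof -
      have u: "u \<in> T" "u \<noteq> q" using that \<open>q \<notin> l\<close> lines_sub[OF \<open>l \<in> lines\<close>] by auto
      then show ?thesis using pur(2)[OF pen_memI[OF qT u(1)]] L_r[OF qT u(1)] by auto
    qed
    then have "3 \<le> card l" using mono_ge3[of x y] xy L_l L_r by auto
    then show ?thesis using card_le_deg[OF qT that] d by simp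
  qed
  obtain l where l: "l \<in> pen q" using other by blast
  obtain j where j: "j \<in> pen q" "j \<noteq> l" using other[of l l] by blast
  obtain k where k: "k \<in> pen q" "k \<noteq> l" "k \<noteq> j" using other[of l j] by blast
  define m where "m = card (B l)"
  have cm: "card (B i) = m" if "i \<in> pen q" for i using eq[OF that l] eq[OF l l] m_def by simp
  have cl: "card i = m + 1" if "i \<in> pen q" for i
    using cm[OF that] pur(1)[OF that] finl[OF that] card_Suc_Diff1[of i q] by auto
  have m2: "2 \<le> m"
  proof -
    obtain x where "x \<in> R l" using Rne[OF l] by blast
    then have "3 \<le> card (L q x)" "L q x = l"
      using mono_ge3[of q x] q lines_L[of l q x] finl[OF l] l pen_lines[OF qT] unfolding R_def by auto
    then show ?thesis using cl[OF l] by simp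
  qed
  obtain a where a: "a \<in> T - {q}" "l = L q a" using pen_ex[OF l] by blast
  obtain b where b: "b \<in> T - {q}" "j = L q b" using pen_ex[OF j(1)] by blast
  obtain c where c: "c \<in> T - {q}" "k = L q c" using pen_ex[OF k(1)] by blast
  have cp: "concurrent_prop p T L" using des unfolding desarguesian_def by blast
  have "p \<noteq> 0 \<and> p \<le> card (B l)"
  proof (rule concurrentD[OF cp qT a(1) b(1) c(1)])
    show "L q a \<noteq> L q b" "L q a \<noteq> L q c" "L q b \<noteq> L q c" using j k a b c by auto
    show "B l \<subseteq> L q a - {q}" "B j \<subseteq> L q b - {q}" "B k \<subseteq> L q c - {q}" using subs a b c by auto
    show "\<exists>z\<in>B k. z \<in> L x y" if "x \<in> B l" "y \<in> B j" for x y
      using bbr[OF l j(1) k(1) _ _ _ that] RB[OF k(1)] j k by auto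
    show "\<exists>z\<in>B l. z \<in> L x y" if "x \<in> B j" "y \<in> B k" for x y
      using bbr[OF j(1) k(1) l _ _ _ that] RB[OF l] j k by auto
    show "B l \<noteq> {}" "2 \<le> card (B j)" using Bne[OF l] cm[OF j(1)] m2 by auto
  qed
  then show "\<exists>m\<ge>2. (\<forall>l\<in>pen q. card l = m + 1 \<and> l - {q} \<subseteq> Red \<inter> Blue) \<and> p \<noteq> 0 \<and> p \<le> m"
    using m2 cl pur(2) cm[OF l] by auto
qed

lemma degree_three:
  assumes "q \<in> T" nontriv "deg q = 3"
  shows "\<exists>m\<ge>2. (\<forall>l\<in>pen q. card l = m + 1 \<and> l - {q} \<subseteq> Red \<inter> Blue) \<and> p \<noteq> 0 \<and> p \<le> m"
    and "\<And>l. l \<in> lines \<Longrightarrow> q \<notin> l \<Longrightarrow> card l = 3"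
proof -
  show "\<exists>m\<ge>2. (\<forall>l\<in>pen q. card l = m + 1 \<and> l - {q} \<subseteq> Red \<inter> Blue) \<and> p \<noteq> 0 \<and> p \<le> m"
    using degree_three_red(1) chromatic.degree_three_red(1)[OF swap] assms col by (auto simp: Int_commute)
  show "card l = 3" if "l \<in> lines" "q \<notin> l" for l
    using degree_three_red(2) chromatic.degree_three_red(2)[OF swap] assms col that by blast
qed

end

section \<open>Planes without purple points\<close>

lemma two_of_card: "2 \<le> card A \<Longrightarrow> \<exists>x\<in>A. \<exists>y\<in>A. x \<noteq> y"
proof -
  assume "2 \<le> card A"
  then obtain B where "B \<subseteq> A" "card B = 2" using obtain_subset_with_card_n by metis
  then show ?thesis by (auto simp: card_2_iff)
qed

context chromatic begin

subsection \<open>Planes without two-coloured points\<close>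

text \<open>Degree three makes points purple.\<close>

lemma unicoloured_deg_ge4:
  assumes "Red \<inter> Blue = {}" nontriv "q \<in> T" shows "4 \<le> deg q"
proof (rule ccontr)
  assume "\<not> 4 \<le> deg q"
  then have d: "deg q = 3" using deg_ge3[OF assms(3,2)] by simp
  obtain m where m: "2 \<le> m" "\<forall>l\<in>pen q. card l = m + 1 \<and> l - {q} \<subseteq> Red \<inter> Blue"
    using degree_three(1)[OF assms(3,2) d] by blast
  obtain l where l: "l \<in> pen q" using d unfolding deg_def by (metis card.empty ex_in_conv zero_neq_numeral)
  then have "l \<subseteq> {q}" "card l \<ge> 3" using m assms(1) by auto
  then show False using card_mono[of "{q}" l] by simp
qed

text \<open>With five reds or fewer, a blue point has degree four or five and almost all lines through it carry a single red. The secants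
  of the reds then have too few blue points to be pairwise consistent.\<close>

lemma unicoloured_red_ge6:
  assumes d: "Red \<inter> Blue = {}" and nt: nontriv
  shows "6 \<le> card Red"
proof (rule ccontr)
  assume "\<not> 6 \<le> card Red"
  then have le5: "card Red \<le> 5" by simp
  have finR: "finite Red" using fin col by simp
  have RT: "x \<in> T" if "x \<in> Red" for x using that col by auto
  have BT: "x \<in> T" if "x \<in> Blue" for x using that col by auto
  have redsum: "card Red = (\<Sum>l\<in>pen Q. card (l \<inter> Red))" if Q: "Q \<in> Blue" for Q
  proof -
    have QT: "Q \<in> T" using BT[OF Q] .
    have "card Red = (\<Sum>y\<in>T - {Q}. if y \<in> Red then 1 else 0)"
      using Q d col fin by (auto simp: sum.If_cases intro!: arg_cong[of _ _ card])
    also have "\<dots> = (\<Sum>l\<in>pen Q. \<Sum>y\<in>l - {Q}. if y \<in> Red then 1 else 0)" by (rule sum_pen[OF QT])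
    also have "\<dots> = (\<Sum>l\<in>pen Q. card (l \<inter> Red))"
    proof (rule sum.cong[OF refl])
      fix l assume "l \<in> pen Q"
      then have "finite l" using pen_lines[OF QT] lines_fin by auto
      then show "(\<Sum>y\<in>l - {Q}. if y \<in> Red then 1 else 0) = card (l \<inter> Red)"
        using Q d by (auto simp: sum.If_cases intro!: arg_cong[of _ _ card])
    qed
    finally show ?thesis .
  qed
  have one: "1 \<le> card (l \<inter> Red)" if "Q \<in> Blue" "l \<in> pen Q" for Q l
  proof -
    have "l \<inter> Red \<noteq> {}" using chromatic.red_pencil_blue[OF swap that] by blast
    then show ?thesis using finR by (simp add: Suc_leI card_gt_0_iff)
  qed
  \<comment> \<open>A blue point sees the reds along at least four lines, each with a red. So a blue point on a
    line with two reds uses up all five reds, and that line has only these two.\<close>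
  have secant: "L x y \<inter> Red = {x, y}" "card Red = 5" "deg Q = 4"
      "\<And>l. l \<in> pen Q \<Longrightarrow> l \<noteq> L x y \<Longrightarrow> card (l \<inter> Red) = 1"
    if x: "x \<in> Red" and y: "y \<in> Red" and xy: "x \<noteq> y" and Q: "Q \<in> Blue" "Q \<in> L x y" for x y Q
  proof -
    note T = RT[OF x] RT[OF y] xy
    have m: "L x y \<in> pen Q" using pen_lines[OF BT[OF Q(1)]] L_lines[OF T] Q by simp
    have s: "{x, y} \<subseteq> L x y \<inter> Red" using x y L_l[OF T] L_r[OF T] by simp
    then have c2: "2 \<le> card (L x y \<inter> Red)" using card_mono[of "L x y \<inter> Red" "{x,y}"] finR xy by simp
    have d4: "4 \<le> deg Q" using unicoloured_deg_ge4[OF d nt BT[OF Q(1)]] .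
    have split: "card Red = card (L x y \<inter> Red) + (\<Sum>l\<in>pen Q - {L x y}. card (l \<inter> Red))"
      using redsum[OF Q(1)] sum.remove[OF fin_pen m, of "\<lambda>l. card (l \<inter> Red)"] by simp
    have "(\<Sum>l\<in>pen Q - {L x y}. 1) \<le> (\<Sum>l\<in>pen Q - {L x y}. card (l \<inter> Red))"
      by (rule sum_mono) (use one[OF Q(1)] in auto)
    then have r: "deg Q - 1 \<le> (\<Sum>l\<in>pen Q - {L x y}. card (l \<inter> Red))"
      using m fin_pen unfolding deg_def by simp
    show "card Red = 5" "deg Q = 4" using split c2 r d4 le5 by linarith+
    have "card (L x y \<inter> Red) = card {x, y}" using split c2 r d4 le5 xy by simp
    then show "L x y \<inter> Red = {x, y}" using card_seteq[of "L x y \<inter> Red" "{x,y}"] s finR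
      by (metis card_subset_eq finite_Int)
    fix l assume l: "l \<in> pen Q" "l \<noteq> L x y"
    have "(\<Sum>l\<in>pen Q - {L x y}. card (l \<inter> Red)) = card (l \<inter> Red) + (\<Sum>l\<in>pen Q - {L x y} - {l}. card (l \<inter> Red))"
      by (rule sum.remove) (use l fin_pen in auto)
    moreover have "(\<Sum>l\<in>pen Q - {L x y} - {l}. 1) \<le> (\<Sum>l\<in>pen Q - {L x y} - {l}. card (l \<inter> Red))"
      by (rule sum_mono) (use one[OF Q(1)] in auto)
    moreover have "card (pen Q - {L x y} - {l}) = deg Q - 2" using m l fin_pen unfolding deg_def by simp
    ultimately show "card (l \<inter> Red) = 1" using split c2 d4 le5 one[OF Q(1) l(1)] by simp
  qed
  \<comment> \<open>Two reds exist, hence five of them.\<close>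
  obtain q where q: "q \<in> T" using nt unfolding nontriv_def by blast
  have "\<exists>Q. Q \<in> Blue"
  proof (cases "q \<in> Blue")
    case False
    then have "q \<in> Red" using q col by auto
    obtain l where "l \<in> pen q" using two_pencil_lines[OF q nt] by blast
    then show ?thesis using red_pencil_blue[OF \<open>q \<in> Red\<close>] by blast
  qed blast
  then obtain Q where Q: "Q \<in> Blue" by blast
  have "(\<Sum>l\<in>pen Q. 1) \<le> card Red" unfolding redsum[OF Q] by (rule sum_mono) (use one[OF Q] in auto)
  then have "4 \<le> card Red" using unicoloured_deg_ge4[OF d nt BT[OF Q]] unfolding deg_def by simp
  then obtain x y where xy: "x \<in> Red" "y \<in> Red" "x \<noteq> y"
    using two_of_card[of Red] by auto
  obtain Q' where "Q' \<in> Blue" "Q' \<in> L x y" using rr[OF xy] by blast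
  then have R5: "card Red = 5" using secant(2)[OF xy] by blast
  define b where "b x y = (SOME z. z \<in> Blue \<and> z \<in> L x y)" for x y
  have b: "b x y \<in> Blue" "b x y \<in> L x y" "b x y \<in> T" if "x \<in> Red" "y \<in> Red" "x \<noteq> y" for x y
    using someI_ex[of "\<lambda>z. z \<in> Blue \<and> z \<in> L x y"] rr[OF that] BT unfolding b_def by blast+
  have only: "L x y \<inter> Red = {x, y}" if "x \<in> Red" "y \<in> Red" "x \<noteq> y" for x y
    using secant(1)[OF that b(1,2)[OF that]] .
  have Bne: "x \<noteq> z" if "x \<in> Red" "z \<in> Blue" for x z using that d by auto
  have five: "w = u" if D: "distinct [i, j, k, l, u]" "{i, j, k, l, u} \<subseteq> Red" and w: "w \<in> Red" "w \<notin> {i, j, k, l}" for i j k l u w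
  proof -
    have "card {i, j, k, l, u} = 5" using D by simp
    then have "{i, j, k, l, u} = Red" using card_subset_eq[OF finR D(2)] R5 by simp
    then show ?thesis using w by auto
  qed
  \<comment> \<open>Where a blue point of one secant sees a given blue point.\<close>
  have sees: "\<exists>z\<in>Red - {x, y}. Q' \<in> L Q z"
    if x: "x \<in> Red" "y \<in> Red" "x \<noteq> y" and Q: "Q \<in> Blue" "Q \<in> L x y" and Q': "Q' \<in> Blue" "Q' \<notin> L x y" for x y Q Q'
  proof -
    have ne: "Q' \<noteq> Q" using Q Q' by auto
    have l: "L Q Q' \<in> pen Q" using pen_memI[OF BT[OF Q(1)] BT[OF Q'(1)]] ne by simp
    have Q'l: "Q' \<in> L Q Q'" using L_r[OF BT[OF Q(1)] BT[OF Q'(1)]] ne by simp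
    have "L Q Q' \<noteq> L x y" using Q'l Q' by auto
    then have "card (L Q Q' \<inter> Red) = 1" using secant(4)[OF x Q l] by simp
    then obtain z where z: "z \<in> L Q Q'" "z \<in> Red" by (metis Int_iff card_1_singletonE insertI1)
    have zQ: "z \<noteq> Q" using Bne z Q by blast
    have "L Q z = L Q Q'" using L_eq[OF BT[OF Q(1)] BT[OF Q'(1)] ne[symmetric] _ z(1) zQ[symmetric]]
        L_l[OF BT[OF Q(1)] BT[OF Q'(1)]] ne by simp
    moreover have "z \<notin> {x, y}"
    proof
      assume "z \<in> {x, y}"
      then have "z \<in> L x y" using L_l[OF RT[OF x(1)] RT[OF x(2)] x(3)] L_r[OF RT[OF x(1)] RT[OF x(2)] x(3)] by auto
      then have "L Q z = L x y" using L_eq[OF RT[OF x(1)] RT[OF x(2)] x(3) Q(2)] zQ by simp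
      then show False using calculation \<open>L Q Q' \<noteq> L x y\<close> by simp
    qed
    ultimately show ?thesis using z Q'l by auto
  qed
  have notsec: "Q \<notin> L z w" if "x \<in> Red" "y \<in> Red" "x \<noteq> y" "z \<in> Red" "w \<in> Red" "z \<noteq> w" "Q \<in> Blue" "Q \<in> L x y" "z \<notin> {x, y}"
    for x y z w Q
  proof
    assume Q: "Q \<in> L z w"
    have lp: "L z w \<in> pen Q" using pen_lines[OF BT[OF that(7)]] L_lines[OF RT[OF that(4)] RT[OF that(5)] that(6)] Q by simp
    have "z \<in> L z w" using L_l[OF RT[OF that(4)] RT[OF that(5)] that(6)] .
    then have "L z w \<noteq> L x y" using only[OF that(1-3)] that(4,9) by auto
    then have "card (L z w \<inter> Red) = 1" using secant(4)[OF that(1-3,7,8) lp] by simp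
    then show False using only[OF that(4-6)] that(6) by simp
  qed
  have opp: "b k l \<in> L (b i j) u" if D: "distinct [i, j, k, l, u]" "{i, j, k, l, u} \<subseteq> Red" for i j k l u
  proof -
    have r: "i \<in> Red" "j \<in> Red" "i \<noteq> j" "k \<in> Red" "l \<in> Red" "k \<noteq> l" using D by auto
    have nk: "b k l \<notin> L i j" "b i j \<notin> L k l"
      using notsec[OF r(4-6) r(1-3) b(1,2)[OF r(4-6)]] notsec[OF r(1-3) r(4-6) b(1,2)[OF r(1-3)]] D by auto
    obtain z where z: "z \<in> Red - {i, j}" "b k l \<in> L (b i j) z"
      using sees[OF r(1-3) b(1,2)[OF r(1-3)] b(1)[OF r(4-6)] nk(1)] by blast
    have T: "b i j \<in> T" "z \<in> T" "b i j \<noteq> z" using b(3)[OF r(1-3)] z RT Bne[of z "b i j"] b(1)[OF r(1-3)] by auto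
    have "z \<notin> {k, l}"
    proof
      assume zk: "z \<in> {k, l}"
      have zb: "z \<noteq> b k l" using Bne[of z] z b(1)[OF r(4-6)] by auto
      have "z \<in> L k l" using zk L_l[OF RT[OF r(4)] RT[OF r(5)] r(6)] L_r[OF RT[OF r(4)] RT[OF r(5)] r(6)] by auto
      then have "L z (b k l) = L k l" using L_eq[OF RT[OF r(4)] RT[OF r(5)] r(6) _ b(2)[OF r(4-6)] zb] by simp
      moreover have "L z (b k l) = L (b i j) z" using L_eq[OF T L_r[OF T] z(2) zb] .
      ultimately show False using L_l[OF T] nk by simp
    qed
    then have "z = u" using five[OF D] z by auto
    then show ?thesis using z by simp
  qed
  \<comment> \<open>The blue points of two secants through i lie on a line with exactly one of the two remaining reds.\<close>
  have adj: "(b i k \<in> L (b i j) l) \<noteq> (b i k \<in> L (b i j) u)" if D: "distinct [i, j, k, l, u]" "{i, j, k, l, u} \<subseteq> Red" for i j k l u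
  proof -
    have r: "i \<in> Red" "j \<in> Red" "i \<noteq> j" "i \<in> Red" "k \<in> Red" "i \<noteq> k" using D by auto
    have r': "k \<in> Red" "i \<in> Red" "k \<noteq> i" "j \<in> Red" "j \<noteq> i" using D by auto
    have com: "L k i = L i k" "L j i = L i j" using L_comm[of i k] L_comm[of i j] RT r by auto
    have nk: "b i k \<notin> L i j" "b i j \<notin> L i k"
      using notsec[OF r(4-6) r'(4,2,5), of "b i k"] notsec[OF r(1-3) r'(1-3), of "b i j"]
        b(1,2)[OF r(4-6)] b(1,2)[OF r(1-3)] com D by auto
    obtain z where z: "z \<in> Red - {i, j}" "b i k \<in> L (b i j) z"
      using sees[OF r(1-3) b(1,2)[OF r(1-3)] b(1)[OF r(4-6)] nk(1)] by blast
    have T: "b i j \<in> T" "z \<in> T" "b i j \<noteq> z" using b(3)[OF r(1-3)] z RT Bne[of z "b i j"] b(1)[OF r(1-3)] by auto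
    have "z \<noteq> k"
    proof
      assume zk: "z = k"
      have zb: "z \<noteq> b i k" using Bne[of z] z b(1)[OF r(4-6)] by auto
      have "z \<in> L i k" using zk L_r[OF RT[OF r(4)] RT[OF r(5)] r(6)] by auto
      then have "L z (b i k) = L i k" using L_eq[OF RT[OF r(4)] RT[OF r(5)] r(6) _ b(2)[OF r(4-6)] zb] by simp
      moreover have "L z (b i k) = L (b i j) z" using L_eq[OF T L_r[OF T] z(2) zb] .
      ultimately show False using L_l[OF T] nk by simp
    qed
    then have zl: "z = l \<or> z = u" using five[OF D, of z] z by auto
    have "\<not> (b i k \<in> L (b i j) l \<and> b i k \<in> L (b i j) u)"
    proof
      assume a: "b i k \<in> L (b i j) l \<and> b i k \<in> L (b i j) u"
      have lu: "l \<in> Red" "u \<in> Red" "l \<noteq> u" using D by auto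
      have ne: "b i j \<noteq> b i k" using nk b(2)[OF r(1-3)] by auto
      have Tl: "b i j \<in> T" "l \<in> T" "b i j \<noteq> l" and Tu: "b i j \<in> T" "u \<in> T" "b i j \<noteq> u"
        using T(1) RT lu Bne[of l "b i j"] Bne[of u "b i j"] b(1)[OF r(1-3)] by auto
      have "L (b i j) l = L (b i j) u"
        using L_eq[OF Tl L_l[OF Tl] _ ne] L_eq[OF Tu L_l[OF Tu] _ ne] a by simp
      then have "l \<in> L (b i j) u" "u \<in> L (b i j) u" using L_r[OF Tl] L_r[OF Tu] by auto
      then have "L l u = L (b i j) u" using L_eq[OF Tu] lu by simp
      then have "b i j \<in> L l u" using L_l[OF Tu] by simp
      then show False using notsec[OF r(1-3) lu b(1,2)[OF r(1-3)]] D by auto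
    qed
    then show ?thesis using z zl by blast
  qed
  have bsym: "b j i = b i j" if "i \<in> Red" "j \<in> Red" "i \<noteq> j" for i j
    unfolding b_def using L_comm[OF RT[OF that(1)] RT[OF that(2)] that(3)] by simp
  have same: "b l k \<in> L (b l j) u" if a: "b i k \<in> L (b i j) u" and D: "distinct [i, j, k, l, u]" "{i, j, k, l, u} \<subseteq> Red" for i j k l u
  proof -
    have r: "i \<in> Red" "j \<in> Red" "k \<in> Red" "l \<in> Red" "u \<in> Red" using D by auto
    have 1: "b k l \<in> L (b i j) u" using opp[of i j k l u] D by auto
    have 2: "b j l \<in> L (b i k) u" using opp[of i k j l u] D by auto
    have T: "b i j \<in> T" "u \<in> T" "b i j \<noteq> u" "b i k \<in> T" "b i k \<noteq> u" "b l j \<in> T" "b l j \<noteq> u"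
      using b(1,3)[of i j] b(1,3)[of i k] b(1,3)[of l j] r D RT Bne[of u "b i j"] Bne[of u "b i k"] Bne[of u "b l j"] by auto
    have e: "L (b i k) u = L (b i j) u" using L_eq[OF T(1,2,3) a L_r[OF T(1-3)] T(5)] .
    have jl: "b l j = b j l" "b l k = b k l" using bsym[of j l] bsym[of k l] r D by auto
    have "L (b l j) u = L (b i j) u" using L_eq[OF T(1,2,3) _ L_r[OF T(1-3)] T(7)] 2 e jl by simp
    then show ?thesis using 1 jl by simp
  qed
  obtain xs where xs: "set xs = Red" "distinct xs" using finite_distinct_list[OF finR] by blast
  then have "length xs = 5" using R5 distinct_card by metis
  then obtain i j k l u where "xs = [i, j, k, l, u]"
    by (auto simp: numeral_eq_Suc length_Suc_conv)
  then have D: "distinct [i, j, k, l, u]" "{i, j, k, l, u} = Red" using xs by auto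
  have D': "{i, j, k, l, u} \<subseteq> Red" "{l, j, k, i, u} \<subseteq> Red" "{i, j, k, u, l} \<subseteq> Red" "{u, j, k, l, i} \<subseteq> Red" "{u, j, k, i, l} \<subseteq> Red" "{l, j, k, u, i} \<subseteq> Red"
    using D(2) by auto
  have E: "distinct [l, j, k, i, u]" "distinct [i, j, k, u, l]" "distinct [u, j, k, l, i]" "distinct [u, j, k, i, l]" "distinct [l, j, k, u, i]"
    using D(1) by auto
  show False
    using adj[OF D(1) D'(1)] adj[OF E(1) D'(2)] adj[OF E(3) D'(4)]
      same[OF _ D(1) D'(1)] same[OF _ E(1) D'(2)] same[OF _ E(2) D'(3)] same[OF _ E(4) D'(5)]
      same[OF _ E(3) D'(4)] same[OF _ E(5) D'(6)] by blast
qed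

end

section \<open>Purple points of degree four\<close>

lemma three_lines_arith:
  fixes r b t1 t2 t3 t4 :: nat
  assumes "2 + r + b \<le> t1 + t2 + t3 + t4" "2 * t1 + 6 * t4 \<le> 6" "2 * t3 + 6 * t2 \<le> 6" "2 * t1 \<le> 3 * r"
    "t1 + 3 * t2 \<le> 3 * r" "2 * t3 \<le> 3 * b" "t3 + 3 * t4 \<le> 3 * b" "r + b \<le> 3" "r = 0 \<or> b = 0 \<longrightarrow> r + b \<le> 1"
  shows False
proof -
  have "r \<le> 3" "b \<le> 3" using assms(8) by auto
  then have "r = 0 \<or> r = 1 \<or> r = 2 \<or> r = 3" "b = 0 \<or> b = 1 \<or> b = 2 \<or> b = 3" by auto
  moreover have "t2 = 0 \<or> t2 = 1" "t4 = 0 \<or> t4 = 1" using assms(2,3) by auto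
  ultimately show False using assms by (elim disjE) auto
qed

lemma small_cases:
  fixes x y dr db :: nat
  assumes "x + y \<le> 3" "dr + db \<le> 1" "1 \<le> x + dr" "1 \<le> y + db"
  shows "(x, y, dr, db) \<in> {(1,1,0,0),(2,1,0,0),(1,2,0,0),(0,1,1,0),(0,2,1,0),(0,3,1,0),(1,1,1,0),(2,1,1,0),(1,2,1,0),
     (1,0,0,1),(2,0,0,1),(3,0,0,1),(1,1,0,1),(2,1,0,1),(1,2,0,1)}"
proof -
  have "x = 0 \<or> x = 1 \<or> x = 2 \<or> x = 3" "y = 0 \<or> y = 1 \<or> y = 2 \<or> y = 3" "dr = 0 \<or> dr = 1" "db = 0 \<or> db = 1"
    using assms by auto
  then show ?thesis using assms by (elim disjE) simp_all
qed

lemma another_element: "2 \<le> card A \<Longrightarrow> \<exists>x\<in>A. x \<noteq> y"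
  using two_of_card[of A] by metis

lemma card1_eq: "finite A \<Longrightarrow> x \<in> A \<Longrightarrow> card A \<le> 1 \<Longrightarrow> A = {x}"
  using card_le_Suc0_iff_eq[of A] by auto

context chromatic begin

definition "Rp = Red - Blue"
definition "Bp = Blue - Red"
definition "Mp = Red \<inter> Blue"

lemma colour_cases: "x \<in> T \<Longrightarrow> x \<in> Rp \<or> x \<in> Bp \<or> x \<in> Mp"
  and colour_disj: "Rp \<inter> Bp = {}" "Rp \<inter> Mp = {}" "Bp \<inter> Mp = {}"
  and colour_sub: "Rp \<subseteq> T" "Bp \<subseteq> T" "Mp \<subseteq> T"
  unfolding Rp_def Bp_def Mp_def using col by auto

lemma line_colours': "l \<in> lines \<Longrightarrow> l \<inter> Rp \<noteq> {} \<and> l \<inter> Bp \<noteq> {} \<or> 3 \<le> card (l \<inter> Mp)"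
  using line_colours[of l] unfolding Rp_def Bp_def Mp_def by blast

end

text \<open>Three lines through \<open>q\<close> have three points and the fourth has three or four; both sizes are treated at once,
  since the counts differ only by the additional point.\<close>

locale degree_four = chromatic T L Red Blue p for T :: "'p set" and L Red Blue p +
  fixes q :: 'p and a b c d :: "'p set"
  assumes qM: "q \<in> Red" "q \<in> Blue" and pen: "pen q = {a, b, c, d}" and dist: "distinct [a, b, c, d]"
    and abc3: "card a = 3" "card b = 3" "card c = 3" and d4: "card d = 3 \<or> card d = 4"
begin

lemma qT: "q \<in> T" using qM col by auto

lemma pl: "m \<in> pen q \<Longrightarrow> m \<in> lines" "m \<in> pen q \<Longrightarrow> q \<in> m" "m \<in> pen q \<Longrightarrow> finite m" "m \<in> pen q \<Longrightarrow> m \<subseteq> T"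
  using pen_lines[OF qT] lines_fin lines_sub by auto

lemma Mq: "q \<in> Mp" unfolding Mp_def using qM by simp

lemma T_eq: "T \<subseteq> a \<union> b \<union> c \<union> d"
proof
  fix x assume "x \<in> T"
  show "x \<in> a \<union> b \<union> c \<union> d"
  proof (cases "x = q")
    case True then show ?thesis using pl(2)[of a] pen by simp
  next
    case False
    then have "L q x \<in> pen q" "x \<in> L q x" using pen_memI[OF qT \<open>x \<in> T\<close>] L_r[OF qT \<open>x \<in> T\<close>] by auto
    then show ?thesis using pen by auto
  qed
qed

lemma meet: "m \<in> pen q \<Longrightarrow> n \<in> pen q \<Longrightarrow> m \<noteq> n \<Longrightarrow> m \<inter> n = {q}"
  using pen_disj[OF qT] pl(2) by blast

text \<open>A line of the quotient has as many points as \<open>P\<close> has lines in the corresponding plane.\<close>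

lemma three_line:
  assumes "m \<in> pen q" "card m = 3"
  shows "(\<exists>r s. r \<in> Rp \<and> s \<in> Bp \<and> m = {q, r, s}) \<or> m \<subseteq> Mp"
proof (cases "3 \<le> card (m \<inter> Mp)")
  case True
  then have "m \<inter> Mp = m" using card_seteq[of m "m \<inter> Mp"] assms pl by auto
  then show ?thesis by blast
next
  case False
  then obtain r s where rs: "r \<in> m" "r \<in> Rp" "s \<in> m" "s \<in> Bp" using line_colours'[OF pl(1)[OF assms(1)]] by blast
  then have "q \<noteq> r" "q \<noteq> s" "r \<noteq> s" using Mq colour_disj by blast+
  then have "card {q, r, s} = 3" by simp
  then have "{q, r, s} = m" using card_subset_eq[of m "{q, r, s}"] rs assms pl by auto
  then show ?thesis using rs by blast
qed

definition "pure m = (if m \<subseteq> Mp then 0 else 1::nat)"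

lemma pure_card:
  assumes "m \<in> pen q" "card m = 3"
  shows "card (Rp \<inter> m) = pure m" "card (Bp \<inter> m) = pure m" "pure m = 1 \<Longrightarrow> Mp \<inter> m = {q}" "pure m \<le> 1"
    "pure m = 0 \<Longrightarrow> (Rp \<union> Bp) \<inter> m = {}"
proof -
  have "card (Rp \<inter> m) = pure m \<and> card (Bp \<inter> m) = pure m \<and> (pure m = 1 \<longrightarrow> Mp \<inter> m = {q}) \<and> pure m \<le> 1
      \<and> (pure m = 0 \<longrightarrow> (Rp \<union> Bp) \<inter> m = {})"
  proof (cases "m \<subseteq> Mp")
    case True
    then have "Rp \<inter> m = {}" "Bp \<inter> m = {}" using colour_disj by auto
    then show ?thesis using True unfolding pure_def by auto
  next
    case False
    then obtain r s where rs: "r \<in> Rp" "s \<in> Bp" "m = {q, r, s}" using three_line[OF assms] by blast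
    then have "Rp \<inter> m = {r}" "Bp \<inter> m = {s}" "Mp \<inter> m = {q}" using colour_disj Mq by auto
    then show ?thesis using False unfolding pure_def by auto
  qed
  then show "card (Rp \<inter> m) = pure m" "card (Bp \<inter> m) = pure m" "pure m = 1 \<Longrightarrow> Mp \<inter> m = {q}" "pure m \<le> 1"
    "pure m = 0 \<Longrightarrow> (Rp \<union> Bp) \<inter> m = {}" by auto
qed

definition "off = {l \<in> lines. q \<notin> l}"

lemma off_meet: "l \<in> off \<Longrightarrow> m \<in> pen q \<Longrightarrow> card (l \<inter> m) \<le> 1"
proof (rule ccontr)
  assume l: "l \<in> off" and m: "m \<in> pen q" and "\<not> card (l \<inter> m) \<le> 1"
  then obtain x y where "x \<in> l \<inter> m" "y \<in> l \<inter> m" "x \<noteq> y" using two_of_card[of "l \<inter> m"] by auto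
  then show False using lines_unique[of l m x y] l m pl unfolding off_def by auto
qed

definition "X = Rp \<inter> (a \<union> b \<union> c)"
definition "Y = Bp \<inter> (a \<union> b \<union> c)"
definition "DR = Rp \<inter> d"
definition "DB = Bp \<inter> d"
definition "s = pure a + pure b + pure c"

lemma pens: "a \<in> pen q" "b \<in> pen q" "c \<in> pen q" "d \<in> pen q" using pen by auto

lemma card_three:
  assumes "q \<notin> Z"
  shows "card (Z \<inter> (a \<union> b \<union> c)) = card (Z \<inter> a) + card (Z \<inter> b) + card (Z \<inter> c)"
proof -
  have d: "a \<inter> b = {q}" "a \<inter> c = {q}" "b \<inter> c = {q}" using meet pens dist by auto
  have f: "finite a" "finite b" "finite c" using pl pens by auto
  have "Z \<inter> (a \<union> b \<union> c) = (Z \<inter> a) \<union> (Z \<inter> b) \<union> (Z \<inter> c)" by blast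
  also have "card \<dots> = card ((Z \<inter> a) \<union> (Z \<inter> b)) + card (Z \<inter> c)"
    by (rule card_Un_disjoint) (use d f assms in auto)
  also have "card ((Z \<inter> a) \<union> (Z \<inter> b)) = card (Z \<inter> a) + card (Z \<inter> b)"
    by (rule card_Un_disjoint) (use d f assms in auto)
  finally show ?thesis .
qed

lemma qnot: "q \<notin> Rp" "q \<notin> Bp" using Mq colour_disj by auto

lemma card_XY: "card X = s" "card Y = s"
  unfolding X_def Y_def s_def using card_three[OF qnot(1)] card_three[OF qnot(2)]
    pure_card(1,2)[OF pens(1) abc3(1)] pure_card(1,2)[OF pens(2) abc3(2)] pure_card(1,2)[OF pens(3) abc3(3)] by auto

lemma off_counts:
  assumes l: "l \<in> off"
  shows "card (X \<inter> l) + card (Y \<inter> l) \<le> s" "card (DR \<inter> l) + card (DB \<inter> l) \<le> 1"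
    "card (l \<inter> Mp) \<le> (3 - s) + 1"
    "l \<inter> Rp \<noteq> {} \<Longrightarrow> 1 \<le> card (X \<inter> l) + card (DR \<inter> l)"
    "l \<inter> Bp \<noteq> {} \<Longrightarrow> 1 \<le> card (Y \<inter> l) + card (DB \<inter> l)"
proof -
  have lT: "l \<subseteq> T" "finite l" "q \<notin> l" using l lines_sub lines_fin unfolding off_def by auto
  have q: "q \<notin> Rp \<inter> l" "q \<notin> Bp \<inter> l" "q \<notin> Mp \<inter> l" using lT by auto
  have m: "card (Rp \<inter> l \<inter> m) + card (Bp \<inter> l \<inter> m) \<le> pure m \<and> card (Mp \<inter> l \<inter> m) \<le> 1 - pure m"
    if "m \<in> pen q" "card m = 3" for m
  proof (cases "pure m = 0")
    case True
    then have "Rp \<inter> l \<inter> m = {}" "Bp \<inter> l \<inter> m = {}" using pure_card(5)[OF that True] by auto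
    moreover have "card (Mp \<inter> l \<inter> m) \<le> card (l \<inter> m)" by (rule card_mono) (use lT in auto)
    ultimately show ?thesis using off_meet[OF l that(1)] True by simp
  next
    case False
    then have p1: "pure m = 1" using pure_card(4)[OF that] by simp
    have "card (Rp \<inter> l \<inter> m) + card (Bp \<inter> l \<inter> m) = card ((Rp \<inter> l \<inter> m) \<union> (Bp \<inter> l \<inter> m))"
      by (rule card_Un_disjoint[symmetric]) (use lT colour_disj in auto)
    also have "\<dots> \<le> card (l \<inter> m)" by (rule card_mono) (use lT in auto)
    finally have "card (Rp \<inter> l \<inter> m) + card (Bp \<inter> l \<inter> m) \<le> 1" using off_meet[OF l that(1)] by simp
    moreover have "Mp \<inter> l \<inter> m = {}" using pure_card(3)[OF that p1] lT by auto
    ultimately show ?thesis using p1 by simp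
  qed
  have XY: "X \<inter> l = (Rp \<inter> l) \<inter> (a \<union> b \<union> c)" "Y \<inter> l = (Bp \<inter> l) \<inter> (a \<union> b \<union> c)" unfolding X_def Y_def by auto
  note ms = m[OF pens(1) abc3(1)] m[OF pens(2) abc3(2)] m[OF pens(3) abc3(3)]
  show "card (X \<inter> l) + card (Y \<inter> l) \<le> s"
    unfolding XY card_three[OF q(1)] card_three[OF q(2)] s_def using ms by linarith
  have "card (DR \<inter> l) + card (DB \<inter> l) = card ((DR \<inter> l) \<union> (DB \<inter> l))"
    by (rule card_Un_disjoint[symmetric]) (use lT colour_disj in \<open>auto simp: DR_def DB_def\<close>)
  also have "\<dots> \<le> card (l \<inter> d)" by (rule card_mono) (use lT in \<open>auto simp: DR_def DB_def\<close>)
  finally show "card (DR \<inter> l) + card (DB \<inter> l) \<le> 1" using off_meet[OF l pens(4)] by simp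
  have "l \<inter> Mp \<subseteq> ((Mp \<inter> l) \<inter> (a \<union> b \<union> c)) \<union> (l \<inter> d)" using lT T_eq by auto
  then have "card (l \<inter> Mp) \<le> card (((Mp \<inter> l) \<inter> (a \<union> b \<union> c)) \<union> (l \<inter> d))" by (rule card_mono[rotated]) (use lT in auto)
  also have "\<dots> \<le> card ((Mp \<inter> l) \<inter> (a \<union> b \<union> c)) + card (l \<inter> d)" by (rule card_Un_le)
  also have "\<dots> \<le> (3 - s) + 1"
  proof -
    have "card ((Mp \<inter> l) \<inter> (a \<union> b \<union> c)) \<le> 3 - s"
      unfolding card_three[OF q(3)] s_def using ms pure_card(4)[OF pens(1) abc3(1)]
        pure_card(4)[OF pens(2) abc3(2)] pure_card(4)[OF pens(3) abc3(3)] by linarith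
    then show ?thesis using off_meet[OF l pens(4)] by simp
  qed
  finally show "card (l \<inter> Mp) \<le> (3 - s) + 1" .
  have "finite (X \<inter> l)" "finite (DR \<inter> l)" "finite (Y \<inter> l)" "finite (DB \<inter> l)" using lT by auto
  moreover have "l \<inter> Rp \<subseteq> (X \<inter> l) \<union> (DR \<inter> l)" "l \<inter> Bp \<subseteq> (Y \<inter> l) \<union> (DB \<inter> l)"
    unfolding X_def DR_def Y_def DB_def using lT T_eq by auto
  ultimately show "l \<inter> Rp \<noteq> {} \<Longrightarrow> 1 \<le> card (X \<inter> l) + card (DR \<inter> l)"
    "l \<inter> Bp \<noteq> {} \<Longrightarrow> 1 \<le> card (Y \<inter> l) + card (DB \<inter> l)"
    by (metis Int_empty_left Un_empty card_eq_0_iff add_is_0 less_one linorder_not_less subset_empty)+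
qed

lemma lines_split: "lines = pen q \<union> off" "pen q \<inter> off = {}" "finite off"
  using pen_lines[OF qT] finite_lines unfolding off_def by auto

lemma sum_lines: "(\<Sum>l\<in>lines. f l) = f a + f b + f c + f d + (\<Sum>l\<in>off. f l)" for f :: "'p set \<Rightarrow> nat"
proof -
  have "(\<Sum>l\<in>lines. f l) = (\<Sum>l\<in>pen q. f l) + (\<Sum>l\<in>off. f l)"
    unfolding lines_split(1) by (rule sum.union_disjoint) (use lines_split fin_pen in auto)
  then show ?thesis using dist unfolding pen by simp
qed

lemma pair_sums:
  defines "x l \<equiv> card (X \<inter> l)" and "y l \<equiv> card (Y \<inter> l)" and "dr l \<equiv> card (DR \<inter> l)" and "db l \<equiv> card (DB \<inter> l)"
  shows "(\<Sum>l\<in>off. x l * (x l - 1)) = s * (s - 1)" "(\<Sum>l\<in>off. y l * (y l - 1)) = s * (s - 1)"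
    "(\<Sum>l\<in>off. x l * y l) + s = s * s" "(\<Sum>l\<in>off. x l * dr l) = s * card DR" "(\<Sum>l\<in>off. x l * db l) = s * card DB"
    "(\<Sum>l\<in>off. y l * dr l) = s * card DR" "(\<Sum>l\<in>off. y l * db l) = s * card DB"
proof -
  have sub: "X \<subseteq> T" "Y \<subseteq> T" "DR \<subseteq> T" "DB \<subseteq> T"
    unfolding X_def Y_def DR_def DB_def using colour_sub by auto
  have dj: "a \<inter> b = {q}" "a \<inter> c = {q}" "b \<inter> c = {q}" "a \<inter> d = {q}" "b \<inter> d = {q}" "c \<inter> d = {q}"
    using meet pens dist by auto
  have XYm: "X \<inter> m = Rp \<inter> m" "Y \<inter> m = Bp \<inter> m" "DR \<inter> m = {}" "DB \<inter> m = {}" if "m \<in> {a, b, c}" for m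
    unfolding X_def Y_def DR_def DB_def using that dj qnot by auto
  have XYd: "X \<inter> d = {}" "Y \<inter> d = {}" unfolding X_def Y_def using dj qnot by auto
  have pc: "x m = pure m" "y m = pure m" "pure m \<le> 1" "dr m = 0" "db m = 0" if "m \<in> {a, b, c}" for m
    using XYm[OF that] pure_card(1,2,4)[of m] that pens abc3 unfolding x_def y_def dr_def db_def by auto
  have pd: "x d = 0" "y d = 0" unfolding x_def y_def XYd by auto
  have z: "pure m * (pure m - 1) = 0" "pure m * pure m = pure m" if "m \<in> {a, b, c}" for m
  proof -
    have "pure m = 0 \<or> pure m = 1" using pc(3)[OF that] by auto
    then show "pure m * (pure m - 1) = 0" "pure m * pure m = pure m" by auto
  qed
  have disj: "X \<inter> Y = {}" "X \<inter> DR = {}" "X \<inter> DB = {}" "Y \<inter> DR = {}" "Y \<inter> DB = {}"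
    unfolding X_def Y_def DR_def DB_def using colour_disj dj qnot by auto
  note m = pc(1)[of a] pc(1)[of b] pc(1)[of c] pc(2)[of a] pc(2)[of b] pc(2)[of c] pc(4)[of a] pc(4)[of b] pc(4)[of c]
    pc(5)[of a] pc(5)[of b] pc(5)[of c] pd pc(3)[of a] pc(3)[of b] pc(3)[of c] z(2)[of a] z(2)[of b] z(2)[of c]
  have le: "pure a \<le> Suc 0" "pure b \<le> Suc 0" "pure c \<le> Suc 0" using pc(3)[of a] pc(3)[of b] pc(3)[of c] by auto
  show "(\<Sum>l\<in>off. x l * (x l - 1)) = s * (s - 1)"
    using pairs_within[OF sub(1)] unfolding card_XY sum_lines x_def[symmetric] by (simp add: m le)
  show "(\<Sum>l\<in>off. y l * (y l - 1)) = s * (s - 1)"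
    using pairs_within[OF sub(2)] unfolding card_XY sum_lines y_def[symmetric] by (simp add: m le)
  show "(\<Sum>l\<in>off. x l * y l) + s = s * s"
    using pairs_between[OF sub(1,2) disj(1)] unfolding card_XY sum_lines x_def[symmetric] y_def[symmetric] by (simp add: m le s_def)
  show "(\<Sum>l\<in>off. x l * dr l) = s * card DR"
    using pairs_between[OF sub(1,3) disj(2)] unfolding card_XY sum_lines x_def[symmetric] dr_def[symmetric] by (simp add: m le)
  show "(\<Sum>l\<in>off. x l * db l) = s * card DB"
    using pairs_between[OF sub(1,4) disj(3)] unfolding card_XY sum_lines x_def[symmetric] db_def[symmetric] by (simp add: m le)
  show "(\<Sum>l\<in>off. y l * dr l) = s * card DR"
    using pairs_between[OF sub(2,3) disj(4)] unfolding card_XY sum_lines y_def[symmetric] dr_def[symmetric] by (simp add: m le)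
  show "(\<Sum>l\<in>off. y l * db l) = s * card DB"
    using pairs_between[OF sub(2,4) disj(5)] unfolding card_XY sum_lines y_def[symmetric] db_def[symmetric] by (simp add: m le)
qed

lemma d_colours: "card DR + card DB \<le> 3" "card DR = 0 \<or> card DB = 0 \<longrightarrow> card DR + card DB \<le> 1"
proof -
  have fd: "finite d" using pl pens by auto
  have "card DR + card DB + card (Mp \<inter> d) = card (DR \<union> DB \<union> (Mp \<inter> d))"
    using fd colour_disj unfolding DR_def DB_def by (subst card_Un_disjoint card_Un_disjoint; auto)+
  also have "\<dots> \<le> card d" by (rule card_mono) (use fd in \<open>auto simp: DR_def DB_def\<close>)
  finally have t: "card DR + card DB + card (Mp \<inter> d) \<le> 4" using d4 by auto
  moreover have "q \<in> Mp \<inter> d" using Mq pl pens by auto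
  then have "1 \<le> card (Mp \<inter> d)" using fd card_gt_0_iff[of "Mp \<inter> d"] by fastforce
  ultimately show "card DR + card DB \<le> 3" by simp
  show "card DR = 0 \<or> card DB = 0 \<longrightarrow> card DR + card DB \<le> 1"
    using line_colours'[OF pl(1)[OF pens(4)]] t fd unfolding DR_def DB_def by (auto simp: Int_commute)
qed

lemma s_le1: "s \<le> 1"
proof (rule ccontr)
  assume "\<not> s \<le> 1"
  moreover have "s \<le> 3" unfolding s_def using pure_card(4)[OF pens(1) abc3(1)]
        pure_card(4)[OF pens(2) abc3(2)] pure_card(4)[OF pens(3) abc3(3)] by linarith
  ultimately have s: "s = 2 \<or> s = 3" by auto
  define x y dr db where "x l = card (X \<inter> l)" and "y l = card (Y \<inter> l)" and "dr l = card (DR \<inter> l)" and "db l = card (DB \<inter> l)" for l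
  note sums = pair_sums[folded x_def y_def dr_def db_def]
  have both: "1 \<le> x l + dr l" "1 \<le> y l + db l" "x l + y l \<le> s" "dr l + db l \<le> 1" if l: "l \<in> off" for l
  proof -
    have "card (l \<inter> Mp) \<le> 2" using off_counts(3)[OF l] s by auto
    then have "l \<inter> Rp \<noteq> {}" "l \<inter> Bp \<noteq> {}" using line_colours'[of l] l unfolding off_def by auto
    then show "1 \<le> x l + dr l" "1 \<le> y l + db l" "x l + y l \<le> s" "dr l + db l \<le> 1"
      using off_counts(1,2,4,5)[OF l] unfolding x_def y_def dr_def db_def by auto
  qed
  define t1 t2 t3 t4 where "t1 l = (if x l = 2 \<and> y l = 1 \<and> dr l = 1 then 1 else 0::nat)"
    and "t2 l = (if x l = 0 \<and> y l = 3 \<and> dr l = 1 then 1 else 0::nat)"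
    and "t3 l = (if x l = 1 \<and> y l = 2 \<and> db l = 1 then 1 else 0::nat)"
    and "t4 l = (if x l = 3 \<and> y l = 0 \<and> db l = 1 then 1 else 0::nat)" for l
  have cases: "(x l, y l, dr l, db l) \<in> {(1,1,0,0),(2,1,0,0),(1,2,0,0),(0,1,1,0),(0,2,1,0),(0,3,1,0),(1,1,1,0),(2,1,1,0),(1,2,1,0),
     (1,0,0,1),(2,0,0,1),(3,0,0,1),(1,1,0,1),(2,1,0,1),(1,2,0,1)}" if "l \<in> off" for l
    by (rule small_cases) (use both[OF that] \<open>s \<le> 3\<close> in auto)
  have p0: "x l * (x l - 1) + y l * (y l - 1) + 2 * (x l * dr l) + 2 * (y l * db l) \<le>
      x l * y l + x l * db l + y l * dr l + 3 * (t1 l + t2 l + t3 l + t4 l)" if "l \<in> off" for l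
    using cases[OF that] unfolding t1_def t2_def t3_def t4_def by (elim insertE) simp_all
  have p: "2 * t1 l + 6 * t4 l \<le> x l * (x l - 1)" "2 * t3 l + 6 * t2 l \<le> y l * (y l - 1)" "2 * t1 l \<le> x l * dr l"
      "t1 l + 3 * t2 l \<le> y l * dr l" "2 * t3 l \<le> y l * db l" "t3 l + 3 * t4 l \<le> x l * db l" for l
    unfolding t1_def t2_def t3_def t4_def by auto
  have S0: "2 * (s * (s - 1)) + 2 * (s * card DR) + 2 * (s * card DB) + s \<le> s * s + s * card DB + s * card DR
      + 3 * (sum t1 off + sum t2 off + sum t3 off + sum t4 off)"
  proof -
    have "(\<Sum>l\<in>off. x l * (x l - 1) + y l * (y l - 1) + 2 * (x l * dr l) + 2 * (y l * db l)) \<le>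
      (\<Sum>l\<in>off. x l * y l + x l * db l + y l * dr l + 3 * (t1 l + t2 l + t3 l + t4 l))"
      by (rule sum_mono) (rule p0)
    then show ?thesis using sums by (simp add: sum.distrib sum_distrib_left[symmetric])
  qed
  have S: "2 * sum t1 off + 6 * sum t4 off \<le> s * (s - 1)" "2 * sum t3 off + 6 * sum t2 off \<le> s * (s - 1)"
      "2 * sum t1 off \<le> s * card DR" "sum t1 off + 3 * sum t2 off \<le> s * card DR"
      "2 * sum t3 off \<le> s * card DB" "sum t3 off + 3 * sum t4 off \<le> s * card DB"
  proof -
    have "(\<Sum>l\<in>off. 2 * t1 l + 6 * t4 l) \<le> (\<Sum>l\<in>off. x l * (x l - 1))" by (intro sum_mono p)
    then show "2 * sum t1 off + 6 * sum t4 off \<le> s * (s - 1)" unfolding sums(1) by (simp add: sum.distrib sum_distrib_left)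
    have "(\<Sum>l\<in>off. 2 * t3 l + 6 * t2 l) \<le> (\<Sum>l\<in>off. y l * (y l - 1))" by (intro sum_mono p)
    then show "2 * sum t3 off + 6 * sum t2 off \<le> s * (s - 1)" unfolding sums(2) by (simp add: sum.distrib sum_distrib_left)
    have "(\<Sum>l\<in>off. 2 * t1 l) \<le> (\<Sum>l\<in>off. x l * dr l)" by (intro sum_mono p)
    then show "2 * sum t1 off \<le> s * card DR" unfolding sums(4) by (simp add: sum_distrib_left)
    have "(\<Sum>l\<in>off. t1 l + 3 * t2 l) \<le> (\<Sum>l\<in>off. y l * dr l)" by (intro sum_mono p)
    then show "sum t1 off + 3 * sum t2 off \<le> s * card DR" unfolding sums(6) by (simp add: sum.distrib sum_distrib_left)
    have "(\<Sum>l\<in>off. 2 * t3 l) \<le> (\<Sum>l\<in>off. y l * db l)" by (intro sum_mono p)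
    then show "2 * sum t3 off \<le> s * card DB" unfolding sums(7) by (simp add: sum_distrib_left)
    have "(\<Sum>l\<in>off. t3 l + 3 * t4 l) \<le> (\<Sum>l\<in>off. x l * db l)" by (intro sum_mono p)
    then show "sum t3 off + 3 * sum t4 off \<le> s * card DB" unfolding sums(5) by (simp add: sum.distrib sum_distrib_left)
  qed
  from s show False
  proof
    assume s2: "s = 2"
    have "t1 l = 0 \<and> t2 l = 0 \<and> t3 l = 0 \<and> t4 l = 0" if "l \<in> off" for l
      using both(3)[OF that] s2 unfolding t1_def t2_def t3_def t4_def by auto
    then have "sum t1 off = 0" "sum t2 off = 0" "sum t3 off = 0" "sum t4 off = 0" by auto
    then show False using S0 s2 by simp
  next
    assume s3: "s = 3"
    show False
      by (rule three_lines_arith[of "card DR" "card DB" "sum t1 off" "sum t2 off" "sum t3 off" "sum t4 off"])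
        (use S0 S d_colours s3 in auto)
  qed
qed

lemma off_transversal:
  assumes l: "l \<in> off" and no: "l \<inter> Rp = {} \<or> l \<inter> Bp = {}" and mnk: "pen q = {i, j, k, m}" "distinct [i, j, k, m]"
    and u: "u \<in> l" "u \<in> m" "u \<notin> Mp"
  shows "\<exists>z\<in>i - {q}. z \<in> l"
proof (rule ccontr)
  assume n: "\<not> ?thesis"
  have lT: "l \<subseteq> T" "finite l" "q \<notin> l" using l lines_sub lines_fin unfolding off_def by auto
  have pm: "i \<in> pen q" "j \<in> pen q" "k \<in> pen q" "m \<in> pen q" using mnk by auto
  have "\<Union>(pen q) = a \<union> b \<union> c \<union> d" unfolding pen by auto
  moreover have "\<Union>(pen q) = i \<union> j \<union> k \<union> m" unfolding mnk(1) by auto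
  ultimately have e: "a \<union> b \<union> c \<union> d = i \<union> j \<union> k \<union> m" by simp
  have lm: "l \<inter> m = {u}"
  proof -
    have "finite (l \<inter> m)" "u \<in> l \<inter> m" using lT u by auto
    then show ?thesis using off_meet[OF l pm(4)] card1_eq by metis
  qed
  have "l \<inter> Mp \<subseteq> (l \<inter> j) \<union> (l \<inter> k)"
  proof
    fix x assume x: "x \<in> l \<inter> Mp"
    then have "x \<in> i \<union> j \<union> k \<union> m" using lT T_eq e by blast
    moreover have "x \<notin> i" using n x lT by blast
    moreover have "x \<notin> m"
    proof
      assume "x \<in> m"
      then have "x \<in> l \<inter> m" using x by blast
      then show False using lm x u by simp
    qed
    ultimately show "x \<in> (l \<inter> j) \<union> (l \<inter> k)" using x by blast
  qed
  then have "card (l \<inter> Mp) \<le> card ((l \<inter> j) \<union> (l \<inter> k))" by (rule card_mono[rotated]) (use lT in auto)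
  also have "\<dots> \<le> card (l \<inter> j) + card (l \<inter> k)" by (rule card_Un_le)
  also have "\<dots> \<le> 2" using off_meet[OF l pm(2)] off_meet[OF l pm(3)] by simp
  finally have "\<not> 3 \<le> card (l \<inter> Mp)" by simp
  moreover have "l \<in> lines" using l unfolding off_def by simp
  ultimately show False using line_colours'[of l] no by blast
qed

lemma cross_off:
  assumes "m \<in> pen q" "n \<in> pen q" "m \<noteq> n" "u \<in> m - {q}" "y \<in> n - {q}"
  shows "L u y \<in> off" "u \<in> L u y" "y \<in> L u y" "u \<in> T" "y \<in> T" "u \<noteq> y"
  using pen_cross[OF qT assms] L_lines L_l L_r unfolding off_def by auto

lemma s0_d_unmixed:
  assumes M: "a \<subseteq> Mp" "b \<subseteq> Mp" "c \<subseteq> Mp" and u: "u \<in> d" "u \<in> Rp" and v: "v \<in> d" "v \<in> Bp"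
  shows False
proof -
  have uq: "u \<in> d - {q}" "v \<in> d - {q}" "u \<noteq> v" "u \<notin> Mp" "v \<notin> Mp" using u v qnot colour_disj by auto
  have da: "d \<noteq> a" "a \<noteq> b" "a \<noteq> c" "b \<noteq> c" using dist by auto
  have perm: "pen q = {b, a, c, d}" "distinct [b, a, c, d]" "pen q = {c, a, b, d}" "distinct [c, a, b, d]"
    using pen dist by auto
  have inD: "x \<in> d" if "x \<in> T" "x \<notin> Mp" for x using subsetD[OF T_eq that(1)] that(2) M by auto
  have ex: "(\<exists>z\<in>b - {q}. z \<in> L w y) \<and> (\<exists>z\<in>c - {q}. z \<in> L w y)" if w: "w = u \<or> w = v" and y: "y \<in> a - {q}" for w y
  proof -
    have wd: "w \<in> d - {q}" "w \<notin> Mp" using w uq by auto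
    note o = cross_off[OF pens(4) pens(1) da(1) wd(1) y]
    have "finite (L w y \<inter> d)" "w \<in> L w y \<inter> d" using o wd pl pens by auto
    then have ld: "L w y \<inter> d = {w}" using off_meet[OF o(1) pens(4)]
      card1_eq by metis
    have lT: "L w y \<subseteq> T" using o(1) lines_sub unfolding off_def by auto
    have "L w y \<inter> Rp = {} \<or> L w y \<inter> Bp = {}"
    proof (rule ccontr)
      assume "\<not> ?thesis"
      then obtain r t where rt: "r \<in> L w y" "r \<in> Rp" "t \<in> L w y" "t \<in> Bp" by blast
      then have "r \<notin> Mp" "t \<notin> Mp" "r \<in> T" "t \<in> T" using colour_disj lT by auto
      then have "r \<in> d" "t \<in> d" using inD by auto
      then have "r \<in> L w y \<inter> d" "t \<in> L w y \<inter> d" using rt by auto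
      then have "r = w" "t = w" unfolding ld by auto
      then show False using rt colour_disj by auto
    qed
    note tr = off_transversal[OF o(1) this]
    have wd': "w \<in> d" using wd by simp
    show ?thesis using tr[OF perm(1) perm(2) o(2) wd' wd(2)] tr[OF perm(3) perm(4) o(2) wd' wd(2)] by blast
  qed
  have "2 \<le> card (a - {q})" using abc3 pl pens by simp
  then obtain a1 a2 where a12: "a1 \<in> a - {q}" "a2 \<in> a - {q}" "a1 \<noteq> a2" using two_of_card by blast
  note o1 = cross_off[OF pens(4) pens(1) da(1) uq(1) a12(1)] and o2 = cross_off[OF pens(4) pens(1) da(1) uq(1) a12(2)]
    and o3 = cross_off[OF pens(4) pens(1) da(1) uq(2) a12(1)]
  have ne12: "L u a1 \<noteq> L u a2"
    using lines_unique[of "L u a1" a a1 a2] o1 o2 a12 pl pens unfolding off_def by auto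
  have ne13: "L u a1 \<noteq> L v a1"
    using lines_unique[of "L u a1" d u v] o1 o3 u v uq pl pens unfolding off_def by auto
  have ne23: "L u a2 \<noteq> L v a1"
    using lines_unique[of "L u a2" a a1 a2] o2 o3 a12 pl pens unfolding off_def by auto
  have share: "\<exists>w\<in>m - {q}. w \<in> L u a2 \<and> w \<in> L v a1" if m: "m = b \<or> m = c" for m
  proof -
    have cm: "card m = 3" "m \<in> pen q" "m \<noteq> a" "m \<noteq> d" using m abc3 pens dist by auto
    obtain z1 where z1: "z1 \<in> m - {q}" "z1 \<in> L u a1" using ex[of u a1] a12 m by blast
    obtain z2 where z2: "z2 \<in> m - {q}" "z2 \<in> L u a2" using ex[of u a2] a12 m by blast
    obtain z3 where z3: "z3 \<in> m - {q}" "z3 \<in> L v a1" using ex[of v a1] a12 m by blast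
    have "z1 \<noteq> z2"
    proof
      assume "z1 = z2"
      then have "u = z1" using lines_unique[of "L u a1" "L u a2" u z1] o1 o2 z1 z2 ne12 unfolding off_def by auto
      then show False using meet[OF cm(2) pens(4) cm(4)] z1 uq by auto
    qed
    moreover have "z1 \<noteq> z3"
    proof
      assume "z1 = z3"
      then have "a1 = z1" using lines_unique[of "L u a1" "L v a1" a1 z1] o1 o3 z1 z3 ne13 unfolding off_def by auto
      then show False using meet[OF cm(2) pens(1) cm(3)] z1 a12 by auto
    qed
    moreover have "card (m - {q}) = 2" using cm pl by simp
    then obtain w1 w2 where "m - {q} = {w1, w2}" by (metis card_2_iff)
    ultimately have "z2 = z3" using z1 z2 z3 by auto
    then show ?thesis using z2 z3 by blast
  qed
  obtain w1 where w1: "w1 \<in> b - {q}" "w1 \<in> L u a2" "w1 \<in> L v a1" using share[of b] by blast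
  obtain w2 where w2: "w2 \<in> c - {q}" "w2 \<in> L u a2" "w2 \<in> L v a1" using share[of c] by blast
  have "w1 \<noteq> w2" using w1 w2 meet[OF pens(2) pens(3) da(4)] by auto
  then show False using lines_unique[of "L u a2" "L v a1" w1 w2] o2 o3 w1 w2 ne23 unfolding off_def by auto
qed

lemma s1_impossible:
  assumes d: "card d = 4" and M: "b \<subseteq> Mp" "c \<subseteq> Mp" and n: "\<not> a \<subseteq> Mp"
  shows False
proof -
  obtain u v where uv: "u \<in> Rp" "v \<in> Bp" "a = {q, u, v}" using three_line[OF pens(1) abc3(1)] n by blast
  have uvq: "u \<in> a - {q}" "v \<in> a - {q}" "u \<noteq> v" "u \<notin> Mp" "v \<notin> Mp" using uv qnot colour_disj by auto
  have dm: "a \<noteq> d" "a \<noteq> b" "a \<noteq> c" "b \<noteq> c" "b \<noteq> d" "c \<noteq> d" using dist by auto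
  have perm: "pen q = {b, c, d, a}" "distinct [b, c, d, a]" using pen dist by auto
  have inAD: "x \<in> a \<or> x \<in> d" if "x \<in> T" "x \<notin> Mp" for x using subsetD[OF T_eq that(1)] that(2) M by auto
  have key: "\<exists>z\<in>b - {q}. z \<in> L w y"
    if w: "w \<in> a - {q}" "w \<notin> Mp" and y: "y \<in> d - {q}" and no: "w \<in> Rp \<and> y \<notin> Bp \<or> w \<in> Bp \<and> y \<notin> Rp" for w y
  proof -
    note o = cross_off[OF pens(1) pens(4) dm(1) w(1) y]
    have one: "L w y \<inter> a = {w}" "L w y \<inter> d = {y}"
    proof -
      have "finite (L w y \<inter> a)" "w \<in> L w y \<inter> a" "finite (L w y \<inter> d)" "y \<in> L w y \<inter> d" using o w y pl pens by auto
      then show "L w y \<inter> a = {w}" "L w y \<inter> d = {y}" using off_meet[OF o(1) pens(1)] off_meet[OF o(1) pens(4)]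
        card1_eq by metis+
    qed
    have lT: "L w y \<subseteq> T" using o(1) lines_sub unfolding off_def by auto
    have "r = w \<or> r = y" if r: "r \<in> L w y" "r \<notin> Mp" for r
      using inAD[OF subsetD[OF lT r(1)] r(2)] r(1) one by blast
    then have "L w y \<inter> Rp = {} \<or> L w y \<inter> Bp = {}" using no colour_disj by blast
    from off_transversal[OF o(1) this perm o(2) _ w(2)] show ?thesis using w(1) by blast
  qed
  have dM: "d - {q} \<subseteq> Mp"
  proof
    fix y assume y: "y \<in> d - {q}"
    show "y \<in> Mp"
    proof (rule ccontr)
      assume yM: "y \<notin> Mp"
      have yT: "y \<in> T" using y pl pens by blast
      define w where "w = (if y \<in> Rp then u else v)"
      have w: "w \<in> a - {q}" "w \<notin> Mp" "w \<in> Rp \<and> y \<in> Rp \<or> w \<in> Bp \<and> y \<in> Bp"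
        using uv uvq colour_cases[OF yT] yM unfolding w_def by auto
      note o = cross_off[OF pens(1) pens(4) dm(1) w(1) y]
      have one: "L w y \<inter> a = {w}" "L w y \<inter> d = {y}"
      proof -
        have "finite (L w y \<inter> a)" "w \<in> L w y \<inter> a" "finite (L w y \<inter> d)" "y \<in> L w y \<inter> d" using o w y pl pens by auto
        then show "L w y \<inter> a = {w}" "L w y \<inter> d = {y}" using off_meet[OF o(1) pens(1)] off_meet[OF o(1) pens(4)]
          card1_eq by metis+
      qed
      have lT: "L w y \<subseteq> T" "finite (L w y)" using o(1) lines_sub lines_fin unfolding off_def by auto
      have "r = w \<or> r = y" if r: "r \<in> L w y" "r \<notin> Mp" for r
        using inAD[OF subsetD[OF lT(1) r(1)] r(2)] r(1) one by blast
      then have "L w y \<inter> Rp = {} \<or> L w y \<inter> Bp = {}" using w(3) colour_disj by blast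
      moreover have "L w y \<inter> Mp \<subseteq> (L w y \<inter> b) \<union> (L w y \<inter> c)"
      proof
        fix x assume x: "x \<in> L w y \<inter> Mp"
        then have "x \<in> a \<union> b \<union> c \<union> d" using lT T_eq by blast
        moreover have "x \<notin> a" "x \<notin> d" using one w(2) yM x by (metis IntD1 IntD2 IntI singletonD)+
        ultimately show "x \<in> (L w y \<inter> b) \<union> (L w y \<inter> c)" using x by blast
      qed
      then have "card (L w y \<inter> Mp) \<le> card ((L w y \<inter> b) \<union> (L w y \<inter> c))" by (rule card_mono[rotated]) (use lT in auto)
      moreover have "\<dots> \<le> card (L w y \<inter> b) + card (L w y \<inter> c)" by (rule card_Un_le)
      moreover have "\<dots> \<le> 2" using off_meet[OF o(1) pens(2)] off_meet[OF o(1) pens(3)] by simp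
      moreover have "L w y \<in> lines" using o(1) unfolding off_def by simp
      ultimately show False using line_colours'[of "L w y"] by auto
    qed
  qed
  have "card (d - {q}) \<le> card (b - {q})"
  proof (rule perspective_card(1)[OF qT pens(4) pens(1) pens(2) dm(1)[symmetric] dm(2) subset_refl subset_refl uvq(1)])
    fix y assume y: "y \<in> d - {q}"
    then have "y \<notin> Bp" using dM colour_disj by auto
    then obtain z where "z \<in> b - {q}" "z \<in> L u y" using key[OF uvq(1,4) y] uv by blast
    then show "\<exists>z\<in>b - {q}. z \<in> L y u"
      using L_comm[OF cross_off(4-6)[OF pens(1) pens(4) dm(1) uvq(1) y]] by auto
  qed
  then show False using d abc3 pl pens by simp
qed

end

context linspace begin

lemma full_cross:
  assumes "x \<in> T" "l \<in> lines" "x \<notin> l" "card l = deg x" "m \<in> pen x"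
  shows "\<exists>u\<in>l. u \<in> m"
proof -
  note i = inj_pen[OF assms(1-3)]
  have "L x ` l = pen x" using card_seteq[OF fin_pen i(2)] card_image[OF i(1)] assms(4) unfolding deg_def by simp
  then obtain u where "u \<in> l" "m = L x u" using assms(5) by blast
  then show ?thesis using L_r[OF assms(1)] lines_sub[OF assms(2)] assms(3) by blast
qed

lemma degree_three_by_count:
  assumes x: "x \<in> T" and l: "l \<in> pen x" "m \<in> pen x" "l \<noteq> m" and three: "\<And>k. k \<in> pen x \<Longrightarrow> 3 \<le> card k"
    and T: "card T = card l + card m + 2"
  shows "deg x = 3"
proof -
  let ?R = "pen x - {l} - {m}"
  have s: "(\<Sum>k\<in>pen x. card k - 1) = (card l - 1) + ((card m - 1) + (\<Sum>k\<in>?R. card k - 1))"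
    using sum.remove[OF fin_pen l(1), of "\<lambda>k. card k - 1"] sum.remove[of "pen x - {l}" m "\<lambda>k. card k - 1"] l fin_pen by simp
  have r: "(\<Sum>k\<in>?R. card k - 1) = 3" using card_pen[OF x] s T three[OF l(1)] three[OF l(2)] by simp
  have "(\<Sum>k\<in>?R. 2) \<le> (\<Sum>k\<in>?R. card k - 1)" by (rule sum_mono) (use three in force)
  then have "card ?R \<le> 1" using r by simp
  moreover have "card ?R \<noteq> 0" using r fin_pen by (metis card_0_eq finite_Diff sum.empty zero_neq_numeral)
  ultimately have "card ?R = 1" by simp
  then show ?thesis using l fin_pen unfolding deg_def by simp
qed

end

context chromatic begin

text \<open>The only alternative to nine purple points is a pure point on some line through \<open>q\<close>; the colour counts on the lines off \<open>q\<close>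
  exclude it.\<close>

lemma degree_four_nine:
  assumes q: "q \<in> Red" "q \<in> Blue" and d4: "deg q = 4" and three: "\<And>l. l \<in> pen q \<Longrightarrow> card l = 3"
  shows "T \<subseteq> Mp" "\<And>l. l \<in> lines \<Longrightarrow> card l = 3"
proof -
  have qT: "q \<in> T" using q col by auto
  have inst: "degree_four T L Red Blue p q i j k m" if "pen q = {i, j, k, m}" "distinct [i, j, k, m]" for i j k m
    by unfold_locales (use q that three in auto)
  have sub: "m \<subseteq> Mp" if m: "m \<in> pen q" for m
  proof (rule ccontr)
    assume n: "\<not> m \<subseteq> Mp"
    have "card (pen q - {m}) = 3" using m d4 fin_pen unfolding deg_def by simp
    then obtain i j k where i3: "pen q - {m} = {i, j, k}" "i \<noteq> j" "j \<noteq> k" "i \<noteq> k"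
      unfolding card_3_iff by metis
    then have ijk: "pen q - {m} = {i, j, k}" "distinct [i, j, k]" by auto
    have "m \<notin> {i, j, k}" using i3(1) by blast
    moreover have "pen q = insert m {i, j, k}" using i3(1) m by blast
    ultimately have P: "pen q = {i, j, k, m}" "distinct [i, j, k, m]" using ijk by auto
    have others: "x \<subseteq> Mp" if x: "x \<in> {i, j, k}" for x
    proof (rule ccontr)
      assume nx: "\<not> x \<subseteq> Mp"
      have "card (pen q - {m} - {x}) = 2" using ijk x by (auto simp: card_insert_if)
      then obtain y z where yz: "pen q - {m} - {x} = {y, z}" "y \<noteq> z" unfolding card_2_iff by metis
      have xm: "x \<in> pen q" "x \<noteq> m" using x P by auto
      have "pen q = insert m (insert x {y, z})" using yz(1) m xm by blast
      moreover have "m \<notin> {y, z}" "x \<notin> {y, z}" using yz(1) by blast+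
      ultimately have "pen q = {m, x, y, z}" "distinct [m, x, y, z]" using yz xm by auto
      then interpret degree_four T L Red Blue p q m x y z by (rule inst)
      show False using s_le1 n nx unfolding s_def pure_def by simp
    qed
    interpret degree_four T L Red Blue p q i j k m by (rule inst[OF P])
    obtain r t where "r \<in> Rp" "t \<in> Bp" "m = {q, r, t}" using three_line[OF m three[OF m]] n by blast
    then show False using s0_d_unmixed[of r t] others by auto
  qed
  show M: "T \<subseteq> Mp"
  proof
    fix x assume "x \<in> T"
    show "x \<in> Mp"
    proof (cases "x = q")
      case False
      then show ?thesis using sub[OF pen_memI[OF qT \<open>x \<in> T\<close>]] L_r[OF qT \<open>x \<in> T\<close>] by auto
    qed (use q in \<open>simp add: Mp_def\<close>)
  qed
  have ge3: "3 \<le> card l" if "l \<in> lines" for l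
  proof -
    have "l \<inter> Rp = {}" "l \<inter> Mp = l" using M lines_sub[OF that] colour_disj by auto
    then show ?thesis using line_colours'[OF that] by auto
  qed
  have T9: "card T = 9" using card_pen[OF qT] three d4 unfolding deg_def by simp
  fix l assume l: "l \<in> lines"
  show "card l = 3"
  proof (rule ccontr)
    assume n3: "card l \<noteq> 3"
    have ql: "q \<notin> l" using three[of l] pen_lines[OF qT] l n3 by auto
    then have c4: "card l = 4" using card_le_deg[OF qT l ql] ge3[OF l] d4 n3 by simp
    obtain u where u: "u \<in> l" using c4 by fastforce
    have uT: "u \<in> T" "u \<noteq> q" using u l lines_sub ql by auto
    have lu: "l \<in> pen u" "L u q \<in> pen u" using pen_lines[OF uT(1)] l u pen_memI[OF uT(1) qT uT(2)] by auto
    have "L u q \<in> pen q" using pen_lines[OF qT] L_lines[OF uT(1) qT uT(2)] L_r[OF uT(1) qT uT(2)] by simp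
    then have cq: "card (L u q) = 3" by (rule three)
    have "deg u = 3"
      by (rule degree_three_by_count[OF uT(1) lu]) (use cq c4 T9 ge3 pen_lines[OF uT(1)] in auto)
    moreover have nontriv unfolding nontriv_def
    proof -
      obtain v where v: "v \<in> l" "v \<noteq> u" using another_element[of l u] c4 by auto
      then have "L u v = l" using lines_L[OF l] u by auto
      then show "\<exists>a\<in>T. \<exists>b\<in>T. \<exists>c\<in>T. a \<noteq> b \<and> c \<notin> L a b" using uT v lines_sub[OF l] ql qT by (metis subsetD)
    qed
    ultimately obtain m where "\<forall>l\<in>pen u. card l = m + 1" using degree_three(1)[OF uT(1)] by blast
    then show False using lu cq c4 by force
  qed
qed

text \<open>The three-point lines are purple. Some point then has degree three, and its lines are too short for the characteristic.\<close>

lemma degree_four_ten: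
  assumes q: "q \<in> Red" "q \<in> Blue" and P: "pen q = {a, b, c, d}" "distinct [a, b, c, d]"
    and card: "card a = 3" "card b = 3" "card c = 3" "card d = 4" and p: "p \<noteq> 2" "p \<noteq> 3"
  shows False
proof -
  interpret degree_four T L Red Blue p q a b c d by unfold_locales (use assms in auto)
  have perm: "degree_four T L Red Blue p q b a c d" "degree_four T L Red Blue p q c a b d"
    by unfold_locales (use assms in auto)
  have M: "a \<subseteq> Mp" "b \<subseteq> Mp" "c \<subseteq> Mp"
    using s_le1 s1_impossible degree_four.s1_impossible[OF perm(1)] degree_four.s1_impossible[OF perm(2)] card
    unfolding s_def pure_def by (auto split: if_splits)
  have T10: "card T = 10" using card_pen[OF qT] P card by auto
  have d4: "deg q = 4" unfolding deg_def P using P(2) by simp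
  have nt: nontriv
  proof -
    obtain x where x: "x \<in> a" "x \<noteq> q" using another_element[of a q] card by auto
    obtain y where y: "y \<in> b" "y \<noteq> q" using another_element[of b q] card by auto
    have "L q x = a" using lines_L[OF pl(1)[OF pens(1)], of q x] x pl(2)[OF pens(1)] by simp
    moreover have "y \<notin> a" using meet[OF pens(1,2)] y P(2) by auto
    ultimately show ?thesis unfolding nontriv_def using x y qT pl(4)[OF pens(1)] pl(4)[OF pens(2)] by (metis subsetD)
  qed
  have charf: False if u: "u \<in> T" "deg u = 3" and l: "l \<in> pen u" "card l = 4" for u l
  proof -
    obtain m where m: "\<forall>l\<in>pen u. card l = m + 1" "p \<noteq> 0" "p \<le> m" using degree_three(1)[OF u(1) nt u(2)] by blast
    have "p \<noteq> 0" "p \<le> 3" using l m by auto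
    moreover have "p \<noteq> 1" using des unfolding desarguesian_def by simp
    ultimately show False using p by linarith
  qed
  have inD: "x \<in> d" if "x \<in> T" "x \<notin> Mp" for x using subsetD[OF T_eq that(1)] that(2) M by auto
  have ge: "3 \<le> card l" "card l \<le> 4" if l: "l \<in> lines" "T \<subseteq> Mp" for l
  proof -
    have "l \<inter> Rp = {}" "l \<inter> Mp = l" using that lines_sub[OF l(1)] colour_disj by auto
    then show "3 \<le> card l" using line_colours'[OF l(1)] by auto
    show "card l \<le> 4"
    proof (cases "q \<in> l")
      case True
      then have "l \<in> pen q" using pen_lines[OF qT] l by simp
      then have "l = a \<or> l = b \<or> l = c \<or> l = d" unfolding P(1) by simp
      then show ?thesis using card by (elim disjE) simp_all
    next
      case False then show ?thesis using card_le_deg[OF qT l(1)] d4 by simp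
    qed
  qed
  show False
  proof (cases "T \<subseteq> Mp")
    case False
    then obtain u where u: "u \<in> T" "u \<notin> Mp" by blast
    have ud: "u \<in> d" using inD u by blast
    have uq: "u \<noteq> q" using u Mq by auto
    have only: "\<not> (r \<in> Rp \<and> t \<in> Bp)" if "r \<in> d" "t \<in> d" for r t using s0_d_unmixed[OF M] that by blast
    have dp: "d \<in> pen u" using pen_lines[OF u(1)] pl(1)[OF pens(4)] ud by simp
    have c4: "card l = 4" if l: "l \<in> pen u" for l
    proof (cases "l = d")
      case False
      have ll: "l \<in> lines" "u \<in> l" using pen_lines[OF u(1)] l by auto
      have ql: "q \<notin> l" using lines_unique[OF ll(1) pl(1)[OF pens(4)], of q u] ll ud uq pl(2)[OF pens(4)] False by auto
      then have o: "l \<in> off" using ll unfolding off_def by simp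
      have "l \<inter> Rp = {} \<or> l \<inter> Bp = {}"
      proof (rule ccontr)
        assume "\<not> ?thesis"
        then obtain r t where rt: "r \<in> l" "r \<in> Rp" "t \<in> l" "t \<in> Bp" by blast
        then have "r \<in> d" "t \<in> d" using inD lines_sub[OF ll(1)] colour_disj by blast+
        then show False using only rt by blast
      qed
      note tr = off_transversal[OF o this _ _ ll(2) ud u(2)]
      have p': "distinct [b, a, c, d]" "distinct [c, a, b, d]" "pen q = {b, a, c, d}" "pen q = {c, a, b, d}"
        using P(2) unfolding P(1) by auto
      obtain x where x: "x \<in> a - {q}" "x \<in> l" using tr[OF P] by blast
      obtain y where y: "y \<in> b - {q}" "y \<in> l" using tr[OF p'(3,1)] by blast
      obtain z where z: "z \<in> c - {q}" "z \<in> l" using tr[OF p'(4,2)] by blast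
      have ne: "a \<noteq> b" "a \<noteq> c" "b \<noteq> c" "a \<noteq> d" "b \<noteq> d" "c \<noteq> d" using P(2) by auto
      have "x \<notin> b" "x \<notin> c" "y \<notin> c" "x \<notin> d" "y \<notin> d" "z \<notin> d"
        using meet[OF pens(1,2) ne(1)] meet[OF pens(1,3) ne(2)] meet[OF pens(2,3) ne(3)] meet[OF pens(1,4) ne(4)]
          meet[OF pens(2,4) ne(5)] meet[OF pens(3,4) ne(6)] x(1) y(1) z(1) by (metis DiffE Int_iff)+
      then have "x \<noteq> y" "x \<noteq> z" "y \<noteq> z" "x \<noteq> u" "y \<noteq> u" "z \<noteq> u" using x(1) y(1) z(1) ud by (metis DiffE)+
      then have "card {x, y, z, u} = 4" by simp
      moreover have "{x, y, z, u} \<subseteq> l" using x y z ll by simp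
      ultimately have "4 \<le> card l" using card_mono[OF lines_fin[OF ll(1)]] by metis
      then show ?thesis using card_le_deg[OF qT ll(1) ql] d4 by simp
    qed (use card in simp)
    have "card T = 1 + (\<Sum>l\<in>pen u. 3)" unfolding card_pen[OF u(1)] using c4 by (simp cong: sum.cong)
    then have "deg u = 3" using T10 unfolding deg_def by simp
    then show False using charf[OF u(1) _ dp card(4)] by simp
  next
    case True
    obtain u where u: "u \<in> a - {q}" using another_element[of a q] card by auto
    then have uT: "u \<in> T" "u \<noteq> q" using pl(4)[OF pens(1)] by auto
    have ap: "a \<in> pen u" using pen_lines[OF uT(1)] pl(1)[OF pens(1)] u by simp
    have "\<exists>l\<in>pen u. card l = 4"
    proof (rule ccontr)
      assume "\<not> ?thesis"
      then have "card l = 3" if "l \<in> pen u" for l using ge[of l] True that pen_lines[OF uT(1)] by force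
      then have "card T = 1 + (\<Sum>l\<in>pen u. 2)" unfolding card_pen[OF uT(1)] by (simp cong: sum.cong)
      then have "10 = 1 + 2 * deg u" using T10 unfolding deg_def by simp
      then show False by presburger
    qed
    then obtain l where l: "l \<in> pen u" "card l = 4" by blast
    have ll: "l \<in> lines" "u \<in> l" using pen_lines[OF uT(1)] l by auto
    have ql: "q \<notin> l" using lines_unique[OF ll(1) pl(1)[OF pens(1)], of q u] ll u uT pl(2)[OF pens(1)] l card by auto
    obtain v where v: "v \<in> l" "v \<in> d" using full_cross[OF qT ll(1) ql _ pens(4)] l d4 by auto
    have vT: "v \<in> T" using v lines_sub ll by auto
    have vp: "d \<in> pen v" "l \<in> pen v" using pen_lines[OF vT] pl(1)[OF pens(4)] ll v by auto
    have "d \<noteq> l" using pl(2)[OF pens(4)] ql by auto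
    have "deg v = 3"
      by (rule degree_three_by_count[OF vT vp \<open>d \<noteq> l\<close>]) (use card l T10 ge True pen_lines[OF vT] in auto)
    then show False using charf[OF vT _ vp(1) card(4)] by simp
  qed
qed

end

section \<open>Weights on thick linear spaces\<close>

lemma perspectiveD:
  assumes "perspective_prop p T L" "a1 \<in> T" "a2 \<in> T" "b1 \<in> T" "b2 \<in> T"
    and "a1 \<noteq> a2" "b1 \<noteq> b2" "A \<subseteq> L a1 a2" "B \<subseteq> L b1 b2" "card A = 4" "card B = 4"
    and "L a1 a2 \<inter> B = {}" "L b1 b2 \<inter> A = {}"
    and "\<And>a. a \<in> A \<Longrightarrow> \<exists>b\<in>B. \<exists>x\<in>T - L a1 a2 - L b1 b2. \<exists>y\<in>T - L a1 a2 - L b1 b2.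
            x \<noteq> y \<and> x \<in> L a b \<and> y \<in> L a b \<and>
            (\<forall>u\<in>A. \<exists>v\<in>B. v \<in> L x u) \<and> (\<forall>u\<in>A. \<exists>v\<in>B. v \<in> L y u)"
  shows "p = 2"
  using assms(1)[unfolded perspective_prop_def, THEN bspec, OF assms(2), THEN bspec, OF assms(3),
    THEN bspec, OF assms(4), THEN bspec, OF assms(5), THEN spec, of A, THEN spec, of B] assms(6-13)
    assms(14) by simp

context linspace begin

lemma sub_linspace: "T' \<subseteq> T \<Longrightarrow> linspace T' (\<lambda>x y. L x y \<inter> T')"
proof (unfold_locales)
  assume T': "T' \<subseteq> T"
  show "finite T'" using T' fin finite_subset by blast
  fix x y assume "x \<in> T'" "y \<in> T'" "x \<noteq> y"
  then have xy: "x \<in> T" "y \<in> T" "x \<noteq> y" using T' by auto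
  show "x \<in> L x y \<inter> T'" "y \<in> L x y \<inter> T'" using L_l[OF xy] L_r[OF xy] \<open>x \<in> T'\<close> \<open>y \<in> T'\<close> by auto
  show "L u v \<inter> T' = L x y \<inter> T'" if "u \<in> L x y \<inter> T'" "v \<in> L x y \<inter> T'" "u \<noteq> v" for u v
    using L_eq[OF xy, of u v] that by auto
qed auto

text \<open>Sixteen points with four on each line form an affine plane of order four.\<close>

lemma sixteen_points:
  assumes T': "T' \<subseteq> T" "card T' = 16" and four: "\<And>x y. x \<in> T' \<Longrightarrow> y \<in> T' \<Longrightarrow> x \<noteq> y \<Longrightarrow> card (L x y \<inter> T') = 4"
    and pp: "perspective_prop p T L"
  shows "p = 2"
proof -
  define L' where "L' x y = L x y \<inter> T'" for x y
  interpret s: linspace T' L' unfolding L'_def by (rule sub_linspace[OF T'(1)])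
  have c4: "card l = 4" if "l \<in> s.lines" for l using that four unfolding s.lines_def L'_def by auto
  have deg5: "s.deg x = 5" if x: "x \<in> T'" for x
  proof -
    have "(\<Sum>l\<in>s.pen x. card l - 1) = (\<Sum>l\<in>s.pen x. 3)" by (rule sum.cong) (use c4 s.pen_lines[OF x] in auto)
    then show ?thesis using s.card_pen[OF x] T'(2) unfolding s.deg_def by simp
  qed
  have missing: "\<exists>k\<in>s.pen x. k \<inter> l = {}" "\<And>k k'. k \<in> s.pen x \<Longrightarrow> k \<inter> l = {} \<Longrightarrow> k' \<in> s.pen x \<Longrightarrow> k' \<inter> l = {} \<Longrightarrow> k = k'"
    if x: "x \<in> T'" and l: "l \<in> s.lines" "x \<notin> l" for x l
  proof -
    note i = s.inj_pen[OF x l]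
    have im: "card (L' x ` l) = 4" using card_image[OF i(1)] c4[OF l(1)] by simp
    have c1: "card (s.pen x - L' x ` l) = 1"
      using card_Diff_subset[OF _ i(2)] im deg5[OF x] s.fin_pen finite_subset[OF i(2)] unfolding s.deg_def by simp
    have iff: "k \<inter> l = {} \<longleftrightarrow> k \<notin> L' x ` l" if k: "k \<in> s.pen x" for k
    proof
      assume "k \<inter> l = {}"
      then show "k \<notin> L' x ` l" using s.L_r[OF x] l s.lines_sub[OF l(1)] by blast
    next
      assume n: "k \<notin> L' x ` l"
      show "k \<inter> l = {}"
      proof (rule ccontr)
        assume "k \<inter> l \<noteq> {}"
        then obtain u where u: "u \<in> k" "u \<in> l" by blast
        then have "x \<noteq> u" using l by auto
        then have "L' x u = k" using s.lines_L[of k x u] s.pen_lines[OF x] k u by auto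
        then show False using n u by auto
      qed
    qed
    obtain k0 where k0: "s.pen x - L' x ` l = {k0}" using c1 by (rule card_1_singletonE)
    then have "k0 \<in> s.pen x" "k0 \<notin> L' x ` l" by auto
    then show "\<exists>k\<in>s.pen x. k \<inter> l = {}" using iff[of k0] by auto
    fix k k' assume "k \<in> s.pen x" "k \<inter> l = {}" "k' \<in> s.pen x" "k' \<inter> l = {}"
    then have "k \<in> s.pen x - L' x ` l" "k' \<in> s.pen x - L' x ` l" using iff by auto
    then show "k = k'" unfolding k0 by simp
  qed
  obtain a1 where a1: "a1 \<in> T'" using T'(2) by fastforce
  obtain a2 where a2: "a2 \<in> T'" "a2 \<noteq> a1" using another_element[of T' a1] T'(2) by auto
  define l1 where "l1 = L' a1 a2"
  have l1: "l1 \<in> s.lines" "card l1 = 4" unfolding l1_def using s.L_lines[OF a1 a2(1)] a2 c4 by auto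
  have "\<not> T' \<subseteq> l1" using card_mono[of l1 T'] s.lines_fin[OF l1(1)] l1 T'(2) by auto
  then obtain x where x: "x \<in> T'" "x \<notin> l1" by blast
  obtain l2 where l2: "l2 \<in> s.pen x" "l2 \<inter> l1 = {}" using missing(1)[OF x(1) l1(1) x(2)] by blast
  then have l2': "l2 \<in> s.lines" "x \<in> l2" "card l2 = 4" using s.pen_lines[OF x(1)] c4 by auto
  obtain b2 where b2: "b2 \<in> l2" "b2 \<noteq> x" using another_element[of l2 x] l2' by auto
  have b2T: "b2 \<in> T'" using b2 s.lines_sub[OF l2'(1)] by auto
  have Lb: "L' x b2 = l2" using s.lines_L[OF l2'(1), of x b2] b2 l2' by auto
  have proj: "\<exists>v\<in>l2. v \<in> L y u" if y: "y \<in> T'" "y \<notin> l1" "y \<notin> l2" and u: "u \<in> l1" for y u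
  proof (rule ccontr)
    assume n: "\<not> ?thesis"
    have uT: "u \<in> T'" "u \<noteq> y" using u y s.lines_sub[OF l1(1)] by auto
    have k: "L' y u \<in> s.pen y" using s.pen_memI[OF y(1) uT(1)] uT by simp
    have kn: "L' y u \<inter> l2 = {}" using n unfolding L'_def by auto
    obtain k' where k': "k' \<in> s.pen y" "k' \<inter> l1 = {}" using missing(1)[OF y(1) l1(1) y(2)] by blast
    have "k' \<noteq> L' y u" using k' u s.L_r[OF y(1) uT(1)] uT by auto
    then have "k' \<inter> l2 \<noteq> {}" using missing(2)[OF y(1) l2'(1) y(3) k kn k'(1)] by auto
    then obtain z where z: "z \<in> k'" "z \<in> l2" by blast
    have zT: "z \<in> T'" "z \<notin> l1" using z l2 s.lines_sub[OF l2'(1)] by auto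
    have "k' \<in> s.lines" "y \<in> k'" using k' s.pen_lines[OF y(1)] by auto
    then have "k' \<in> s.pen z" "l2 \<in> s.pen z" using s.pen_lines[OF zT(1)] z l2' by auto
    then have "k' = l2" using missing(2)[OF zT(1) l1(1) zT(2)] k' l2 by auto
    then show False using \<open>y \<in> k'\<close> y by simp
  qed
  show ?thesis
  proof (rule perspectiveD[OF pp, of a1 a2 x b2 l1 l2])
    show "a1 \<in> T" "a2 \<in> T" "x \<in> T" "b2 \<in> T" using a1 a2 x b2T T' by auto
    show "l1 \<subseteq> L a1 a2" "l2 \<subseteq> L x b2" using Lb unfolding l1_def L'_def by auto
    have cap: "L a1 a2 \<inter> T' = l1" "L x b2 \<inter> T' = l2" using Lb unfolding l1_def L'_def by auto
    then show "L a1 a2 \<inter> l2 = {}" "L x b2 \<inter> l1 = {}"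
      using l2 s.lines_sub[OF l2'(1)] s.lines_sub[OF l1(1)] by blast+
    fix a assume a: "a \<in> l1"
    then have aT: "a \<in> T'" "a \<noteq> x" "a \<notin> l2" using s.lines_sub[OF l1(1)] x l2 by auto
    have m: "L' a x \<in> s.lines" using s.L_lines[OF aT(1) x(1) aT(2)] .
    have ax: "a \<in> L' a x" "x \<in> L' a x" using s.L_l[OF aT(1) x(1) aT(2)] s.L_r[OF aT(1) x(1) aT(2)] by auto
    have "card (L' a x - {a, x}) = 2" using c4[OF m] ax aT s.lines_fin[OF m] by (simp add: card_Diff_subset)
    then obtain y z where yz: "y \<in> L' a x - {a, x}" "z \<in> L' a x - {a, x}" "y \<noteq> z" using two_of_card by (metis order_refl)
    have off: "w \<in> T' \<and> w \<notin> l1 \<and> w \<notin> l2" if w: "w \<in> L' a x - {a, x}" for w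
    proof -
      have "w \<notin> l1" using s.lines_unique[OF m l1(1), of w a] w a ax x by auto
      moreover have "w \<notin> l2" using s.lines_unique[OF m l2'(1), of w x] w l2' ax aT by auto
      ultimately show ?thesis using w s.lines_sub[OF m] by auto
    qed
    have wT: "w \<in> T - L a1 a2 - L x b2 \<and> w \<in> L a x \<and> (\<forall>u\<in>l1. \<exists>v\<in>l2. v \<in> L w u)" if w: "w \<in> L' a x - {a, x}" for w
      using off[OF w] cap T' proj[of w] w unfolding L'_def by blast
    show "\<exists>b\<in>l2. \<exists>xa\<in>T - L a1 a2 - L x b2. \<exists>y\<in>T - L a1 a2 - L x b2.
            xa \<noteq> y \<and> xa \<in> L a b \<and> y \<in> L a b \<and>
            (\<forall>u\<in>l1. \<exists>v\<in>l2. v \<in> L xa u) \<and> (\<forall>u\<in>l1. \<exists>v\<in>l2. v \<in> L y u)"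
      using wT[OF yz(1)] wT[OF yz(2)] yz(3) l2'(2) by blast
  qed (use a2 b2 l1 l2' in auto)
qed

lemma incidence_count:
  assumes "F \<subseteq> lines" shows "(\<Sum>x\<in>T. card {l \<in> F. x \<in> l}) = (\<Sum>l\<in>F. card l)"
proof -
  have fF: "finite F" using assms finite_lines finite_subset by blast
  have "(\<Sum>x\<in>T. card {l \<in> F. x \<in> l}) = (\<Sum>x\<in>T. \<Sum>l\<in>F. if x \<in> l then 1 else 0)"
  proof (rule sum.cong[OF refl])
    fix x
    have "F \<inter> {l. x \<in> l} = {l \<in> F. x \<in> l}" by auto
    then show "card {l \<in> F. x \<in> l} = (\<Sum>l\<in>F. if x \<in> l then 1 else 0)" using fF by (simp add: sum.If_cases)
  qed
  also have "\<dots> = (\<Sum>l\<in>F. \<Sum>x\<in>T. if x \<in> l then 1 else 0)" by (rule sum.swap)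
  also have "\<dots> = (\<Sum>l\<in>F. card l)"
  proof (rule sum.cong[OF refl])
    fix l assume "l \<in> F"
    then have "T \<inter> l = l" using assms lines_sub by auto
    then show "(\<Sum>x\<in>T. if x \<in> l then 1 else 0) = card l" using fin by (simp add: sum.If_cases)
  qed
  finally show ?thesis .
qed

lemma crossing_count:
  assumes "F \<subseteq> lines"
  shows "(\<Sum>x\<in>T. card {l \<in> F. x \<in> l} * (card {l \<in> F. x \<in> l} - 1)) \<le> card F * (card F - 1)"
proof -
  have fF: "finite F" using assms finite_lines finite_subset by blast
  let ?P = "\<lambda>x. {(l, m). l \<in> {l \<in> F. x \<in> l} \<and> m \<in> {l \<in> F. x \<in> l} \<and> l \<noteq> m}"
  have fP: "finite (?P x)" for x by (rule finite_subset[of _ "F \<times> F"]) (use fF in auto)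
  have "(\<Sum>x\<in>T. card {l \<in> F. x \<in> l} * (card {l \<in> F. x \<in> l} - 1)) = (\<Sum>x\<in>T. card (?P x))"
    by (rule sum.cong[OF refl], rule card_offdiag[symmetric]) (use fF in auto)
  also have "\<dots> = card (\<Union>x\<in>T. ?P x)"
  proof (rule card_UN_disjoint[symmetric, OF fin])
    show "\<forall>x\<in>T. \<forall>y\<in>T. x \<noteq> y \<longrightarrow> ?P x \<inter> ?P y = {}"
    proof (intro ballI impI equals0I)
      fix x y z assume "x \<noteq> y" "z \<in> ?P x \<inter> ?P y"
      then obtain l m where "l \<in> F" "m \<in> F" "l \<noteq> m" "x \<in> l" "y \<in> l" "x \<in> m" "y \<in> m" by blast
      then show False using lines_unique[of l m x y] assms \<open>x \<noteq> y\<close> by (metis subsetD)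
    qed
  qed (use fP in auto)
  also have "\<dots> \<le> card {(l, m). l \<in> F \<and> m \<in> F \<and> l \<noteq> m}"
  proof (rule card_mono)
    show "finite {(l, m). l \<in> F \<and> m \<in> F \<and> l \<noteq> m}" by (rule finite_subset[of _ "F \<times> F"]) (use fF in auto)
  qed auto
  also have "\<dots> = card F * (card F - 1)" by (rule card_offdiag[OF fF])
  finally show ?thesis .
qed

lemma weight_star:
  fixes w :: "'p \<Rightarrow> nat"
  assumes x: "x \<in> T" and k: "\<And>l. l \<in> pen x \<Longrightarrow> k \<le> sum w (l - {x})"
  shows "w x + deg x * k \<le> sum w T"
proof -
  have "sum w T = w x + sum w (T - {x})" using sum.remove[OF fin x] .
  also have "sum w (T - {x}) = (\<Sum>l\<in>pen x. sum w (l - {x}))" by (rule sum_pen[OF x])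
  finally show ?thesis using sum_mono[of "pen x" "\<lambda>_. k" "\<lambda>l. sum w (l - {x})"] k unfolding deg_def by simp
qed

end

lemma divisibility_20:
  fixes a b f :: nat
  assumes "5 * f = 4 * a + b" "11 \<le> a" "a + b = 20" shows "a = 15 \<and> f = 13 \<or> a = 20"
proof -
  obtain k where k: "a = 5 * k" using assms by (intro that[of "2 * f - 8 - a"]) linarith
  then have "k = 3 \<or> k = 4" using assms by linarith
  then show ?thesis using k assms by auto
qed

lemma divisibility_21:
  fixes a b f :: nat
  assumes "5 * f = 5 * a + 2 * b" "14 \<le> a" "a + b = 21" shows "a = 16 \<and> f = 18 \<and> b = 5 \<or> a = 21"
proof -
  obtain k where k: "b = 5 * k" using assms by (intro that[of "b + 2 * a - 2 * f"]) linarith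
  then have "k = 0 \<or> k = 1" using assms by linarith
  then show ?thesis using k assms by auto
qed

lemma divisibility_19:
  fixes a f :: nat
  assumes "5 * f = 3 * a" "8 \<le> a" "a \<le> 19" shows "f = 6 \<and> a = 10 \<or> f = 9 \<and> a = 15"
proof -
  obtain k where k: "a = 5 * k" using assms by (intro that[of "2 * f - a"]) linarith
  then have "k = 2 \<or> k = 3" using assms by linarith
  then show ?thesis using k assms by auto
qed

lemma weight_ge: "finite A \<Longrightarrow> (\<And>x. x \<in> A \<Longrightarrow> k \<le> (w x::nat)) \<Longrightarrow> k * card A \<le> sum w A"
  using sum_mono[of A "\<lambda>_. k" w] by (simp add: mult.commute)

context linspace begin

lemma weight_light:
  fixes w :: "'p \<Rightarrow> nat"
  assumes w2: "\<And>x. x \<in> T \<Longrightarrow> 2 \<le> w x"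
  shows "2 * card T + card {x \<in> T. w x \<noteq> 2} \<le> sum w T"
proof -
  have "sum w T \<ge> (\<Sum>x\<in>T. 2 + (if w x \<noteq> 2 then 1 else 0))" by (rule sum_mono) (use w2 in force)
  moreover have "T \<inter> {x. w x \<noteq> 2} = {x \<in> T. w x \<noteq> 2}" by auto
  moreover have "(\<Sum>x\<in>T. 2 + (if w x \<noteq> 2 then 1 else 0)) = (\<Sum>x\<in>T. 2) + (\<Sum>x\<in>T. if w x \<noteq> 2 then 1 else 0::nat)"
    by (rule sum.distrib)
  ultimately show ?thesis using fin by (simp add: sum.If_cases mult.commute)
qed

text \<open>A total weight below 50 bounds the number of points by 24, and the line sizes through points of weight two by four and five.
  Divisibility of the incidence counts leaves few sizes; each of these contains sixteen points with four on every line, an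
  affine plane of order four, which the perspective property excludes.\<close>

theorem weighted_thick_four:
  fixes w :: "'p \<Rightarrow> nat"
  assumes nt: nontriv and th: "thick 4" and des: "desarguesian p T L" and p: "p \<noteq> 2" "p \<noteq> 3"
    and w2: "\<And>x. x \<in> T \<Longrightarrow> 2 \<le> w x"
    and w4: "\<And>l. l \<in> lines \<Longrightarrow> card l = 4 \<Longrightarrow> 10 \<le> sum w l"
  shows "50 \<le> sum w T"
proof (rule ccontr)
  assume "\<not> ?thesis"
  then have W: "sum w T \<le> 49" by simp
  have pp: "perspective_prop p T L" and p14: "p \<noteq> 1" "p \<noteq> 4" using des unfolding desarguesian_def by auto
  have no16: False if "T' \<subseteq> T" "card T' = 16" "\<And>x y. x \<in> T' \<Longrightarrow> y \<in> T' \<Longrightarrow> x \<noteq> y \<Longrightarrow> card (L x y \<inter> T') = 4" for T'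
    using sixteen_points[OF that pp] p by simp
  have line10: "10 \<le> sum w l" if l: "l \<in> lines" for l
  proof (cases "card l = 4")
    case False
    then have "5 \<le> card l" using thickD[OF th l] by simp
    moreover have "2 * card l \<le> sum w l" by (rule weight_ge[OF lines_fin[OF l]]) (use w2 lines_sub[OF l] in auto)
    ultimately show ?thesis by simp
  qed (use w4 l in auto)
  have light: "deg x \<le> 5" if x: "x \<in> T" "w x = 2" for x
  proof (rule ccontr)
    assume n: "\<not> ?thesis"
    have "w x + deg x * 8 \<le> sum w T"
    proof (rule weight_star[OF x(1)])
      fix l assume "l \<in> pen x"
      then have l: "l \<in> lines" "x \<in> l" "finite l" using pen_lines[OF x(1)] lines_fin by auto
      then have "sum w l = w x + sum w (l - {x})" by (simp add: sum.remove)
      then show "8 \<le> sum w (l - {x})" using line10[OF l(1)] x by simp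
    qed
    then show False using W n x by simp
  qed
  have deg4: "4 \<le> deg x" if "x \<in> T" for x using deg_ge[OF th nt that] .
  have deg5: "5 \<le> deg x" if x: "x \<in> T" for x
  proof (rule ccontr)
    assume "\<not> ?thesis"
    then have d: "deg x = 4" using deg4[OF x] by simp
    have c6: "6 \<le> card l" if "l \<in> pen x" for l
      using tight_degree_char[OF x _ _ that des] d th p p14 by simp
    then have "1 + 5 * deg x \<le> card T" by (intro card_ge_deg[OF x]) force
    then have n21: "21 \<le> card T" using d by simp
    have "3 \<le> w y" if y: "y \<in> T" "y \<noteq> x" for y
    proof -
      obtain l where l: "l \<in> pen x" "l \<noteq> L x y" using another_element[of "pen x" "L x y"] d unfolding deg_def by auto
      have "y \<notin> l" using pen_disj[OF x l(1) pen_memI[OF x y(1)], of y] l y L_r[OF x y(1)] by auto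
      then have "6 \<le> deg y" using card_le_deg[OF y(1), of l] c6[OF l(1)] pen_lines[OF x] l by auto
      then have "w y \<noteq> 2" using light[OF y(1)] by linarith
      then show ?thesis using w2[OF y(1)] by simp
    qed
    then have "3 * card (T - {x}) \<le> sum w (T - {x})" by (intro weight_ge) (use fin in auto)
    moreover have "sum w T = w x + sum w (T - {x})" using sum.remove[OF fin x] .
    ultimately show False using W n21 x fin by simp
  qed
  define n where "n = card T"
  have nonl: "2 * n + card {x \<in> T. w x \<noteq> 2} \<le> 49" using weight_light[of w, OF w2] W unfolding n_def by linarith
  have nlt: "n = card {x \<in> T. w x \<noteq> 2} + card {x \<in> T. w x = 2}"
    unfolding n_def by (subst card_Un_disjoint[symmetric]) (use fin in \<open>auto intro!: arg_cong[of _ _ card]\<close>)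
  have nge: "1 + 3 * deg x \<le> n" if "x \<in> T" for x
    unfolding n_def using card_ge_deg[OF that, of 3] thickD[OF th] pen_lines[OF that] by auto
  obtain x0 where x0: "x0 \<in> T" using nt unfolding nontriv_def by blast
  have n16: "16 \<le> n" using nge[OF x0] deg5[OF x0] by simp
  have short: "card l \<le> 5" if l: "l \<in> lines" for l
  proof (rule ccontr)
    assume long: "\<not> ?thesis"
    have onl: "x \<in> l" if "x \<in> T" "w x = 2" for x
      using card_le_deg[OF that(1) l] light[OF that] long by auto
    obtain y where y: "y \<in> T" "y \<notin> l" using nontriv_off[OF nt l] by blast
    then have n19: "19 \<le> n" using card_le_deg[OF y(1) l y(2)] nge[OF y(1)] long by simp
    then have "{x \<in> T. w x = 2} \<noteq> {}" using nonl nlt by (intro notI) simp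
    then obtain x where x: "x \<in> T" "w x = 2" by blast
    have d: "deg x = 5" using light[OF x] deg5[OF x(1)] by simp
    have lp: "l \<in> pen x" using pen_lines[OF x(1)] l onl[OF x] by simp
    have "n = 1 + ((card l - 1) + (\<Sum>k\<in>pen x - {l}. card k - 1))"
      unfolding n_def using card_pen[OF x(1)] sum.remove[OF fin_pen lp, of "\<lambda>k. card k - 1"] by linarith
    moreover have "3 * card (pen x - {l}) \<le> (\<Sum>k\<in>pen x - {l}. card k - 1)"
    proof (rule weight_ge)
      fix k assume "k \<in> pen x - {l}"
      then have "k \<in> lines" using pen_lines[OF x(1)] by auto
      then show "3 \<le> card k - 1" using thickD[OF th] by force
    qed (use fin_pen in auto)
    moreover have "card (pen x - {l}) = 4" using lp d fin_pen unfolding deg_def by simp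
    ultimately have "card l + 12 \<le> n" using long by simp
    moreover have "card (T - l) = n - card l" unfolding n_def using lines_sub[OF l] lines_fin[OF l] by (simp add: card_Diff_subset)
    moreover have "card (T - l) \<le> card {x \<in> T. w x \<noteq> 2}" by (rule card_mono) (use fin onl in auto)
    ultimately show False using nonl n19 by simp
  qed
  define F where "F k = {l \<in> lines. card l = k}" for k
  define v where "v k x = card {l \<in> F k. x \<in> l}" for k x
  have Fl: "F k \<subseteq> lines" "finite (F k)" for k unfolding F_def using finite_lines by auto
  have lc: "card l = 4 \<or> card l = 5" if "l \<in> lines" for l using short[OF that] thickD[OF th that] by auto
  have vv: "deg x = v 4 x + v 5 x" "n = 1 + 3 * v 4 x + 4 * v 5 x" if x: "x \<in> T" for x
  proof -
    have sp: "pen x = {l \<in> F 4. x \<in> l} \<union> {l \<in> F 5. x \<in> l}" "{l \<in> F 4. x \<in> l} \<inter> {l \<in> F 5. x \<in> l} = {}"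
      using pen_lines[OF x] lc unfolding F_def by auto
    show "deg x = v 4 x + v 5 x" unfolding deg_def sp(1) v_def by (rule card_Un_disjoint) (use Fl sp in auto)
    have "(\<Sum>l\<in>pen x. card l - 1) = (\<Sum>l\<in>{l \<in> F 4. x \<in> l}. card l - 1) + (\<Sum>l\<in>{l \<in> F 5. x \<in> l}. card l - 1)"
      unfolding sp(1) by (rule sum.union_disjoint) (use Fl sp in auto)
    also have "\<dots> = 3 * v 4 x + 4 * v 5 x" unfolding v_def by (simp add: F_def)
    finally show "n = 1 + 3 * v 4 x + 4 * v 5 x" unfolding n_def using card_pen[OF x] by simp
  qed
  have sum_v: "(\<Sum>x\<in>T. v k x) = k * card (F k)" for k
    unfolding v_def incidence_count[OF Fl(1)] by (simp add: F_def)
  have pairs: "(\<Sum>x\<in>T. v 5 x * (v 5 x - 1)) \<le> card (F 5) * (card (F 5) - 1)"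
    unfolding v_def by (rule crossing_count[OF Fl(1)])
  have n21: "n \<le> 21"
  proof (cases "n = 16")
    case False
    then have "{x \<in> T. w x = 2} \<noteq> {}" using nonl nlt n16 by (intro notI) simp
    then obtain x where x: "x \<in> T" "w x = 2" by blast
    then show ?thesis using light[OF x] vv[OF x(1)] by linarith
  qed simp
  have d56: "deg x = 5 \<or> deg x = 6" if "x \<in> T" for x using nge[OF that] n21 deg5[OF that] by linarith
  define A where "A = {x \<in> T. deg x = 5}"
  define B where "B = {x \<in> T. deg x = 6}"
  have AB: "T = A \<union> B" "A \<inter> B = {}" "finite A" "finite B" using d56 fin unfolding A_def B_def by auto
  have nAB: "n = card A + card B" unfolding n_def AB(1) by (rule card_Un_disjoint) (use AB in auto)
  have vA: "v 5 x + 16 = n" "v 4 x + n = 21" if "x \<in> A" for x using vv[of x] that unfolding A_def by auto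
  have vB: "v 5 x + 19 = n" "v 4 x + n = 25" if "x \<in> B" for x using vv[of x] that unfolding B_def by auto
  have B0: "B = {}" if "n < 19" using vB(1) that by fastforce
  have split: "(\<Sum>x\<in>T. f x) = (\<Sum>x\<in>A. f x) + (\<Sum>x\<in>B. f x)" for f :: "'p \<Rightarrow> nat"
    unfolding AB(1) by (rule sum.union_disjoint) (use AB in auto)
  have S5: "5 * card (F 5) = (n - 16) * card A + (n - 19) * card B"
  proof -
    have "(\<Sum>x\<in>A. v 5 x) = (\<Sum>x\<in>A. n - 16)" "(\<Sum>x\<in>B. v 5 x) = (\<Sum>x\<in>B. n - 19)"
      by (rule sum.cong[OF refl], use vA vB in force)+
    then show ?thesis using sum_v[of 5] split[of "v 5"] by (simp add: mult.commute)
  qed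
  have P5: "(n - 16) * (n - 17) * card A + (n - 19) * (n - 20) * card B \<le> card (F 5) * (card (F 5) - 1)"
  proof -
    have "(\<Sum>x\<in>A. v 5 x * (v 5 x - 1)) = (\<Sum>x\<in>A. (n - 16) * (n - 17))" "(\<Sum>x\<in>B. v 5 x * (v 5 x - 1)) = (\<Sum>x\<in>B. (n - 19) * (n - 20))"
      by (rule sum.cong[OF refl], use vA vB in force)+
    then show ?thesis using pairs split[of "\<lambda>x. v 5 x * (v 5 x - 1)"] by (simp add: mult.commute)
  qed
  have lightA: "card {x \<in> T. w x = 2} \<le> card A"
  proof (rule card_mono[OF AB(3)])
    show "{x \<in> T. w x = 2} \<subseteq> A"
    proof
      fix x assume "x \<in> {x \<in> T. w x = 2}"
      then show "x \<in> A" using light[of x] deg5[of x] unfolding A_def by simp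
    qed
  qed
  have "n = 16 \<or> n = 17 \<or> n = 18 \<or> n = 19 \<or> n = 20 \<or> n = 21" using n16 n21 by auto
  then show False
  proof (elim disjE)
    assume n: "n = 16"
    have TA: "T = A" using B0 AB(1) n by simp
    have z: "v 5 x = 0" if "x \<in> T" for x using vA(1)[of x] that n unfolding TA by simp
    have "l \<notin> F 5" for l
    proof
      assume l: "l \<in> F 5"
      then obtain x where x: "x \<in> l" unfolding F_def by fastforce
      then have "x \<in> T" using l Fl lines_sub by blast
      then have "{l \<in> F 5. x \<in> l} = {}" using z Fl unfolding v_def by auto
      then show False using l x by auto
    qed
    then have all4: "card l = 4" if "l \<in> lines" for l using lc that unfolding F_def by auto
    show False
    proof (rule no16[of T])
      fix x y assume xy: "x \<in> T" "y \<in> T" "x \<noteq> y"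
      have "L x y \<inter> T = L x y" using L_sub[OF xy] by auto
      then show "card (L x y \<inter> T) = 4" using all4[OF L_lines[OF xy]] by simp
    qed (use n in \<open>auto simp: n_def\<close>)
  next
    assume n: "n = 17"
    have "card B = 0" using B0 n by simp
    then have "card A = 17" using nAB n by linarith
    then have "5 * card (F 5) = 17" using S5 \<open>card B = 0\<close> n by simp
    then show False by presburger
  next
    assume n: "n = 18"
    have TA: "T = A" using B0 AB(1) n by simp
    have "(\<Sum>x\<in>T. v 4 x) = (\<Sum>x\<in>T. 3)" by (rule sum.cong[OF refl], use vA(2) n TA in force)
    then have "4 * card (F 4) = 54" using sum_v[of 4] n unfolding n_def by simp
    then show False by presburger
  next
    assume n: "n = 19"
    then have e: "5 * card (F 5) = 3 * card A" "6 * card A \<le> card (F 5) * (card (F 5) - 1)" "8 \<le> card A" "card A \<le> 19"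
      using S5[unfolded n, simplified] P5[unfolded n, simplified] nonl nlt lightA nAB n unfolding One_nat_def by linarith+
    show False using divisibility_19[OF e(1,3,4)] e(2) by auto
  next
    assume n: "n = 20"
    then have e: "5 * card (F 5) = 4 * card A + card B" "12 * card A \<le> card (F 5) * (card (F 5) - 1)" "11 \<le> card A" "card A + card B = 20"
      using S5[unfolded n, simplified] P5[unfolded n, simplified] nonl nlt lightA nAB n unfolding One_nat_def by linarith+
    have "card A = 20" using divisibility_20[OF e(1,3,4)] e(2) by auto
    then have "B = {}" using e AB by simp
    then have v: "v 5 x = 4" "v 4 x = 1" if "x \<in> T" for x using vA[of x] AB that n by auto
    obtain t where t: "t \<in> F 4" "x0 \<in> t" 
    proof -
      have "card {l \<in> F 4. x0 \<in> l} = 1" using v(2)[OF x0] unfolding v_def .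
      then obtain k where "{l \<in> F 4. x0 \<in> l} = {k}" by (rule card_1_singletonE)
      then have "k \<in> F 4" "x0 \<in> k" by auto
      then show ?thesis using that by blast
    qed
    have tl: "t \<in> lines" "card t = 4" using t unfolding F_def by auto
    have uniq: "l = t" if "l \<in> F 4" "u \<in> l" "u \<in> t" for l u
    proof -
      have "u \<in> T" using that tl lines_sub by auto
      then have "card {l \<in> F 4. u \<in> l} = 1" using v(2) unfolding v_def by simp
      then obtain k where "{l \<in> F 4. u \<in> l} = {k}" by (rule card_1_singletonE)
      moreover have "l \<in> {l \<in> F 4. u \<in> l}" "t \<in> {l \<in> F 4. u \<in> l}" using that t by auto
      ultimately show ?thesis by auto
    qed
    show False
    proof (rule no16[of "T - t"])
      show "card (T - t) = 16" using n tl lines_sub[OF tl(1)] lines_fin[OF tl(1)] unfolding n_def by (simp add: card_Diff_subset)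
      fix x y assume x: "x \<in> T - t" and y: "y \<in> T - t" and xy: "x \<noteq> y"
      have T: "x \<in> T" "y \<in> T" using x y by auto
      note l = L_lines[OF T xy] L_l[OF T xy]
      have i: "inj_on (L x) t" "L x ` t \<subseteq> pen x" using inj_pen[OF T(1) tl(1)] x by auto
      have five: "L x ` t \<subseteq> {l \<in> F 5. x \<in> l}"
      proof
        fix k assume "k \<in> L x ` t"
        then obtain u where u: "u \<in> t" "k = L x u" by blast
        then have uT: "u \<in> T" "x \<noteq> u" using lines_sub[OF tl(1)] x by auto
        note k = L_lines[OF T(1) uT] L_l[OF T(1) uT] L_r[OF T(1) uT]
        have "L x u \<noteq> t" using k x by auto
        then have "L x u \<notin> F 4" using uniq[of "L x u" u] u k by auto
        then show "k \<in> {l \<in> F 5. x \<in> l}" using lc[OF k(1)] k u unfolding F_def by auto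
      qed
      have "card {l \<in> F 5. x \<in> l} = card (L x ` t)" using v(1)[OF T(1)] card_image[OF i(1)] tl unfolding v_def by simp
      then have e5: "L x ` t = {l \<in> F 5. x \<in> l}" using card_subset_eq[OF _ five] Fl by auto
      show "card (L x y \<inter> (T - t)) = 4"
      proof (cases "card (L x y) = 4")
        case True
        then have "L x y \<inter> t = {}" using uniq[of "L x y"] l x unfolding F_def by auto
        then have "L x y \<inter> (T - t) = L x y" using lines_sub[OF l(1)] by auto
        then show ?thesis using True by simp
      next
        case False
        then have c5: "card (L x y) = 5" using lc[OF l(1)] by simp
        then have "L x y \<in> L x ` t" unfolding e5 using l unfolding F_def by simp
        then obtain u where u: "u \<in> t" "L x y = L x u" by blast
        then have uL: "u \<in> L x y" using L_r[OF T(1), of u] lines_sub[OF tl(1)] x by auto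
        have "L x y \<inter> t = {u}" using lines_unique[OF l(1) tl(1)] uL u l x by blast
        then have "L x y \<inter> (T - t) = L x y - {u}" using lines_sub[OF l(1)] by auto
        then show ?thesis using c5 uL lines_fin[OF l(1)] by simp
      qed
    qed auto
  next
    assume n: "n = 21"
    then have e: "5 * card (F 5) = 5 * card A + 2 * card B" "20 * card A + 2 * card B \<le> card (F 5) * (card (F 5) - 1)" "14 \<le> card A" "card A + card B = 21"
      using S5[unfolded n, simplified] P5[unfolded n, simplified] nonl nlt lightA nAB n unfolding One_nat_def by linarith+
    have "card A = 21" using divisibility_21[OF e(1,3,4)] e(2) by auto
    then have "B = {}" using e AB by simp
    then have v: "v 5 x = 5" "v 4 x = 0" "deg x = 5" if "x \<in> T" for x using vA[of x] AB that n unfolding A_def by auto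
    have c5: "card l = 5" if l: "l \<in> lines" for l
    proof (rule ccontr)
      assume "card l \<noteq> 5"
      then have l4: "l \<in> F 4" using lc[OF l] l unfolding F_def by auto
      then obtain x where x: "x \<in> l" unfolding F_def by fastforce
      then have "{l \<in> F 4. x \<in> l} = {}" using v(2)[of x] lines_sub[OF l] Fl(2)[of 4] unfolding v_def by auto
      then show False using l4 x by auto
    qed
    obtain t where t: "t \<in> pen x0" using v(3)[OF x0] unfolding deg_def by fastforce
    then have tl: "t \<in> lines" "card t = 5" using pen_lines[OF x0] c5 by auto
    show False
    proof (rule no16[of "T - t"])
      show "card (T - t) = 16" using n tl lines_sub[OF tl(1)] lines_fin[OF tl(1)] unfolding n_def by (simp add: card_Diff_subset)
      fix x y assume x: "x \<in> T - t" and y: "y \<in> T - t" and xy: "x \<noteq> y"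
      have T: "x \<in> T" "y \<in> T" using x y by auto
      note l = L_lines[OF T xy] L_l[OF T xy]
      obtain u where u: "u \<in> t" "u \<in> L x y" using full_cross[OF T(1) tl(1) _ _ pen_memI[OF T xy]] x tl v(3)[OF T(1)] by auto
      have "L x y \<inter> t = {u}" using lines_unique[OF l(1) tl(1)] u l x by blast
      then have "L x y \<inter> (T - t) = L x y - {u}" using lines_sub[OF l(1)] by auto
      then show "card (L x y \<inter> (T - t)) = 4" using c5[OF l(1)] u lines_fin[OF l(1)] by simp
    qed auto
  qed
qed

end

context linspace begin

lemma unique_parallel:
  assumes x: "x \<in> T" and l: "l \<in> lines" "x \<notin> l" and d: "card l + 1 = deg x"
  shows "\<exists>k\<in>pen x. k \<inter> l = {}" "\<And>k k'. k \<in> pen x \<Longrightarrow> k \<inter> l = {} \<Longrightarrow> k' \<in> pen x \<Longrightarrow> k' \<inter> l = {} \<Longrightarrow> k = k'"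
proof -
  note i = inj_pen[OF x l]
  have c1: "card (pen x - L x ` l) = 1"
    using card_Diff_subset[OF finite_subset[OF i(2) fin_pen] i(2)] card_image[OF i(1)] d unfolding deg_def by simp
  have iff: "k \<inter> l = {} \<longleftrightarrow> k \<notin> L x ` l" if k: "k \<in> pen x" for k
  proof
    assume "k \<inter> l = {}"
    then show "k \<notin> L x ` l" using L_r[OF x] l lines_sub[OF l(1)] by blast
  next
    assume n: "k \<notin> L x ` l"
    show "k \<inter> l = {}"
    proof (rule ccontr)
      assume "k \<inter> l \<noteq> {}"
      then obtain u where u: "u \<in> k" "u \<in> l" by blast
      then have "x \<noteq> u" using l by auto
      then have "L x u = k" using lines_L[of k x u] pen_lines[OF x] k u by auto
      then show False using n u by auto
    qed
  qed
  obtain k0 where k0: "pen x - L x ` l = {k0}" using c1 by (rule card_1_singletonE)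
  then have "k0 \<in> pen x" "k0 \<notin> L x ` l" by auto
  then show "\<exists>k\<in>pen x. k \<inter> l = {}" using iff[of k0] by auto
  fix k k' assume "k \<in> pen x" "k \<inter> l = {}" "k' \<in> pen x" "k' \<inter> l = {}"
  then have "k \<in> pen x - L x ` l" "k' \<in> pen x - L x ` l" using iff by auto
  then show "k = k'" unfolding k0 by simp
qed

lemma pen_count:
  assumes x: "x \<in> T" and P: "P \<subseteq> T"
  shows "card (P - {x}) = (\<Sum>l\<in>pen x. card (l \<inter> P - {x}))"
proof -
  have "card (P - {x}) = (\<Sum>y\<in>T - {x}. if y \<in> P then 1 else 0)"
    using P fin by (simp add: sum.If_cases) (rule arg_cong[of _ _ card], blast)
  also have "\<dots> = (\<Sum>l\<in>pen x. \<Sum>y\<in>l - {x}. if y \<in> P then 1 else 0)" by (rule sum_pen[OF x])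
  also have "\<dots> = (\<Sum>l\<in>pen x. card (l \<inter> P - {x}))"
  proof (rule sum.cong[OF refl])
    fix l assume "l \<in> pen x"
    then have "finite l" using pen_lines[OF x] lines_fin by auto
    moreover have "(l - {x}) \<inter> {y. y \<in> P} = l \<inter> P - {x}" by auto
    ultimately show "(\<Sum>y\<in>l - {x}. if y \<in> P then 1 else 0) = card (l \<inter> P - {x})"
      by (simp add: sum.If_cases)
  qed
  finally show ?thesis .
qed

lemma incidence_weight:
  fixes f :: "'p set \<Rightarrow> nat"
  assumes P: "P \<subseteq> T" and F: "F \<subseteq> lines"
  shows "(\<Sum>x\<in>P. \<Sum>l\<in>{l \<in> F. x \<in> l}. f l) = (\<Sum>l\<in>F. f l * card (l \<inter> P))"
proof -
  have fF: "finite F" and fP: "finite P" using F finite_lines P fin finite_subset by blast+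
  have "(\<Sum>x\<in>P. \<Sum>l\<in>{l \<in> F. x \<in> l}. f l) = (\<Sum>x\<in>P. \<Sum>l\<in>F. if x \<in> l then f l else 0)"
    by (rule sum.cong[OF refl], rule sum.inter_filter[OF fF])
  also have "\<dots> = (\<Sum>l\<in>F. \<Sum>x\<in>P. if x \<in> l then f l else 0)" by (rule sum.swap)
  also have "\<dots> = (\<Sum>l\<in>F. f l * card (l \<inter> P))"
  proof (rule sum.cong[OF refl])
    fix l
    have "P \<inter> {x. x \<in> l} = l \<inter> P" by auto
    then show "(\<Sum>x\<in>P. if x \<in> l then f l else 0) = f l * card (l \<inter> P)" using fP by (simp add: sum.If_cases)
  qed
  finally show ?thesis .
qed

end

section \<open>Nine points of an affine plane inside a linear space\<close>

text \<open>The set \<open>H\<close> is an affine plane of order three. Its geometry is used through parallelism: a point of \<open>H\<close> off a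
  line of \<open>H\<close> lies on exactly one line of \<open>H\<close> disjoint from it.\<close>

locale hesse = linspace T L for T :: "'p set" and L +
  fixes H :: "'p set" and p :: nat
  assumes HT: "H \<subseteq> T" and H9: "card H = 9"
    and H3: "\<And>a b. a \<in> H \<Longrightarrow> b \<in> H \<Longrightarrow> a \<noteq> b \<Longrightarrow> card (L a b \<inter> H) = 3"
    and des: "desarguesian p T L" and p23: "p \<noteq> 2" "p \<noteq> 3"
begin

sublocale h: linspace H "\<lambda>x y. L x y \<inter> H" by (rule sub_linspace[OF HT])

lemma finH: "finite H" using HT fin finite_subset by blast

text \<open>The lines of the space meet \<open>H\<close> in three, one or no points; \<open>tau\<close>, \<open>gg\<close> and \<open>jj\<close> count the lines of
  each kind through a point.\<close>

definition "HL = {l \<in> lines. card (l \<inter> H) = 3}"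
definition "GL = {l \<in> lines. card (l \<inter> H) = 1}"
definition "ZL = {l \<in> lines. card (l \<inter> H) = 0}"
definition "N = T - H"
definition "tau x = card {l \<in> HL. x \<in> l}"
definition "gg x = card {l \<in> GL. x \<in> l}"
definition "jj x = card {l \<in> ZL. x \<in> l}"

lemma line_types: "l \<in> lines \<Longrightarrow> l \<in> HL \<or> l \<in> GL \<or> l \<in> ZL"
proof -
  assume l: "l \<in> lines"
  show ?thesis
  proof (cases "2 \<le> card (l \<inter> H)")
    case True
    then obtain a b where ab: "a \<in> l \<inter> H" "b \<in> l \<inter> H" "a \<noteq> b" using two_of_card by blast
    then have "L a b = l" using lines_L[OF l] by auto
    then show ?thesis using H3[of a b] ab l unfolding HL_def by auto
  next
    case False
    then have "card (l \<inter> H) = 0 \<or> card (l \<inter> H) = 1" by linarith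
    then show ?thesis using l unfolding GL_def ZL_def by auto
  qed
qed

lemma sets: "HL \<subseteq> lines" "GL \<subseteq> lines" "ZL \<subseteq> lines" "finite HL" "finite GL" "finite ZL"
  unfolding HL_def GL_def ZL_def using finite_lines by auto

lemma types_disj: "HL \<inter> GL = {}" "HL \<inter> ZL = {}" "GL \<inter> ZL = {}"
  unfolding HL_def GL_def ZL_def by auto

lemma pen_split:
  fixes f :: "'p set \<Rightarrow> nat"
  assumes x: "x \<in> T"
  shows "(\<Sum>l\<in>pen x. f l) = (\<Sum>l\<in>{l \<in> HL. x \<in> l}. f l) + (\<Sum>l\<in>{l \<in> GL. x \<in> l}. f l) + (\<Sum>l\<in>{l \<in> ZL. x \<in> l}. f l)"
proof -
  have "pen x = {l \<in> HL. x \<in> l} \<union> {l \<in> GL. x \<in> l} \<union> {l \<in> ZL. x \<in> l}"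
    using pen_lines[OF x] line_types sets by blast
  moreover have "(\<Sum>l\<in>{l \<in> HL. x \<in> l} \<union> {l \<in> GL. x \<in> l} \<union> {l \<in> ZL. x \<in> l}. f l) =
      (\<Sum>l\<in>{l \<in> HL. x \<in> l} \<union> {l \<in> GL. x \<in> l}. f l) + (\<Sum>l\<in>{l \<in> ZL. x \<in> l}. f l)"
    by (rule sum.union_disjoint) (use sets types_disj in auto)
  moreover have "(\<Sum>l\<in>{l \<in> HL. x \<in> l} \<union> {l \<in> GL. x \<in> l}. f l) = (\<Sum>l\<in>{l \<in> HL. x \<in> l}. f l) + (\<Sum>l\<in>{l \<in> GL. x \<in> l}. f l)"
    by (rule sum.union_disjoint) (use sets types_disj in auto)
  ultimately show ?thesis by simp
qed

lemma nine: "x \<in> N \<Longrightarrow> 9 = 3 * tau x + gg x"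
proof -
  assume "x \<in> N"
  then have x: "x \<in> T" "x \<notin> H" unfolding N_def by auto
  have e: "l \<inter> H - {x} = l \<inter> H" for l using x by auto
  have "9 = (\<Sum>l\<in>pen x. card (l \<inter> H))" using pen_count[OF x(1) HT] x H9 unfolding e by simp
  then show ?thesis unfolding pen_split[OF x(1)] tau_def gg_def by (simp add: HL_def GL_def ZL_def)
qed

lemma HL_of: "l \<in> HL \<Longrightarrow> x \<in> l \<Longrightarrow> y \<in> l \<Longrightarrow> x \<noteq> y \<Longrightarrow> m \<in> lines \<Longrightarrow> x \<in> m \<Longrightarrow> y \<in> m \<Longrightarrow> l = m"
  using lines_unique[of l m x y] sets(1) by blast

lemma hdeg: "a \<in> H \<Longrightarrow> h.deg a = 4"
proof -
  assume a: "a \<in> H"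
  have "(\<Sum>l\<in>h.pen a. card l - 1) = (\<Sum>l\<in>h.pen a. 2)"
  proof (rule sum.cong[OF refl])
    fix l assume "l \<in> h.pen a"
    then obtain y where "y \<in> H" "y \<noteq> a" "l = L a y \<inter> H" using h.pen_ex by blast
    then show "card l - 1 = 2" using H3[OF a, of y] by simp
  qed
  then show ?thesis using h.card_pen[OF a] H9 unfolding h.deg_def by simp
qed

lemma hline_card: "k \<in> h.lines \<Longrightarrow> card k = 3"
  unfolding h.lines_def using H3 by auto

lemma hline_HL: "k \<in> h.lines \<Longrightarrow> \<exists>l\<in>HL. k = l \<inter> H"
proof -
  assume "k \<in> h.lines"
  then obtain a b where ab: "a \<in> H" "b \<in> H" "a \<noteq> b" "k = L a b \<inter> H" unfolding h.lines_def by blast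
  then have "L a b \<in> lines" using L_lines HT by blast
  then have "L a b \<in> HL" using ab H3 unfolding HL_def by simp
  then show ?thesis using ab by blast
qed

lemma HL_hline: "l \<in> HL \<Longrightarrow> l \<inter> H \<in> h.lines"
proof -
  assume l: "l \<in> HL"
  then obtain a b where ab: "a \<in> l \<inter> H" "b \<in> l \<inter> H" "a \<noteq> b" using two_of_card[of "l \<inter> H"] unfolding HL_def by auto
  then have "L a b = l" using lines_L sets(1) l by blast
  then show ?thesis using h.L_lines[of a b] ab by auto
qed

lemma HL_inj: "l \<in> HL \<Longrightarrow> m \<in> HL \<Longrightarrow> l \<inter> H = m \<inter> H \<Longrightarrow> l = m"
proof -
  assume l: "l \<in> HL" "m \<in> HL" "l \<inter> H = m \<inter> H"
  obtain a b where "a \<in> l \<inter> H" "b \<in> l \<inter> H" "a \<noteq> b" using two_of_card[of "l \<inter> H"] l unfolding HL_def by auto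
  then show ?thesis using lines_unique[of l m a b] l sets(1) by blast
qed

lemma parallel:
  assumes "a \<in> H" "k \<in> h.lines" "a \<notin> k"
  shows "\<exists>k'\<in>h.pen a. k' \<inter> k = {}" "\<And>i j. i \<in> h.lines \<Longrightarrow> a \<in> i \<Longrightarrow> i \<inter> k = {} \<Longrightarrow> j \<in> h.lines \<Longrightarrow> a \<in> j \<Longrightarrow> j \<inter> k = {} \<Longrightarrow> i = j"
  using h.unique_parallel[OF assms] hline_card[OF assms(2)] hdeg[OF assms(1)] h.pen_lines[OF assms(1)] by auto

lemma parallel_trans:
  assumes "i \<in> h.lines" "j \<in> h.lines" "k \<in> h.lines" "i \<inter> k = {}" "j \<inter> k = {}" "i \<noteq> j"
  shows "i \<inter> j = {}"
proof (rule ccontr)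
  assume "i \<inter> j \<noteq> {}"
  then obtain a where a: "a \<in> i" "a \<in> j" by blast
  then have "a \<in> H" "a \<notin> k" using assms h.lines_sub by blast+
  then show False using parallel(2)[OF _ assms(3)] a assms by blast
qed

lemma two_parallels: "k \<in> h.lines \<Longrightarrow> card {i \<in> h.lines. i \<inter> k = {}} = 2"
proof -
  assume k: "k \<in> h.lines"
  let ?D = "{i \<in> h.lines. i \<inter> k = {}}"
  have fD: "finite ?D" using h.finite_lines by simp
  have "(\<Union>i\<in>?D. i) = H - k"
  proof
    show "(\<Union>i\<in>?D. i) \<subseteq> H - k" using h.lines_sub by blast
    show "H - k \<subseteq> (\<Union>i\<in>?D. i)"
    proof
      fix a assume "a \<in> H - k"
      then obtain i where "i \<in> h.pen a" "i \<inter> k = {}" using parallel(1)[of a k] k by blast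
      then show "a \<in> (\<Union>i\<in>?D. i)" using h.pen_lines[of a] \<open>a \<in> H - k\<close> by auto
    qed
  qed
  moreover have "card (\<Union>i\<in>?D. i) = (\<Sum>i\<in>?D. card i)"
  proof (rule card_UN_disjoint[OF fD])
    show "\<forall>i\<in>?D. finite i" using h.lines_fin by simp
    show "\<forall>i\<in>?D. \<forall>j\<in>?D. i \<noteq> j \<longrightarrow> i \<inter> j = {}" using parallel_trans[OF _ _ k] by blast
  qed
  moreover have "(\<Sum>i\<in>?D. card i) = (\<Sum>i\<in>?D. 3)" by (rule sum.cong) (use hline_card in auto)
  moreover have "card (H - k) = 6" using H9 hline_card[OF k] h.lines_sub[OF k] h.lines_fin[OF k] by (simp add: card_Diff_subset)
  ultimately show ?thesis by simp
qed

lemma meet_outside: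
  assumes "x \<in> N" "l \<in> HL" "m \<in> HL" "l \<noteq> m" "x \<in> l" "x \<in> m"
  shows "(l \<inter> H) \<inter> (m \<inter> H) = {}"
proof (rule ccontr)
  assume "\<not> ?thesis"
  then obtain y where "y \<in> l" "y \<in> m" "y \<in> H" by blast
  then show False using HL_of[of l x y m] assms sets(1) unfolding N_def by auto
qed

lemma complement_line:
  assumes i: "i \<in> h.lines" and j: "j \<in> h.lines" and ij: "i \<inter> j = {}"
  shows "H - i - j \<in> h.lines"
proof -
  have c: "card (H - i - j) = 3"
  proof -
    have "card (i \<union> j) = 6"
      using card_Un_disjoint[OF h.lines_fin[OF i] h.lines_fin[OF j] ij] hline_card[OF i] hline_card[OF j] by simp
    moreover have "i \<union> j \<subseteq> H" using h.lines_sub[OF i] h.lines_sub[OF j] by simp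
    moreover have "H - i - j = H - (i \<union> j)" by auto
    ultimately show ?thesis using card_Diff_subset[of "i \<union> j" H] finite_subset[OF _ finH] H9 by simp
  qed
  have "H - i - j \<noteq> {}" using c by (metis card.empty zero_neq_numeral)
  then obtain a where a: "a \<in> H - i - j" by blast
  obtain k where k: "k \<in> h.pen a" "k \<inter> i = {}" using parallel(1)[of a i] a i by blast
  then have kl: "k \<in> h.lines" "a \<in> k" using h.pen_lines[of a] a by auto
  have "k \<noteq> j" using kl a by auto
  then have "k \<inter> j = {}" using parallel_trans[OF kl(1) j i k(2)] ij by blast
  then have "k \<subseteq> H - i - j" using h.lines_sub[OF kl(1)] k(2) by blast
  then have "k = H - i - j" using card_subset_eq[of "H - i - j" k] c hline_card[OF kl(1)] finH by simp
  then show ?thesis using kl by simp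
qed

text \<open>Three lines of \<open>H\<close> through a point outside \<open>H\<close> would form a full parallel class of \<open>H\<close>. Parallel classes are closed under
  joining, which forces the characteristic to be at most three.\<close>

lemma tau_le2: "x \<in> N \<Longrightarrow> tau x \<le> 2"
proof (rule ccontr)
  assume xN: "x \<in> N" and "\<not> tau x \<le> 2"
  then have "3 \<le> card {l \<in> HL. x \<in> l}" unfolding tau_def by simp
  then obtain S where S: "S \<subseteq> {l \<in> HL. x \<in> l}" "card S = 3" using obtain_subset_with_card_n by metis
  then obtain l m n where lmn: "S = {l, m, n}" "l \<noteq> m" "m \<noteq> n" "l \<noteq> n" unfolding card_3_iff by metis
  then have HLs: "l \<in> HL" "m \<in> HL" "n \<in> HL" "x \<in> l" "x \<in> m" "x \<in> n" using S by auto
  have x: "x \<in> T" "x \<notin> H" using xN unfolding N_def by auto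
  have ls: "l \<in> lines" "m \<in> lines" "n \<in> lines" using HLs sets(1) by auto
  have d: "(l \<inter> H) \<inter> (m \<inter> H) = {}" "(m \<inter> H) \<inter> (n \<inter> H) = {}" "(l \<inter> H) \<inter> (n \<inter> H) = {}"
    using meet_outside[OF xN] HLs lmn by blast+
  have c3: "card (l \<inter> H) = 3" "card (m \<inter> H) = 3" "card (n \<inter> H) = 3" using HLs unfolding HL_def by auto
  have "card ((l \<inter> H) \<union> (m \<inter> H)) = 6" using card_Un_disjoint[OF _ _ d(1)] c3 finH by simp
  moreover have "((l \<inter> H) \<union> (m \<inter> H)) \<inter> (n \<inter> H) = {}" using d(2,3) by blast
  ultimately have "card ((l \<inter> H) \<union> (m \<inter> H) \<union> (n \<inter> H)) = 9"
    using card_Un_disjoint[of "l \<inter> H \<union> m \<inter> H" "n \<inter> H"] c3 finH by simp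
  then have cover: "(l \<inter> H) \<union> (m \<inter> H) \<union> (n \<inter> H) = H" using card_subset_eq[OF finH, of "(l \<inter> H) \<union> (m \<inter> H) \<union> (n \<inter> H)"] H9 by auto
  have third: "\<exists>z\<in>k \<inter> H. z \<in> L a b"
    if a: "a \<in> i \<inter> H" and b: "b \<in> j \<inter> H" and ijk: "i \<in> HL" "j \<in> HL" "x \<in> i" "x \<in> j" "i \<noteq> j" "(i \<inter> H) \<union> (j \<inter> H) \<union> (k \<inter> H) = H" for a b i j k
  proof -
    have ab: "a \<noteq> b" using meet_outside[OF xN ijk(1,2,5,3,4)] a b by auto
    have T: "a \<in> T" "b \<in> T" using a b HT by auto
    note l' = L_lines[OF T ab] L_l[OF T ab] L_r[OF T ab]
    have "card (L a b \<inter> H - {a, b}) = 1" using H3[of a b] a b ab l' finH by (simp add: card_Diff_subset)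
    then obtain z where "L a b \<inter> H - {a, b} = {z}" by (rule card_1_singletonE)
    then have z: "z \<in> L a b" "z \<in> H" "z \<noteq> a" "z \<noteq> b" by auto
    have "z \<notin> i"
    proof
      assume "z \<in> i"
      then have "i = L a b" using HL_of[of i a z "L a b"] ijk a z l' by auto
      then have "b \<in> i \<inter> H" using b l' by auto
      then show False using meet_outside[OF xN ijk(1,2,5,3,4)] b by auto
    qed
    moreover have "z \<notin> j"
    proof
      assume "z \<in> j"
      then have "j = L a b" using HL_of[of j b z "L a b"] ijk b z l' by auto
      then have "a \<in> j \<inter> H" using a l' by auto
      then show False using meet_outside[OF xN ijk(1,2,5,3,4)] a by auto
    qed
    ultimately show ?thesis using z ijk(6) by blast
  qed
  obtain a where a: "a \<in> l \<inter> H" using c3(1) by (metis all_not_in_conv card.empty zero_neq_numeral)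
  obtain b where b: "b \<in> m \<inter> H" using c3(2) by (metis all_not_in_conv card.empty zero_neq_numeral)
  obtain c where c: "c \<in> n \<inter> H" using c3(3) by (metis all_not_in_conv card.empty zero_neq_numeral)
  have La: "L x a = l" "L x b = m" "L x c = n"
    using lines_L[OF ls(1), of x a] lines_L[OF ls(2), of x b] lines_L[OF ls(3), of x c] a b c HLs x by auto
  have cp: "concurrent_prop p T L" and p14: "p \<noteq> 1" using des unfolding desarguesian_def by auto
  have "p \<noteq> 0 \<and> p \<le> card (l \<inter> H)"
  proof (rule concurrentD[OF cp x(1), of a b c "l \<inter> H" "m \<inter> H" "n \<inter> H"])
    show "a \<in> T - {x}" "b \<in> T - {x}" "c \<in> T - {x}" using a b c HT x by auto
    show "L x a \<noteq> L x b" "L x a \<noteq> L x c" "L x b \<noteq> L x c" using La lmn by auto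
    show "l \<inter> H \<subseteq> L x a - {x}" "m \<inter> H \<subseteq> L x b - {x}" "n \<inter> H \<subseteq> L x c - {x}" using La x by auto
    show "\<exists>z\<in>n \<inter> H. z \<in> L u v" if "u \<in> l \<inter> H" "v \<in> m \<inter> H" for u v
      using third[OF that HLs(1,2,4,5) lmn(2) cover] .
    have cover': "(m \<inter> H) \<union> (n \<inter> H) \<union> (l \<inter> H) = H" using cover by blast
    show "\<exists>z\<in>l \<inter> H. z \<in> L u v" if "u \<in> m \<inter> H" "v \<in> n \<inter> H" for u v
      using third[OF that HLs(2,3,5,6) lmn(3) cover'] .
  qed (use a c3 in auto)
  then show False using c3(1) p14 p23 by linarith
qed

text \<open>Diagonal points: a line that meets H in one point carries at most one point on two Hesse lines.\<close>

lemma one_vertex: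
  assumes V: "V \<in> N" "tau V = 2" and W: "W \<in> N" "tau W = 2" and l: "l \<in> GL" "V \<in> l" "W \<in> l"
  shows "V = W"
proof (rule ccontr)
  assume VW: "V \<noteq> W"
  have two: "\<exists>m n. m \<in> HL \<and> n \<in> HL \<and> m \<noteq> n \<and> x \<in> m \<and> x \<in> n" if "tau x = 2" for x
  proof -
    have "2 \<le> card {l \<in> HL. x \<in> l}" using that unfolding tau_def by simp
    then show ?thesis using two_of_card by blast
  qed
  obtain m n where mn: "m \<in> HL" "n \<in> HL" "m \<noteq> n" "V \<in> m" "V \<in> n" using two[OF V(2)] by blast
  obtain m' n' where mn': "m' \<in> HL" "n' \<in> HL" "m' \<noteq> n'" "W \<in> m'" "W \<in> n'" using two[OF W(2)] by blast
  have ll: "l \<in> lines" "l \<notin> HL" using l sets types_disj by auto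
  have "card (l \<inter> H) = 1" using l(1) unfolding GL_def by simp
  then obtain A where A: "l \<inter> H = {A}" by (rule card_1_singletonE)
  have AVW: "A \<in> H" "A \<in> l" "A \<noteq> V" "A \<noteq> W" using A V W unfolding N_def by auto
  have An: "A \<notin> k" if "k \<in> HL" "x \<in> k" "x \<in> l" "x \<in> N" for k x
    using HL_of[of k x A l] that ll AVW unfolding N_def by auto
  have Amn: "A \<notin> m" "A \<notin> n" "A \<notin> m'" "A \<notin> n'" using An mn mn' V W l by blast+
  have dif: "k \<noteq> k'" if "k \<in> HL" "V \<in> k" "W \<in> k'" for k k'
    using HL_of[of k V W l] that ll VW l by auto
  define i j i' j' where "i = m \<inter> H" and "j = n \<inter> H" and "i' = m' \<inter> H" and "j' = n' \<inter> H"
  have hl: "i \<in> h.lines" "j \<in> h.lines" "i' \<in> h.lines" "j' \<in> h.lines"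
    unfolding i_def j_def i'_def j'_def using HL_hline mn mn' by auto
  have ij: "i \<inter> j = {}" "i' \<inter> j' = {}"
    unfolding i_def j_def i'_def j'_def using meet_outside[OF V(1) mn] meet_outside[OF W(1) mn'] by auto
  have ne: "i \<noteq> i'" "i \<noteq> j'" "j \<noteq> i'" "j \<noteq> j'"
    unfolding i_def j_def i'_def j'_def using HL_inj dif mn mn' by metis+
  define k k' where "k = H - i - j" and "k' = H - i' - j'"
  have kl: "k \<in> h.lines" "k' \<in> h.lines" unfolding k_def k'_def using complement_line hl ij by auto
  have Ak: "A \<in> k" "A \<in> k'" "A \<notin> i" "A \<notin> j" "A \<notin> i'" "A \<notin> j'" using AVW Amn unfolding k_def k'_def i_def j_def i'_def j'_def by auto
  have meets: "r \<inter> s \<noteq> {}" if r: "r \<in> h.lines" "r \<noteq> i" "r \<noteq> j" "r \<noteq> k" and s: "s \<in> {i, j, k}" for r s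
  proof
    assume e: "r \<inter> s = {}"
    have le1: "card (r \<inter> t) \<le> 1" if "t \<in> {i, j, k}" for t
    proof (rule ccontr)
      assume "\<not> ?thesis"
      then obtain y z where "y \<in> r \<inter> t" "z \<in> r \<inter> t" "y \<noteq> z" using two_of_card[of "r \<inter> t"] by auto
      then show False using h.lines_unique[of r t y z] that r hl kl by auto
    qed
    have "r = (r \<inter> i) \<union> (r \<inter> j) \<union> (r \<inter> k)" using h.lines_sub[OF r(1)] unfolding k_def by blast
    then have "card r \<le> card (r \<inter> i) + card (r \<inter> j) + card (r \<inter> k)"
      by (metis card_Un_le le_trans add_le_mono1)
    moreover have "card (r \<inter> i) = 0 \<or> card (r \<inter> j) = 0 \<or> card (r \<inter> k) = 0" using e s by auto
    ultimately show False using hline_card[OF r(1)] le1[of i] le1[of j] le1[of k] by auto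
  qed
  have ki': "i' \<noteq> k" "j' \<noteq> k" using Ak by auto
  obtain q1 where q1: "q1 \<in> i" "q1 \<in> i'" using meets[OF hl(3) ne(1)[symmetric] ne(3)[symmetric] ki'(1), of i] by blast
  obtain q2 where q2: "q2 \<in> i" "q2 \<in> j'" using meets[OF hl(4) ne(2)[symmetric] ne(4)[symmetric] ki'(2), of i] by blast
  obtain q3 where q3: "q3 \<in> j" "q3 \<in> i'" using meets[OF hl(3) ne(1)[symmetric] ne(3)[symmetric] ki'(1), of j] by blast
  obtain q4 where q4: "q4 \<in> j" "q4 \<in> j'" using meets[OF hl(4) ne(2)[symmetric] ne(4)[symmetric] ki'(2), of j] by blast
  have kk: "k \<noteq> k'"
  proof
    assume e: "k = k'"
    have "i' \<inter> k \<noteq> {}" using meets[OF hl(3) ne(1)[symmetric] ne(3)[symmetric] ki'(1), of k] by blast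
    then show False unfolding e k'_def by blast
  qed
  have diag: "A \<in> L x y" if x: "x \<in> s" "x \<in> s'" and y: "y \<in> t" "y \<in> t'"
      and st: "s = i \<and> t = j" and st': "s' = i' \<and> t' = j' \<or> s' = j' \<and> t' = i'" for x y s t s' t'
  proof -
    have sl: "s \<in> h.lines" "t \<in> h.lines" "s' \<in> h.lines" "t' \<in> h.lines" "s \<inter> t = {}" "s' \<inter> t' = {}" using st st' hl ij by auto
    have xy: "x \<in> H" "y \<in> H" "x \<noteq> y" using x y sl h.lines_sub by blast+
    note r = h.L_lines[OF xy] h.L_l[OF xy] h.L_r[OF xy]
    have "card (L x y \<inter> H - {x, y}) = 1" using H3[OF xy] r xy finH by (simp add: card_Diff_subset)
    then obtain z where "L x y \<inter> H - {x, y} = {z}" by (rule card_1_singletonE)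
    then have z: "z \<in> L x y \<inter> H" "z \<noteq> x" "z \<noteq> y" by auto
    have no: "z \<notin> f" if f: "f \<in> h.lines" "g \<in> h.lines" "f \<inter> g = {}" "x \<in> f \<and> y \<in> g \<or> y \<in> f \<and> x \<in> g" for f g
    proof
      assume "z \<in> f"
      then have "f = L x y \<inter> H" using h.lines_unique[OF f(1) r(1)] f(4) z r by blast
      then show False using f r by auto
    qed
    have "z \<notin> s" "z \<notin> t" "z \<notin> s'" "z \<notin> t'"
      using no[OF sl(1,2,5)] no[OF sl(2,1)] no[OF sl(3,4,6)] no[OF sl(4,3)] sl(5,6) x y by (auto simp: Int_commute)
    then have "z \<in> k" "z \<in> k'" using z st st' unfolding k_def k'_def by auto
    then have "z = A" using h.lines_unique[OF kl, of z A] Ak kk by auto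
    then show ?thesis using z by simp
  qed
  have g1: "A \<in> L q1 q4" using diag[OF q1 q4] by blast
  have g2: "A \<in> L q2 q3" using diag[OF q2 q3] by blast
  have qH: "q1 \<in> H" "q2 \<in> H" "q3 \<in> H" "q4 \<in> H" using q1 q2 q3 q4 hl h.lines_sub by blast+
  have qd: "q1 \<noteq> q2" "q1 \<noteq> q3" "q1 \<noteq> q4" "q2 \<noteq> q3" "q2 \<noteq> q4" "q3 \<noteq> q4" using q1 q2 q3 q4 ij by blast+
  have qT: "q1 \<in> T" "q2 \<in> T" "q3 \<in> T" "q4 \<in> T" using qH HT by auto
  have mq: "L q1 q2 = m" "L q3 q4 = n" "L q1 q3 = m'" "L q2 q4 = n'"
    using lines_L[of m q1 q2] lines_L[of n q3 q4] lines_L[of m' q1 q3] lines_L[of n' q2 q4] mn mn' sets(1) q1 q2 q3 q4 qd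
    unfolding i_def j_def i'_def j'_def by auto
  have fp: "fano_prop p T L" using des unfolding desarguesian_def by blast
  have nm: "q3 \<notin> m" "q4 \<notin> m" "q4 \<notin> m'" using q1 q2 q3 q4 ij qH unfolding i_def j_def i'_def j'_def by auto
  have n23: "q4 \<notin> L q2 q3"
  proof
    assume "q4 \<in> L q2 q3"
    then have "q2 \<in> n" using L_eq[OF qT(2,3) qd(4), of q3 q4] L_r[OF qT(2,3) qd(4)] L_l[OF qT(2,3) qd(4)] qd mq by auto
    then show False using q2 ij qH unfolding i_def j_def by auto
  qed
  have "A \<in> L V W" using lines_L[OF ll(1) VW l(2,3)] AVW by simp
  moreover have "V \<in> T" "W \<in> T" "A \<in> T" using V W AVW HT unfolding N_def by auto
  ultimately have "p = 2"
    using fp[unfolded fano_prop_def, THEN bspec, OF qT(1), THEN bspec, OF qT(2), THEN bspec, OF qT(3), THEN bspec, OF qT(4),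
      THEN bspec, of V, THEN bspec, of W, THEN bspec, of A] qd mq nm n23 mn mn' g1 g2 VW by simp
  then show False using p23 by simp
qed

end

text \<open>The counts of \<open>hesse_small\<close> are contradictory. Here \<open>e\<close> is the number of points outside \<open>H\<close> in excess of 13,
  \<open>u\<close> and \<open>v\<close> are the numbers of those on one and on two lines of \<open>H\<close>, and the other letters are incidence sums.\<close>

lemma small_plane_arith:
  fixes e u v Z X A B D G Q :: nat
  assumes "e \<le> 2" "u + v = 13 + e" "u + 2 * v = Z + 12" "2 * Z \<le> Q" "Q + G = e * u + D"
    "D + A + B = (6 + e) * v" "3 * A \<le> G" "4 * X + A \<le> G + 6 * v" "A \<le> X" "6 * v + A \<le> 6 * u"
    "D \<le> 2 * Z" "9 * e \<le> 3 * Z + X" "D \<le> 2 * max e 1 * v" "v \<le> 1 \<Longrightarrow> 2 * Z + 2 * D \<le> Q + 4 * v"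
    and B: "B = 0 \<or> v = 7 \<and> B = 24 \<or> (\<exists>k. 4 \<le> k \<and> k \<le> v \<and> B = k * (k - 1) \<and> (k = v \<longrightarrow> D \<le> Z))"
  shows False
proof -
  have "v \<le> 7" using assms(1,2,10) by linarith
  then have v: "v = 0 \<or> v = 1 \<or> v = 2 \<or> v = 3 \<or> v = 4 \<or> v = 5 \<or> v = 6 \<or> v = 7" by linarith
  have e: "e = 0 \<or> e = 1 \<or> e = 2" using assms(1) by linarith
  have B': "B = 0 \<or> v = 7 \<and> B = 24 \<or> 4 \<le> v \<and> B = 12 \<and> (v = 4 \<longrightarrow> D \<le> Z) \<or> 5 \<le> v \<and> B = 20 \<and> (v = 5 \<longrightarrow> D \<le> Z)
      \<or> 6 \<le> v \<and> B = 30 \<and> (v = 6 \<longrightarrow> D \<le> Z) \<or> v = 7 \<and> B = 42 \<and> D \<le> Z"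
    using B
  proof (elim disjE exE conjE)
    fix k assume k: "4 \<le> k" "k \<le> v" "B = k * (k - 1)" "k = v \<longrightarrow> D \<le> Z"
    then have "k = 4 \<or> k = 5 \<or> k = 6 \<or> k = 7" using \<open>v \<le> 7\<close> by linarith
    then show ?thesis using k \<open>v \<le> 7\<close> by (elim disjE) auto
  qed auto
  have m: "max (0::nat) 1 = 1" "max (1::nat) 1 = 1" "max (2::nat) 1 = 2" by auto
  note arith = assms(2-14)
  show False using e v
    by (elim disjE) (insert B' arith, (simp add: m del: max.bounded_iff, linarith?)+)
qed

lemma nat_quadratics:
  fixes x :: nat
  shows "2 * x \<le> x * (x + 1)" "4 * x \<le> x * (x + 1) + 2" "4 * x \<le> x * (x + 3)" "5 * x \<le> x * (x + 2) + 2"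
proof -
  consider "x = 0" | "x = 1" | y where "x = y + 2" by (metis One_nat_def add_2_eq_Suc' not0_implies_Suc)
  then have "2 * x \<le> x * (x + 1) \<and> 4 * x \<le> x * (x + 1) + 2 \<and> 4 * x \<le> x * (x + 3) \<and> 5 * x \<le> x * (x + 2) + 2"
    by cases (auto simp: algebra_simps)
  then show "2 * x \<le> x * (x + 1)" "4 * x \<le> x * (x + 1) + 2" "4 * x \<le> x * (x + 3)" "5 * x \<le> x * (x + 2) + 2" by auto
qed

text \<open>At most fifteen points outside \<open>H\<close> are assumed towards a contradiction. Every line has at least four points, so it has at
  least \<open>1\<close>, \<open>3\<close> or \<open>4\<close> points outside \<open>H\<close>, according to its kind; \<open>z\<close> and \<open>xx\<close> measure the excess.\<close>

locale hesse_small = hesse T L H p for T :: "'p set" and L H p +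
  assumes thick4: "thick 4" and N15: "card N \<le> 15" and Nne: "N \<noteq> {}"
begin

definition "c l = card (l \<inter> N)"
definition "z l = c l - 1"
definition "xx l = c l - 3"
definition "zz x = (\<Sum>l\<in>{l \<in> HL. x \<in> l}. z l)"
definition "xs x = (\<Sum>l\<in>{l \<in> GL. x \<in> l}. xx l)"
definition "J x = (\<Sum>l\<in>{l \<in> ZL. x \<in> l}. c l - 1)"
definition "U = {x \<in> N. tau x = 1}"
definition "V = {x \<in> N. tau x = 2}"

lemma NT: "N \<subseteq> T" "finite N" using fin unfolding N_def by auto

lemma card_split: "l \<in> lines \<Longrightarrow> card l = card (l \<inter> H) + c l"
proof -
  assume l: "l \<in> lines"
  have "l = (l \<inter> H) \<union> (l \<inter> N)" using lines_sub[OF l] unfolding N_def by auto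
  moreover have "card ((l \<inter> H) \<union> (l \<inter> N)) = card (l \<inter> H) + card (l \<inter> N)"
    by (rule card_Un_disjoint) (use lines_fin[OF l] in \<open>auto simp: N_def\<close>)
  ultimately show ?thesis unfolding c_def by simp
qed

lemma four: "l \<in> lines \<Longrightarrow> 4 \<le> card l"
proof -
  assume "l \<in> lines"
  then show ?thesis by (rule thickD[OF thick4])
qed

lemma c_HL: "l \<in> HL \<Longrightarrow> c l = z l + 1"
  using card_split[of l] four[of l] unfolding HL_def z_def by auto
lemma c_GL: "l \<in> GL \<Longrightarrow> c l = xx l + 3"
  using card_split[of l] four[of l] unfolding GL_def xx_def by auto
lemma c_ZL: "l \<in> ZL \<Longrightarrow> 4 \<le> c l"
  using card_split[of l] four[of l] unfolding ZL_def by auto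

lemma count_N:
  assumes x: "x \<in> N"
  shows "card N - 1 = zz x + xs x + 2 * gg x + J x"
proof -
  have xT: "x \<in> T" using x NT by auto
  have s: "card (l \<inter> N - {x}) = c l - 1" if "x \<in> l" for l
    using that x NT unfolding c_def by (simp add: card_Diff_singleton)
  have "card N - 1 = card (N - {x})" using x NT by simp
  also have "\<dots> = (\<Sum>l\<in>pen x. c l - 1)"
    unfolding pen_count[OF xT NT(1)] by (rule sum.cong[OF refl], rule s) (use pen_lines[OF xT] in auto)
  also have "\<dots> = zz x + (\<Sum>l\<in>{l \<in> GL. x \<in> l}. xx l + 2) + J x"
    unfolding pen_split[OF xT] zz_def J_def
    by (intro arg_cong2[of _ _ _ _ "(+)"] sum.cong refl) (auto simp: c_HL c_GL)
  also have "(\<Sum>l\<in>{l \<in> GL. x \<in> l}. xx l + 2) = xs x + 2 * gg x"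
    unfolding xs_def gg_def by (simp add: sum.distrib sum_Suc)
  finally show ?thesis by simp
qed

lemma J_pos: "l \<in> ZL \<Longrightarrow> x \<in> l \<Longrightarrow> 3 \<le> J x"
proof -
  assume l: "l \<in> ZL" "x \<in> l"
  then have "c l - 1 \<le> J x" unfolding J_def by (intro member_le_sum) (use sets in auto)
  then show ?thesis using c_ZL[OF l(1)] by simp
qed

lemma NUV: "N = U \<union> V" "U \<inter> V = {}" "finite U" "finite V"
proof -
  have "tau x \<noteq> 0" if x: "x \<in> N" for x
  proof
    assume "tau x = 0"
    then have "gg x = 9" using nine[OF x] by simp
    then have "18 \<le> card N - 1" using count_N[OF x] by simp
    then show False using N15 by simp
  qed
  then have "tau x = 1 \<or> tau x = 2" if "x \<in> N" for x using tau_le2[OF that] that by (metis One_nat_def le_0_eq le_Suc_eq numeral_2_eq_2)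
  then show "N = U \<union> V" unfolding U_def V_def by auto
  show "U \<inter> V = {}" "finite U" "finite V" using NT unfolding U_def V_def by auto
qed

lemma UgV: "U \<subseteq> N" "V \<subseteq> N" unfolding U_def V_def by auto

lemma ggU: "x \<in> U \<Longrightarrow> gg x = 6" using nine[of x] unfolding U_def by auto
lemma ggV: "x \<in> V \<Longrightarrow> gg x = 3" using nine[of x] unfolding V_def by auto

lemma vg: "l \<in> GL \<Longrightarrow> card (l \<inter> V) \<le> 1"
proof (rule ccontr)
  assume l: "l \<in> GL" and "\<not> card (l \<inter> V) \<le> 1"
  then obtain v w where "v \<in> l \<inter> V" "w \<in> l \<inter> V" "v \<noteq> w" using two_of_card[of "l \<inter> V"] by auto
  then show False using one_vertex[of v w l] l unfolding V_def by auto
qed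

lemma uv: "card (l \<inter> U) + card (l \<inter> V) = c l"
proof -
  have "l \<inter> N = (l \<inter> U) \<union> (l \<inter> V)" using NUV by auto
  moreover have "card ((l \<inter> U) \<union> (l \<inter> V)) = card (l \<inter> U) + card (l \<inter> V)"
    by (rule card_Un_disjoint) (use NUV in auto)
  ultimately show ?thesis unfolding c_def by simp
qed

lemma U_ne: "U \<noteq> {}"
proof
  assume "U = {}"
  then obtain x where x: "x \<in> V" using NUV Nne by auto
  then have "{l \<in> GL. x \<in> l} \<noteq> {}" using ggV unfolding gg_def by (metis card.empty zero_neq_numeral)
  then obtain l where l: "l \<in> GL" by auto
  then show False using uv[of l] vg[OF l] c_GL[OF l] \<open>U = {}\<close> by simp
qed

definition "e = card N - 13"

lemma m13: "card N = 13 + e" "e \<le> 2"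
proof -
  obtain x where x: "x \<in> U" using U_ne by auto
  have "12 \<le> card N - 1" using count_N[of x] x UgV ggU[OF x] by auto
  then show "card N = 13 + e" unfolding e_def by simp
  show "e \<le> 2" using N15 unfolding e_def by simp
qed

lemma countU: "x \<in> U \<Longrightarrow> zz x + xs x = e \<and> J x = 0"
proof -
  assume x: "x \<in> U"
  have s: "zz x + xs x + J x = e" using count_N[of x] x UgV ggU[OF x] m13 by auto
  have "{l \<in> ZL. x \<in> l} = {}"
  proof (rule ccontr)
    assume "\<not> ?thesis"
    then obtain l where "l \<in> ZL" "x \<in> l" by auto
    then have "3 \<le> J x" by (rule J_pos)
    then show False using s m13 by simp
  qed
  then have "J x = 0" unfolding J_def by (simp only: sum.empty)
  then show ?thesis using s by simp
qed

lemma countV: "x \<in> V \<Longrightarrow> zz x + xs x + J x = 6 + e"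
  using count_N[of x] UgV ggV[of x] m13 by auto

lemma ZLV: "l \<in> ZL \<Longrightarrow> l \<subseteq> V"
proof
  fix x assume l: "l \<in> ZL" "x \<in> l"
  have "x \<in> N" using l lines_sub sets(3) finH unfolding N_def ZL_def by auto
  moreover have "x \<notin> U" using countU[of x] J_pos[OF l] by auto
  ultimately show "x \<in> V" using NUV by auto
qed

lemma HL_at: "a \<in> H \<Longrightarrow> card {l \<in> HL. a \<in> l} = 4"
proof -
  assume a: "a \<in> H"
  have "bij_betw (\<lambda>l. l \<inter> H) {l \<in> HL. a \<in> l} (h.pen a)"
  proof (rule bij_betwI')
    fix l m assume "l \<in> {l \<in> HL. a \<in> l}" "m \<in> {l \<in> HL. a \<in> l}"
    then show "(l \<inter> H = m \<inter> H) = (l = m)" using HL_inj by auto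
  next
    fix l assume "l \<in> {l \<in> HL. a \<in> l}"
    then show "l \<inter> H \<in> h.pen a" using HL_hline[of l] h.pen_lines[OF a] a by auto
  next
    fix k assume "k \<in> h.pen a"
    then have "k \<in> h.lines" "a \<in> k" using h.pen_lines[OF a] by auto
    then show "\<exists>l\<in>{l \<in> HL. a \<in> l}. k = l \<inter> H" using hline_HL[of k] by auto
  qed
  then have "card {l \<in> HL. a \<in> l} = card (h.pen a)" by (rule bij_betw_same_card)
  then show ?thesis using hdeg[OF a] unfolding h.deg_def by simp
qed

definition "Z = (\<Sum>l\<in>HL. z l)"
definition "X = (\<Sum>l\<in>GL. xx l)"

lemma card_HL: "card HL = 12"
proof -
  have "(\<Sum>x\<in>H. \<Sum>l\<in>{l \<in> HL. x \<in> l}. (1::nat)) = (\<Sum>l\<in>HL. 1 * card (l \<inter> H))" by (rule incidence_weight[OF HT sets(1)])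
  moreover have "(\<Sum>x\<in>H. \<Sum>l\<in>{l \<in> HL. x \<in> l}. (1::nat)) = (\<Sum>x\<in>H. (4::nat))" by (rule sum.cong) (use HL_at in auto)
  moreover have "(\<Sum>l\<in>HL. 1 * card (l \<inter> H)) = (\<Sum>l\<in>HL. (3::nat))" by (rule sum.cong) (auto simp: HL_def)
  ultimately show ?thesis using H9 by simp
qed

lemma tau_sum: "card U + 2 * card V = Z + 12"
proof -
  have "(\<Sum>x\<in>N. \<Sum>l\<in>{l \<in> HL. x \<in> l}. (1::nat)) = (\<Sum>l\<in>HL. 1 * card (l \<inter> N))" by (rule incidence_weight[OF NT(1) sets(1)])
  moreover have "(\<Sum>l\<in>HL. 1 * card (l \<inter> N)) = (\<Sum>l\<in>HL. z l + 1)" by (rule sum.cong) (auto simp: c_HL simp flip: c_def)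
  moreover have "(\<Sum>l\<in>HL. z l + 1) = Z + 12" using card_HL unfolding Z_def by (simp add: sum.distrib sum_Suc)
  moreover have "(\<Sum>x\<in>N. \<Sum>l\<in>{l \<in> HL. x \<in> l}. (1::nat)) = (\<Sum>x\<in>U. tau x) + (\<Sum>x\<in>V. tau x)"
    unfolding NUV(1) tau_def using sum.union_disjoint[OF NUV(3,4,2)] by simp
  moreover have "(\<Sum>x\<in>U. tau x) = card U" unfolding U_def by simp
  moreover have "(\<Sum>x\<in>V. tau x) = 2 * card V" unfolding V_def by simp
  ultimately show ?thesis by simp
qed

lemma uv_sum: "card U + card V = 13 + e"
  using card_Un_disjoint[OF NUV(3,4,2)] NUV(1) m13 by simp

lemma H_count: "9 * e \<le> 3 * Z + X"
proof -
  have pt: "e \<le> zz a + xs a" if a: "a \<in> H" for a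
  proof -
    have aT: "a \<in> T" using a HT by auto
    have "l \<inter> N - {a} = l \<inter> N" for l using a unfolding N_def by auto
    moreover have "card (N - {a}) = card N" using a unfolding N_def by simp
    ultimately have "card N = (\<Sum>l\<in>pen a. c l)" using pen_count[OF aT NT(1)] unfolding c_def by simp
    moreover have "{l \<in> ZL. a \<in> l} = {}" using a finH unfolding ZL_def by auto
    moreover have "(\<Sum>l\<in>{l \<in> HL. a \<in> l}. c l) = (\<Sum>l\<in>{l \<in> HL. a \<in> l}. z l + 1)" by (rule sum.cong) (auto simp: c_HL)
    moreover have "(\<Sum>l\<in>{l \<in> GL. a \<in> l}. c l) = (\<Sum>l\<in>{l \<in> GL. a \<in> l}. xx l + 3)" by (rule sum.cong) (auto simp: c_GL)
    ultimately have "card N = zz a + 4 + (xs a + 3 * gg a)"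
      using HL_at[OF a] unfolding pen_split[OF aT] zz_def xs_def gg_def by (simp add: sum.distrib sum_Suc)
    then have "9 + e = zz a + xs a + 3 * gg a" using m13 by simp
    then show ?thesis using m13(2) by presburger
  qed
  have "(\<Sum>a\<in>H. e) \<le> (\<Sum>a\<in>H. zz a + xs a)" by (rule sum_mono) (rule pt)
  moreover have "(\<Sum>a\<in>H. zz a) = (\<Sum>l\<in>HL. z l * card (l \<inter> H))" unfolding zz_def by (rule incidence_weight[OF HT sets(1)])
  moreover have "(\<Sum>l\<in>HL. z l * card (l \<inter> H)) = (\<Sum>l\<in>HL. 3 * z l)" by (rule sum.cong) (auto simp: HL_def)
  moreover have "(\<Sum>a\<in>H. xs a) = (\<Sum>l\<in>GL. xx l * card (l \<inter> H))" unfolding xs_def by (rule incidence_weight[OF HT sets(2)])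
  moreover have "(\<Sum>l\<in>GL. xx l * card (l \<inter> H)) = X" unfolding X_def by (rule sum.cong) (auto simp: GL_def)
  ultimately show ?thesis using H9 by (simp add: sum.distrib Z_def sum_distrib_left)
qed

definition "A = (\<Sum>x\<in>V. xs x)"
definition "B = (\<Sum>x\<in>V. J x)"
definition "D = (\<Sum>x\<in>V. zz x)"
definition "G = (\<Sum>l\<in>GL. xx l * card (l \<inter> U))"
definition "Q = (\<Sum>l\<in>HL. z l * c l)"

lemma A_alt: "A = (\<Sum>l\<in>GL. xx l * card (l \<inter> V))"
  unfolding A_def xs_def using incidence_weight[OF _ sets(2), of V xx] UgV NT by blast
lemma D_alt: "D = (\<Sum>l\<in>HL. z l * card (l \<inter> V))"
  unfolding D_def zz_def using incidence_weight[OF _ sets(1), of V z] UgV NT by blast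

lemma V_sum: "D + A + B = (6 + e) * card V"
proof -
  have "(\<Sum>x\<in>V. zz x + xs x + J x) = (\<Sum>x\<in>V. 6 + e)" by (rule sum.cong[OF refl]) (rule countV)
  then show ?thesis unfolding A_def B_def D_def by (simp add: sum.distrib mult.commute)
qed

lemma Q_sum: "Q + G = e * card U + D"
proof -
  have "Q = (\<Sum>x\<in>N. zz x)" unfolding Q_def c_def zz_def by (rule incidence_weight[OF NT(1) sets(1), symmetric])
  also have "\<dots> = (\<Sum>x\<in>U. zz x) + D" unfolding NUV(1) D_def by (rule sum.union_disjoint[OF NUV(3,4,2)])
  finally have "Q = (\<Sum>x\<in>U. zz x) + D" .
  moreover have "G = (\<Sum>x\<in>U. xs x)"
    unfolding G_def xs_def using incidence_weight[OF _ sets(2), of U xx] UgV NT by (metis subset_trans)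
  moreover have "(\<Sum>x\<in>U. zz x + xs x) = (\<Sum>x\<in>U. e)" by (rule sum.cong) (use countU in auto)
  ultimately show ?thesis by (simp add: sum.distrib mult.commute)
qed

lemma vv: "(\<Sum>l\<in>GL. card (l \<inter> V)) = 3 * card V" "(\<Sum>l\<in>GL. card (l \<inter> U)) = 6 * card U" "(\<Sum>l\<in>HL. card (l \<inter> V)) = 2 * card V"
proof -
  have "(\<Sum>x\<in>V. \<Sum>l\<in>{l \<in> GL. x \<in> l}. (1::nat)) = (\<Sum>l\<in>GL. 1 * card (l \<inter> V))" by (rule incidence_weight[OF _ sets(2)]) (use UgV NT in auto)
  moreover have "(\<Sum>x\<in>V. \<Sum>l\<in>{l \<in> GL. x \<in> l}. (1::nat)) = (\<Sum>x\<in>V. (3::nat))" by (rule sum.cong) (use ggV in \<open>auto simp: gg_def\<close>)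
  ultimately show "(\<Sum>l\<in>GL. card (l \<inter> V)) = 3 * card V" by simp
  have "(\<Sum>x\<in>U. \<Sum>l\<in>{l \<in> GL. x \<in> l}. (1::nat)) = (\<Sum>l\<in>GL. 1 * card (l \<inter> U))" by (rule incidence_weight[OF _ sets(2)]) (use UgV NT in auto)
  moreover have "(\<Sum>x\<in>U. \<Sum>l\<in>{l \<in> GL. x \<in> l}. (1::nat)) = (\<Sum>x\<in>U. (6::nat))" by (rule sum.cong) (use ggU in \<open>auto simp: gg_def\<close>)
  ultimately show "(\<Sum>l\<in>GL. card (l \<inter> U)) = 6 * card U" by simp
  have "(\<Sum>x\<in>V. \<Sum>l\<in>{l \<in> HL. x \<in> l}. (1::nat)) = (\<Sum>l\<in>HL. 1 * card (l \<inter> V))" by (rule incidence_weight[OF _ sets(1)]) (use UgV NT in auto)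
  moreover have "(\<Sum>x\<in>V. \<Sum>l\<in>{l \<in> HL. x \<in> l}. (1::nat)) = (\<Sum>x\<in>V. (2::nat))" by (rule sum.cong) (auto simp: tau_def V_def)
  ultimately show "(\<Sum>l\<in>HL. card (l \<inter> V)) = 2 * card V" by simp
qed

lemma GL_cases: "l \<in> GL \<Longrightarrow> card (l \<inter> V) = 0 \<and> card (l \<inter> U) = xx l + 3 \<or> card (l \<inter> V) = 1 \<and> card (l \<inter> U) = xx l + 2"
  using vg[of l] uv[of l] c_GL[of l] by linarith

lemma G_bounds: "3 * A \<le> G" "4 * X + A \<le> G + 6 * card V" "A \<le> X" "6 * card V + A \<le> 6 * card U"
proof -
  have "(\<Sum>l\<in>GL. 3 * (xx l * card (l \<inter> V))) \<le> G" unfolding G_def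
  proof (rule sum_mono)
    fix l assume "l \<in> GL"
    from GL_cases[OF this] show "3 * (xx l * card (l \<inter> V)) \<le> xx l * card (l \<inter> U)"
      by (cases "xx l") auto
  qed
  then show "3 * A \<le> G" unfolding A_alt by (simp add: sum_distrib_left)
  have "(\<Sum>l\<in>GL. 4 * xx l + xx l * card (l \<inter> V)) \<le> (\<Sum>l\<in>GL. xx l * card (l \<inter> U) + 2 * card (l \<inter> V))"
  proof (rule sum_mono)
    fix l assume "l \<in> GL"
    moreover have "4 * x \<le> x * (x + 3)" "5 * x \<le> x * (x + 2) + 2" for x :: nat by (rule nat_quadratics)+
    ultimately show "4 * xx l + xx l * card (l \<inter> V) \<le> xx l * card (l \<inter> U) + 2 * card (l \<inter> V)"
      using GL_cases[of l] by auto
  qed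
  then have "4 * X + A \<le> G + 2 * (\<Sum>l\<in>GL. card (l \<inter> V))"
    unfolding A_alt X_def G_def by (simp add: sum.distrib sum_distrib_left)
  then show "4 * X + A \<le> G + 6 * card V" using vv(1) by simp
  show "A \<le> X" unfolding A_alt X_def by (rule sum_mono) (use vg in auto)
  have "(\<Sum>l\<in>GL. 2 * card (l \<inter> V) + xx l * card (l \<inter> V)) \<le> (\<Sum>l\<in>GL. card (l \<inter> U))"
    by (rule sum_mono) (use GL_cases in fastforce)
  then have "2 * (\<Sum>l\<in>GL. card (l \<inter> V)) + A \<le> 6 * card U"
    unfolding A_alt vv(2) by (simp add: sum.distrib sum_distrib_left)
  then show "6 * card V + A \<le> 6 * card U" using vv(1) by simp
qed

text \<open>The other line of \<open>H\<close> through such a point meets \<open>H\<close> in one of the two parallels of \<open>l \<inter> H\<close>.\<close>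

lemma vh: "l \<in> HL \<Longrightarrow> card (l \<inter> V) \<le> 2"
proof -
  assume l: "l \<in> HL"
  have other: "\<exists>m. m \<in> HL \<and> m \<noteq> l \<and> x \<in> m" if x: "x \<in> V" "x \<in> l" for x
  proof -
    have "2 \<le> card {l \<in> HL. x \<in> l}" using x unfolding V_def tau_def by simp
    then obtain m where "m \<in> {l \<in> HL. x \<in> l}" "l \<noteq> m" using another_element[of "{l \<in> HL. x \<in> l}" l] by blast
    then show ?thesis by auto
  qed
  define o' where "o' x = (SOME m. m \<in> HL \<and> m \<noteq> l \<and> x \<in> m)" for x
  have o': "o' x \<in> HL" "o' x \<noteq> l" "x \<in> o' x" if "x \<in> l \<inter> V" for x
    using someI_ex[OF other[of x]] that unfolding o'_def by auto
  have "card (l \<inter> V) \<le> card {i \<in> h.lines. i \<inter> (l \<inter> H) = {}}"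
  proof (rule card_inj_on_le[of "\<lambda>x. o' x \<inter> H"])
    show "inj_on (\<lambda>x. o' x \<inter> H) (l \<inter> V)"
    proof (rule inj_onI)
      fix x y assume x: "x \<in> l \<inter> V" and y: "y \<in> l \<inter> V" and e: "o' x \<inter> H = o' y \<inter> H"
      have eq: "o' x = o' y" using HL_inj[OF _ _ e] o' x y by blast
      show "x = y"
      proof (rule ccontr)
        assume "x \<noteq> y"
        then have "l = o' x" using HL_of[OF l, of x y "o' x"] x y o'[OF x] o'[OF y] eq sets(1) by auto
        then show False using o'(2)[OF x] by simp
      qed
    qed
    show "(\<lambda>x. o' x \<inter> H) ` (l \<inter> V) \<subseteq> {i \<in> h.lines. i \<inter> (l \<inter> H) = {}}"
    proof (rule image_subsetI)
      fix x assume x: "x \<in> l \<inter> V"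
      then have "x \<in> N" "x \<in> l" using UgV by auto
      then show "o' x \<inter> H \<in> {i \<in> h.lines. i \<inter> (l \<inter> H) = {}}"
        using HL_hline[OF o'(1)[OF x]] meet_outside[OF _ o'(1)[OF x] l o'(2)[OF x] o'(3)[OF x]] by auto
    qed
    show "finite {i \<in> h.lines. i \<inter> (l \<inter> H) = {}}" using h.finite_lines by simp
  qed
  then show ?thesis using two_parallels[OF HL_hline[OF l]] by simp
qed

lemma z_le: "l \<in> HL \<Longrightarrow> z l \<le> max e 1"
proof -
  assume l: "l \<in> HL"
  show ?thesis
  proof (cases "l \<inter> U = {}")
    case True
    then show ?thesis using uv[of l] vh[OF l] unfolding z_def by simp
  next
    case False
    then obtain x where x: "x \<in> l" "x \<in> U" by auto
    have "z l \<le> zz x" unfolding zz_def by (rule member_le_sum) (use l x sets in auto)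
    then show ?thesis using countU[OF x(2)] by linarith
  qed
qed

lemma D_bounds: "D \<le> 2 * Z" "D \<le> 2 * max e 1 * card V" "card V \<le> 1 \<Longrightarrow> 2 * Z + 2 * D \<le> Q + 4 * card V" "2 * Z \<le> Q"
proof -
  have "D \<le> (\<Sum>l\<in>HL. 2 * z l)" unfolding D_alt by (rule sum_mono) (use vh in \<open>auto simp: mult.commute\<close>)
  then show "D \<le> 2 * Z" unfolding Z_def by (simp add: sum_distrib_left)
  have "D \<le> (\<Sum>l\<in>HL. max e 1 * card (l \<inter> V))" unfolding D_alt by (rule sum_mono) (use z_le in auto)
  then show "D \<le> 2 * max e 1 * card V" using vv(3) by (simp flip: sum_distrib_left)
  have "(\<Sum>l\<in>HL. 2 * z l) \<le> Q" unfolding Q_def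
  proof (rule sum_mono)
    fix l assume "l \<in> HL"
    then show "2 * z l \<le> z l * c l" using c_HL[of l] by (cases "z l") auto
  qed
  then show "2 * Z \<le> Q" unfolding Z_def by (simp add: sum_distrib_left)
  show "2 * Z + 2 * D \<le> Q + 4 * card V" if v: "card V \<le> 1"
  proof -
    have "(\<Sum>l\<in>HL. 2 * z l + 2 * (z l * card (l \<inter> V))) \<le> (\<Sum>l\<in>HL. z l * c l + 2 * card (l \<inter> V))"
    proof (rule sum_mono)
      fix l assume l: "l \<in> HL"
      have "card (l \<inter> V) \<le> card V" using NUV by (intro card_mono) auto
      then have "card (l \<inter> V) = 0 \<or> card (l \<inter> V) = 1" using v by linarith
      moreover have "2 * x \<le> x * (x + 1)" "4 * x \<le> x * (x + 1) + 2" for x :: nat by (rule nat_quadratics)+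
      ultimately show "2 * z l + 2 * (z l * card (l \<inter> V)) \<le> z l * c l + 2 * card (l \<inter> V)" using c_HL[OF l] by auto
    qed
    then have "2 * Z + 2 * D \<le> Q + 2 * (\<Sum>l\<in>HL. card (l \<inter> V))"
      unfolding Z_def D_alt Q_def by (simp add: sum.distrib sum_distrib_left)
    then show ?thesis using vv(3) by simp
  qed
qed

lemma B_alt: "B = (\<Sum>l\<in>ZL. (c l - 1) * c l)"
proof -
  have "B = (\<Sum>l\<in>ZL. (c l - 1) * card (l \<inter> V))"
    unfolding B_def J_def using incidence_weight[OF _ sets(3), of V "\<lambda>l. c l - 1"] UgV NT by blast
  also have "\<dots> = (\<Sum>l\<in>ZL. (c l - 1) * c l)"
  proof (rule sum.cong[OF refl])
    fix l assume "l \<in> ZL"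
    then have "l \<inter> V = l" "l \<inter> N = l" using ZLV UgV by auto
    then show "(c l - 1) * card (l \<inter> V) = (c l - 1) * c l" unfolding c_def by simp
  qed
  finally show ?thesis .
qed

lemma cZ: "l \<in> ZL \<Longrightarrow> c l = card l"
proof -
  assume "l \<in> ZL"
  then have "l \<inter> N = l" using ZLV UgV by auto
  then show ?thesis unfolding c_def by simp
qed

lemma ZL_meet: "l \<in> ZL \<Longrightarrow> m \<in> ZL \<Longrightarrow> l \<noteq> m \<Longrightarrow> card (l \<inter> m) \<le> 1"
proof (rule ccontr)
  assume l: "l \<in> ZL" "m \<in> ZL" "l \<noteq> m" and "\<not> card (l \<inter> m) \<le> 1"
  then obtain x y where "x \<in> l \<inter> m" "y \<in> l \<inter> m" "x \<noteq> y" using two_of_card[of "l \<inter> m"] by auto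
  then show False using lines_unique[of l m x y] l sets(3) by auto
qed

text \<open>Lines missing \<open>H\<close> consist of points on two lines of \<open>H\<close>. There are at most seven of those, so there is at most one such
  line, unless two of them with four points each meet in a point.\<close>

lemma ZL_shape:
  assumes v7: "card V \<le> 7"
  shows "B = 0 \<or> card V = 7 \<and> B = 24 \<or> (\<exists>k. 4 \<le> k \<and> k \<le> card V \<and> B = k * (k - 1) \<and> (k = card V \<longrightarrow> D \<le> Z))"
proof (cases "card ZL \<le> 1")
  case le1: True
  show ?thesis
  proof (cases "ZL = {}")
    case True
    then show ?thesis unfolding B_alt by simp
  next
    case False
    then obtain l where l: "l \<in> ZL" by auto
    have ZL1: "ZL = {l}" by (rule card1_eq[OF sets(6) l le1])
    have lV: "l \<subseteq> V" using ZLV l by auto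
    have "D \<le> Z" if eq: "c l = card V"
    proof -
      have V: "l = V" using card_subset_eq[OF NUV(4) lV] eq cZ[OF l] by simp
      have "card (m \<inter> V) \<le> 1" if m: "m \<in> HL" for m
      proof (rule ccontr)
        assume "\<not> card (m \<inter> V) \<le> 1"
        then obtain x y where "x \<in> m \<inter> V" "y \<in> m \<inter> V" "x \<noteq> y" using two_of_card[of "m \<inter> V"] by auto
        then have "m = l" using HL_of[OF m, of x y l] l sets(3) V by auto
        then show False using l m types_disj by auto
      qed
      then show ?thesis unfolding D_alt Z_def by (intro sum_mono) auto
    qed
    moreover have "c l \<le> card V" using cZ[OF l] card_mono[OF NUV(4) lV] by simp
    moreover have "B = c l * (c l - 1)" unfolding B_alt ZL1 by (simp add: mult.commute)
    ultimately show ?thesis using c_ZL[OF l] by blast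
  qed
next
  case False
  then obtain l m where lm: "l \<in> ZL" "m \<in> ZL" "l \<noteq> m" using two_of_card[of ZL] by auto
  have f: "finite l" "finite m" using lm lines_fin sets(3) by auto
  have un: "card l + card m = card (l \<union> m) + card (l \<inter> m)" using card_Un_Int[OF f] .
  have "card (l \<union> m) \<le> card V" by (rule card_mono[OF NUV(4)]) (use ZLV lm in auto)
  then have c: "card l = 4" "card m = 4" "card (l \<union> m) = 7" "card V = 7"
    using un ZL_meet[OF lm] c_ZL[OF lm(1)] c_ZL[OF lm(2)] cZ lm v7 by auto
  have lmV: "l \<union> m = V" using card_subset_eq[OF NUV(4), of "l \<union> m"] ZLV lm c by auto
  have "ZL = {l, m}"
  proof (rule ccontr)
    assume "ZL \<noteq> {l, m}"
    then obtain k where k: "k \<in> ZL" "k \<noteq> l" "k \<noteq> m" using lm by auto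
    have "k = (k \<inter> l) \<union> (k \<inter> m)" using ZLV[OF k(1)] lmV by auto
    then have "card k \<le> card (k \<inter> l) + card (k \<inter> m)" using card_Un_le[of "k \<inter> l" "k \<inter> m"] by simp
    then show False using ZL_meet[OF k(1) lm(1) k(2)] ZL_meet[OF k(1) lm(2) k(3)] c_ZL[OF k(1)] cZ[OF k(1)] by simp
  qed
  then have "B = 24" unfolding B_alt using lm c cZ by simp
  then show ?thesis using c by simp
qed

lemma impossible: False
proof (rule small_plane_arith[OF m13(2) uv_sum tau_sum D_bounds(4) Q_sum V_sum G_bounds D_bounds(1) H_count D_bounds(2) D_bounds(3)])
  have "card V \<le> 7" using uv_sum m13(2) G_bounds(4) by linarith
  then show "B = 0 \<or> card V = 7 \<and> B = 24 \<or> (\<exists>k. 4 \<le> k \<and> k \<le> card V \<and> B = k * (k - 1) \<and> (k = card V \<longrightarrow> D \<le> Z))"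
    by (rule ZL_shape)
qed

end

context hesse begin

lemma thick_four_card:
  assumes "thick 4" "N \<noteq> {}"
  shows "25 \<le> card T"
proof (rule ccontr)
  assume "\<not> 25 \<le> card T"
  moreover have "card T = 9 + card N" using card_Diff_subset[OF finH HT] card_mono[OF fin HT] H9 unfolding N_def by simp
  ultimately have "card N \<le> 15" by simp
  then interpret hesse_small T L H p using assms by unfold_locales
  show False by (rule impossible)
qed


text \<open>If some line has only three points, all its weights are at least five. A point outside \<open>H\<close> on at most
  one line of \<open>H\<close> has degree at least seven; the weights around it suffice.\<close>

lemma weighted:
  fixes w :: "'p \<Rightarrow> nat"
  assumes w2: "\<And>x. x \<in> T \<Longrightarrow> 2 \<le> w x" and t3: "thick 3" and N: "N \<noteq> {}"
    and w5: "\<And>l x. l \<in> lines \<Longrightarrow> card l = 3 \<Longrightarrow> x \<in> l \<Longrightarrow> 5 \<le> w x"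
  shows "50 \<le> sum w T"
proof (cases "thick 4")
  case True
  then have "25 \<le> card T" using thick_four_card N by simp
  then show ?thesis using weight_ge[OF fin, of 2 w] w2 by simp
next
  case not4: False
  have wl: "2 * (card l - 1) \<le> sum w (l - {x})" if "l \<in> lines" "x \<in> l" for l x
  proof -
    have "2 * card (l - {x}) \<le> sum w (l - {x})"
      by (rule weight_ge) (use that lines_fin[OF that(1)] lines_sub[OF that(1)] w2 in auto)
    then show ?thesis using that(2) lines_fin[OF that(1)] by (simp add: card_Diff_singleton)
  qed
  have wl3: "10 \<le> sum w (l - {x})" if "l \<in> lines" "x \<in> l" "card l = 3" for l x
  proof -
    have "5 * card (l - {x}) \<le> sum w (l - {x})"
      by (rule weight_ge) (use that lines_fin[OF that(1)] w5 in auto)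
    then show ?thesis using that lines_fin[OF that(1)] by (simp add: card_Diff_singleton)
  qed
  have wl6: "6 \<le> sum w (l - {x})" if "l \<in> lines" "x \<in> l" for l x
    using wl[OF that] wl3[OF that] thickD[OF t3 that(1)] by (cases "card l = 3") auto
  obtain x where x: "x \<in> N" "tau x \<noteq> 2"
  proof -
    obtain v where v: "v \<in> N" using N by auto
    show ?thesis
    proof (cases "tau v = 2")
      case True
      then have "gg v = 3" using nine[OF v] by simp
      then have "{l \<in> GL. v \<in> l} \<noteq> {}" unfolding gg_def by (metis card.empty zero_neq_numeral)
      then obtain l where l: "l \<in> GL" "v \<in> l" by auto
      have ll: "l \<in> lines" "3 \<le> card l" using l sets thickD[OF t3] by auto
      have "card (l \<inter> H) = 1" using l unfolding GL_def by auto
      then have "2 \<le> card (l - H)" using card_Diff_subset_Int[of l H] ll lines_fin[OF ll(1)] by simp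
      then obtain u where "u \<in> l - H" "u \<noteq> v" using another_element[of "l - H" v] by blast
      then have u: "u \<in> l" "u \<in> N" "u \<noteq> v" using lines_sub[OF ll(1)] unfolding N_def by auto
      have "tau u \<noteq> 2" using one_vertex[OF v True u(2) _ l u(1)] u(3) by auto
      then show ?thesis using that u(2) by blast
    qed (use v that in auto)
  qed
  have xT: "x \<in> T" using x N_def by auto
  have t: "tau x = 0 \<or> tau x = 1" using tau_le2[OF x(1)] x(2) by linarith
  have dg: "deg x = tau x + gg x + jj x"
    using pen_split[OF xT, of "\<lambda>_. 1"] unfolding deg_def tau_def gg_def jj_def by simp
  have star: "w x + deg x * 6 \<le> sum w T"
    by (rule weight_star[OF xT]) (use wl6 pen_lines[OF xT] in auto)
  show ?thesis
  proof (cases "tau x = 0")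
    case True
    then have "9 \<le> deg x" using dg nine[OF x(1)] by simp
    then show ?thesis using star w2[OF xT] by simp
  next
    case False
    then have t1: "tau x = 1" "gg x = 6" using t nine[OF x(1)] by auto
    then have d7: "7 \<le> deg x" using dg by simp
    show ?thesis
    proof (cases "\<exists>l\<in>pen x. card l = 3")
      case True
      then obtain l where l: "l \<in> pen x" "card l = 3" by blast
      then have ll: "l \<in> lines" "x \<in> l" using pen_lines[OF xT] by auto
      have "sum w T = w x + (\<Sum>l\<in>pen x. sum w (l - {x}))" using sum.remove[OF fin xT] sum_pen[OF xT] by metis
      also have "(\<Sum>l\<in>pen x. sum w (l - {x})) = sum w (l - {x}) + (\<Sum>l\<in>pen x - {l}. sum w (l - {x}))"
        by (rule sum.remove[OF fin_pen l(1)])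
      finally have e: "sum w T = w x + (sum w (l - {x}) + (\<Sum>l\<in>pen x - {l}. sum w (l - {x})))" .
      have "6 * card (pen x - {l}) \<le> (\<Sum>l\<in>pen x - {l}. sum w (l - {x}))"
        by (rule weight_ge[OF finite_Diff[OF fin_pen]]) (use wl6 pen_lines[OF xT] in auto)
      moreover have "card (pen x - {l}) \<ge> 6" using l d7 fin_pen unfolding deg_def by (simp add: card_Diff_singleton)
      ultimately show ?thesis using e wl3[OF ll l(2)] w5[OF ll(1) l(2) ll(2)] by linarith
    next
      case no3: False
      have "card T \<ge> 1 + 3 * deg x"
      proof (rule card_ge_deg[OF xT])
        fix l assume l: "l \<in> pen x"
        then have "3 \<le> card l" "card l \<noteq> 3" using thickD[OF t3] pen_lines[OF xT] no3 by auto
        then show "3 + 1 \<le> card l" by simp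
      qed
      then have T22: "22 \<le> card T" using d7 by simp
      obtain a b where ab: "a \<in> T" "b \<in> T" "a \<noteq> b" "\<not> 4 \<le> card (L a b)" using not4 unfolding thick_def by blast
      note l = L_lines[OF ab(1-3)]
      have c3: "card (L a b) = 3" using ab(4) thickD[OF t3 l] by simp
      have "sum w T = sum w (T - L a b) + sum w (L a b)" by (rule sum.subset_diff[OF lines_sub[OF l] fin])
      moreover have "5 * card (L a b) \<le> sum w (L a b)" by (rule weight_ge[OF lines_fin[OF l]]) (use w5[OF l c3] in auto)
      moreover have "2 * card (T - L a b) \<le> sum w (T - L a b)" by (rule weight_ge) (use fin w2 in auto)
      moreover have "card (T - L a b) \<ge> 19" using T22 c3 lines_sub[OF l] lines_fin[OF l] by (simp add: card_Diff_subset)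
      ultimately show ?thesis using c3 by linarith
    qed
  qed
qed

end

section \<open>Planes and quotients in space\<close>

lemma desarguesian_mono:
  assumes "desarguesian p T L" "T' \<subseteq> T"
  shows "desarguesian p T' L"
proof -
  have f: "fano_prop p T L" and c: "concurrent_prop p T L" and q: "perspective_prop p T L"
    using assms(1) unfolding desarguesian_def by auto
  have "fano_prop p T' L"
    unfolding fano_prop_def
    by (intro ballI) (rule f[unfolded fano_prop_def, THEN bspec, THEN bspec, THEN bspec, THEN bspec, THEN bspec, THEN bspec, THEN bspec]; erule subsetD[OF assms(2)])
  moreover have "concurrent_prop p T' L"
    unfolding concurrent_prop_def
  proof (intro ballI allI impI)
    fix q a b c A B C
    assume h: "q \<in> T'" "a \<in> T' - {q}" "b \<in> T' - {q}" "c \<in> T' - {q}" "L q a \<noteq> L q b" "L q a \<noteq> L q c" "L q b \<noteq> L q c"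
      "A \<subseteq> L q a - {q}" "B \<subseteq> L q b - {q}" "C \<subseteq> L q c - {q}" "A \<noteq> {}" "2 \<le> card B"
      "\<forall>x\<in>A. \<forall>y\<in>B. \<exists>z\<in>C. z \<in> L x y" "\<forall>y\<in>B. \<forall>z\<in>C. \<exists>x\<in>A. x \<in> L y z"
    have m: "q \<in> T" "a \<in> T - {q}" "b \<in> T - {q}" "c \<in> T - {q}" using h(1-4) assms(2) by auto
    show "p \<noteq> 0 \<and> p \<le> card A"
      by (rule concurrentD[OF c m h(5-12)]) (use bspec[OF bspec[OF h(13)]] bspec[OF bspec[OF h(14)]] in simp_all)
  qed
  moreover have "perspective_prop p T' L"
    unfolding perspective_prop_def
  proof (intro ballI allI impI)
    fix a1 a2 b1 b2 A B
    assume h: "a1 \<in> T'" "a2 \<in> T'" "b1 \<in> T'" "b2 \<in> T'" "a1 \<noteq> a2" "b1 \<noteq> b2" "A \<subseteq> L a1 a2" "B \<subseteq> L b1 b2" "card A = 4" "card B = 4"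
      "L a1 a2 \<inter> B = {}" "L b1 b2 \<inter> A = {}"
      and e: "\<forall>a\<in>A. \<exists>b\<in>B. \<exists>x\<in>T' - L a1 a2 - L b1 b2. \<exists>y\<in>T' - L a1 a2 - L b1 b2. x \<noteq> y \<and> x \<in> L a b \<and> y \<in> L a b \<and>
            (\<forall>u\<in>A. \<exists>v\<in>B. v \<in> L x u) \<and> (\<forall>u\<in>A. \<exists>v\<in>B. v \<in> L y u)"
    have "\<forall>a\<in>A. \<exists>b\<in>B. \<exists>x\<in>T - L a1 a2 - L b1 b2. \<exists>y\<in>T - L a1 a2 - L b1 b2. x \<noteq> y \<and> x \<in> L a b \<and> y \<in> L a b \<and>
            (\<forall>u\<in>A. \<exists>v\<in>B. v \<in> L x u) \<and> (\<forall>u\<in>A. \<exists>v\<in>B. v \<in> L y u)"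
    proof
      fix a assume "a \<in> A"
      from bspec[OF e this] obtain b where b: "b \<in> B" "\<exists>x\<in>T' - L a1 a2 - L b1 b2. \<exists>y\<in>T' - L a1 a2 - L b1 b2. x \<noteq> y \<and> x \<in> L a b \<and> y \<in> L a b \<and>
            (\<forall>u\<in>A. \<exists>v\<in>B. v \<in> L x u) \<and> (\<forall>u\<in>A. \<exists>v\<in>B. v \<in> L y u)" by (rule bexE)
      from b(2) obtain x where x: "x \<in> T' - L a1 a2 - L b1 b2" "\<exists>y\<in>T' - L a1 a2 - L b1 b2. x \<noteq> y \<and> x \<in> L a b \<and> y \<in> L a b \<and>
            (\<forall>u\<in>A. \<exists>v\<in>B. v \<in> L x u) \<and> (\<forall>u\<in>A. \<exists>v\<in>B. v \<in> L y u)" by (rule bexE)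
      from x(2) obtain y where y: "y \<in> T' - L a1 a2 - L b1 b2" "x \<noteq> y \<and> x \<in> L a b \<and> y \<in> L a b \<and>
            (\<forall>u\<in>A. \<exists>v\<in>B. v \<in> L x u) \<and> (\<forall>u\<in>A. \<exists>v\<in>B. v \<in> L y u)" by (rule bexE)
      have m: "x \<in> T - L a1 a2 - L b1 b2" "y \<in> T - L a1 a2 - L b1 b2" using x(1) y(1) assms(2) by auto
      show "\<exists>b\<in>B. \<exists>x\<in>T - L a1 a2 - L b1 b2. \<exists>y\<in>T - L a1 a2 - L b1 b2. x \<noteq> y \<and> x \<in> L a b \<and> y \<in> L a b \<and>
            (\<forall>u\<in>A. \<exists>v\<in>B. v \<in> L x u) \<and> (\<forall>u\<in>A. \<exists>v\<in>B. v \<in> L y u)"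
        by (rule bexI[of _ b], rule bexI[of _ x], rule bexI[of _ y]) (fact y(2) m b(1))+
    qed
    moreover have "a1 \<in> T" "a2 \<in> T" "b1 \<in> T" "b2 \<in> T" using h assms(2) by auto
    ultimately show "p = 2"
      using q[unfolded perspective_prop_def, THEN bspec, of a1, THEN bspec, of a2, THEN bspec, of b1, THEN bspec, of b2, THEN spec, of A, THEN spec, of B]
        h(5-12) by simp
  qed
  ultimately show ?thesis using assms(1) unfolding desarguesian_def by simp
qed

text \<open>The lines of the quotient at \<open>P\<close> are the pencils of \<open>P\<close> in the planes through it. The quotient is written with a
  choice of representatives, as its lines have to be a function of two lines through \<open>P\<close>.\<close>

locale space3 = chromatic S L Red Blue p for S :: "'p set" and L Red Blue p +
  fixes Pl :: "'p \<Rightarrow> 'p \<Rightarrow> 'p \<Rightarrow> 'p set"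
  assumes Pl_sub: "Pl a b c \<subseteq> S"
    and Pl_mem: "\<lbrakk>a \<in> S; b \<in> S; c \<in> S; a \<noteq> b; c \<notin> L a b\<rbrakk> \<Longrightarrow> a \<in> Pl a b c \<and> b \<in> Pl a b c \<and> c \<in> Pl a b c"
    and Pl_closed: "\<lbrakk>a \<in> S; b \<in> S; c \<in> S; a \<noteq> b; c \<notin> L a b; x \<in> Pl a b c; y \<in> Pl a b c; x \<noteq> y\<rbrakk> \<Longrightarrow> L x y \<subseteq> Pl a b c"
    and Pl_eq: "\<lbrakk>a \<in> S; b \<in> S; c \<in> S; a \<noteq> b; c \<notin> L a b; x \<in> Pl a b c; y \<in> Pl a b c; z \<in> Pl a b c; x \<noteq> y; z \<notin> L x y\<rbrakk>
      \<Longrightarrow> Pl x y z = Pl a b c"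
    and dim: "\<lbrakk>a \<in> S; b \<in> S; c \<in> S; a \<noteq> b; c \<notin> L a b\<rbrakk> \<Longrightarrow> \<exists>d\<in>S. d \<notin> Pl a b c"
    and nt: nontriv
    and desQ: "P \<in> S \<Longrightarrow> desarguesian p (pencil S L P)
        (\<lambda>X Y. L P ` (Pl P (SOME x. x \<in> X - {P}) (SOME y. y \<in> Y - {P}) - {P}))"
begin

definition plane :: "'p set \<Rightarrow> bool" where
  "plane \<pi> \<longleftrightarrow> (\<exists>a\<in>S. \<exists>b\<in>S. \<exists>c\<in>S. a \<noteq> b \<and> c \<notin> L a b \<and> \<pi> = Pl a b c)"

lemma plane_sub: "plane \<pi> \<Longrightarrow> \<pi> \<subseteq> S"
  unfolding plane_def using Pl_sub by blast

lemma plane_closed: "plane \<pi> \<Longrightarrow> x \<in> \<pi> \<Longrightarrow> y \<in> \<pi> \<Longrightarrow> x \<noteq> y \<Longrightarrow> L x y \<subseteq> \<pi>"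
  unfolding plane_def using Pl_closed by blast

lemma plane_eq: "plane \<pi> \<Longrightarrow> x \<in> \<pi> \<Longrightarrow> y \<in> \<pi> \<Longrightarrow> z \<in> \<pi> \<Longrightarrow> x \<noteq> y \<Longrightarrow> z \<notin> L x y \<Longrightarrow> \<pi> = Pl x y z"
  unfolding plane_def using Pl_eq by blast

lemma planeI: "a \<in> S \<Longrightarrow> b \<in> S \<Longrightarrow> c \<in> S \<Longrightarrow> a \<noteq> b \<Longrightarrow> c \<notin> L a b \<Longrightarrow> plane (Pl a b c)"
  unfolding plane_def by blast

lemma plane_ex3: "plane \<pi> \<Longrightarrow> \<exists>a\<in>\<pi>. \<exists>b\<in>\<pi>. \<exists>c\<in>\<pi>. a \<noteq> b \<and> c \<notin> L a b"
  unfolding plane_def using Pl_mem by blast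

lemma plane_outside: "plane \<pi> \<Longrightarrow> \<exists>d\<in>S. d \<notin> \<pi>"
  unfolding plane_def using dim by blast

lemma plane_chromatic:
  assumes "plane \<pi>"
  shows "chromatic \<pi> L (Red \<inter> \<pi>) (Blue \<inter> \<pi>) p" "linspace.nontriv \<pi> L"
proof -
  note sub = plane_sub[OF assms]
  note cl = plane_closed[OF assms]
  show ch: "chromatic \<pi> L (Red \<inter> \<pi>) (Blue \<inter> \<pi>) p"
  proof (unfold_locales)
    show "finite \<pi>" using sub fin finite_subset by blast
    show "L x y \<subseteq> \<pi>" if "x \<in> \<pi>" "y \<in> \<pi>" "x \<noteq> y" for x y using cl[OF that] .
    show "x \<in> L x y" "y \<in> L x y" if "x \<in> \<pi>" "y \<in> \<pi>" "x \<noteq> y" for x y using L_l[of x y] L_r[of x y] that sub by auto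
    show "L u v = L x y" if "x \<in> \<pi>" "y \<in> \<pi>" "x \<noteq> y" "u \<in> L x y" "v \<in> L x y" "u \<noteq> v" for x y u v
      using L_eq[of x y u v] that sub by auto
    show "\<pi> = Red \<inter> \<pi> \<union> Blue \<inter> \<pi>" using sub col by auto
    show "\<exists>z\<in>Red \<inter> \<pi>. z \<noteq> x \<and> z \<noteq> y \<and> z \<in> L x y" if "x \<in> Blue \<inter> \<pi>" "y \<in> Blue \<inter> \<pi>" "x \<noteq> y" for x y
      using bb[of x y] cl[of x y] that by blast
    show "\<exists>z\<in>Blue \<inter> \<pi>. z \<noteq> x \<and> z \<noteq> y \<and> z \<in> L x y" if "x \<in> Red \<inter> \<pi>" "y \<in> Red \<inter> \<pi>" "x \<noteq> y" for x y
      using rr[of x y] cl[of x y] that by blast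
    show "desarguesian p \<pi> L" by (rule desarguesian_mono[OF des sub])
  qed
  interpret c: chromatic \<pi> L "Red \<inter> \<pi>" "Blue \<inter> \<pi>" p by (rule ch)
  show "linspace.nontriv \<pi> L" unfolding c.nontriv_def using plane_ex3[OF assms] by blast
qed

lemma swap3: "space3 S L Blue Red p Pl"
proof -
  interpret s: chromatic S L Blue Red p by (rule swap)
  show ?thesis by unfold_locales (fact Pl_sub Pl_mem Pl_closed Pl_eq dim nt desQ)+
qed

lemma purple_lines: "q \<in> Red \<Longrightarrow> q \<in> Blue \<Longrightarrow> l \<in> pen q \<Longrightarrow> 3 \<le> card l"
  by (rule purple_pencil_ge3)

end

locale pointed = space3 S L Red Blue p Pl for S :: "'p set" and L Red Blue p Pl +
  fixes P :: 'p
  assumes PS: "P \<in> S"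
begin

abbreviation "TQ \<equiv> pencil S L P"
definition "LQ X Y = L P ` (Pl P (SOME x. x \<in> X - {P}) (SOME y. y \<in> Y - {P}) - {P})"
definition "w X = card X - 1"

lemma TQ_ex: "X \<in> TQ \<Longrightarrow> \<exists>x\<in>S. x \<noteq> P \<and> X = L P x"
  using pen_ex by blast

lemma TQ_I: "x \<in> S \<Longrightarrow> x \<noteq> P \<Longrightarrow> L P x \<in> TQ"
  using pen_memI[OF PS] by metis

lemma TQ_lines: "X \<in> TQ \<Longrightarrow> X \<in> lines \<and> P \<in> X \<and> finite X \<and> X \<subseteq> S"
  using pen_lines[OF PS] lines_fin lines_sub by auto

lemma TQ_of: "X \<in> TQ \<Longrightarrow> x \<in> X \<Longrightarrow> x \<noteq> P \<Longrightarrow> L P x = X"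
  using lines_L[of X P x] TQ_lines by auto

lemma TQ_disj: "X \<in> TQ \<Longrightarrow> Y \<in> TQ \<Longrightarrow> X \<noteq> Y \<Longrightarrow> X \<inter> Y = {P}"
  using pen_disj[OF PS, of X Y] TQ_lines by auto

lemma LQ_plane:
  assumes XY: "X \<in> TQ" "Y \<in> TQ" "X \<noteq> Y" and x: "x \<in> X" "x \<noteq> P" and y: "y \<in> Y" "y \<noteq> P"
  shows "plane (Pl P x y)" "LQ X Y = L P ` (Pl P x y - {P})" "x \<in> Pl P x y" "y \<in> Pl P x y" "P \<in> Pl P x y" "y \<notin> L P x"
proof -
  have ind: "x' \<in> S \<and> y' \<in> S \<and> y' \<notin> L P x'" if "x' \<in> X - {P}" "y' \<in> Y - {P}" for x' y'
    using that TQ_lines[OF XY(1)] TQ_lines[OF XY(2)] TQ_of[OF XY(1), of x'] TQ_disj[OF XY] by auto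
  have e: "x \<in> S" "y \<in> S" "y \<notin> L P x" using ind[of x y] x y by auto
  show "y \<notin> L P x" by (rule e(3))
  show pl: "plane (Pl P x y)" using planeI[OF PS e(1,2) _ e(3)] x by auto
  show m: "x \<in> Pl P x y" "y \<in> Pl P x y" "P \<in> Pl P x y" using Pl_mem[OF PS e(1,2) _ e(3)] x by auto
  define x' where "x' = (SOME x. x \<in> X - {P})"
  define y' where "y' = (SOME y. y \<in> Y - {P})"
  have x': "x' \<in> X - {P}" unfolding x'_def by (rule someI[of _ x]) (use x in auto)
  have y': "y' \<in> Y - {P}" unfolding y'_def by (rule someI[of _ y]) (use y in auto)
  note e' = ind[OF x' y']
  have "x' \<in> L P x" "y' \<in> L P y" using TQ_of[OF XY(1) x] TQ_of[OF XY(2) y] x' y' by auto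
  then have "x' \<in> Pl P x y" "y' \<in> Pl P x y"
    using plane_closed[OF pl m(3) m(1)] plane_closed[OF pl m(3) m(2)] x y by auto
  then have "Pl P x y = Pl P x' y'" using plane_eq[OF pl m(3), of x' y'] x' y' e' by auto
  then show "LQ X Y = L P ` (Pl P x y - {P})" unfolding LQ_def x'_def y'_def by simp
qed

lemma LQ_at:
  assumes "X \<in> TQ" "Y \<in> TQ" "X \<noteq> Y"
  obtains x y where "x \<in> X" "x \<noteq> P" "y \<in> Y" "y \<noteq> P" "X = L P x" "Y = L P y"
    "plane (Pl P x y)" "LQ X Y = L P ` (Pl P x y - {P})" "x \<in> Pl P x y" "y \<in> Pl P x y" "P \<in> Pl P x y" "y \<notin> L P x"
proof -
  obtain x where x: "x \<in> S" "x \<noteq> P" "X = L P x" using TQ_ex assms by blast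
  obtain y where y: "y \<in> S" "y \<noteq> P" "Y = L P y" using TQ_ex assms by blast
  have "x \<in> X" "y \<in> Y" using L_r[OF PS x(1)] L_r[OF PS y(1)] x y by auto
  then show ?thesis using that[of x y] LQ_plane[OF assms _ x(2) _ y(2)] x y by blast
qed

sublocale q: linspace TQ LQ
proof (unfold_locales)
  show "finite TQ" using fin_pen by simp
  fix X Y assume XY: "X \<in> TQ" "Y \<in> TQ" "X \<noteq> Y"
  obtain x y where xy: "x \<in> X" "x \<noteq> P" "y \<in> Y" "y \<noteq> P" "X = L P x" "Y = L P y"
    "plane (Pl P x y)" "LQ X Y = L P ` (Pl P x y - {P})" "x \<in> Pl P x y" "y \<in> Pl P x y" "P \<in> Pl P x y" "y \<notin> L P x"
    using LQ_at[OF XY] by metis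
  show "LQ X Y \<subseteq> TQ" unfolding xy(8) using TQ_I plane_sub[OF xy(7)] by auto
  show "X \<in> LQ X Y" "Y \<in> LQ X Y" unfolding xy(8) using xy by auto
  fix U V assume U: "U \<in> LQ X Y" and V: "V \<in> LQ X Y" and UV: "U \<noteq> V"
  obtain u v where u: "u \<in> Pl P x y - {P}" "U = L P u" and v: "v \<in> Pl P x y - {P}" "V = L P v"
    using U V unfolding xy(8) by auto
  have uS: "u \<in> S" "v \<in> S" "u \<noteq> P" "v \<noteq> P" using u v plane_sub[OF xy(7)] by auto
  have T: "U \<in> TQ" "V \<in> TQ" "u \<in> U" "v \<in> V" using u v uS TQ_I L_r[OF PS uS(1)] L_r[OF PS uS(2)] by auto
  note l = LQ_plane[OF T(1,2) UV T(3) uS(3) T(4) uS(4)]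
  have "Pl P x y = Pl P u v" using plane_eq[OF xy(7,11), of u v] u v l(6) by auto
  then show "LQ U V = LQ X Y" using l(2) xy(8) by simp
qed

lemma desq: "desarguesian p TQ LQ"
  using desQ[OF PS] unfolding LQ_def .

lemma plane_pencil: "plane \<pi> \<Longrightarrow> P \<in> \<pi> \<Longrightarrow> pencil \<pi> L P \<in> q.lines"
proof -
  assume pl: "plane \<pi>" and P: "P \<in> \<pi>"
  interpret c: chromatic \<pi> L "Red \<inter> \<pi>" "Blue \<inter> \<pi>" p by (rule plane_chromatic(1)[OF pl])
  have "\<exists>l m. l \<in> c.pen P \<and> m \<in> c.pen P \<and> l \<noteq> m"
    using c.two_pencil_lines[OF P plane_chromatic(2)[OF pl]] by blast
  then obtain x y where xy: "x \<in> \<pi>" "x \<noteq> P" "y \<in> \<pi>" "y \<noteq> P" "L P x \<noteq> L P y" unfolding pencil_def by auto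
  have S: "x \<in> S" "y \<in> S" using xy plane_sub[OF pl] by auto
  note T = TQ_I[OF S(1) xy(2)] TQ_I[OF S(2) xy(4)]
  note l = LQ_plane[OF T xy(5) L_r[OF PS S(1) xy(2)[symmetric]] xy(2) L_r[OF PS S(2) xy(4)[symmetric]] xy(4)]
  have "\<pi> = Pl P x y" using plane_eq[OF pl P xy(1,3) xy(2)[symmetric] l(6)] .
  then have "LQ (L P x) (L P y) = pencil \<pi> L P" using l(2) unfolding pencil_def by simp
  then show ?thesis using q.L_lines[OF T xy(5)] by simp
qed

lemma q_line:
  assumes "k \<in> q.lines"
  obtains \<pi> where "plane \<pi>" "P \<in> \<pi>" "k = pencil \<pi> L P"
proof -
  obtain X Y where XY: "X \<in> TQ" "Y \<in> TQ" "X \<noteq> Y" "k = LQ X Y" using assms unfolding q.lines_def by blast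
  show ?thesis using LQ_at[OF XY(1-3)] that XY(4) unfolding pencil_def by metis
qed

lemma in_pencil: "plane \<pi> \<Longrightarrow> P \<in> \<pi> \<Longrightarrow> x \<in> S \<Longrightarrow> x \<noteq> P \<Longrightarrow> L P x \<in> pencil \<pi> L P \<longleftrightarrow> x \<in> \<pi>"
proof
  assume pl: "plane \<pi>" "P \<in> \<pi>" and x: "x \<in> S" "x \<noteq> P"
  show "x \<in> \<pi> \<Longrightarrow> L P x \<in> pencil \<pi> L P" unfolding pencil_def using x by auto
  assume "L P x \<in> pencil \<pi> L P"
  then obtain y where "y \<in> \<pi>" "y \<noteq> P" "L P x = L P y" unfolding pencil_def by auto
  then show "x \<in> \<pi>" using L_r[OF PS x(1)] x plane_closed[OF pl] by auto
qed

lemma q_nontriv: q.nontriv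
proof -
  obtain l m where lm: "l \<in> pen P" "m \<in> pen P" "l \<noteq> m" using two_pencil_lines[OF PS nt] by blast
  obtain x y where xy: "x \<in> l" "x \<noteq> P" "y \<in> m" "y \<noteq> P" "l = L P x" "m = L P y"
    "plane (Pl P x y)" "LQ l m = L P ` (Pl P x y - {P})" "x \<in> Pl P x y" "y \<in> Pl P x y" "P \<in> Pl P x y" "y \<notin> L P x"
    using LQ_at[OF lm] by metis
  obtain d where d: "d \<in> S" "d \<notin> Pl P x y" using plane_outside[OF xy(7)] by blast
  have dP: "d \<noteq> P" using d xy by auto
  have "L P d \<notin> LQ l m" using in_pencil[OF xy(7,11) d(1) dP] d(2) unfolding xy(8) pencil_def by simp
  then show ?thesis unfolding q.nontriv_def using lm TQ_I[OF d(1) dP] by blast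
qed

lemma q_ex2: "\<exists>X\<in>TQ. \<exists>Y\<in>TQ. X \<noteq> Y"
  using q_nontriv unfolding q.nontriv_def by blast

lemma sum_w_plane: "plane \<pi> \<Longrightarrow> P \<in> \<pi> \<Longrightarrow> sum w (pencil \<pi> L P) = card \<pi> - 1"
proof -
  assume pl: "plane \<pi>" and P: "P \<in> \<pi>"
  interpret c: chromatic \<pi> L "Red \<inter> \<pi>" "Blue \<inter> \<pi>" p by (rule plane_chromatic(1)[OF pl])
  show ?thesis using c.card_pen[OF P] unfolding w_def by simp
qed

lemma thick3: "q.thick 3"
  unfolding q.thick_def
proof (intro ballI impI)
  fix X Y assume "X \<in> TQ" "Y \<in> TQ" "X \<noteq> Y"
  then have "LQ X Y \<in> q.lines" by (rule q.L_lines)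
  then obtain \<pi> where pi: "plane \<pi>" "P \<in> \<pi>" "LQ X Y = pencil \<pi> L P" by (rule q_line)
  interpret c: chromatic \<pi> L "Red \<inter> \<pi>" "Blue \<inter> \<pi>" p by (rule plane_chromatic(1)[OF pi(1)])
  show "3 \<le> card (LQ X Y)" using c.deg_ge3[OF pi(2) plane_chromatic(2)[OF pi(1)]] unfolding pi(3) c.deg_def .
qed

lemma three_line:
  assumes "k \<in> q.lines" "card k = 3"
  shows "\<exists>m\<ge>2. (\<forall>X\<in>k. card X = m + 1 \<and> X - {P} \<subseteq> Red \<inter> Blue) \<and> p \<noteq> 0 \<and> p \<le> m"
proof -
  obtain \<pi> where pi: "plane \<pi>" "P \<in> \<pi>" "k = pencil \<pi> L P" using assms(1) by (rule q_line)
  interpret c: chromatic \<pi> L "Red \<inter> \<pi>" "Blue \<inter> \<pi>" p by (rule plane_chromatic(1)[OF pi(1)])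
  have "c.deg P = 3" using assms(2) unfolding pi(3) c.deg_def .
  from c.degree_three(1)[OF pi(2) plane_chromatic(2)[OF pi(1)] this]
  obtain m where m: "2 \<le> m" "\<forall>l\<in>c.pen P. card l = m + 1 \<and> l - {P} \<subseteq> Red \<inter> \<pi> \<inter> (Blue \<inter> \<pi>)" "p \<noteq> 0" "p \<le> m" by blast
  show ?thesis unfolding pi(3) by (rule exI[of _ m]) (use m in auto)
qed

end

context pointed begin

lemma red_meets_blue: "P \<in> Red \<Longrightarrow> X \<in> TQ \<Longrightarrow> \<exists>z\<in>X - {P}. z \<in> Blue"
  using red_pencil_blue[of P X] by blast

text \<open>Without purple points, project from a blue point and weigh every line by its red points.\<close>

lemma unicoloured_red_count:
  assumes disj: "Red \<inter> Blue = {}" and PB: "P \<in> Blue"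
  shows "21 \<le> card Red" "p \<noteq> 2 \<Longrightarrow> p \<noteq> 3 \<Longrightarrow> 26 \<le> card Red"
proof -
  define r where "r X = card (X \<inter> Red)" for X
  have PnR: "P \<notin> Red" using disj PB by auto
  have finR: "finite Red" using fin col by auto
  have thick4: "q.thick 4"
    unfolding q.thick_def
  proof (intro ballI impI)
    fix X Y assume "X \<in> TQ" "Y \<in> TQ" "X \<noteq> Y"
    then have "LQ X Y \<in> q.lines" by (rule q.L_lines)
    then obtain \<pi> where pi: "plane \<pi>" "P \<in> \<pi>" "LQ X Y = pencil \<pi> L P" by (rule q_line)
    interpret c: chromatic \<pi> L "Red \<inter> \<pi>" "Blue \<inter> \<pi>" p by (rule plane_chromatic(1)[OF pi(1)])
    show "4 \<le> card (LQ X Y)" using c.unicoloured_deg_ge4[OF _ plane_chromatic(2)[OF pi(1)] pi(2)] disj unfolding pi(3) c.deg_def by blast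
  qed
  have r1: "1 \<le> r X" if X: "X \<in> TQ" for X
  proof -
    have "\<exists>z\<in>X - {P}. z \<in> Red" using chromatic.red_pencil_blue[OF swap PB X] by blast
    then have "X \<inter> Red \<noteq> {}" by auto
    then show ?thesis using finR unfolding r_def by (simp add: Suc_leI card_gt_0_iff)
  qed
  have rl: "6 \<le> sum r k" if k: "k \<in> q.lines" for k
  proof -
    obtain \<pi> where pi: "plane \<pi>" "P \<in> \<pi>" "k = pencil \<pi> L P" using k by (rule q_line)
    interpret c: chromatic \<pi> L "Red \<inter> \<pi>" "Blue \<inter> \<pi>" p by (rule plane_chromatic(1)[OF pi(1)])
    have ne: "l \<inter> (Red \<inter> \<pi>) - {P} = l \<inter> Red" if "l \<in> c.pen P" for l
      using PnR c.pen_lines[OF pi(2)] c.lines_sub that by auto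
    have "6 \<le> card (Red \<inter> \<pi>)" using c.unicoloured_red_ge6[OF _ plane_chromatic(2)[OF pi(1)]] disj by blast
    also have "Red \<inter> \<pi> = Red \<inter> \<pi> - {P}" using PnR by auto
    also have "card \<dots> = (\<Sum>l\<in>c.pen P. card (l \<inter> (Red \<inter> \<pi>) - {P}))" by (rule c.pen_count[OF pi(2)]) simp
    also have "\<dots> = sum r k" unfolding pi(3) r_def by (rule sum.cong[OF refl]) (simp only: ne)
    finally show ?thesis .
  qed
  have sumr: "sum r TQ = card Red"
  proof -
    have "card (Red - {P}) = (\<Sum>l\<in>TQ. card (l \<inter> Red - {P}))" by (rule pen_count[OF PS]) (use col in auto)
    moreover have "Red - {P} = Red" "l \<inter> Red - {P} = l \<inter> Red" for l using PnR by auto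
    ultimately show ?thesis unfolding r_def by simp
  qed
  have star: "1 + 5 * q.deg X \<le> card Red" if X: "X \<in> TQ" "r X = 1" for X
  proof -
    have "r X + q.deg X * 5 \<le> sum r TQ"
    proof (rule q.weight_star[OF X(1)])
      fix k assume "k \<in> q.pen X"
      then have k: "k \<in> q.lines" "X \<in> k" using q.pen_lines[OF X(1)] by auto
      then show "5 \<le> sum r (k - {X})" using rl[OF k(1)] X(2) sum.remove[OF q.lines_fin[OF k(1)] k(2), of r] by simp
    qed
    then show ?thesis using X sumr by simp
  qed
  have d4: "4 \<le> q.deg X" if "X \<in> TQ" for X using q.deg_ge[OF thick4 q_nontriv that] .
  obtain X0 Y0 where X0: "X0 \<in> TQ" "Y0 \<in> TQ" "X0 \<noteq> Y0" using q_ex2 by blast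
  have U: "1 + k * q.deg X \<le> card TQ" if "X \<in> TQ" "\<And>l. l \<in> q.pen X \<Longrightarrow> k + 1 \<le> card l" for X k
    using q.card_ge_deg[OF that] .
  have U3: "1 + 3 * q.deg X \<le> card TQ" if X: "X \<in> TQ" for X
  proof (rule U[OF X])
    fix l assume "l \<in> q.pen X"
    then show "3 + 1 \<le> card l" using q.thickD[OF thick4, of l] q.pen_lines[OF X] by simp
  qed
  have heavy: "26 \<le> card Red" if "\<And>X. X \<in> TQ \<Longrightarrow> r X \<noteq> 1"
  proof -
    have "2 * card TQ \<le> sum r TQ" by (rule weight_ge[OF q.fin]) (use r1 that in force)
    then show ?thesis using sumr U3[OF X0(1)] d4[OF X0(1)] by simp
  qed
  show "21 \<le> card Red"
  proof (cases "\<exists>X\<in>TQ. r X = 1")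
    case True
    then obtain X where X: "X \<in> TQ" "r X = 1" by blast
    show ?thesis using star[OF X] d4[OF X(1)] by simp
  next
    case False
    have "26 \<le> card Red" by (rule heavy) (use False in blast)
    then show ?thesis by simp
  qed
  show "26 \<le> card Red" if p23: "p \<noteq> 2" "p \<noteq> 3"
  proof (cases "\<exists>X\<in>TQ. r X = 1")
    case True
    then obtain X where X: "X \<in> TQ" "r X = 1" by blast
    show ?thesis
    proof (cases "q.deg X = 4")
      case False
      then show ?thesis using star[OF X] d4[OF X(1)] by simp
    next
      case deg4: True
      have six: "6 \<le> card l" if l: "l \<in> q.pen X" for l
      proof -
        have "p \<noteq> 0 \<and> p + 1 \<le> card l" by (rule q.tight_degree_char[OF X(1) _ _ l desq]) (use thick4 deg4 in auto)
        moreover have "p \<noteq> 1" "p \<noteq> 4" using desq unfolding desarguesian_def by auto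
        ultimately show ?thesis using p23 by linarith
      qed
      have U21: "21 \<le> card TQ" using U[OF X(1), of 5] six deg4 by simp
      show ?thesis
      proof (cases "\<exists>Y\<in>TQ. Y \<noteq> X \<and> r Y = 1")
        case True
        then obtain Y where Y: "Y \<in> TQ" "Y \<noteq> X" "r Y = 1" by blast
        have "\<exists>l\<in>q.pen X. Y \<notin> l"
        proof -
          have "2 \<le> card (q.pen X)" using deg4 unfolding q.deg_def by simp
          then obtain l m where lm: "l \<in> q.pen X" "m \<in> q.pen X" "l \<noteq> m" using two_of_card by blast
          then show ?thesis using q.pen_disj[OF X(1) lm, of Y] Y(2) by blast
        qed
        then obtain l where l: "l \<in> q.pen X" "Y \<notin> l" by blast
        then have "card l \<le> q.deg Y" using q.card_le_deg[OF Y(1) _ l(2)] q.pen_lines[OF X(1)] by simp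
        then have "6 \<le> q.deg Y" using six[OF l(1)] by simp
        then show ?thesis using star[OF Y(1,3)] by simp
      next
        case False
        have "2 * card (TQ - {X}) \<le> sum r (TQ - {X})"
          by (rule weight_ge) (use q.fin r1 False in force)+
        then show ?thesis using sumr U21 X q.fin sum.remove[OF q.fin X(1), of r] by simp
      qed
    qed
  next
    case False
    show ?thesis by (rule heavy) (use False in blast)
  qed
qed

end

context space3 begin

lemma pointedI: "P \<in> S \<Longrightarrow> pointed S L Red Blue p Pl P"
  by unfold_locales

lemma colours_ne: "Red \<noteq> {}" "Blue \<noteq> {}"
proof -
  obtain a b where ab: "a \<in> S" "b \<in> S" "a \<noteq> b" using nt unfolding nontriv_def by blast
  show "Red \<noteq> {}" using bb[of a b] ab col by auto
  show "Blue \<noteq> {}" using rr[of a b] ab col by auto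
qed

lemma unicoloured_bounds:
  assumes "Red \<inter> Blue = {}"
  shows "42 \<le> card S" "p \<noteq> 2 \<Longrightarrow> p \<noteq> 3 \<Longrightarrow> 52 \<le> card S"
proof -
  have "card S = card Red + card Blue" unfolding col by (rule card_Un_disjoint) (use fin col assms in auto)
  moreover obtain P Q where PQ: "P \<in> Blue" "Q \<in> Red" using colours_ne by auto
  interpret a: pointed S L Red Blue p Pl P by (rule pointedI) (use PQ col in auto)
  interpret b: pointed S L Blue Red p Pl Q by (rule space3.pointedI[OF swap3]) (use PQ col in auto)
  note a.unicoloured_red_count[OF assms PQ(1)] b.unicoloured_red_count[OF _ PQ(2)] assms
  ultimately show "42 \<le> card S" "p \<noteq> 2 \<Longrightarrow> p \<noteq> 3 \<Longrightarrow> 52 \<le> card S" by (auto simp: Int_commute)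
qed

end

locale purple = pointed S L Red Blue p Pl P for S :: "'p set" and L Red Blue p Pl P +
  assumes PM: "P \<in> Red" "P \<in> Blue"
begin

lemma w2: "X \<in> TQ \<Longrightarrow> 2 \<le> w X"
  using purple_lines[OF PM, of X] unfolding w_def by simp

lemma card_S: "card S = 1 + sum w TQ"
  using card_pen[OF PS] unfolding w_def by simp

lemma three_line_w:
  assumes "k \<in> q.lines" "card k = 3"
  shows "\<exists>m\<ge>2. (\<forall>X\<in>k. w X = m \<and> X - {P} \<subseteq> Red \<inter> Blue) \<and> p \<noteq> 0 \<and> p \<le> m"
  using three_line[OF assms] unfolding w_def by auto

lemma q_deg3: "X \<in> TQ \<Longrightarrow> 3 \<le> q.deg X"
  using q.deg_ge[OF thick3 q_nontriv] .

lemma TQ7: "7 \<le> card TQ"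
proof -
  obtain X where X: "X \<in> TQ" using q_ex2 by blast
  have "1 + 2 * q.deg X \<le> card TQ"
    by (rule q.card_ge_deg[OF X]) (use q.thickD[OF thick3] q.pen_lines[OF X] in force)
  then show ?thesis using q_deg3[OF X] by simp
qed

lemma ge15: "15 \<le> card S"
  using card_S TQ7 weight_ge[OF q.fin, of 2 w] w2 by simp

lemma all_in_lines: "X \<in> TQ \<Longrightarrow> \<exists>k\<in>q.lines. X \<in> k"
proof -
  assume X: "X \<in> TQ"
  then have "q.pen X \<noteq> {}" using q_deg3[OF X] unfolding q.deg_def by auto
  then show ?thesis using q.pen_lines[OF X] by auto
qed

lemma all_purple_if: "(\<And>X. X \<in> TQ \<Longrightarrow> X - {P} \<subseteq> Red \<inter> Blue) \<Longrightarrow> S \<subseteq> Red \<inter> Blue"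
proof
  fix x assume a: "\<And>X. X \<in> TQ \<Longrightarrow> X - {P} \<subseteq> Red \<inter> Blue" and x: "x \<in> S"
  show "x \<in> Red \<inter> Blue"
  proof (cases "x = P")
    case False
    then show ?thesis using a[OF TQ_I[OF x False]] L_r[OF PS x] by auto
  qed (use PM in auto)
qed

lemma w2_all:
  assumes "sum w TQ = 2 * card TQ" "X \<in> TQ" shows "w X = 2"
proof -
  have "2 * card TQ + card {x \<in> TQ. w x \<noteq> 2} \<le> sum w TQ" by (rule q.weight_light) (rule w2)
  then have "{x \<in> TQ. w x \<noteq> 2} = {}" using assms q.fin by simp
  then show ?thesis using assms by auto
qed

lemma eq15:
  assumes "card S = 15"
  shows "p = 2" "S \<subseteq> Red \<inter> Blue" "X \<in> TQ \<Longrightarrow> card X = 3" "\<And>\<pi>. plane \<pi> \<Longrightarrow> P \<in> \<pi> \<Longrightarrow> card \<pi> = 7"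
proof -
  have s: "sum w TQ = 14" using card_S assms by simp
  have "2 * card TQ \<le> sum w TQ" by (rule weight_ge[OF q.fin w2])
  then have c7: "card TQ = 7" using TQ7 s by simp
  then have wX: "w X = 2" if "X \<in> TQ" for X using w2_all that s by simp
  show "X \<in> TQ \<Longrightarrow> card X = 3" using wX[of X] unfolding w_def by simp
  have l3: "card k = 3" if k: "k \<in> q.lines" for k
  proof (rule ccontr)
    assume "card k \<noteq> 3"
    then have c4: "4 \<le> card k" using q.thickD[OF thick3 k] by simp
    obtain X where X: "X \<in> TQ" "X \<notin> k" using q.nontriv_off[OF q_nontriv k] by blast
    have "4 \<le> q.deg X" using q.card_le_deg[OF X(1) k X(2)] c4 by simp
    moreover have "1 + 2 * q.deg X \<le> card TQ"
      by (rule q.card_ge_deg[OF X(1)]) (use q.thickD[OF thick3] q.pen_lines[OF X(1)] in force)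
    ultimately show False using c7 by simp
  qed
  show "S \<subseteq> Red \<inter> Blue"
  proof (rule all_purple_if)
    fix X assume "X \<in> TQ"
    then obtain k where "k \<in> q.lines" "X \<in> k" using all_in_lines by blast
    then show "X - {P} \<subseteq> Red \<inter> Blue" using three_line[OF _ l3] by blast
  qed
  show "card \<pi> = 7" if pi: "plane \<pi>" "P \<in> \<pi>" for \<pi>
  proof -
    have "sum w (pencil \<pi> L P) = (\<Sum>X\<in>pencil \<pi> L P. 2)"
      by (rule sum.cong[OF refl]) (use wX q.lines_sub[OF plane_pencil[OF pi]] in auto)
    then have "card \<pi> - 1 = 6" using sum_w_plane[OF pi] l3[OF plane_pencil[OF pi]] by simp
    then show ?thesis by linarith
  qed
  obtain X where X: "X \<in> TQ" using q_ex2 by blast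
  then obtain k where k: "k \<in> q.lines" "X \<in> k" using all_in_lines by blast
  obtain m where "w X = m" "p \<noteq> 0" "p \<le> m" using three_line_w[OF k(1) l3[OF k(1)]] k(2) by blast
  moreover have "p \<noteq> 1" using des unfolding desarguesian_def by simp
  ultimately show "p = 2" using wX[OF X] by simp
qed

lemma light_lines:
  assumes "p \<noteq> 2" "X \<in> TQ" "w X = 2" "l \<in> q.pen X" shows "4 \<le> card l"
proof (rule ccontr)
  assume "\<not> 4 \<le> card l"
  moreover have l: "l \<in> q.lines" "X \<in> l" using assms q.pen_lines by auto
  ultimately have "card l = 3" using q.thickD[OF thick3 l(1)] by simp
  then obtain m where "w X = m" "p \<noteq> 0" "p \<le> m" using three_line_w[OF l(1)] l(2) by blast
  moreover have "p \<noteq> 1" using des unfolding desarguesian_def by simp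
  ultimately show False using assms by simp
qed

text \<open>A point of weight two lies on lines of at least four points only, because a line of three points has weights at least
  \<open>p\<close>. Degree three would force long lines, hence 26 is attained at best with degree four.\<close>

lemma ge27:
  assumes p2: "p \<noteq> 2"
  shows "26 \<le> sum w TQ" "sum w TQ = 26 \<Longrightarrow> \<exists>X\<in>TQ. w X = 2 \<and> q.deg X = 4"
proof -
  have tight: "1 + 3 * q.deg X \<le> card TQ \<and> (\<forall>k\<in>q.lines. X \<notin> k \<longrightarrow> card k = 3) \<and> 3 \<le> p" if X: "X \<in> TQ" "q.deg X = 3" for X
  proof -
    have "p \<noteq> 0 \<and> p + 1 \<le> card l" if l: "l \<in> q.pen X" for l
      by (rule q.tight_degree_char[OF X(1) _ _ l desq]) (use thick3 X in auto)
    moreover obtain l where "l \<in> q.pen X" using X(2) unfolding q.deg_def by fastforce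
    moreover have "p \<noteq> 1" using des unfolding desarguesian_def by simp
    ultimately have p3: "3 \<le> p" using p2 by (metis One_nat_def le_antisym less_2_cases not_less_eq_eq not_le numeral_2_eq_2 numeral_3_eq_3 le_neq_implies_less Suc_leI)
    then have "1 + 3 * q.deg X \<le> card TQ"
      by (intro q.card_ge_deg[OF X(1)]) (use \<open>\<And>l. l \<in> q.pen X \<Longrightarrow> p \<noteq> 0 \<and> p + 1 \<le> card l\<close> in force)
    moreover have "card k = 3" if "k \<in> q.lines" "X \<notin> k" for k
      using q.tight_degree_card[OF X(1) _ that] thick3 X by simp
    ultimately show ?thesis using p3 by blast
  qed
  have T9: "9 \<le> card TQ"
  proof -
    obtain X where X: "X \<in> TQ" using q_ex2 by blast
    show ?thesis
    proof (cases "q.deg X = 3")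
      case True
      then show ?thesis using tight[OF X] by simp
    next
      case False
      have "1 + 2 * q.deg X \<le> card TQ"
        by (rule q.card_ge_deg[OF X]) (use q.thickD[OF thick3] q.pen_lines[OF X] in force)
      then show ?thesis using q_deg3[OF X] False by simp
    qed
  qed
  have main: "27 \<le> sum w TQ \<or> 26 \<le> sum w TQ \<and> (\<exists>X\<in>TQ. w X = 2 \<and> q.deg X = 4)"
  proof (cases "\<exists>X\<in>TQ. w X = 2")
    case False
    have "3 * card TQ \<le> sum w TQ" by (rule weight_ge[OF q.fin]) (use w2 False in force)
    then show ?thesis using T9 by simp
  next
    case True
    then obtain X where X: "X \<in> TQ" "w X = 2" by blast
    have star: "2 + q.deg X * 6 \<le> sum w TQ"
    proof -
      have "w X + q.deg X * 6 \<le> sum w TQ"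
      proof (rule q.weight_star[OF X(1)])
        fix l assume l: "l \<in> q.pen X"
        have ll: "l \<in> q.lines" "X \<in> l" using l q.pen_lines[OF X(1)] by auto
        have "2 * card (l - {X}) \<le> sum w (l - {X})"
          by (rule weight_ge) (use q.lines_fin[OF ll(1)] w2 q.lines_sub[OF ll(1)] in auto)
        moreover have "3 \<le> card (l - {X})" using light_lines[OF p2 X l] ll q.lines_fin[OF ll(1)] by (simp add: card_Diff_singleton)
        ultimately show "6 \<le> sum w (l - {X})" by simp
      qed
      then show ?thesis using X by simp
    qed
    show ?thesis
    proof (cases "q.deg X = 3")
      case False
      then have "4 \<le> q.deg X" using q_deg3[OF X(1)] by simp
      moreover have "26 \<le> sum w TQ" using star calculation by simp
      moreover have "27 \<le> sum w TQ \<or> q.deg X = 4" using star calculation by linarith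
      ultimately show ?thesis using X by blast
    next
      case d3: True
      note t = tight[OF X(1) d3]
      have w3: "3 \<le> w Y" if Y: "Y \<in> TQ - {X}" for Y
      proof -
        have YT: "Y \<in> TQ" using Y by simp
        have "2 \<le> card (q.pen Y)" using q_deg3[OF YT] unfolding q.deg_def by simp
        then obtain l m where lm: "l \<in> q.pen Y" "m \<in> q.pen Y" "l \<noteq> m" using two_of_card by blast
        then obtain k where k: "k \<in> q.pen Y" "X \<notin> k" using q.pen_disj[OF YT lm, of X] Y by blast
        then have kl: "k \<in> q.lines" "Y \<in> k" using q.pen_lines[OF YT] by auto
        then have "card k = 3" using t k(2) by blast
        then obtain n where "w Y = n" "p \<le> n" using three_line_w[OF kl(1)] kl(2) by blast
        then show ?thesis using t by simp
      qed
      have "3 * card (TQ - {X}) \<le> sum w (TQ - {X})" by (rule weight_ge[OF _ w3]) (use q.fin in auto)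
      moreover have "card (TQ - {X}) = card TQ - 1" using X q.fin by simp
      moreover have "10 \<le> card TQ" using t d3 by simp
      ultimately have "27 \<le> sum w (TQ - {X})" by linarith
      then show ?thesis using sum.remove[OF q.fin X(1), of w] by linarith
    qed
  qed
  show "26 \<le> sum w TQ" using main by linarith
  show "sum w TQ = 26 \<Longrightarrow> \<exists>X\<in>TQ. w X = 2 \<and> q.deg X = 4" using main by auto
qed

lemma eq27:
  assumes p2: "p \<noteq> 2" and S27: "card S = 27"
  shows "p = 3" "S \<subseteq> Red \<inter> Blue" "\<And>X. X \<in> TQ \<Longrightarrow> card X = 3" "\<And>\<pi>. plane \<pi> \<Longrightarrow> P \<in> \<pi> \<Longrightarrow> card \<pi> = 9"
proof -
  have s: "sum w TQ = 26" using card_S S27 by simp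
  obtain X0 where X0: "X0 \<in> TQ" "w X0 = 2" "q.deg X0 = 4" using ge27(2)[OF p2 s] by blast
  have T13: "13 \<le> card TQ" using q.card_ge_deg[OF X0(1), of 3] light_lines[OF p2 X0(1,2)] X0(3) by simp
  moreover have "2 * card TQ \<le> sum w TQ" by (rule weight_ge[OF q.fin w2])
  ultimately have c13: "card TQ = 13" using s by simp
  have wX: "w X = 2" if "X \<in> TQ" for X using w2_all[OF _ that] s c13 by simp
  show c3: "\<And>X. X \<in> TQ \<Longrightarrow> card X = 3" using wX unfolding w_def by force
  have t4: "4 \<le> card l" if l: "l \<in> q.lines" for l
  proof -
    have "l \<noteq> {}" using q.thickD[OF thick3 l] by auto
    then obtain X where X: "X \<in> TQ" "X \<in> l" using q.lines_sub[OF l] by auto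
    then show ?thesis using light_lines[OF p2 X(1) wX[OF X(1)]] l q.pen_lines[OF X(1)] by simp
  qed
  have l4: "card l = 4" if l: "l \<in> q.lines" for l
  proof (rule ccontr)
    assume "card l \<noteq> 4"
    then have c5: "5 \<le> card l" using t4[OF l] by simp
    obtain X where X: "X \<in> TQ" "X \<notin> l" using q.nontriv_off[OF q_nontriv l] by blast
    have "5 \<le> q.deg X" using q.card_le_deg[OF X(1) l X(2)] c5 by simp
    moreover have "1 + 3 * q.deg X \<le> card TQ"
      by (rule q.card_ge_deg[OF X(1)]) (use t4 q.pen_lines[OF X(1)] in force)
    ultimately show False using c13 by simp
  qed
  have thick4: "q.thick 4" unfolding q.thick_def using l4 q.L_lines by auto
  have pl: "\<pi> \<subseteq> Red \<inter> Blue \<and> card \<pi> = 9" if pi: "plane \<pi>" "P \<in> \<pi>" for \<pi>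
  proof -
    interpret c: chromatic \<pi> L "Red \<inter> \<pi>" "Blue \<inter> \<pi>" p by (rule plane_chromatic(1)[OF pi(1)])
    have d: "c.deg P = 4" using l4[OF plane_pencil[OF pi]] unfolding c.deg_def .
    have t: "card l = 3" if "l \<in> c.pen P" for l
      using c3[of l] that plane_sub[OF pi(1)] unfolding pencil_def by auto
    have "\<pi> \<subseteq> c.Mp" by (rule c.degree_four_nine(1)[OF _ _ d t]) (use PM pi in auto)
    moreover have "card \<pi> = 1 + (\<Sum>l\<in>c.pen P. card l - 1)" by (rule c.card_pen[OF pi(2)])
    moreover have "(\<Sum>l\<in>c.pen P. card l - 1) = (\<Sum>l\<in>c.pen P. 2)" by (rule sum.cong) (use t in auto)
    ultimately show ?thesis using d unfolding c.Mp_def c.deg_def by auto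
  qed
  then show "\<And>\<pi>. plane \<pi> \<Longrightarrow> P \<in> \<pi> \<Longrightarrow> card \<pi> = 9" by blast
  show "S \<subseteq> Red \<inter> Blue"
  proof (rule all_purple_if)
    fix X assume "X \<in> TQ"
    then obtain k where k: "k \<in> q.lines" "X \<in> k" using all_in_lines by blast
    obtain \<pi> where pi: "plane \<pi>" "P \<in> \<pi>" "k = pencil \<pi> L P" using k(1) by (rule q_line)
    then have "X \<subseteq> \<pi>" using k(2) plane_closed[OF pi(1,2)] unfolding pencil_def by auto
    then show "X - {P} \<subseteq> Red \<inter> Blue" using pl[OF pi(1,2)] by auto
  qed
  obtain l where l: "l \<in> q.pen X0" using X0(3) unfolding q.deg_def by fastforce
  have "p \<noteq> 0 \<and> p + 1 \<le> card l" by (rule q.tight_degree_char[OF X0(1) _ _ l desq]) (use thick4 X0 in auto)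
  moreover have "card l = 4" using l4 l q.pen_lines[OF X0(1)] by auto
  moreover have "p \<noteq> 1" using des unfolding desarguesian_def by simp
  ultimately show "p = 3" using p2 by linarith
qed

end

context space3 begin

text \<open>These are the planes of type \<open>AG(2, 3)\<close> produced by \<open>degree_four_nine\<close>.\<close>

definition "hesse_plane \<pi> \<longleftrightarrow> plane \<pi> \<and> card \<pi> = 9 \<and> \<pi> \<subseteq> Red \<inter> Blue \<and> (\<forall>a\<in>\<pi>. \<forall>b\<in>\<pi>. a \<noteq> b \<longrightarrow> card (L a b) = 3)"

lemma p_ge5:
  assumes "p \<noteq> 0" "p \<noteq> 2" "p \<noteq> 3" shows "5 \<le> p"
proof -
  have "p \<noteq> 1" "p \<noteq> 4" using des unfolding desarguesian_def by auto
  then show ?thesis using assms by linarith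
qed

end

text \<open>Projection from a point off the plane is injective on the plane, so the plane becomes nine points of the
  space of lines to which the results on \<open>hesse\<close> apply.\<close>

locale off_hesse = pointed S L Red Blue p Pl P for S :: "'p set" and L Red Blue p Pl P +
  fixes \<pi> :: "'p set"
  assumes hp: "hesse_plane \<pi>" and off: "P \<notin> \<pi>" and p23: "p \<noteq> 2" "p \<noteq> 3"
begin

lemma pl: "plane \<pi>" and c9: "card \<pi> = 9" and pur: "\<pi> \<subseteq> Red \<inter> Blue"
  and l3: "a \<in> \<pi> \<Longrightarrow> b \<in> \<pi> \<Longrightarrow> a \<noteq> b \<Longrightarrow> card (L a b) = 3"
  using hp unfolding hesse_plane_def by auto

definition "H = L P ` \<pi>"

lemma pi_S: "a \<in> \<pi> \<Longrightarrow> a \<in> S \<and> a \<noteq> P"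
  using plane_sub[OF pl] off by auto

lemma in_LPa: "a \<in> \<pi> \<Longrightarrow> a \<in> L P a"
  using L_r[OF PS] pi_S by auto

lemma H_meet: assumes "X \<in> TQ" "a \<in> X" "b \<in> X" "a \<in> \<pi>" "b \<in> \<pi>" shows "a = b"
proof (rule ccontr)
  assume ab: "a \<noteq> b"
  have "L a b = X" using lines_L[of X a b] TQ_lines[OF assms(1)] assms ab by auto
  then have "P \<in> \<pi>" using plane_closed[OF pl assms(4,5) ab] TQ_lines[OF assms(1)] by auto
  then show False using off by simp
qed

lemma H_inj: "inj_on (L P) \<pi>"
proof (rule inj_onI)
  fix a b assume ab: "a \<in> \<pi>" "b \<in> \<pi>" "L P a = L P b"
  have "L P a \<in> TQ" using TQ_I pi_S[OF ab(1)] by blast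
  then show "a = b" using H_meet[of "L P a" a b] in_LPa[OF ab(1)] in_LPa[OF ab(2)] ab by auto
qed

lemma H_sub: "H \<subseteq> TQ"
  unfolding H_def using TQ_I pi_S by blast

sublocale h: hesse TQ LQ H p
proof (unfold_locales)
  show "H \<subseteq> TQ" by (rule H_sub)
  show "card H = 9" unfolding H_def using card_image[OF H_inj] c9 by simp
  show "desarguesian p TQ LQ" by (rule desq)
  show "p \<noteq> 2" "p \<noteq> 3" by (fact p23)+
  fix X Y assume X: "X \<in> H" and Y: "Y \<in> H" and XY: "X \<noteq> Y"
  obtain a b where ab: "a \<in> \<pi>" "X = L P a" "b \<in> \<pi>" "Y = L P b" using X Y unfolding H_def by auto
  have nab: "a \<noteq> b" using ab XY by auto
  note T = subsetD[OF H_sub X] subsetD[OF H_sub Y]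
  have aX: "a \<in> X" "b \<in> Y" using in_LPa ab by auto
  have nP: "a \<noteq> P" "b \<noteq> P" using pi_S ab by auto
  note l = LQ_plane[OF T XY aX(1) nP(1) aX(2) nP(2)]
  have "LQ X Y \<inter> H = L P ` (L a b)"
  proof
    show "L P ` (L a b) \<subseteq> LQ X Y \<inter> H"
    proof
      fix Z assume "Z \<in> L P ` (L a b)"
      then obtain c where c: "c \<in> L a b" "Z = L P c" by auto
      then have "c \<in> Pl P a b" "c \<in> \<pi>" using plane_closed[OF l(1,3,4) nab] plane_closed[OF pl ab(1,3) nab] by auto
      moreover have "c \<noteq> P" using calculation off by auto
      ultimately show "Z \<in> LQ X Y \<inter> H" unfolding l(2) H_def c(2) by auto
    qed
    show "LQ X Y \<inter> H \<subseteq> L P ` (L a b)"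
    proof
      fix Z assume Z: "Z \<in> LQ X Y \<inter> H"
      then obtain c where c: "c \<in> \<pi>" "Z = L P c" unfolding H_def by auto
      have "c \<in> Pl P a b"
        using in_pencil[OF l(1,5), of c] pi_S[OF c(1)] Z unfolding c(2) l(2) pencil_def by auto
      have "c \<in> L a b"
      proof (rule ccontr)
        assume n: "c \<notin> L a b"
        have "\<pi> = Pl a b c" by (rule plane_eq[OF pl ab(1,3) c(1) nab n])
        also have "\<dots> = Pl P a b" by (rule plane_eq[OF l(1,3,4) \<open>c \<in> Pl P a b\<close> nab n, symmetric])
        finally show False using l(5) off by simp
      qed
      then show "Z \<in> L P ` (L a b)" using c by auto
    qed
  qed
  moreover have "inj_on (L P) (L a b)" by (rule inj_on_subset[OF H_inj plane_closed[OF pl ab(1,3) nab]])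
  ultimately show "card (LQ X Y \<inter> H) = 3" using card_image l3[OF ab(1,3) nab] by metis
qed

lemma N_empty_lines: "h.N = {} \<Longrightarrow> k \<in> q.lines \<Longrightarrow> card k = 3"
proof -
  assume N: "h.N = {}" and k: "k \<in> q.lines"
  have TH: "TQ = H" using N H_sub unfolding h.N_def by auto
  obtain X Y where XY: "X \<in> TQ" "Y \<in> TQ" "X \<noteq> Y" "k = LQ X Y" using k unfolding q.lines_def by blast
  have "k \<inter> H = k" using q.lines_sub[OF k] TH by auto
  then show "card k = 3" using h.H3[of X Y] XY TH by auto
qed

text \<open>A pure point off the plane sees only thick lines, and each of them carries a pure point of the other colour.\<close>

lemma pure_count:
  assumes PR: "P \<in> Red" and pure: "\<And>x. x \<in> S \<Longrightarrow> x \<notin> \<pi> \<Longrightarrow> x \<notin> Red \<or> x \<notin> Blue"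
  shows "25 \<le> card (Blue - Red)"
proof -
  have no3: "card k \<noteq> 3" if k: "k \<in> q.lines" for k
  proof
    assume "card k = 3"
    then obtain m where m: "2 \<le> m" "\<forall>X\<in>k. card X = m + 1 \<and> X - {P} \<subseteq> Red \<inter> Blue" using three_line[OF k] by blast
    have "k \<noteq> {}" using \<open>card k = 3\<close> by auto
    then obtain X where X: "X \<in> k" "X \<in> TQ" using q.lines_sub[OF k] by auto
    have "card X = m + 1" "X - {P} \<subseteq> Red \<inter> Blue" using m(2) X by auto
    then have "2 \<le> card (X - {P})" using m(1) TQ_lines[OF X(2)] by (simp add: card_Diff_singleton)
    then obtain a b where ab: "a \<in> X - {P}" "b \<in> X - {P}" "a \<noteq> b" using two_of_card by blast
    have "a \<in> \<pi>" "b \<in> \<pi>" using pure[of a] pure[of b] ab \<open>X - {P} \<subseteq> Red \<inter> Blue\<close> TQ_lines[OF X(2)] by auto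
    then show False using H_meet[OF X(2)] ab by auto
  qed
  have thick4: "q.thick 4"
    unfolding q.thick_def using no3 q.L_lines q.thickD[OF thick3] by (metis eval_nat_numeral(2) le_neq_implies_less numeral_3_eq_3 semiring_norm(26) semiring_norm(27) Suc_leI numeral_eq_Suc pred_numeral_simps(2))
  have "h.N \<noteq> {}"
  proof
    assume N: "h.N = {}"
    obtain X Y where XY: "X \<in> TQ" "Y \<in> TQ" "X \<noteq> Y" using q_ex2 by blast
    show False using N_empty_lines[OF N q.L_lines[OF XY]] no3[OF q.L_lines[OF XY]] by simp
  qed
  then have T25: "25 \<le> card TQ" using h.thick_four_card[OF thick4] by simp
  have ex: "\<exists>z. z \<in> X \<and> z \<noteq> P \<and> z \<in> Blue - Red" if X: "X \<in> TQ" for X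
  proof (cases "X \<in> H")
    case True
    then obtain a where a: "a \<in> \<pi>" "X = L P a" unfolding H_def by auto
    obtain z where z: "z \<in> Blue" "z \<noteq> P" "z \<noteq> a" "z \<in> L P a" using rr[OF PR, of a] pur a pi_S[OF a(1)] by auto
    have "z \<notin> \<pi>" using H_meet[OF X, of z a] z a in_LPa[OF a(1)] by auto
    then show ?thesis using pure[of z] z a col by auto
  next
    case False
    obtain z where z: "z \<in> X - {P}" "z \<in> Blue" using red_meets_blue[OF PR X] by blast
    have "z \<notin> \<pi>"
    proof
      assume "z \<in> \<pi>"
      then have "X \<in> H" using TQ_of[OF X, of z] z unfolding H_def by auto
      then show False using False by simp
    qed
    then show ?thesis using pure[of z] z col by auto
  qed
  define f where "f X = (SOME z. z \<in> X \<and> z \<noteq> P \<and> z \<in> Blue - Red)" for X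
  have f: "f X \<in> X" "f X \<noteq> P" "f X \<in> Blue - Red" if "X \<in> TQ" for X
    using someI_ex[OF ex[OF that]] unfolding f_def by auto
  have "card TQ \<le> card (Blue - Red)"
  proof (rule card_inj_on_le[of f])
    show "inj_on f TQ"
    proof (rule inj_onI)
      fix X Y assume XY: "X \<in> TQ" "Y \<in> TQ" "f X = f Y"
      then show "X = Y" using TQ_disj[OF XY(1,2)] f[OF XY(1)] f[OF XY(2)] by auto
    qed
    show "f ` TQ \<subseteq> Blue - Red" using f by auto
    show "finite (Blue - Red)" using fin col by auto
  qed
  then show ?thesis using T25 by simp
qed

end

locale purple_off = off_hesse S L Red Blue p Pl P \<pi> + purple S L Red Blue p Pl P
  for S :: "'p set" and L Red Blue p Pl P \<pi>
begin

text \<open>The second alternative is the one where every line through \<open>P\<close> meets the plane and all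
  of these lines have six points.\<close>

lemma dichotomy: "51 \<le> card S \<or> card S = 46 \<and> S \<subseteq> Red \<inter> Blue \<and> (\<forall>X\<in>TQ. card X = 6)"
proof -
  have m5: "\<exists>m\<ge>5. \<forall>X\<in>k. w X = m \<and> X - {P} \<subseteq> Red \<inter> Blue" if k: "k \<in> q.lines" "card k = 3" for k
  proof -
    obtain m where m: "\<forall>X\<in>k. w X = m \<and> X - {P} \<subseteq> Red \<inter> Blue" "p \<noteq> 0" "p \<le> m" using three_line_w[OF k] by blast
    then show ?thesis using p_ge5[OF m(2) p23] by (intro exI[of _ m]) auto
  qed
  show ?thesis
  proof (cases "h.N = {}")
    case False
    have "50 \<le> sum w TQ"
    proof (rule h.weighted[OF w2 thick3 False])
      fix l x assume l: "l \<in> q.lines" "card l = 3" "x \<in> l"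
      then show "5 \<le> w x" using m5[OF l(1,2)] by auto
    qed
    then show ?thesis using card_S by simp
  next
    case True
    have TH: "TQ = H" using True H_sub unfolding h.N_def by auto
    note l3 = N_empty_lines[OF True]
    obtain X0 Y0 where X0: "X0 \<in> TQ" "Y0 \<in> TQ" "X0 \<noteq> Y0" using q_ex2 by blast
    have w: "w X = w X0 \<and> 5 \<le> w X \<and> X - {P} \<subseteq> Red \<inter> Blue" if X: "X \<in> TQ" for X
    proof (cases "X = X0")
      case True
      obtain m where "m \<ge> 5" "\<forall>X\<in>LQ X0 Y0. w X = m \<and> X - {P} \<subseteq> Red \<inter> Blue"
        using m5[OF q.L_lines[OF X0] l3[OF q.L_lines[OF X0]]] by blast
      then show ?thesis using q.L_l[OF X0] True by auto
    next
      case False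
      note n = X0(1) X False[symmetric]
      obtain m where "m \<ge> 5" "\<forall>Y\<in>LQ X0 X. w Y = m \<and> Y - {P} \<subseteq> Red \<inter> Blue"
        using m5[OF q.L_lines[OF n] l3[OF q.L_lines[OF n]]] by blast
      then show ?thesis using q.L_l[OF n] q.L_r[OF n] by auto
    qed
    have "sum w TQ = (\<Sum>X\<in>TQ. w X0)" by (rule sum.cong) (use w in auto)
    then have s: "sum w TQ = 9 * w X0" using TH h.H9 by simp
    show ?thesis
    proof (cases "w X0 = 5")
      case True
      have "card X = 6" if "X \<in> TQ" for X proof -
        have "w X = 5" using w[OF that] True by simp
        then show ?thesis unfolding w_def by linarith
      qed
      moreover have "S \<subseteq> Red \<inter> Blue" by (rule all_purple_if) (use w in blast)
      ultimately show ?thesis using card_S s True by simp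
    next
      case False
      then have "6 \<le> w X0" using w[OF X0(1)] by simp
      then show ?thesis using card_S s by simp
    qed
  qed
qed

end

context space3 begin

text \<open>If all purple points off the plane fall under the second alternative of \<open>dichotomy\<close>, every line that meets the plane in one
  point has five further points, but 37 points off the plane cannot be divided into such lines. If no point off the plane is purple, count the pure
  points of both colours.\<close>

lemma hesse_bound:
  assumes hp: "hesse_plane \<pi>" and p23: "p \<noteq> 2" "p \<noteq> 3"
  shows "51 \<le> card S"
proof -
  have pl: "plane \<pi>" "card \<pi> = 9" "\<pi> \<subseteq> Red \<inter> Blue" using hp unfolding hesse_plane_def by auto
  have piS: "\<pi> \<subseteq> S" by (rule plane_sub[OF pl(1)])
  have dich: "51 \<le> card S \<or> card S = 46 \<and> S \<subseteq> Red \<inter> Blue \<and> (\<forall>X\<in>pen Q. card X = 6)"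
    if Q: "Q \<in> S" "Q \<notin> \<pi>" "Q \<in> Red" "Q \<in> Blue" for Q
  proof -
    interpret a: purple_off S L Red Blue p Pl Q \<pi>
      by unfold_locales (use Q hp p23 in auto)
    show ?thesis by (rule a.dichotomy)
  qed
  obtain Q where Q: "Q \<in> S" "Q \<notin> \<pi>" using plane_outside[OF pl(1)] by blast
  show ?thesis
  proof (cases "\<exists>x\<in>S. x \<notin> \<pi> \<and> x \<in> Red \<and> x \<in> Blue")
    case True
    then obtain Q where Q: "Q \<in> S" "Q \<notin> \<pi>" "Q \<in> Red" "Q \<in> Blue" by blast
    show ?thesis
    proof (rule ccontr)
      assume n: "\<not> 51 \<le> card S"
      then have c: "card S = 46" "S \<subseteq> Red \<inter> Blue" using dich[OF Q] by auto
      have six: "card X = 6" if "R \<in> S" "R \<notin> \<pi>" "X \<in> pen R" for R X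
        using dich[of R] that n c(2) by blast
      obtain A where A: "A \<in> \<pi>" using pl(2) by fastforce
      then have AS: "A \<in> S" using piS by auto
      have fpi: "finite \<pi>" using finite_subset[OF piS fin] .
      have l5: "card (l \<inter> (S - \<pi>) - {A}) = 0 \<or> card (l \<inter> (S - \<pi>) - {A}) = 5" if l: "l \<in> pen A" for l
      proof (cases "l \<subseteq> \<pi>")
        case True
        then have "l \<inter> (S - \<pi>) - {A} = {}" by auto
        then have "card (l \<inter> (S - \<pi>) - {A}) = 0" by (simp only: card.empty)
        then show ?thesis by blast
      next
        case False
        have ll: "l \<in> lines" "A \<in> l" using l pen_lines[OF AS] by auto
        obtain R where R: "R \<in> l" "R \<notin> \<pi>" using False by blast
        then have RS: "R \<in> S" using lines_sub[OF ll(1)] by auto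
        have "card l = 6" by (rule six[OF RS R(2)]) (use pen_lines[OF RS] ll R in auto)
        moreover have "l \<inter> (S - \<pi>) - {A} = l - {A}"
        proof -
          have "x \<notin> \<pi>" if x: "x \<in> l" "x \<noteq> A" for x
          proof
            assume "x \<in> \<pi>"
            then have "L A x \<subseteq> \<pi>" using plane_closed[OF pl(1) A] x by auto
            then show False using lines_L[OF ll(1), of A x] ll x R by auto
          qed
          then show ?thesis using lines_sub[OF ll(1)] by auto
        qed
        ultimately show ?thesis using ll lines_fin[OF ll(1)] by (simp add: card_Diff_singleton)
      qed
      have "card (S - \<pi> - {A}) = (\<Sum>l\<in>pen A. card (l \<inter> (S - \<pi>) - {A}))" by (rule pen_count[OF AS]) auto
      moreover have "5 dvd (\<Sum>l\<in>pen A. card (l \<inter> (S - \<pi>) - {A}))" by (rule dvd_sum) (use l5 in fastforce)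
      moreover have "card (S - \<pi> - {A}) = 37" using A c(1) pl(2) card_Diff_subset[OF fpi piS] by simp
      ultimately have "5 dvd (37::nat)" by metis
      then show False by presburger
    qed
  next
    case False
    have pure: "\<And>x. x \<in> S \<Longrightarrow> x \<notin> \<pi> \<Longrightarrow> x \<notin> Red \<or> x \<notin> Blue" using False by blast
    have hp': "space3.hesse_plane S L Blue Red Pl \<pi>"
      using hp unfolding hesse_plane_def space3.hesse_plane_def[OF swap3] space3.plane_def[OF swap3] plane_def by (simp add: Int_commute)
    have B: "25 \<le> card (Blue - Red)" if R: "R \<in> S" "R \<notin> \<pi>" "R \<in> Red" for R
    proof -
      interpret a: off_hesse S L Red Blue p Pl R \<pi> by unfold_locales (use R hp p23 in auto)
      show ?thesis by (rule a.pure_count[OF R(3) pure])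
    qed
    have Rd: "25 \<le> card (Red - Blue)" if R: "R \<in> S" "R \<notin> \<pi>" "R \<in> Blue" for R
    proof -
      interpret s: space3 S L Blue Red p Pl by (rule swap3)
      interpret a: off_hesse S L Blue Red p Pl R \<pi> by unfold_locales (use R hp' p23 in auto)
      show ?thesis by (rule a.pure_count[OF R(3)]) (use pure in blast)
    qed
    have "25 \<le> card (Blue - Red) \<and> 25 \<le> card (Red - Blue)"
    proof (cases "Q \<in> Red")
      case True
      have b: "25 \<le> card (Blue - Red)" by (rule B[OF Q True])
      then have "Blue - Red \<noteq> {}" by (metis card.empty not_numeral_le_zero)
      then obtain R where "R \<in> Blue" "R \<notin> Red" by auto
      then show ?thesis using b Rd[of R] pl(3) col by auto
    next
      case False
      then have b: "25 \<le> card (Red - Blue)" using Rd[OF Q] Q col by auto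
      then have "Red - Blue \<noteq> {}" by (metis card.empty not_numeral_le_zero)
      then obtain R where "R \<in> Red" "R \<notin> Blue" by auto
      then show ?thesis using b B[of R] pl(3) col by auto
    qed
    moreover have "card (Blue - Red) + card (Red - Blue) + card \<pi> \<le> card S"
    proof -
      have f: "finite (Blue - Red)" "finite (Red - Blue)" "finite \<pi>" using fin col finite_subset[OF piS fin] by auto
      have "card ((Blue - Red) \<union> (Red - Blue) \<union> \<pi>) = card ((Blue - Red) \<union> (Red - Blue)) + card \<pi>"
        by (rule card_Un_disjoint) (use f pl(3) in auto)
      also have "card ((Blue - Red) \<union> (Red - Blue)) = card (Blue - Red) + card (Red - Blue)"
        by (rule card_Un_disjoint) (use f in auto)
      finally show ?thesis using card_mono[OF fin, of "(Blue - Red) \<union> (Red - Blue) \<union> \<pi>"] col piS by auto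
    qed
    ultimately show ?thesis using pl(2) by linarith
  qed
qed

end

context purple begin

text \<open>Weights \<open>2, 2, 2, 2\<close> give a plane of nine points and weights \<open>2, 2, 2, 3\<close> the plane of \<open>degree_four_ten\<close>.\<close>

lemma four_line_weight:
  assumes p23: "p \<noteq> 2" "p \<noteq> 3" and no: "\<And>\<pi>. \<not> hesse_plane \<pi>" and k: "k \<in> q.lines" "card k = 4"
  shows "10 \<le> sum w k"
proof (rule ccontr)
  assume n: "\<not> 10 \<le> sum w k"
  obtain \<pi> where pi: "plane \<pi>" "P \<in> \<pi>" "k = pencil \<pi> L P" using k(1) by (rule q_line)
  interpret c: chromatic \<pi> L "Red \<inter> \<pi>" "Blue \<inter> \<pi>" p by (rule plane_chromatic(1)[OF pi(1)])
  have PM': "P \<in> Red \<inter> \<pi>" "P \<in> Blue \<inter> \<pi>" using PM pi by auto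
  have d: "c.deg P = 4" using k(2) unfolding pi(3) c.deg_def .
  have fk: "finite k" using q.lines_fin[OF k(1)] .
  have wk: "2 \<le> w X" "card X = w X + 1" if "X \<in> k" for X
    using w2[of X] q.lines_sub[OF k(1)] that unfolding w_def by auto
  show False
  proof (cases "\<exists>X\<in>k. w X \<noteq> 2")
    case False
    then have t: "card l = 3" if "l \<in> c.pen P" for l using wk(2)[of l] that pi(3) by auto
    note nine = c.degree_four_nine[OF PM' d t]
    have "card \<pi> = 1 + (\<Sum>l\<in>c.pen P. card l - 1)" by (rule c.card_pen[OF pi(2)])
    moreover have "(\<Sum>l\<in>c.pen P. card l - 1) = (\<Sum>l\<in>c.pen P. 2)" by (rule sum.cong) (use t in auto)
    ultimately have "card \<pi> = 9" using d unfolding c.deg_def by simp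
    moreover have "\<pi> \<subseteq> Red \<inter> Blue" using nine(1) unfolding c.Mp_def by auto
    moreover have "\<forall>a\<in>\<pi>. \<forall>b\<in>\<pi>. a \<noteq> b \<longrightarrow> card (L a b) = 3" using nine(2) c.L_lines by auto
    ultimately have "hesse_plane \<pi>" using pi(1) unfolding hesse_plane_def by simp
    then show False using no by blast
  next
    case True
    then obtain D where D: "D \<in> k" "w D \<noteq> 2" by blast
    have s: "sum w k = w D + sum w (k - {D})" by (rule sum.remove[OF fk D(1)])
    have c3: "card (k - {D}) = 3" using D k fk by (simp add: card_Diff_singleton)
    have ge: "2 * card (k - {D}) \<le> sum w (k - {D})" by (rule weight_ge) (use fk wk in auto)
    have wD: "w D = 3" "sum w (k - {D}) = 6" using n s ge c3 wk(1)[OF D(1)] D(2) by linarith+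
    have "w X = 2" if X: "X \<in> k - {D}" for X
    proof -
      have "sum w (k - {D}) = w X + sum w (k - {D} - {X})" by (rule sum.remove) (use fk X in auto)
      moreover have "2 * card (k - {D} - {X}) \<le> sum w (k - {D} - {X})" by (rule weight_ge) (use fk wk in auto)
      moreover have "card (k - {D} - {X}) = 2" using c3 X fk by (simp add: card_Diff_singleton)
      ultimately show ?thesis using wD wk(1)[of X] X by auto
    qed
    note w2' = this
    obtain a b c' where abc: "k - {D} = {a, b, c'}" "a \<noteq> b" "b \<noteq> c'" "a \<noteq> c'" using c3 unfolding card_3_iff by metis
    have "k = insert D (k - {D})" using D(1) by blast
    also have "\<dots> = {a, b, c', D}" unfolding abc(1) by (simp add: insert_commute)
    finally have kd: "c.pen P = {a, b, c', D}" unfolding pi(3) .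
    have m: "a \<in> k - {D}" "b \<in> k - {D}" "c' \<in> k - {D}" unfolding abc(1) by simp_all
    have dist: "distinct [a, b, c', D]" using abc(2-4) m by simp
    have cc: "card a = 3" "card b = 3" "card c' = 3" "card D = 4"
      using wk(2)[of a] wk(2)[of b] wk(2)[of c'] wk(2)[OF D(1)] w2'[OF m(1)] w2'[OF m(2)] w2'[OF m(3)] wD(1) m by simp_all
    show False by (rule c.degree_four_ten[OF PM' kd dist cc p23])
  qed
qed

text \<open>Points off the heavy line have degree at least six. Their weights are either all at least three, and then add
  up to 35 off the line, or one of them is two, and then all lines through it are heavy.\<close>

lemma thick_line_bound:
  assumes p23: "p \<noteq> 2" "p \<noteq> 3" and no: "\<And>\<pi>. \<not> hesse_plane \<pi>"
    and k: "k \<in> q.lines" "6 \<le> card k" "15 \<le> sum w k"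
  shows "51 \<le> card S"
proof -
  have w5: "5 \<le> w X" if l: "l \<in> q.lines" "card l = 3" "X \<in> l" for l X
  proof -
    obtain m where "w X = m" "p \<noteq> 0" "p \<le> m" using three_line_w[OF l(1,2)] l(3) by blast
    then show ?thesis using p_ge5 p23 by force
  qed
  have deg6: "6 \<le> q.deg X" if "X \<in> TQ" "X \<notin> k" for X using q.card_le_deg[OF that(1) k(1) that(2)] k(2) by simp
  show ?thesis
  proof (cases "\<exists>X\<in>TQ. X \<notin> k \<and> w X = 2")
    case True
    then obtain X where X: "X \<in> TQ" "X \<notin> k" "w X = 2" by blast
    have "w X + q.deg X * 8 \<le> sum w TQ"
    proof (rule q.weight_star[OF X(1)])
      fix l assume lp: "l \<in> q.pen X"
      have l: "l \<in> q.lines" "X \<in> l" using lp q.pen_lines[OF X(1)] by auto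
      have c4: "4 \<le> card l" by (rule light_lines[OF p23(1) X(1,3) lp])
      have rem: "sum w l = w X + sum w (l - {X})" by (rule sum.remove[OF q.lines_fin[OF l(1)] l(2)])
      have "2 * card (l - {X}) \<le> sum w (l - {X})" by (rule weight_ge) (use q.lines_fin[OF l(1)] q.lines_sub[OF l(1)] w2 in auto)
      moreover have "card (l - {X}) = card l - 1" using l q.lines_fin[OF l(1)] by (simp add: card_Diff_singleton)
      ultimately show "8 \<le> sum w (l - {X})"
        using four_line_weight[OF p23 no l(1)] rem X(3) c4 by (cases "card l = 4") auto
    qed
    then show ?thesis using deg6[OF X(1,2)] X(3) card_S by simp
  next
    case False
    have w3: "3 \<le> w X" if "X \<in> TQ" "X \<notin> k" for X using w2[OF that(1)] False that by force
    obtain X where X: "X \<in> TQ" "X \<notin> k" using q.nontriv_off[OF q_nontriv k(1)] by blast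
    define v where "v Y = (if Y \<in> k then 0 else w Y)" for Y
    have star: "n + 6 * j \<le> sum v TQ" if n: "n \<le> w X" and j: "\<And>l. l \<in> q.pen X \<Longrightarrow> j \<le> sum v (l - {X})" for n j
    proof -
      have "v X + q.deg X * j \<le> sum v TQ" by (rule q.weight_star[OF X(1) j])
      moreover have "6 * j \<le> q.deg X * j" using deg6[OF X] by simp
      moreover have "v X = w X" using X(2) unfolding v_def by simp
      ultimately show ?thesis using n by linarith
    qed
    have one: "card (l \<inter> k) \<le> 1" if l: "l \<in> q.pen X" for l
    proof (rule ccontr)
      assume "\<not> ?thesis"
      then obtain a b where ab: "a \<in> l \<inter> k" "b \<in> l \<inter> k" "a \<noteq> b" using two_of_card[of "l \<inter> k"] by auto
      then have "l = k" using q.lines_unique[of l k a b] l k(1) q.pen_lines[OF X(1)] by auto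
      then show False using l X q.pen_lines[OF X(1)] by auto
    qed
    have vl: "sum v (l - {X}) = sum w (l - k - {X})" "card l \<le> card (l - k - {X}) + 2" if lp: "l \<in> q.pen X" for l
    proof -
      have l: "l \<in> q.lines" "X \<in> l" "finite l" using lp q.pen_lines[OF X(1)] q.lines_fin by auto
      have "l - k - {X} = (l - {X}) - (l - {X}) \<inter> k" by auto
      have "sum v (l - {X}) = sum v (l - k - {X})" by (rule sum.mono_neutral_right) (use l in \<open>auto simp: v_def\<close>)
      also have "\<dots> = sum w (l - k - {X})" by (rule sum.cong) (auto simp: v_def)
      finally show "sum v (l - {X}) = sum w (l - k - {X})" .
      have "card (l - k - {X}) = card (l - k) - 1" using l X by (simp add: card_Diff_singleton)
      moreover have "card (l - k) = card l - card (l \<inter> k)" by (rule card_Diff_subset_Int) (use l in auto)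
      ultimately show "card l \<le> card (l - k - {X}) + 2" using one[OF lp] by linarith
    qed
    have v35: "35 \<le> sum v TQ"
    proof (cases "\<exists>l\<in>q.pen X. card l = 3")
      case True
      then obtain l0 where l0: "l0 \<in> q.pen X" "card l0 = 3" by blast
      then have wX: "5 \<le> w X" using w5[of l0 X] q.pen_lines[OF X(1)] by auto
      have "5 + 6 * 5 \<le> sum v TQ"
      proof (rule star[OF wX])
        fix l assume lp: "l \<in> q.pen X"
        have l: "l \<in> q.lines" "X \<in> l" "finite l" using lp q.pen_lines[OF X(1)] q.lines_fin by auto
        show "5 \<le> sum v (l - {X})"
        proof (cases "card l = 3")
          case True
          have "5 * card (l - k - {X}) \<le> sum w (l - k - {X})" by (rule weight_ge) (use l w5[OF l(1) True] in auto)
          then show ?thesis using vl[OF lp] True by simp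
        next
          case False
          then have "4 \<le> card l" using q.thickD[OF thick3 l(1)] by simp
          moreover have "3 * card (l - k - {X}) \<le> sum w (l - k - {X})" by (rule weight_ge) (use l w3 q.lines_sub[OF l(1)] in auto)
          ultimately show ?thesis using vl[OF lp] by simp
        qed
      qed
      then show ?thesis by simp
    next
      case no3: False
      have "3 + 6 * 6 \<le> sum v TQ"
      proof (rule star[OF w3[OF X]])
        fix l assume lp: "l \<in> q.pen X"
        have l: "l \<in> q.lines" "X \<in> l" "finite l" using lp q.pen_lines[OF X(1)] q.lines_fin by auto
        then have "4 \<le> card l" using q.thickD[OF thick3 l(1)] no3 lp by (cases "card l = 3") auto
        moreover have "3 * card (l - k - {X}) \<le> sum w (l - k - {X})" by (rule weight_ge) (use l w3 q.lines_sub[OF l(1)] in auto)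
        ultimately show "6 \<le> sum v (l - {X})" using vl[OF lp] by simp
      qed
      then show ?thesis by simp
    qed
    have "sum v TQ = sum w (TQ - k)"
    proof -
      have "sum v TQ = sum v (TQ - k)" by (rule sum.mono_neutral_right) (use q.fin in \<open>auto simp: v_def\<close>)
      then show ?thesis by (simp add: v_def)
    qed
    moreover have "sum w TQ = sum w (TQ - k) + sum w k" by (rule sum.subset_diff[OF q.lines_sub[OF k(1)] q.fin])
    ultimately show ?thesis using v35 k(3) card_S by simp
  qed
qed

end

context space3 begin

lemma purpleI: "P \<in> Red \<Longrightarrow> P \<in> Blue \<Longrightarrow> purple S L Red Blue p Pl P"
  by unfold_locales (use col in auto)

theorem bound51:
  assumes p23: "p \<noteq> 2" "p \<noteq> 3" shows "51 \<le> card S"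
proof (cases "Red \<inter> Blue = {}")
  case True
  then show ?thesis using unicoloured_bounds(2) p23 by force
next
  case False
  then obtain P where P: "P \<in> Red" "P \<in> Blue" by blast
  show ?thesis
  proof (cases "\<exists>\<pi>. hesse_plane \<pi>")
    case True
    then show ?thesis using hesse_bound p23 by blast
  next
    case noh: False
    then have no: "\<And>\<pi>. \<not> hesse_plane \<pi>" by blast
    interpret a: purple S L Red Blue p Pl P by (rule purpleI[OF P])
    show ?thesis
    proof (cases "\<exists>k\<in>a.q.lines. card k = 3")
      case True
      then obtain k where k: "k \<in> a.q.lines" "card k = 3" by blast
      obtain \<pi> where pi: "plane \<pi>" "P \<in> \<pi>" "k = pencil \<pi> L P" using k(1) by (rule a.q_line)
      interpret c: chromatic \<pi> L "Red \<inter> \<pi>" "Blue \<inter> \<pi>" p by (rule plane_chromatic(1)[OF pi(1)])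
      have d: "c.deg P = 3" using k(2) unfolding pi(3) c.deg_def .
      note nt' = plane_chromatic(2)[OF pi(1)]
      obtain m where m: "\<forall>l\<in>c.pen P. card l = m + 1 \<and> l - {P} \<subseteq> Red \<inter> \<pi> \<inter> (Blue \<inter> \<pi>)" "p \<noteq> 0" "p \<le> m"
        using c.degree_three(1)[OF pi(2) nt' d] by blast
      have m5: "5 \<le> m" using p_ge5[OF m(2) p23] m(3) by simp
      have "c.pen P \<noteq> {}" using d unfolding c.deg_def by auto
      then obtain l where l: "l \<in> c.pen P" by auto
      have lc: "card l = m + 1" "l - {P} \<subseteq> Red \<inter> Blue" using m(1) l by auto
      have lf: "finite l" "l \<in> c.lines" "P \<in> l" "l \<subseteq> \<pi>" using l c.pen_lines[OF pi(2)] c.lines_fin c.lines_sub by auto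
      have "2 \<le> card l" using lc(1) m5 by simp
      then obtain y where y: "y \<in> l" "y \<noteq> P" using another_element[of l P] by blast
      have yp: "y \<in> Red" "y \<in> Blue" "y \<in> \<pi>" using y lc lf by auto
      interpret b: purple S L Red Blue p Pl y by (rule purpleI[OF yp(1,2)])
      let ?k = "pencil \<pi> L y"
      have kl: "?k \<in> b.q.lines" by (rule b.plane_pencil[OF pi(1) yp(3)])
      have "card \<pi> = 1 + (\<Sum>l\<in>c.pen P. card l - 1)" by (rule c.card_pen[OF pi(2)])
      also have "(\<Sum>l\<in>c.pen P. card l - 1) = (\<Sum>l\<in>c.pen P. m)" by (rule sum.cong) (use m(1) in auto)
      finally have cpi: "card \<pi> = 1 + 3 * m" using d unfolding c.deg_def by simp
      have s15: "15 \<le> sum b.w ?k" using b.sum_w_plane[OF pi(1) yp(3)] cpi m5 by simp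
      have "card \<pi> = 1 + (\<Sum>l\<in>c.pen y. card l - 1)" by (rule c.card_pen[OF yp(3)])
      also have lp: "l \<in> c.pen y" using c.pen_lines[OF yp(3)] lf y by auto
      have "(\<Sum>l\<in>c.pen y. card l - 1) = (card l - 1) + (\<Sum>l\<in>c.pen y - {l}. card l - 1)" by (rule sum.remove[OF c.fin_pen lp])
      also have "(\<Sum>l\<in>c.pen y - {l}. card l - 1) = (\<Sum>l\<in>c.pen y - {l}. 2)"
      proof (rule sum.cong[OF refl])
        fix j assume j: "j \<in> c.pen y - {l}"
        then have "P \<notin> j" using c.pen_disj[OF yp(3), of j l P] lp lf y by auto
        then have "card j = 3" using c.degree_three(2)[OF pi(2) nt' d, of j] j c.pen_lines[OF yp(3)] by auto
        then show "card j - 1 = 2" by simp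
      qed
      finally have "3 * m = m + 2 * card (c.pen y - {l})" using cpi lc by simp
      then have "m + 1 = card ?k" using lp c.fin_pen[of y] m5 by (simp add: card_Diff_singleton)
      then have "6 \<le> card ?k" using m5 by simp
      then show ?thesis using b.thick_line_bound[OF p23 no kl _ s15] by simp
    next
      case no3: False
      have t4: "a.q.thick 4"
        unfolding a.q.thick_def
      proof (intro ballI impI)
        fix X Y assume "X \<in> a.TQ" "Y \<in> a.TQ" "X \<noteq> Y"
        then have l: "a.LQ X Y \<in> a.q.lines" by (rule a.q.L_lines)
        then have "3 \<le> card (a.LQ X Y)" "card (a.LQ X Y) \<noteq> 3" using a.q.thickD[OF a.thick3 l] no3 by auto
        then show "4 \<le> card (a.LQ X Y)" by simp
      qed
      have "50 \<le> sum a.w a.TQ"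
        by (rule a.q.weighted_thick_four) (use a.q_nontriv t4 a.desq p23 a.w2 a.four_line_weight[OF p23 no] in auto)
      then show ?thesis using a.card_S by simp
    qed
  qed
qed

theorem bound15: "15 \<le> card S"
proof (cases "Red \<inter> Blue = {}")
  case True
  then show ?thesis using unicoloured_bounds(1) by simp
next
  case False
  then obtain P where P: "P \<in> Red" "P \<in> Blue" by blast
  interpret a: purple S L Red Blue p Pl P by (rule purpleI[OF P])
  show ?thesis by (rule a.ge15)
qed

theorem bound27: assumes "p \<noteq> 2" shows "27 \<le> card S"
proof (cases "Red \<inter> Blue = {}")
  case True
  then show ?thesis using unicoloured_bounds(1) by simp
next
  case False
  then obtain P where P: "P \<in> Red" "P \<in> Blue" by blast
  interpret a: purple S L Red Blue p Pl P by (rule purpleI[OF P])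
  show ?thesis using a.ge27(1)[OF assms] a.card_S by simp
qed

theorem equality15:
  assumes "card S = 15"
  shows "p = 2" "\<And>l. l \<in> lines \<Longrightarrow> card l = 3" "\<And>\<pi>. plane \<pi> \<Longrightarrow> card \<pi> = 7"
proof -
  have "Red \<inter> Blue \<noteq> {}" using unicoloured_bounds(1) assms by auto
  then obtain P where P: "P \<in> Red" "P \<in> Blue" by blast
  interpret a: purple S L Red Blue p Pl P by (rule purpleI[OF P])
  show "p = 2" by (rule a.eq15(1)[OF assms])
  have pur: "purple S L Red Blue p Pl Q" if "Q \<in> S" for Q
    by (rule purpleI) (use a.eq15(2)[OF assms] that in auto)
  show "card l = 3" if l: "l \<in> lines" for l
  proof -
    obtain Q R where Q: "Q \<in> S" "R \<in> S" "Q \<noteq> R" "l = L Q R" using l unfolding lines_def by blast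
    interpret b: purple S L Red Blue p Pl Q by (rule pur[OF Q(1)])
    show "card l = 3" by (rule b.eq15(3)[OF assms]) (use Q b.TQ_I in auto)
  qed
  show "card \<pi> = 7" if pi: "plane \<pi>" for \<pi>
  proof -
    obtain Q where Q: "Q \<in> \<pi>" using plane_ex3[OF pi] by blast
    interpret b: purple S L Red Blue p Pl Q by (rule pur) (use Q plane_sub[OF pi] in auto)
    show "card \<pi> = 7" by (rule b.eq15(4)[OF assms pi Q])
  qed
qed

theorem equality27:
  assumes "p \<noteq> 2" "card S = 27"
  shows "p = 3" "\<And>l. l \<in> lines \<Longrightarrow> card l = 3" "\<And>\<pi>. plane \<pi> \<Longrightarrow> card \<pi> = 9"
proof -
  have "Red \<inter> Blue \<noteq> {}" using unicoloured_bounds(1) assms by auto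
  then obtain P where P: "P \<in> Red" "P \<in> Blue" by blast
  interpret a: purple S L Red Blue p Pl P by (rule purpleI[OF P])
  show "p = 3" by (rule a.eq27(1)[OF assms])
  have pur: "purple S L Red Blue p Pl Q" if "Q \<in> S" for Q
    by (rule purpleI) (use a.eq27(2)[OF assms] that in auto)
  show "card l = 3" if l: "l \<in> lines" for l
  proof -
    obtain Q R where Q: "Q \<in> S" "R \<in> S" "Q \<noteq> R" "l = L Q R" using l unfolding lines_def by blast
    interpret b: purple S L Red Blue p Pl Q by (rule pur[OF Q(1)])
    show "card l = 3" by (rule b.eq27(3)[OF assms]) (use Q b.TQ_I in auto)
  qed
  show "card \<pi> = 9" if pi: "plane \<pi>" for \<pi>
  proof -
    obtain Q where Q: "Q \<in> \<pi>" using plane_ex3[OF pi] by blast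
    interpret b: purple S L Red Blue p Pl Q by (rule pur) (use Q plane_sub[OF pi] in auto)
    show "card \<pi> = 9" by (rule b.eq27(4)[OF assms pi Q])
  qed
qed

end

section \<open>Points represented by vectors modulo a subspace\<close>

definition lsub :: "('a::division_ring^'n) set \<Rightarrow> bool" where
  "lsub W \<longleftrightarrow> 0 \<in> W \<and> (\<forall>x\<in>W. \<forall>y\<in>W. x + y \<in> W) \<and> (\<forall>c. \<forall>x\<in>W. c *s x \<in> W)"

text \<open>The left subspace spanned by \<open>W\<close> and \<open>a\<close>, if \<open>W\<close> is a left subspace.\<close>

definition adj :: "('a::division_ring^'n) set \<Rightarrow> 'a^'n \<Rightarrow> ('a^'n) set" where
  "adj W a = {w + c *s a |w c. w \<in> W}"

lemma lsubD: "lsub W \<Longrightarrow> 0 \<in> W" "lsub W \<Longrightarrow> x \<in> W \<Longrightarrow> y \<in> W \<Longrightarrow> x + y \<in> W" "lsub W \<Longrightarrow> x \<in> W \<Longrightarrow> c *s x \<in> W"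
  unfolding lsub_def by auto

lemma lsub_diff: "lsub W \<Longrightarrow> x \<in> W \<Longrightarrow> y \<in> W \<Longrightarrow> x - y \<in> W"
proof -
  assume W: "lsub W" "x \<in> W" "y \<in> W"
  have "x - y = x + (-1) *s y" by (simp add: vec_eq_iff)
  then show ?thesis using lsubD(2)[OF W(1,2) lsubD(3)[OF W(1,3)]] by (simp only:)
qed

lemma zero_smult: "(0::'a::division_ring) *s (x::'a^'n) = 0"
  by (simp add: vec_eq_iff)

lemma in_adj: "x \<in> adj W a \<longleftrightarrow> (\<exists>c. x - c *s a \<in> W)"
proof
  assume "x \<in> adj W a"
  then obtain w c where "w \<in> W" "x = w + c *s a" unfolding adj_def by auto
  then have "x - c *s a \<in> W" by simp
  then show "\<exists>c. x - c *s a \<in> W" by blast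
next
  assume "\<exists>c. x - c *s a \<in> W"
  then obtain c where "x - c *s a \<in> W" by blast
  moreover have "x = (x - c *s a) + c *s a" by simp
  ultimately show "x \<in> adj W a" unfolding adj_def by blast
qed

lemma in_adj2: "x \<in> adj (adj W a) b \<longleftrightarrow> (\<exists>c d. x - c *s a - d *s b \<in> W)"
proof -
  have "x - d *s b - c *s a = x - c *s a - d *s b" for c d by simp
  then show ?thesis unfolding in_adj by metis
qed

lemma lsub_adj: "lsub W \<Longrightarrow> lsub (adj W a)"
  unfolding lsub_def[of "adj W a"]
proof (intro conjI ballI allI)
  assume W: "lsub W"
  have "(0::'a^'b) - 0 *s a \<in> W" using lsubD(1)[OF W] by (simp add: vec_eq_iff)
  then show "0 \<in> adj W a" unfolding in_adj by blast
  fix x assume x: "x \<in> adj W a"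
  then obtain c where c: "x - c *s a \<in> W" unfolding in_adj by blast
  show "k *s x \<in> adj W a" for k
  proof -
    have "k *s x - (k * c) *s a = k *s (x - c *s a)" by (simp add: vec_eq_iff algebra_simps)
    then have "k *s x - (k * c) *s a \<in> W" using lsubD(3)[OF W c] by (simp only:)
    then show ?thesis unfolding in_adj by blast
  qed
  fix y assume "y \<in> adj W a"
  then obtain d where d: "y - d *s a \<in> W" unfolding in_adj by blast
  have "(x + y) - (c + d) *s a = (x - c *s a) + (y - d *s a)" by (simp add: vec_eq_iff algebra_simps)
  then have "(x + y) - (c + d) *s a \<in> W" using lsubD(2)[OF W c d] by (simp only:)
  then show "x + y \<in> adj W a" unfolding in_adj by blast
qed

lemma adj_sub: "lsub W \<Longrightarrow> x \<in> W \<Longrightarrow> x \<in> adj W a"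
proof -
  assume "lsub W" "x \<in> W"
  then have "x - 0 *s a \<in> W" by (simp add: vec_eq_iff)
  then show ?thesis unfolding in_adj by blast
qed

lemma adj_self: "lsub W \<Longrightarrow> a \<in> adj W a"
proof -
  assume "lsub W"
  then have "a - 1 *s a \<in> W" using lsubD(1) by simp
  then show ?thesis unfolding in_adj by blast
qed

lemma adj_least: "lsub U \<Longrightarrow> W \<subseteq> U \<Longrightarrow> a \<in> U \<Longrightarrow> adj W a \<subseteq> U"
  unfolding adj_def using lsubD(2,3) by blast

lemma adj_commute: "lsub W \<Longrightarrow> adj (adj W a) b = adj (adj W b) a"
proof -
  have "adj (adj W a) b \<subseteq> adj (adj W b) a" if W: "lsub W" for a b
    by (intro adj_least lsub_adj W subsetI) (use adj_sub adj_self lsub_adj W in blast)+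
  then show "lsub W \<Longrightarrow> ?thesis" by blast
qed

lemma smult_inverse:
  fixes b :: "'a::division_ring^'n"
  shows "c \<noteq> 0 \<Longrightarrow> b - inverse c *s (b' :: 'a^'n) = inverse c *s (c *s b - b')"
  by (simp add: vec_eq_iff algebra_simps flip: mult.assoc)

lemma adj_exchange: "lsub W \<Longrightarrow> b \<in> adj W a \<Longrightarrow> b \<notin> W \<Longrightarrow> adj W b = adj W a"
proof
  assume W: "lsub W" and b: "b \<in> adj W a" "b \<notin> W"
  show "adj W b \<subseteq> adj W a" by (rule adj_least[OF lsub_adj[OF W]]) (use adj_sub[OF W] b in auto)
  obtain c where c: "b - c *s a \<in> W" using b unfolding in_adj by blast
  have "c \<noteq> 0" using c b by (auto simp: vec_eq_iff)
  then have "a - inverse c *s b = inverse c *s (c *s a - b)" by (rule smult_inverse)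
  moreover have "c *s a - b = (-1) *s (b - c *s a)" by (simp add: vec_eq_iff)
  ultimately have "a - inverse c *s b \<in> W" using lsubD(3)[OF W] c by metis
  then have "a \<in> adj W b" unfolding in_adj by blast
  then show "adj W a \<subseteq> adj W b" by (intro adj_least[OF lsub_adj[OF W]]) (use adj_sub[OF W] in auto)
qed

lemma adj_exchange2:
  assumes W: "lsub W" and x: "x \<in> adj (adj W a) b" "x \<notin> W" and y: "y \<in> adj (adj W a) b" "y \<notin> adj W x"
  shows "adj (adj W x) y = adj (adj W a) b"
proof (cases "x \<in> adj W a")
  case True
  have "adj W x = adj W a" by (rule adj_exchange[OF W True x(2)])
  then show ?thesis using adj_exchange[OF lsub_adj[OF W] y(1)] y(2) by simp
next
  case False
  then have e: "adj (adj W a) b = adj (adj W x) a"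
    using adj_exchange[OF lsub_adj[OF W] x(1)] adj_commute[OF W, of a x] False by simp
  show ?thesis using adj_exchange[OF lsub_adj[OF W] y(1)[unfolded e] y(2)] e by simp
qed

lemma adj_exchange3:
  assumes W: "lsub W" and x: "x \<in> adj (adj (adj W a) b) c" "x \<notin> W" and y: "y \<in> adj (adj (adj W a) b) c" "y \<notin> adj W x"
    and z: "z \<in> adj (adj (adj W a) b) c" "z \<notin> adj (adj W x) y"
  shows "adj (adj (adj W x) y) z = adj (adj (adj W a) b) c"
proof -
  note l1 = lsub_adj[OF W] and l2 = lsub_adj[OF lsub_adj[OF W]]
  have "\<exists>d e. adj (adj (adj W a) b) c = adj (adj (adj W x) d) e"
  proof (cases "x \<in> adj W a")
    case True
    have "adj W x = adj W a" by (rule adj_exchange[OF W True x(2)])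
    then show ?thesis by (intro exI[of _ b] exI[of _ c]) simp
  next
    case n1: False
    show ?thesis
    proof (cases "x \<in> adj (adj W a) b")
      case True
      then have "adj (adj W a) b = adj (adj W x) a" using adj_exchange[OF l1 True n1] adj_commute[OF W, of a x] by simp
      then show ?thesis by (intro exI[of _ a] exI[of _ c]) simp
    next
      case False
      then have "adj (adj (adj W a) b) c = adj (adj (adj W a) b) x" using adj_exchange[OF l2 x(1)] by simp
      also have "\<dots> = adj (adj (adj W x) a) b" using adj_commute[OF l1, of a b x] adj_commute[OF W, of a x] by simp
      finally show ?thesis by (intro exI[of _ a] exI[of _ b]) simp
    qed
  qed
  then obtain d e where de: "adj (adj (adj W a) b) c = adj (adj (adj W x) d) e" by blast
  show ?thesis using adj_exchange2[OF l1 y(1)[unfolded de] y(2) z(1)[unfolded de] z(2)] de by simp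
qed

lemma independent3:
  assumes W: "lsub W" and a: "a \<notin> W" and b: "b \<notin> adj W a" and c: "c \<notin> adj (adj W a) b"
    and s: "x *s a + y *s b + z *s c \<in> W"
  shows "x = 0" "y = 0" "z = 0"
proof -
  show z: "z = 0"
  proof (rule ccontr)
    assume z: "z \<noteq> 0"
    have "c - (- (inverse z * x)) *s a - (- (inverse z * y)) *s b = inverse z *s (x *s a + y *s b + z *s c)"
      using z by (simp add: vec_eq_iff algebra_simps flip: mult.assoc)
    then show False using lsubD(3)[OF W s] c unfolding in_adj2 by metis
  qed
  show y: "y = 0"
  proof (rule ccontr)
    assume y: "y \<noteq> 0"
    have "b - (- (inverse y * x)) *s a = inverse y *s (x *s a + y *s b + z *s c)"
      using y z by (simp add: vec_eq_iff algebra_simps flip: mult.assoc)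
    then show False using lsubD(3)[OF W s] b unfolding in_adj by metis
  qed
  show "x = 0"
  proof (rule ccontr)
    assume x: "x \<noteq> 0"
    have "a = inverse x *s (x *s a + y *s b + z *s c)"
      using x y z by (simp add: vec_eq_iff algebra_simps flip: mult.assoc)
    then show False using lsubD(3)[OF W s] a by metis
  qed
qed

text \<open>Points are independent modulo \<open>W\<close>. The case \<open>W = {0}\<close> describes the points of \<open>S\<close>; with \<open>W\<close> spanned
  by the vector of \<open>P\<close> it describes the lines through \<open>P\<close>, so both inherit Desargues' theorem at once.\<close>

locale represented =
  fixes T :: "'p set" and L :: "'p \<Rightarrow> 'p \<Rightarrow> 'p set" and v :: "'p \<Rightarrow> 'a::division_ring^'n" and W :: "('a^'n) set"
  assumes finT: "finite T" and W: "lsub W"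
    and vW: "a \<in> T \<Longrightarrow> v a \<notin> W"
    and dist: "a \<in> T \<Longrightarrow> b \<in> T \<Longrightarrow> a \<noteq> b \<Longrightarrow> v b \<notin> adj W (v a)"
    and L_rep: "a \<in> T \<Longrightarrow> b \<in> T \<Longrightarrow> a \<noteq> b \<Longrightarrow> L a b = {c \<in> T. v c \<in> adj (adj W (v a)) (v b)}"
begin

lemma W1: "lsub (adj W x)" and W2: "lsub (adj (adj W x) y)"
  using lsub_adj W by auto

lemma line_span: "a \<in> T \<Longrightarrow> b \<in> T \<Longrightarrow> a \<noteq> b \<Longrightarrow> c \<in> L a b \<Longrightarrow> d \<in> L a b \<Longrightarrow> c \<noteq> d \<Longrightarrow>
    adj (adj W (v c)) (v d) = adj (adj W (v a)) (v b)"
  using L_rep[of a b] by (intro adj_exchange2[OF W]) (use vW dist in auto)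

sublocale linspace T L
proof
  show "finite T" by (rule finT)
  fix x y assume xy: "x \<in> T" "y \<in> T" "x \<noteq> y"
  show "L x y \<subseteq> T" unfolding L_rep[OF xy] by auto
  show "x \<in> L x y" "y \<in> L x y" unfolding L_rep[OF xy] using xy adj_self[OF W1] adj_sub[OF W1 adj_self[OF W]] by auto
  show "L c d = L x y" if "c \<in> L x y" "d \<in> L x y" "c \<noteq> d" for c d
  proof -
    have "c \<in> T" "d \<in> T" using that L_rep[OF xy] by auto
    then show ?thesis using line_span[OF xy that] L_rep[OF xy] L_rep[of c d] that by simp
  qed
qed

lemma L_iff: "a \<in> T \<Longrightarrow> b \<in> T \<Longrightarrow> a \<noteq> b \<Longrightarrow> c \<in> T \<Longrightarrow> c \<in> L a b \<longleftrightarrow> (\<exists>x y. v c - x *s v a - y *s v b \<in> W)"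
  by (simp add: L_rep in_adj2)

lemma L_I: "a \<in> T \<Longrightarrow> b \<in> T \<Longrightarrow> a \<noteq> b \<Longrightarrow> c \<in> T \<Longrightarrow> v c - x *s v a - y *s v b \<in> W \<Longrightarrow> c \<in> L a b"
  unfolding L_iff by blast

lemma L_E:
  assumes "a \<in> T" "b \<in> T" "a \<noteq> b" "c \<in> L a b"
  obtains x y where "v c - x *s v a - y *s v b \<in> W"
  using assms L_iff[OF assms(1-3)] L_mem by blast

lemma ind3:
  assumes "a \<in> T" "b \<in> T" "c \<in> T" "a \<noteq> b" "c \<notin> L a b" "x *s v a + y *s v b + z *s v c \<in> W"
  shows "x = 0" "y = 0" "z = 0"
  using independent3[OF W vW[OF assms(1)] dist[OF assms(1,2,4)] _ assms(6)] assms L_rep by auto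

lemma char_two: "(2::'a) = 0 \<Longrightarrow> CHAR('a) = 2"
proof -
  assume "(2::'a) = 0"
  then have "of_nat 2 = (0::'a)" by simp
  then have d: "CHAR('a) dvd 2" using of_nat_eq_0_iff_char_dvd by blast
  have "CHAR('a) \<noteq> 1" using of_nat_CHAR[where 'a='a] by (metis of_nat_1 zero_neq_one)
  moreover have "CHAR('a) \<noteq> 0" using d by (metis dvd_0_left_iff zero_neq_numeral)
  moreover have "CHAR('a) \<le> 2" using d by (rule dvd_imp_le) simp
  ultimately show ?thesis by linarith
qed

lemma fano: "fano_prop CHAR('a) T L"
  unfolding fano_prop_def
proof (intro ballI impI)
  fix a b c d e f g
  assume T: "a \<in> T" "b \<in> T" "c \<in> T" "d \<in> T" "e \<in> T" "f \<in> T" "g \<in> T" and ab: "a \<noteq> b"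
    and c: "c \<notin> L a b" and d: "d \<notin> L a b" "d \<notin> L a c" "d \<notin> L b c"
    and e: "e \<in> L a b" "e \<in> L c d" and f: "f \<in> L a c" "f \<in> L b d" and g: "g \<in> L a d" "g \<in> L b c"
    and ef: "e \<noteq> f" and gef: "g \<in> L e f"
  have n: "a \<noteq> c" "b \<noteq> c" "a \<noteq> d" "b \<noteq> d" "c \<noteq> d" using c d L_l L_r T ab by metis+
  have "e \<noteq> c" using e c by auto
  have "d \<in> L c e" using L_eq[OF T(3,4) n(5) L_l[OF T(3,4) n(5)] e(2)] L_r[OF T(3,4) n(5)] \<open>e \<noteq> c\<close> by auto
  then obtain d1 d2 where d12: "v d - d1 *s v c - d2 *s v e \<in> W" using L_E[OF T(3,5) \<open>e \<noteq> c\<close>[symmetric]] by metis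
  obtain e1 e2 where e12: "v e - e1 *s v a - e2 *s v b \<in> W" using e L_E[OF T(1,2) ab] by metis
  define x y z where "x = d2 * e1" and "y = d2 * e2" and "z = d1"
  have "v d - x *s v a - y *s v b - z *s v c = (v d - d1 *s v c - d2 *s v e) + d2 *s (v e - e1 *s v a - e2 *s v b)"
    unfolding x_def y_def z_def by (simp add: vec_eq_iff algebra_simps)
  then have dW: "v d - x *s v a - y *s v b - z *s v c \<in> W" using lsubD(2)[OF W d12 lsubD(3)[OF W e12]] by (simp only:)
  have x0: "x \<noteq> 0" 
  proof
    assume "x = 0"
    then have "v d - y *s v b - z *s v c \<in> W" using dW by (simp add: zero_smult)
    then have "d \<in> L b c" by (rule L_I[OF T(2,3) n(2) T(4)])
    then show False using d(3) by simp
  qed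
  have y0: "y \<noteq> 0" 
  proof
    assume "y = 0"
    then have "v d - x *s v a - z *s v c \<in> W" using dW by (simp add: zero_smult)
    then have "d \<in> L a c" by (rule L_I[OF T(1,3) n(1) T(4)])
    then show False using d(2) by simp
  qed
  have z0: "z \<noteq> 0" 
  proof
    assume "z = 0"
    then have "v d - x *s v a - y *s v b \<in> W" using dW by (simp add: zero_smult)
    then have "d \<in> L a b" by (rule L_I[OF T(1,2) ab T(4)])
    then show False using d(1) by simp
  qed
  note i3 = ind3[OF T(1,2,3) ab c]
  obtain e3 e4 where e34: "v e - e3 *s v c - e4 *s v d \<in> W" using e L_E[OF T(3,4) n(5)] by metis
  have "(e4 * x - e1) *s v a + (e4 * y - e2) *s v b + (e3 + e4 * z) *s v c =
      (v e - e1 *s v a - e2 *s v b) - (v e - e3 *s v c - e4 *s v d) - e4 *s (v d - x *s v a - y *s v b - z *s v c)"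
    by (simp add: vec_eq_iff algebra_simps)
  then have ee: "(e4 * x - e1) *s v a + (e4 * y - e2) *s v b + (e3 + e4 * z) *s v c \<in> W"
    using lsub_diff[OF W lsub_diff[OF W e12 e34] lsubD(3)[OF W dW]] by (simp only:)
  have e': "e1 = e4 * x" "e2 = e4 * y" using i3[OF ee] by auto
  obtain f1 f2 where f12: "v f - f1 *s v a - f2 *s v c \<in> W" using f L_E[OF T(1,3) n(1)] by metis
  obtain f3 f4 where f34: "v f - f3 *s v b - f4 *s v d \<in> W" using f L_E[OF T(2,4) n(4)] by metis
  have "(f4 * x - f1) *s v a + (f3 + f4 * y) *s v b + (f4 * z - f2) *s v c =
      (v f - f1 *s v a - f2 *s v c) - (v f - f3 *s v b - f4 *s v d) - f4 *s (v d - x *s v a - y *s v b - z *s v c)"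
    by (simp add: vec_eq_iff algebra_simps)
  then have ff: "(f4 * x - f1) *s v a + (f3 + f4 * y) *s v b + (f4 * z - f2) *s v c \<in> W"
    using lsub_diff[OF W lsub_diff[OF W f12 f34] lsubD(3)[OF W dW]] by (simp only:)
  have f': "f1 = f4 * x" "f2 = f4 * z" using i3[OF ff] by auto
  obtain g1 g2 where g12: "v g - g1 *s v b - g2 *s v c \<in> W" using g L_E[OF T(2,3) n(2)] by metis
  obtain g3 g4 where g34: "v g - g3 *s v a - g4 *s v d \<in> W" using g L_E[OF T(1,4) n(3)] by metis
  have "(g3 + g4 * x) *s v a + (g4 * y - g1) *s v b + (g4 * z - g2) *s v c =
      (v g - g1 *s v b - g2 *s v c) - (v g - g3 *s v a - g4 *s v d) - g4 *s (v d - x *s v a - y *s v b - z *s v c)"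
    by (simp add: vec_eq_iff algebra_simps)
  then have gg: "(g3 + g4 * x) *s v a + (g4 * y - g1) *s v b + (g4 * z - g2) *s v c \<in> W"
    using lsub_diff[OF W lsub_diff[OF W g12 g34] lsubD(3)[OF W dW]] by (simp only:)
  have g': "g1 = g4 * y" "g2 = g4 * z" using i3[OF gg] by auto
  obtain p q where pq: "v g - p *s v e - q *s v f \<in> W" using gef L_E[OF T(5,6) ef] by metis
  have "((p * e4 + q * f4) * x) *s v a + ((p * e4 - g4) * y) *s v b + ((q * f4 - g4) * z) *s v c =
     (v g - g1 *s v b - g2 *s v c) - (v g - p *s v e - q *s v f) - p *s (v e - e1 *s v a - e2 *s v b) - q *s (v f - f1 *s v a - f2 *s v c)"
    unfolding e' f' g' by (simp add: vec_eq_iff algebra_simps)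
  then have "((p * e4 + q * f4) * x) *s v a + ((p * e4 - g4) * y) *s v b + ((q * f4 - g4) * z) *s v c \<in> W"
    using lsub_diff[OF W lsub_diff[OF W lsub_diff[OF W g12 pq] lsubD(3)[OF W e12]] lsubD(3)[OF W f12]] by (simp only:)
  from i3[OF this] have k: "p * e4 + q * f4 = 0" "p * e4 = g4" "q * f4 = g4" using x0 y0 z0 by auto
  then have "g4 + g4 = 0" by simp
  then have "2 * g4 = 0" by (simp add: mult_2)
  moreover have "g4 \<noteq> 0"
  proof
    assume "g4 = 0"
    then have "v g \<in> W" using g12 g' by (simp add: zero_smult)
    then show False using vW[OF T(7)] by simp
  qed
  ultimately have "(2::'a) = 0" by simp
  then show "CHAR('a) = 2" by (rule char_two)
qed

end

lemma smult_smult: "c *s (d *s x) = (c * d) *s (x :: 'a::division_ring^'n)"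
  by (simp add: vec_eq_iff mult.assoc)

lemma inv_smult: "c \<noteq> 0 \<Longrightarrow> inverse c *s (c *s x) = (x :: 'a::division_ring^'n)"
  by (simp add: vec_eq_iff flip: mult.assoc)

lemma cancel: "c \<noteq> 0 \<Longrightarrow> a * inverse c * c = a" "c \<noteq> 0 \<Longrightarrow> a * c * inverse c = a" for a c :: "'a::division_ring"
  by (simp_all add: mult.assoc)

lemma cancel_left:
  fixes m r :: "'a::division_ring"
  shows "m \<noteq> 0 \<Longrightarrow> m * (inverse m * r) = r" "m \<noteq> 0 \<Longrightarrow> m * (inverse m * a * b * c) = a * (b * c)"
    "m \<noteq> 0 \<Longrightarrow> r \<noteq> 0 \<Longrightarrow> inverse r * m * (inverse m * r) = 1"
  by (simp_all add: cancel flip: mult.assoc)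

lemma proportional_diff:
  fixes g x y :: "'a::division_ring^'n"
  shows "m \<noteq> 0 \<Longrightarrow> y - (n * inverse m) *s x = (y - n *s g) - (n * inverse m) *s (x - m *s g)"
  by (simp add: vec_eq_iff algebra_simps cancel flip: mult.assoc)

context represented begin

lemma coordinate:
  assumes q: "q \<in> T" "g \<in> T" "g \<noteq> q" and k: "v g - k *s c \<in> W" "k \<noteq> 0" and x: "x \<in> L q g" "x \<noteq> q"
  shows "\<exists>u l. l \<noteq> 0 \<and> v x - l *s (c + u *s v q) \<in> W"
proof -
  have xT: "x \<in> T" using L_mem[OF q(1,2) q(3)[symmetric] x(1)] .
  obtain r d where rd: "v x - r *s v q - d *s v g \<in> W" using L_E[OF q(1,2) q(3)[symmetric] x(1)] by metis
  have d: "d \<noteq> 0"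
  proof
    assume "d = 0"
    then have "v x - r *s v q \<in> W" using rd by (simp add: zero_smult)
    then have "v x \<in> adj W (v q)" unfolding in_adj by blast
    then show False using dist[OF q(1) xT] x(2) by simp
  qed
  have "v x - (d * k) *s (c + (inverse (d * k) * r) *s v q) = (v x - r *s v q - d *s v g) + d *s (v g - k *s c)"
    using d k(2) by (simp add: vec_eq_iff algebra_simps cancel flip: mult.assoc)
  then have "v x - (d * k) *s (c + (inverse (d * k) * r) *s v q) \<in> W" using lsubD(2)[OF W rd lsubD(3)[OF W k(1)]] by (simp only:)
  moreover have "d * k \<noteq> 0" using d k(2) by simp
  ultimately show ?thesis by blast
qed

text \<open>Scale so that the vectors of three collinear points on the lines are \<open>al\<close>, \<open>be\<close> and \<open>al + be\<close>. The coordinate of a point is then the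
  coefficient of the vector of \<open>q\<close>.\<close>

lemma concurrent: "concurrent_prop CHAR('a) T L"
  unfolding concurrent_prop_def
proof (intro ballI allI impI)
  fix q a b c A B C
  assume q: "q \<in> T" and abc: "a \<in> T - {q}" "b \<in> T - {q}" "c \<in> T - {q}"
    and ne: "L q a \<noteq> L q b" "L q a \<noteq> L q c" "L q b \<noteq> L q c"
    and A: "A \<subseteq> L q a - {q}" and B: "B \<subseteq> L q b - {q}" and C: "C \<subseteq> L q c - {q}"
    and A0: "A \<noteq> {}" and B2: "2 \<le> card B"
    and AB: "\<forall>x\<in>A. \<forall>y\<in>B. \<exists>z\<in>C. z \<in> L x y" and BC: "\<forall>y\<in>B. \<forall>z\<in>C. \<exists>x\<in>A. x \<in> L y z"
  have on: "x \<in> T \<and> x \<noteq> q \<and> L q x = L q g" if g: "g \<in> T - {q}" and x: "x \<in> L q g - {q}" for x g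
  proof -
    have g': "g \<in> T" "q \<noteq> g" using g by auto
    show ?thesis using L_mem[OF q g'] L_eq[OF q g' L_l[OF q g'], of x] x by auto
  qed
  have oA: "x \<in> T" "x \<noteq> q" "L q x = L q a" if "x \<in> A" for x using on[OF abc(1), of x] A that by auto
  have oB: "x \<in> T" "x \<noteq> q" "L q x = L q b" if "x \<in> B" for x using on[OF abc(2), of x] B that by auto
  have oC: "x \<in> T" "x \<noteq> q" "L q x = L q c" if "x \<in> C" for x using on[OF abc(3), of x] C that by auto
  obtain y1 y2 where y12: "y1 \<in> B" "y2 \<in> B" "y1 \<noteq> y2" using two_of_card[OF B2] by blast
  obtain x0 where x0: "x0 \<in> A" using A0 by blast
  define y0 where "y0 = y1"
  have y0: "y0 \<in> B" using y12 y0_def by simp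
  obtain z0 where z0: "z0 \<in> C" "z0 \<in> L x0 y0" using AB x0 y0 by blast
  note X = oA[OF x0] and Y = oB[OF y0] and Z = oC[OF z0(1)]
  have sep: "y \<notin> L q x" if "x \<in> T" "x \<noteq> q" "y \<in> T" "y \<noteq> q" "L q x \<noteq> L q y" for x y
    using L_eq[OF q that(1) that(2)[symmetric] L_l[OF q that(1) that(2)[symmetric]], of y] that by auto
  have xy0: "x0 \<noteq> y0" using X Y ne by auto
  obtain s t where st: "v z0 - s *s v x0 - t *s v y0 \<in> W" using L_E[OF X(1) Y(1) xy0 z0(2)] by metis
  have s0: "s \<noteq> 0"
  proof
    assume "s = 0"
    then have "v z0 - 0 *s v q - t *s v y0 \<in> W" using st by (simp add: zero_smult)
    then have "z0 \<in> L q y0" by (rule L_I[OF q Y(1) Y(2)[symmetric] Z(1)])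
    then show False using sep[OF Y(1,2) Z(1,2)] Y(3) Z(3) ne by auto
  qed
  have t0: "t \<noteq> 0"
  proof
    assume "t = 0"
    then have "v z0 - 0 *s v q - s *s v x0 \<in> W" using st by (simp add: zero_smult)
    then have "z0 \<in> L q x0" by (rule L_I[OF q X(1) X(2)[symmetric] Z(1)])
    then show False using sep[OF X(1,2) Z(1,2)] X(3) Z(3) ne by auto
  qed
  define al where "al = s *s v x0"
  define be where "be = t *s v y0"
  have ind: "i = 0 \<and> j = 0 \<and> k = 0" if "i *s v q + j *s al + k *s be \<in> W" for i j k
  proof -
    have "i *s v q + (j * s) *s v x0 + (k * t) *s v y0 \<in> W" using that unfolding al_def be_def smult_smult .
    moreover have "y0 \<notin> L q x0" by (rule sep) (use X Y ne in auto)
    ultimately have "i = 0" "j * s = 0" "k * t = 0" using ind3[OF q X(1) Y(1) X(2)[symmetric]] by metis+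
    then show ?thesis using s0 t0 by simp
  qed
  have W0: "0 \<in> W" by (rule lsubD(1)[OF W])
  have bx: "v x0 - inverse s *s al \<in> W" "inverse s \<noteq> 0" unfolding al_def inv_smult[OF s0] using s0 W0 by auto
  have bY: "v y0 - inverse t *s be \<in> W" "inverse t \<noteq> 0" unfolding be_def inv_smult[OF t0] using t0 W0 by auto
  have "v z0 - 1 *s (al + be) = v z0 - s *s v x0 - t *s v y0" unfolding al_def be_def by (simp add: vec_eq_iff)
  then have bz: "v z0 - 1 *s (al + be) \<in> W" using st by (simp only:)
  have eA: "\<forall>x\<in>A. \<exists>u l. l \<noteq> 0 \<and> v x - l *s (al + u *s v q) \<in> W"
  proof
    fix x assume x: "x \<in> A"
    show "\<exists>u l. l \<noteq> 0 \<and> v x - l *s (al + u *s v q) \<in> W"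
      by (rule coordinate[OF q X(1,2) bx]) (use A x X(3) oA[OF x] in auto)
  qed
  have eB: "\<forall>x\<in>B. \<exists>u l. l \<noteq> 0 \<and> v x - l *s (be + u *s v q) \<in> W"
  proof
    fix x assume x: "x \<in> B"
    show "\<exists>u l. l \<noteq> 0 \<and> v x - l *s (be + u *s v q) \<in> W"
      by (rule coordinate[OF q Y(1,2) bY]) (use B x Y(3) oB[OF x] in auto)
  qed
  have eC: "\<forall>x\<in>C. \<exists>u l. l \<noteq> 0 \<and> v x - l *s ((al + be) + u *s v q) \<in> W"
  proof
    fix x assume x: "x \<in> C"
    show "\<exists>u l. l \<noteq> 0 \<and> v x - l *s ((al + be) + u *s v q) \<in> W"
      by (rule coordinate[OF q Z(1,2) bz]) (use C x Z(3) oC[OF x] in auto)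
  qed
  obtain fu where fu: "\<forall>x\<in>A. \<exists>l. l \<noteq> 0 \<and> v x - l *s (al + fu x *s v q) \<in> W" using bchoice[OF eA] by blast
  obtain fv where fv: "\<forall>x\<in>B. \<exists>l. l \<noteq> 0 \<and> v x - l *s (be + fv x *s v q) \<in> W" using bchoice[OF eB] by blast
  obtain fw where fw: "\<forall>x\<in>C. \<exists>l. l \<noteq> 0 \<and> v x - l *s ((al + be) + fw x *s v q) \<in> W" using bchoice[OF eC] by blast
  have rel: "fw z = fu x + fv y" if x: "x \<in> A" and y: "y \<in> B" and z: "z \<in> C" and zl: "z \<in> L x y" for x y z
  proof -
    obtain xi where xi: "v x - xi *s (al + fu x *s v q) \<in> W" using fu x by blast
    obtain et where et: "v y - et *s (be + fv y *s v q) \<in> W" using fv y by blast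
    obtain ze where ze: "ze \<noteq> 0" "v z - ze *s ((al + be) + fw z *s v q) \<in> W" using fw z by blast
    have "x \<noteq> y" using oA(3)[OF x] oB(3)[OF y] ne by auto
    then obtain k m where km: "v z - k *s v x - m *s v y \<in> W" using L_E[OF oA(1)[OF x] oB(1)[OF y] _ zl] by metis
    have "(ze * fw z - k * xi * fu x - m * et * fv y) *s v q + (ze - k * xi) *s al + (ze - m * et) *s be =
       (v z - k *s v x - m *s v y) - (v z - ze *s ((al + be) + fw z *s v q)) + k *s (v x - xi *s (al + fu x *s v q)) + m *s (v y - et *s (be + fv y *s v q))"
      by (simp add: vec_eq_iff algebra_simps)
    then have "(ze * fw z - k * xi * fu x - m * et * fv y) *s v q + (ze - k * xi) *s al + (ze - m * et) *s be \<in> W"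
      using lsubD(2)[OF W lsubD(2)[OF W lsub_diff[OF W km ze(2)] lsubD(3)[OF W xi]] lsubD(3)[OF W et]] by (simp only:)
    from ind[OF this] have "ze * fw z - k * xi * fu x - m * et * fv y = 0" "k * xi = ze" "m * et = ze" by auto
    then have "ze * (fw z - (fu x + fv y)) = 0" by (simp add: algebra_simps)
    then show ?thesis using ze(1) by simp
  qed
  define h where "h = fv y1 - fv y2"
  have h0: "h \<noteq> 0"
  proof
    assume "h = 0"
    then have e: "fv y1 = fv y2" unfolding h_def by simp
    obtain l1 where l1: "l1 \<noteq> 0" "v y1 - l1 *s (be + fv y1 *s v q) \<in> W" using fv y12(1) by blast
    obtain l2 where l2: "l2 \<noteq> 0" "v y2 - l2 *s (be + fv y1 *s v q) \<in> W" using fv y12(2) e by metis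
    have "v y1 - (l1 * inverse l2) *s v y2 = (v y1 - l1 *s (be + fv y1 *s v q)) - (l1 * inverse l2) *s (v y2 - l2 *s (be + fv y1 *s v q))"
      using l2(1) by (simp add: vec_eq_iff algebra_simps cancel flip: mult.assoc)
    then have "v y1 - (l1 * inverse l2) *s v y2 \<in> W" using lsub_diff[OF W l1(2) lsubD(3)[OF W l2(2)]] by (simp only:)
    then have "v y1 \<in> adj W (v y2)" unfolding in_adj by blast
    then show False using dist[OF oB(1)[OF y12(2)] oB(1)[OF y12(1)]] y12(3) by simp
  qed
  have step: "fu x + h \<in> fu ` A" if x: "x \<in> A" for x
  proof -
    obtain z where z: "z \<in> C" "z \<in> L x y1" using AB x y12(1) by blast
    obtain x' where x': "x' \<in> A" "x' \<in> L y2 z" using BC y12(2) z(1) by blast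
    have n: "y2 \<noteq> z" "x' \<noteq> y2" using oB(3)[OF y12(2)] oC(3)[OF z(1)] oA(3)[OF x'(1)] ne by auto
    note T' = oB(1)[OF y12(2)] oC(1)[OF z(1)]
    have "z \<in> L x' y2" using L_eq[OF T' n(1) x'(2) L_l[OF T' n(1)] n(2)] L_r[OF T' n(1)] by simp
    then have "fu x' = fu x + h" using rel[OF x'(1) y12(2) z(1)] rel[OF x y12(1) z] unfolding h_def by (simp add: algebra_simps)
    then show ?thesis using x'(1) by (metis imageI)
  qed
  have fA: "finite A" using finite_subset[OF _ fin, of A] oA(1) by blast
  have many: "fu x0 + of_nat k * h \<in> fu ` A" for k
  proof (induction k)
    case (Suc k)
    then obtain x where "x \<in> A" "fu x = fu x0 + of_nat k * h" by auto
    then show ?case using step[of x] by (simp add: algebra_simps)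
  qed (use x0 in simp)
  have "\<not> inj_on (\<lambda>k. fu x0 + of_nat k * h) {..card A}"
  proof
    assume i: "inj_on (\<lambda>k. fu x0 + of_nat k * h) {..card A}"
    have "card {..card A} \<le> card (fu ` A)" by (rule card_inj_on_le[OF i]) (use many fA in auto)
    also have "\<dots> \<le> card A" by (rule card_image_le[OF fA])
    finally show False by simp
  qed
  then obtain i j where ij: "i \<le> card A" "j \<le> card A" "i \<noteq> j" "of_nat i * h = of_nat j * h" unfolding inj_on_def by auto
  have key: "CHAR('a) \<noteq> 0 \<and> CHAR('a) \<le> card A" if "i < j" "j \<le> card A" "of_nat i * h = of_nat j * h" for i j :: nat
  proof -
    have "of_nat i = (of_nat j :: 'a)" using that(3) h0 by simp
    then have "of_nat (j - i) = (0::'a)" using that(1) by (simp add: of_nat_diff)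
    then have d: "CHAR('a) dvd j - i" using of_nat_eq_0_iff_char_dvd by blast
    then have "CHAR('a) \<le> j - i" by (rule dvd_imp_le) (use that in simp)
    moreover have "CHAR('a) \<noteq> 0"
    proof
      assume "CHAR('a) = 0"
      then have "j - i = 0" using d by simp
      then show False using that(1) by simp
    qed
    ultimately show ?thesis using that(2) by linarith
  qed
  show "CHAR('a) \<noteq> 0 \<and> CHAR('a) \<le> card A"
    using key[of i j] key[of j i] ij by (cases "i < j") auto
qed

text \<open>In coordinates in which the common point \<open>e\<close> of the two lines is at infinity, a perspectivity from the point with parameter \<open>sg\<close> has slope
  \<open>-1 / sg\<close>.\<close>

lemma perspective_step:
  assumes ind: "\<And>i j k. i *s e + j *s al + k *s be \<in> W \<Longrightarrow> i = 0 \<and> j = 0 \<and> k = 0"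
    and x: "vx - xi *s (al + ka *s e + sg *s be) \<in> W" and u: "vu - om *s (al + ku *s e) \<in> W"
    and w: "vw - et *s (be + mu *s e) \<in> W" "et \<noteq> 0" and l: "vw - c *s vx - d *s vu \<in> W"
  shows "sg * mu = ka - ku"
proof -
  have "(et * mu - c * xi * ka - d * om * ku) *s e + (0 - c * xi - d * om) *s al + (et - c * xi * sg) *s be =
     (vw - c *s vx - d *s vu) - (vw - et *s (be + mu *s e)) + c *s (vx - xi *s (al + ka *s e + sg *s be)) + d *s (vu - om *s (al + ku *s e))"
    by (simp add: vec_eq_iff algebra_simps)
  then have "(et * mu - c * xi * ka - d * om * ku) *s e + (0 - c * xi - d * om) *s al + (et - c * xi * sg) *s be \<in> W"
    using lsubD(2)[OF W lsubD(2)[OF W lsub_diff[OF W l w(1)] lsubD(3)[OF W x]] lsubD(3)[OF W u]] by (simp only:)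
  from ind[OF this] have k: "et * mu - c * xi * ka - d * om * ku = 0" "d * om = - (c * xi)" "et = c * xi * sg"
    by (auto simp: eq_neg_iff_add_eq_0 algebra_simps)
  have "c * xi * (sg * mu - (ka - ku)) = 0" using k(1) unfolding k(2,3) by (simp add: algebra_simps)
  moreover have "c * xi \<noteq> 0" using w(2) k(3) by auto
  ultimately show ?thesis by simp
qed

lemma perspective: "perspective_prop CHAR('a) T L"
  unfolding perspective_prop_def
proof (intro ballI allI impI)
  fix a1 a2 b1 b2 A B
  assume T: "a1 \<in> T" "a2 \<in> T" "b1 \<in> T" "b2 \<in> T" and na: "a1 \<noteq> a2" and nb: "b1 \<noteq> b2"
    and A: "A \<subseteq> L a1 a2" and B: "B \<subseteq> L b1 b2" and A4: "card A = 4" and B4: "card B = 4"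
    and dB: "L a1 a2 \<inter> B = {}" and dA: "L b1 b2 \<inter> A = {}"
    and hyp: "\<forall>a\<in>A. \<exists>b\<in>B. \<exists>x\<in>T - L a1 a2 - L b1 b2. \<exists>y\<in>T - L a1 a2 - L b1 b2. x \<noteq> y \<and> x \<in> L a b \<and> y \<in> L a b \<and>
            (\<forall>u\<in>A. \<exists>v\<in>B. v \<in> L x u) \<and> (\<forall>u\<in>A. \<exists>v\<in>B. v \<in> L y u)"
  define M1 where "M1 = adj (adj W (v a1)) (v a2)"
  define M2 where "M2 = adj (adj W (v b1)) (v b2)"
  have lM: "lsub M1" "lsub M2" unfolding M1_def M2_def using W2 by auto
  have WM: "W \<subseteq> M2" unfolding M2_def using adj_sub[OF W] adj_sub[OF W1] by auto
  have iA: "x \<in> L a1 a2 \<longleftrightarrow> x \<in> T \<and> v x \<in> M1" for x unfolding M1_def L_rep[OF T(1,2) na] by simp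
  have iB: "x \<in> L b1 b2 \<longleftrightarrow> x \<in> T \<and> v x \<in> M2" for x unfolding M2_def L_rep[OF T(3,4) nb] by simp
  have AT: "x \<in> T \<and> v x \<in> M1 \<and> v x \<notin> M2" if "x \<in> A" for x using that A dA iA iB by blast
  have BT: "x \<in> T \<and> v x \<in> M2 \<and> v x \<notin> M1" if "x \<in> B" for x using that B dB iA iB by blast
  obtain a a' where aa: "a \<in> A" "a' \<in> A" "a \<noteq> a'" using two_of_card[of A] A4 by auto
  obtain b where b: "b \<in> B" "\<exists>x\<in>T - L a1 a2 - L b1 b2. \<exists>y\<in>T - L a1 a2 - L b1 b2. x \<noteq> y \<and> x \<in> L a b \<and> y \<in> L a b \<and>
            (\<forall>u\<in>A. \<exists>v\<in>B. v \<in> L x u) \<and> (\<forall>u\<in>A. \<exists>v\<in>B. v \<in> L y u)" using bspec[OF hyp aa(1)] by (rule bexE)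
  obtain x where x: "x \<in> T" "v x \<notin> M1" "v x \<notin> M2" "x \<in> L a b" "\<forall>u\<in>A. \<exists>v\<in>B. v \<in> L x u" using b(2) iA iB by blast
  obtain b' where b': "b' \<in> B" "b' \<in> L x a'" using x(5) aa(2) by blast
  have neq: "a \<noteq> b" "x \<noteq> a'" "x \<noteq> b" using AT[OF aa(1)] BT[OF b(1)] AT[OF aa(2)] x by auto
  obtain p r where pr: "v x - p *s v a - r *s v b \<in> W" using L_E[OF conjunct1[OF AT[OF aa(1)]] conjunct1[OF BT[OF b(1)]] neq(1) x(4)] by metis
  obtain s t where st: "v b' - s *s v x - t *s v a' \<in> W" using L_E[OF x(1) conjunct1[OF AT[OF aa(2)]] neq(2) b'(2)] by metis
  define e where "e = (s * p) *s v a + t *s v a'"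
  have e1: "e \<in> M1" unfolding e_def using AT aa lsubD(2,3)[OF lM(1)] by metis
  have "v b' - (s * r) *s v b - e = (v b' - s *s v x - t *s v a') + s *s (v x - p *s v a - r *s v b)"
    unfolding e_def by (simp add: vec_eq_iff algebra_simps)
  then have be: "v b' - (s * r) *s v b - e \<in> W" using lsubD(2)[OF W st lsubD(3)[OF W pr]] by (simp only:)
  have "e = (v b' - (s * r) *s v b) - (v b' - (s * r) *s v b - e)" by simp
  moreover have "v b' - (s * r) *s v b \<in> M2" using BT b(1) b'(1) lsubD(3)[OF lM(2)] lsub_diff[OF lM(2)] by metis
  ultimately have e2: "e \<in> M2" using lsub_diff[OF lM(2)] be WM by (metis subsetD)
  have eW: "e \<notin> W"
  proof
    assume eW: "e \<in> W"
    have "t = 0"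
    proof (rule ccontr)
      assume t: "t \<noteq> 0"
      have "v a' - (- (inverse t * (s * p))) *s v a = inverse t *s e"
        unfolding e_def using t by (simp add: vec_eq_iff algebra_simps cancel flip: mult.assoc)
      then have "v a' \<in> adj W (v a)" unfolding in_adj using lsubD(3)[OF W eW] by metis
      then show False using dist[of a a'] AT aa by auto
    qed
    moreover have "s \<noteq> 0"
    proof
      assume "s = 0"
      then have "v b' \<in> W" using st \<open>t = 0\<close> by (simp add: zero_smult)
      then show False using vW[of b'] BT b'(1) by auto
    qed
    moreover have "p \<noteq> 0"
    proof
      assume "p = 0"
      then have "v x - r *s v b \<in> W" using pr by (simp add: zero_smult)
      then have "v x \<in> adj W (v b)" unfolding in_adj by blast
      then show False using dist[of b x] BT[OF b(1)] x(1) neq(3) by auto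
    qed
    ultimately have sp: "s * p \<noteq> 0" and et: "e = (s * p) *s v a" unfolding e_def by (auto simp: zero_smult)
    have "v a = inverse (s * p) *s e" unfolding et by (simp only: inv_smult[OF sp])
    then have "v a \<in> W" using lsubD(3)[OF W eW] by metis
    then show False using vW[of a] AT aa by auto
  qed
  have Ae: "v u \<notin> adj W e" if "u \<in> A" for u
    using adj_least[OF lM(2) WM e2] AT[OF that] by blast
  have Be: "v u \<notin> adj W e" if u: "u \<in> B" for u
  proof -
    have "W \<subseteq> M1" unfolding M1_def using adj_sub[OF W] adj_sub[OF W1] by auto
    then show ?thesis using adj_least[OF lM(1) _ e1] BT[OF u] by blast
  qed
  define al where "al = v a"
  have M1e: "M1 = adj (adj W e) al"
    unfolding M1_def al_def using adj_exchange2[OF W e1[unfolded M1_def] eW] AT[OF aa(1)] Ae[OF aa(1)] unfolding M1_def by metis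
  have M2e: "M2 = adj (adj W e) (v u)" if "u \<in> B" for u
    unfolding M2_def using adj_exchange2[OF W e2[unfolded M2_def] eW] BT[OF that] Be[OF that] unfolding M2_def by metis
  have coord: "\<exists>k l. l \<noteq> 0 \<and> v u - l *s (g + k *s e) \<in> W" if u: "v u \<in> adj (adj W e) (m *s g)" "v u \<notin> adj W e" and m: "m \<noteq> 0" for u g m
  proof -
    obtain c d where cd: "v u - c *s e - d *s (m *s g) \<in> W" using u(1) unfolding in_adj2 by blast
    have d: "d \<noteq> 0"
    proof
      assume "d = 0"
      then have "v u - c *s e \<in> W" using cd by (simp add: zero_smult)
      then show False using u(2) unfolding in_adj by blast
    qed
    have "v u - (d * m) *s (g + (inverse (d * m) * c) *s e) = v u - c *s e - d *s (m *s g)"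
      using d m by (simp add: vec_eq_iff algebra_simps cancel flip: mult.assoc)
    then have "v u - (d * m) *s (g + (inverse (d * m) * c) *s e) \<in> W" using cd by (simp only:)
    moreover have "d * m \<noteq> 0" using d m by simp
    ultimately show ?thesis by blast
  qed
  have "\<forall>u\<in>A. \<exists>k l. l \<noteq> 0 \<and> v u - l *s (al + k *s e) \<in> W"
  proof
    fix u assume u: "u \<in> A"
    show "\<exists>k l. l \<noteq> 0 \<and> v u - l *s (al + k *s e) \<in> W"
      by (rule coord[of u 1]) (use AT[OF u] Ae[OF u] M1e in auto)
  qed
  then obtain ka where ka: "\<forall>u\<in>A. \<exists>l. l \<noteq> 0 \<and> v u - l *s (al + ka u *s e) \<in> W" using bchoice[of A "\<lambda>u k. \<exists>l. l \<noteq> 0 \<and> v u - l *s (al + k *s e) \<in> W"] by blast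
  have ka_inj: "inj_on ka A"
  proof (rule inj_onI, rule ccontr)
    fix u w assume u: "u \<in> A" and w: "w \<in> A" and eq: "ka u = ka w" and ne: "u \<noteq> w"
    obtain l1 where l1: "l1 \<noteq> 0" "v u - l1 *s (al + ka u *s e) \<in> W" using ka u by blast
    obtain l2 where l2: "l2 \<noteq> 0" "v w - l2 *s (al + ka u *s e) \<in> W" using ka w eq by metis
    have "v u - (l1 * inverse l2) *s v w = (v u - l1 *s (al + ka u *s e)) - (l1 * inverse l2) *s (v w - l2 *s (al + ka u *s e))"
      using l2(1) by (simp add: vec_eq_iff algebra_simps cancel flip: mult.assoc)
    then have "v u - (l1 * inverse l2) *s v w \<in> W" using lsub_diff[OF W l1(2) lsubD(3)[OF W l2(2)]] by (simp only:)
    then have "v u \<in> adj W (v w)" unfolding in_adj by blast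
    then show False using dist[of w u] AT u w ne by auto
  qed
  have fA: "finite A" "finite B" using A4 B4 by (metis card.infinite zero_neq_numeral)+
  have sums: "4 * ka c = sum ka A" if c: "c \<in> A" for c
  proof -
    obtain b where b: "b \<in> B" "\<exists>x\<in>T - L a1 a2 - L b1 b2. \<exists>y\<in>T - L a1 a2 - L b1 b2. x \<noteq> y \<and> x \<in> L c b \<and> y \<in> L c b \<and>
            (\<forall>u\<in>A. \<exists>v\<in>B. v \<in> L x u) \<and> (\<forall>u\<in>A. \<exists>v\<in>B. v \<in> L y u)" using bspec[OF hyp c] by (rule bexE)
    obtain x where x: "x \<in> T" "v x \<notin> M1" "v x \<notin> M2" "x \<in> L c b" "\<forall>u\<in>A. \<exists>v\<in>B. v \<in> L x u"
      and "\<exists>y\<in>T - L a1 a2 - L b1 b2. x \<noteq> y \<and> y \<in> L c b \<and> (\<forall>u\<in>A. \<exists>v\<in>B. v \<in> L y u)" using b(2) iA iB by blast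
    then obtain y where y: "y \<in> T" "v y \<notin> M1" "v y \<notin> M2" "y \<in> L c b" "\<forall>u\<in>A. \<exists>v\<in>B. v \<in> L y u" "x \<noteq> y" using iA iB by blast
    have cT: "c \<in> T" "b \<in> T" "c \<noteq> b" using AT[OF c] BT[OF b(1)] by auto
    obtain la where la: "la \<noteq> 0" "v c - la *s (al + ka c *s e) \<in> W" using ka c by blast
    have shape: "\<exists>p r. p \<noteq> 0 \<and> r \<noteq> 0 \<and> v z - p *s v c - r *s v b \<in> W" if z: "z \<in> T" "v z \<notin> M1" "v z \<notin> M2" "z \<in> L c b" for z
    proof -
      obtain p r where pr: "v z - p *s v c - r *s v b \<in> W" using L_E[OF cT z(4)] by metis
      have "p \<noteq> 0"
      proof
        assume "p = 0"
        then have "v z - r *s v b \<in> W" using pr by (simp add: zero_smult)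
        then have "v z \<in> adj W (v b)" unfolding in_adj by blast
        then show False using dist[of b z] BT[OF b(1)] z by auto
      qed
      moreover have "r \<noteq> 0"
      proof
        assume "r = 0"
        then have "v z - p *s v c \<in> W" using pr by (simp add: zero_smult)
        then have "v z \<in> adj W (v c)" unfolding in_adj by blast
        then show False using dist[of c z] AT[OF c] z by auto
      qed
      ultimately show ?thesis using pr by blast
    qed
    obtain p r where pr: "p \<noteq> 0" "r \<noteq> 0" "v x - p *s v c - r *s v b \<in> W" using shape[OF x(1-4)] by blast
    obtain p' r' where pr': "p' \<noteq> 0" "r' \<noteq> 0" "v y - p' *s v c - r' *s v b \<in> W" using shape[OF y(1-4)] by blast
    define be where "be = (inverse (p * la) * r) *s v b"
    define sg where "sg = inverse (p' * la) * r' * inverse r * (p * la)"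
    have k0: "inverse (p * la) * r \<noteq> 0" using pr la by simp
    have pl0: "p * la \<noteq> 0" "p' * la \<noteq> 0" using pr pr' la by auto
    have vb: "v b = (inverse r * (p * la)) *s be" unfolding be_def smult_smult cancel_left(3)[OF pl0(1) pr(2)] by (simp add: vec_eq_iff)
    have ind: "i = 0 \<and> j = 0 \<and> k = 0" if "i *s e + j *s al + k *s be \<in> W" for i j k
    proof -
      have "i *s e + j *s al + (k * (inverse (p * la) * r)) *s v b \<in> W" using that unfolding be_def smult_smult .
      moreover have "al \<notin> adj W e" "v b \<notin> adj (adj W e) al" using Ae[OF aa(1)] BT[OF b(1)] M1e unfolding al_def by auto
      ultimately have "i = 0" "j = 0" "k * (inverse (p * la) * r) = 0" using independent3[OF W eW] by metis+
      then show ?thesis using k0 by simp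
    qed
    have rx: "r *s v b = (p * la) *s be" unfolding be_def smult_smult cancel_left(1)[OF pl0(1)] by (rule refl)
    have "v x - (p * la) *s (al + ka c *s e + 1 *s be) = (v x - p *s v c - r *s v b) + p *s (v c - la *s (al + ka c *s e))"
      unfolding rx by (simp add: vec_eq_iff algebra_simps)
    then have X: "v x - (p * la) *s (al + ka c *s e + 1 *s be) \<in> W" using lsubD(2)[OF W pr(3) lsubD(3)[OF W la(2)]] by (simp only:)
    have "(p' * la) * sg = r' * (inverse r * (p * la))" unfolding sg_def by (rule cancel_left(2)[OF pl0(2)])
    then have ry: "r' *s v b = ((p' * la) * sg) *s be" unfolding vb smult_smult by simp
    have "v y - (p' * la) *s (al + ka c *s e + sg *s be) = (v y - p' *s v c - r' *s v b) + p' *s (v c - la *s (al + ka c *s e))"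
      unfolding ry by (simp add: vec_eq_iff algebra_simps)
    then have Y: "v y - (p' * la) *s (al + ka c *s e + sg *s be) \<in> W" using lsubD(2)[OF W pr'(3) lsubD(3)[OF W la(2)]] by (simp only:)
    have sg1: "sg \<noteq> 1"
    proof
      assume s1: "sg = 1"
      define g where "g = al + ka c *s e + 1 *s be"
      have pl: "p * la \<noteq> 0" using pr la by simp
      have "v y - (p' * la * inverse (p * la)) *s v x = (v y - (p' * la) *s g) - (p' * la * inverse (p * la)) *s (v x - (p * la) *s g)"
        by (rule proportional_diff[OF pl])
      then have "v y - (p' * la * inverse (p * la)) *s v x \<in> W"
        using lsub_diff[OF W Y[unfolded s1, folded g_def] lsubD(3)[OF W X[folded g_def]]] by (simp only:)
      then have "v y \<in> adj W (v x)" unfolding in_adj by blast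
      then show False using dist[OF x(1) y(1) y(6)] by simp
    qed
    have "\<forall>u\<in>B. \<exists>k l. l \<noteq> 0 \<and> v u - l *s (be + k *s e) \<in> W"
    proof
      fix u assume u: "u \<in> B"
      show "\<exists>k l. l \<noteq> 0 \<and> v u - l *s (be + k *s e) \<in> W"
        by (rule coord[of u "inverse r * (p * la)"]) (use BT[OF u] Be[OF u] M2e[OF b(1)] vb pr la in auto)
    qed
    then obtain mu where mu: "\<forall>u\<in>B. \<exists>l. l \<noteq> 0 \<and> v u - l *s (be + mu u *s e) \<in> W" using bchoice[of B "\<lambda>u k. \<exists>l. l \<noteq> 0 \<and> v u - l *s (be + k *s e) \<in> W"] by blast
    have total: "s * sum mu B = 4 * ka c - sum ka A"
      if z: "z \<in> T" "v z \<notin> M1" "\<forall>u\<in>A. \<exists>v\<in>B. v \<in> L z u" and Z: "v z - xi *s (al + ka c *s e + s *s be) \<in> W" for z s xi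
    proof -
      obtain f where f: "\<forall>u\<in>A. f u \<in> B \<and> f u \<in> L z u" using z(3) bchoice[of A "\<lambda>u w. w \<in> B \<and> w \<in> L z u"] by blast
      have fe: "s * mu (f u) = ka c - ka u" if u: "u \<in> A" for u
      proof -
        have fu: "f u \<in> B" "f u \<in> L z u" using f u by auto
        have "z \<noteq> u" using z AT[OF u] by auto
        then obtain k m where km: "v (f u) - k *s v z - m *s v u \<in> W" using L_E[OF z(1) conjunct1[OF AT[OF u]] _ fu(2)] by metis
        obtain om where om: "v u - om *s (al + ka u *s e) \<in> W" using ka u by blast
        obtain et where et: "et \<noteq> 0" "v (f u) - et *s (be + mu (f u) *s e) \<in> W" using mu fu(1) by blast
        show ?thesis by (rule perspective_step[OF ind Z om et(2,1) km])
      qed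
      have "inj_on f A"
      proof (rule inj_onI)
        fix u w assume u: "u \<in> A" and w: "w \<in> A" and "f u = f w"
        then have "ka u = ka w" using fe[OF u] fe[OF w] by simp
        then show "u = w" using ka_inj u w unfolding inj_on_def by blast
      qed
      moreover have "f ` A = B" by (rule card_subset_eq) (use f fA card_image[OF calculation] A4 B4 in auto)
      ultimately have "sum mu B = (\<Sum>u\<in>A. mu (f u))" using sum.reindex[of f A mu] by simp
      then have "s * sum mu B = (\<Sum>u\<in>A. ka c - ka u)" using fe by (simp add: sum_distrib_left)
      then show ?thesis using A4 by (simp add: sum_subtractf)
    qed
    have t1: "1 * sum mu B = 4 * ka c - sum ka A" by (rule total[OF x(1,2,5) X])
    have t2: "sg * sum mu B = 4 * ka c - sum ka A" by (rule total[OF y(1,2,5) Y])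
    have "sg * sum mu B = 1 * sum mu B" using t1 t2 by (simp only:)
    then have "(sg - 1) * sum mu B = 0" by (simp only: left_diff_distrib diff_self)
    then have "sum mu B = 0" using sg1 by simp
    then show ?thesis using t1 by simp
  qed
  have "4 * (ka a - ka a') = 0" using sums[OF aa(1)] sums[OF aa(2)] by (simp add: algebra_simps)
  moreover have "ka a \<noteq> ka a'" using ka_inj aa unfolding inj_on_def by blast
  ultimately have "(4::'a) = 0" by simp
  moreover have "(4::'a) = 2 * 2" by simp
  ultimately have "(2::'a) = 0" by (metis mult_eq_0_iff)
  then show "CHAR('a) = 2" by (rule char_two)
qed

theorem desarguesian: "desarguesian CHAR('a) T L"
proof -
  have "CHAR('a) \<noteq> 1" using of_nat_CHAR[where 'a='a] by (metis of_nat_1 zero_neq_one)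
  moreover have "CHAR('a) \<noteq> 4"
  proof
    assume c4: "CHAR('a) = 4"
    then have "(of_nat 4 :: 'a) = 0" using of_nat_CHAR[where 'a='a] by simp
    then have "(2::'a) * 2 = 0" by simp
    then have "(2::'a) = 0" by (metis mult_eq_0_iff)
    then show False using char_two c4 by simp
  qed
  ultimately show ?thesis unfolding desarguesian_def using fano concurrent perspective by simp
qed

end

section \<open>From projective points to vectors\<close>

lemma lsub_zero: "lsub {0}"
  unfolding lsub_def by (auto simp: vec_eq_iff)

lemma left_span_0: "left_span 0 b = {0}"
  unfolding left_span_def by auto

lemma left_span_Suc: "left_span (Suc k) b = adj (left_span k b) (b k)"
proof
  show "left_span (Suc k) b \<subseteq> adj (left_span k b) (b k)"
    unfolding left_span_def adj_def by auto
  show "adj (left_span k b) (b k) \<subseteq> left_span (Suc k) b"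
  proof
    fix x assume "x \<in> adj (left_span k b) (b k)"
    then obtain c d where x: "x = (\<Sum>i<k. c i *s b i) + d *s b k" unfolding left_span_def adj_def by auto
    have "(\<Sum>i<k. (c(k := d)) i *s b i) = (\<Sum>i<k. c i *s b i)" by (rule sum.cong) auto
    then have "x = (\<Sum>i<Suc k. (c(k := d)) i *s b i)" using x by simp
    then show "x \<in> left_span (Suc k) b" unfolding left_span_def by blast
  qed
qed

lemma lsub_left_span: "lsub (left_span k b)"
  by (induction k) (auto simp: left_span_0 left_span_Suc lsub_zero lsub_adj)

lemma left_indep_0: "left_indep 0 b"
  unfolding left_indep_def by simp

lemma left_indep_Suc:
  assumes "left_indep k b" "b k \<notin> left_span k b" shows "left_indep (Suc k) b"
  unfolding left_indep_def
proof (intro allI impI)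
  fix c i assume s: "(\<Sum>i<Suc k. c i *s b i) = 0" and i: "i < Suc k"
  have s': "(\<Sum>i<k. c i *s b i) + c k *s b k = 0" using s by simp
  have ck: "c k = 0"
  proof (rule ccontr)
    assume ck: "c k \<noteq> 0"
    have e: "c k *s b k = (-1) *s (\<Sum>i<k. c i *s b i)" using s' by (simp add: vec_eq_iff add_eq_0_iff)
    have sp: "(\<Sum>i<k. c i *s b i) \<in> left_span k b" unfolding left_span_def by (rule rangeI)
    have "c k *s b k \<in> left_span k b" unfolding e by (rule lsubD(3)[OF lsub_left_span sp])
    then have "inverse (c k) *s (c k *s b k) \<in> left_span k b" by (rule lsubD(3)[OF lsub_left_span])
    then show False using assms(2) unfolding inv_smult[OF ck] by contradiction
  qed
  then have "(\<Sum>i<k. c i *s b i) = 0" using s' by (simp add: zero_smult)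
  then have "\<forall>i<k. c i = 0" using assms(1) unfolding left_indep_def by blast
  then show "c i = 0" using ck i by (metis less_antisym)
qed

lemma flat0: "a \<noteq> 0 \<Longrightarrow> is_flat 0 {P \<in> proj_points. P \<subseteq> adj {0} a}"
  unfolding is_flat_def by (rule exI[of _ "\<lambda>_. a"]) (simp add: left_indep_Suc left_indep_0 left_span_0 left_span_Suc)

lemma flat1: "a \<noteq> 0 \<Longrightarrow> b \<notin> adj {0} a \<Longrightarrow> is_line {P \<in> proj_points. P \<subseteq> adj (adj {0} a) b}"
  unfolding is_flat_def by (rule exI[of _ "\<lambda>i. if i = 0 then a else b"]) (simp add: left_indep_Suc left_indep_0 left_span_0 left_span_Suc)

lemma flat2: "a \<noteq> 0 \<Longrightarrow> b \<notin> adj {0} a \<Longrightarrow> c \<notin> adj (adj {0} a) b \<Longrightarrow>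
    is_flat 2 {P \<in> proj_points. P \<subseteq> adj (adj (adj {0} a) b) c}"
  unfolding is_flat_def by (rule exI[of _ "\<lambda>i. if i = 0 then a else if i = 1 then b else c"])
    (simp add: left_indep_Suc left_indep_0 left_span_0 left_span_Suc numeral_2_eq_2)

lemma line_form:
  assumes "is_line l"
  obtains a b where "a \<noteq> 0" "b \<notin> adj {0} a" "l = {P \<in> proj_points. P \<subseteq> adj (adj {0} a) b}"
proof -
  obtain b where b: "left_indep (Suc 1) b" "l = {P \<in> proj_points. P \<subseteq> left_span (Suc 1) b}" using assms unfolding is_flat_def by blast
  have sp: "left_span (Suc 1) b = adj (adj {0} (b 0)) (b 1)" by (simp add: left_span_0 left_span_Suc)
  have ind: "x = 0 \<and> y = 0" if s: "x *s b 0 + y *s b 1 = 0" for x y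
  proof -
    let ?c = "\<lambda>i::nat. if i = 0 then x else y"
    have e: "(\<Sum>i<Suc 1. ?c i *s b i) = x *s b 0 + y *s b 1" by simp
    note z = b(1)[unfolded left_indep_def, THEN spec, of ?c, THEN mp, OF trans[OF e s]]
    show ?thesis using z[THEN spec, of 0] z[THEN spec, of 1] by simp
  qed
  have n0: "b 0 \<noteq> 0"
  proof
    assume "b 0 = 0"
    then have "1 *s b 0 + 0 *s b 1 = 0" by (simp add: zero_smult)
    then show False using ind[of 1 0] by simp
  qed
  have n1: "b 1 \<notin> adj {0} (b 0)"
  proof
    assume "b 1 \<in> adj {0} (b 0)"
    then obtain c where "b 1 = c *s b 0" unfolding adj_def by auto
    then have "c *s b 0 + (-1) *s b 1 = 0" by (simp add: vec_eq_iff)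
    then show False using ind[of c "-1"] by simp
  qed
  show ?thesis by (rule that[OF n0 n1]) (simp only: b(2) sp)
qed

definition vec :: "('a::division_ring^'n) set \<Rightarrow> 'a^'n" where
  "vec A = (SOME v. v \<noteq> 0 \<and> A = range (\<lambda>c. c *s v))"

lemma vecD: "A \<in> proj_points \<Longrightarrow> vec A \<noteq> 0 \<and> A = range (\<lambda>c. c *s vec A)"
  unfolding proj_points_def vec_def by (rule someI_ex) auto

lemma vec_ne: "A \<in> proj_points \<Longrightarrow> vec A \<noteq> 0"
  by (rule conjunct1[OF vecD])

lemma vec_range: "A \<in> proj_points \<Longrightarrow> A = range (\<lambda>c. c *s vec A)"
  by (rule conjunct2[OF vecD])

lemma vec_sub: "A \<in> proj_points \<Longrightarrow> lsub U \<Longrightarrow> A \<subseteq> U \<longleftrightarrow> vec A \<in> U"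
proof
  assume A: "A \<in> proj_points" and U: "lsub U"
  have "1 *s vec A \<in> A" by (subst (2) vec_range[OF A]) (rule rangeI)
  then show "A \<subseteq> U \<Longrightarrow> vec A \<in> U" by auto
  show "vec A \<in> U \<Longrightarrow> A \<subseteq> U" by (subst vec_range[OF A]) (use lsubD(3)[OF U] in auto)
qed

lemma vec_eq:
  assumes "A \<in> proj_points" "B \<in> proj_points" "vec B \<in> adj {0} (vec A)" shows "A = B"
proof -
  obtain c where c: "vec B = c *s vec A" using assms(3) unfolding adj_def by auto
  have c0: "c \<noteq> 0" using c vec_ne[OF assms(2)] by (auto simp: zero_smult)
  have vA: "A = range (\<lambda>c. c *s vec A)" and vB: "B = range (\<lambda>c. c *s vec B)" using vec_range[OF assms(1)] vec_range[OF assms(2)] .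
  have "d *s vec B \<in> A" for d using rangeI[of "\<lambda>c. c *s vec A" "d * c"] unfolding c smult_smult vA[symmetric] .
  then have "range (\<lambda>c. c *s vec B) \<subseteq> A" by auto
  then have "B \<subseteq> A" unfolding vB[symmetric] .
  moreover have "d *s vec A \<in> B" for d
  proof -
    have "d *s vec A = (d * inverse c) *s vec B" unfolding c smult_smult cancel(1)[OF c0] by (rule refl)
    then show ?thesis using rangeI[of "\<lambda>c. c *s vec B" "d * inverse c"] unfolding vB[symmetric] by (simp only:)
  qed
  then have "range (\<lambda>c. c *s vec A) \<subseteq> B" by auto
  then have "A \<subseteq> B" unfolding vA[symmetric] .
  ultimately show ?thesis by blast
qed

locale coloured_points =
  fixes S Red Blue :: "('a::division_ring^'n) set set"
  assumes finS: "finite S" and Sp: "S \<subseteq> proj_points" and SRB: "S = Red \<union> Blue"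
    and hB: "\<forall>A\<in>Blue. \<forall>B\<in>Blue. A \<noteq> B \<longrightarrow> (\<exists>C\<in>Red. C \<noteq> A \<and> C \<noteq> B \<and> proj_collinear {A, B, C})"
    and hR: "\<forall>A\<in>Red. \<forall>B\<in>Red. A \<noteq> B \<longrightarrow> (\<exists>C\<in>Blue. C \<noteq> A \<and> C \<noteq> B \<and> proj_collinear {A, B, C})"
    and nc: "\<not> proj_coplanar S"
begin

definition "LL A B = {C \<in> S. vec C \<in> adj (adj {0} (vec A)) (vec B)}"
definition "PP A B C = {D \<in> S. vec D \<in> adj (adj (adj {0} (vec A)) (vec B)) (vec C)}"

sublocale r: represented S LL vec "{0}"
proof
  show "finite S" by (rule finS)
  show "lsub ({0} :: ('a^'n) set)" by (rule lsub_zero)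
  show "vec A \<notin> {0}" if "A \<in> S" for A using vec_ne[of A] that Sp by auto
  show "vec B \<notin> adj {0} (vec A)" if "A \<in> S" "B \<in> S" "A \<noteq> B" for A B using vec_eq[of A B] that Sp by auto
qed (simp add: LL_def)

lemma collinear_LL: "A \<in> S \<Longrightarrow> B \<in> S \<Longrightarrow> C \<in> S \<Longrightarrow> A \<noteq> B \<Longrightarrow> proj_collinear {A, B, C} \<Longrightarrow> C \<in> LL A B"
proof -
  assume S: "A \<in> S" "B \<in> S" "C \<in> S" and AB: "A \<noteq> B" and c: "proj_collinear {A, B, C}"
  obtain l where l: "is_line l" "{A, B, C} \<subseteq> l" using c unfolding proj_collinear_def by blast
  obtain a b where ab: "l = {P \<in> proj_points. P \<subseteq> adj (adj {0} a) b}" using l(1) by (rule line_form)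
  note ls = lsub_adj[OF lsub_adj[OF lsub_zero]]
  have "A \<subseteq> adj (adj {0} a) b" "B \<subseteq> adj (adj {0} a) b" "C \<subseteq> adj (adj {0} a) b" using l(2) unfolding ab by auto
  then have v: "vec A \<in> adj (adj {0} a) b" "vec B \<in> adj (adj {0} a) b" "vec C \<in> adj (adj {0} a) b"
    using vec_sub[OF subsetD[OF Sp S(1)] ls] vec_sub[OF subsetD[OF Sp S(2)] ls] vec_sub[OF subsetD[OF Sp S(3)] ls] by simp_all
  have "adj (adj {0} (vec A)) (vec B) = adj (adj {0} a) b"
    by (rule adj_exchange2[OF lsub_zero v(1) r.vW[OF S(1)] v(2) r.dist[OF S(1,2) AB]])
  then show "C \<in> LL A B" unfolding LL_def using v(3) S by simp
qed

lemma not_in_flat: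
  assumes "k \<le> 2" "is_flat k {P \<in> proj_points. P \<subseteq> U}" "lsub U" shows "\<exists>D\<in>S. vec D \<notin> U"
proof (rule ccontr)
  assume "\<not> ?thesis"
  then have all: "vec A \<in> U" if "A \<in> S" for A using that by blast
  have "S \<subseteq> {P \<in> proj_points. P \<subseteq> U}"
  proof
    fix A assume A: "A \<in> S"
    then have "A \<in> proj_points" using Sp by blast
    then show "A \<in> {P \<in> proj_points. P \<subseteq> U}" using vec_sub[OF _ assms(3), of A] all[OF A] by simp
  qed
  then have "proj_coplanar S" unfolding proj_coplanar_def
    by (intro exI[of _ k] conjI[OF assms(1)] exI[of _ "{P \<in> proj_points. P \<subseteq> U}"] conjI[OF assms(2)])
  then show False using nc by contradiction
qed

lemma outside_plane: "A \<in> S \<Longrightarrow> B \<in> S \<Longrightarrow> C \<in> S \<Longrightarrow> A \<noteq> B \<Longrightarrow> C \<notin> LL A B \<Longrightarrow> \<exists>D\<in>S. D \<notin> PP A B C"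
proof -
  assume S: "A \<in> S" "B \<in> S" "C \<in> S" and AB: "A \<noteq> B" and C: "C \<notin> LL A B"
  have "is_flat 2 {P \<in> proj_points. P \<subseteq> adj (adj (adj {0} (vec A)) (vec B)) (vec C)}"
    by (rule flat2) (use r.vW[OF S(1)] r.dist[OF S(1,2) AB] C S in \<open>auto simp: LL_def\<close>)
  from not_in_flat[OF _ this lsub_adj[OF lsub_adj[OF lsub_adj[OF lsub_zero]]]] show ?thesis unfolding PP_def by simp
qed

lemma three_points: "\<exists>A\<in>S. \<exists>B\<in>S. \<exists>C\<in>S. A \<noteq> B \<and> C \<notin> LL A B"
proof -
  obtain A where A: "A \<in> S"
  proof -
    have "(\<chi> i. 1 :: 'a^'n) \<noteq> 0" by (simp add: vec_eq_iff)
    then obtain A where "A \<in> S" using not_in_flat[OF _ flat0 lsub_adj[OF lsub_zero]] by (metis zero_le)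
    then show ?thesis by (rule that)
  qed
  obtain B where B: "B \<in> S" "vec B \<notin> adj {0} (vec A)"
    using not_in_flat[OF _ flat0 lsub_adj[OF lsub_zero], of "vec A"] r.vW[OF A] by auto
  have AB: "A \<noteq> B" using B adj_self[OF lsub_zero] by auto
  obtain C where C: "C \<in> S" "vec C \<notin> adj (adj {0} (vec A)) (vec B)"
    using not_in_flat[OF _ flat1 lsub_adj[OF lsub_adj[OF lsub_zero]], of "vec A" "vec B"] r.vW[OF A] B(2) by auto
  then show ?thesis using A B(1) AB unfolding LL_def by blast
qed

lemma quotient_desarguesian:
  assumes P: "P \<in> S"
  shows "desarguesian CHAR('a) (pencil S LL P)
    (\<lambda>X Y. LL P ` (PP P (SOME x. x \<in> X - {P}) (SOME y. y \<in> Y - {P}) - {P}))"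
proof -
  define sel where "sel X = (SOME x. x \<in> X - {P})" for X
  have sel: "sel X \<in> S \<and> sel X \<noteq> P \<and> sel X \<in> X \<and> LL P (sel X) = X" if X: "X \<in> pencil S LL P" for X
  proof -
    obtain x where x: "x \<in> S" "x \<noteq> P" "X = LL P x" using r.pen_ex[OF X] by blast
    have "x \<in> X - {P}" using r.L_r[OF P x(1)] x by auto
    then have s: "sel X \<in> X - {P}" unfolding sel_def by (rule someI[of "\<lambda>x. x \<in> X - {P}"])
    have "X \<in> r.lines" "P \<in> X" using r.pen_lines[OF P] X by auto
    then show ?thesis using r.lines_L[of X P "sel X"] r.lines_sub s by auto
  qed
  have "represented (pencil S LL P) (\<lambda>X Y. LL P ` (PP P (sel X) (sel Y) - {P})) (\<lambda>X. vec (sel X)) (adj {0} (vec P))"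
  proof
    show "finite (pencil S LL P)" by (rule r.fin_pen)
    show "lsub (adj {0} (vec P))" using lsub_adj lsub_zero by blast
    show "vec (sel X) \<notin> adj {0} (vec P)" if "X \<in> pencil S LL P" for X
      using r.dist[OF P, of "sel X"] sel[OF that] by auto
    fix X Y assume X: "X \<in> pencil S LL P" and Y: "Y \<in> pencil S LL P" and XY: "X \<noteq> Y"
    show nd: "vec (sel Y) \<notin> adj (adj {0} (vec P)) (vec (sel X))"
    proof
      assume "vec (sel Y) \<in> adj (adj {0} (vec P)) (vec (sel X))"
      then have "sel Y \<in> X" using sel[OF X] sel[OF Y] unfolding LL_def by auto
      then have "LL P (sel Y) = X" using r.lines_L[of X P "sel Y"] r.pen_lines[OF P] X sel[OF Y] by auto
      then show False using sel[OF Y] XY by simp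
    qed
    let ?M = "adj (adj (adj {0} (vec P)) (vec (sel X))) (vec (sel Y))"
    have lM: "lsub ?M" by (intro lsub_adj lsub_zero)
    have PM: "vec P \<in> ?M" by (intro adj_sub adj_self lsub_adj lsub_zero)
    have inside: "vec e \<in> ?M" if "d \<in> S" "vec d \<in> ?M" "e \<in> LL P d" for d e
    proof -
      have "adj (adj {0} (vec P)) (vec d) \<subseteq> ?M" by (intro adj_least lM) (use that PM lsubD(1)[OF lM] in auto)
      then show ?thesis using that unfolding LL_def by auto
    qed
    show "LL P ` (PP P (sel X) (sel Y) - {P}) = {Z \<in> pencil S LL P. vec (sel Z) \<in> ?M}"
    proof (rule set_eqI, rule iffI)
      fix Z assume "Z \<in> LL P ` (PP P (sel X) (sel Y) - {P})"
      then obtain d where d: "d \<in> S" "d \<noteq> P" "vec d \<in> ?M" "Z = LL P d" unfolding PP_def by auto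
      have Z: "Z \<in> pencil S LL P" unfolding d(4) pencil_def using d by auto
      then show "Z \<in> {Z \<in> pencil S LL P. vec (sel Z) \<in> ?M}" using inside[OF d(1,3)] sel[OF Z] d(4) by auto
    next
      fix Z assume "Z \<in> {Z \<in> pencil S LL P. vec (sel Z) \<in> ?M}"
      then have Z: "Z \<in> pencil S LL P" "vec (sel Z) \<in> ?M" by auto
      have "sel Z \<in> PP P (sel X) (sel Y) - {P}" unfolding PP_def using Z sel[OF Z(1)] by auto
      then show "Z \<in> LL P ` (PP P (sel X) (sel Y) - {P})" using sel[OF Z(1)] by (metis imageI)
    qed
  qed
  then interpret w: represented "pencil S LL P" "\<lambda>X Y. LL P ` (PP P (sel X) (sel Y) - {P})" "\<lambda>X. vec (sel X)" "adj {0} (vec P)" .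
  show ?thesis using w.desarguesian unfolding sel_def .
qed

lemma space: "space3 S LL Red Blue CHAR('a) PP"
proof (unfold_locales)
  show "S = Red \<union> Blue" by (rule SRB)
  show "\<exists>z\<in>Red. z \<noteq> x \<and> z \<noteq> y \<and> z \<in> LL x y" if xy: "x \<in> Blue" "y \<in> Blue" "x \<noteq> y" for x y
  proof -
    obtain z where z: "z \<in> Red" "z \<noteq> x" "z \<noteq> y" "proj_collinear {x, y, z}" using hB xy by blast
    have "z \<in> LL x y" by (rule collinear_LL) (use z xy SRB in auto)
    then show ?thesis using z by blast
  qed
  show "\<exists>z\<in>Blue. z \<noteq> x \<and> z \<noteq> y \<and> z \<in> LL x y" if xy: "x \<in> Red" "y \<in> Red" "x \<noteq> y" for x y
  proof -
    obtain z where z: "z \<in> Blue" "z \<noteq> x" "z \<noteq> y" "proj_collinear {x, y, z}" using hR xy by blast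
    have "z \<in> LL x y" by (rule collinear_LL) (use z xy SRB in auto)
    then show ?thesis using z by blast
  qed
  show "desarguesian CHAR('a) S LL" by (rule r.desarguesian)
  show "r.nontriv" unfolding r.nontriv_def using three_points by blast
  show "PP a b c \<subseteq> S" for a b c unfolding PP_def by auto
  show "desarguesian CHAR('a) (pencil S LL P) (\<lambda>X Y. LL P ` (PP P (SOME x. x \<in> X - {P}) (SOME y. y \<in> Y - {P}) - {P}))" if "P \<in> S" for P
    by (rule quotient_desarguesian[OF that])
  fix a b c assume S: "a \<in> S" "b \<in> S" "c \<in> S" and ab: "a \<noteq> b" and c: "c \<notin> LL a b"
  let ?M = "adj (adj (adj {0} (vec a)) (vec b)) (vec c)"
  have lM: "lsub ?M" by (intro lsub_adj lsub_zero)
  show "a \<in> PP a b c \<and> b \<in> PP a b c \<and> c \<in> PP a b c"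
    unfolding PP_def using S by (simp add: adj_self adj_sub lsub_adj lsub_zero)
  show "\<exists>d\<in>S. d \<notin> PP a b c" by (rule outside_plane[OF S ab c])
  fix x y assume x: "x \<in> PP a b c" and y: "y \<in> PP a b c" and xy: "x \<noteq> y"
  have v: "x \<in> S" "y \<in> S" "vec x \<in> ?M" "vec y \<in> ?M" using x y unfolding PP_def by auto
  show "LL x y \<subseteq> PP a b c"
  proof -
    have "adj (adj {0} (vec x)) (vec y) \<subseteq> ?M" by (intro adj_least lM) (use v lsubD(1)[OF lM] in auto)
    then show ?thesis unfolding LL_def PP_def by auto
  qed
  fix z assume z: "z \<in> PP a b c" and zn: "z \<notin> LL x y"
  have "z \<in> S" "vec z \<in> ?M" using z unfolding PP_def by auto
  then have "adj (adj (adj {0} (vec x)) (vec y)) (vec z) = ?M"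
    by (intro adj_exchange3[OF lsub_zero]) (use v r.vW[OF v(1)] r.dist[OF v(1,2) xy] zn in \<open>auto simp: LL_def\<close>)
  then show "PP x y z = PP a b c" unfolding PP_def by simp
qed

sublocale sp: space3 S LL Red Blue "CHAR('a)" PP by (rule space)

lemma induced_lines: "induced_geometry S = (S, r.lines)"
proof -
  have "{l \<inter> S |l. is_line l \<and> (\<exists>A\<in>l \<inter> S. \<exists>B\<in>l \<inter> S. A \<noteq> B)} = r.lines"
  proof (rule set_eqI, rule iffI)
    fix k assume "k \<in> {l \<inter> S |l. is_line l \<and> (\<exists>A\<in>l \<inter> S. \<exists>B\<in>l \<inter> S. A \<noteq> B)}"
    then obtain l A B where l: "is_line l" "k = l \<inter> S" "A \<in> l \<inter> S" "B \<in> l \<inter> S" "A \<noteq> B" by blast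
    obtain a b where ab: "l = {P \<in> proj_points. P \<subseteq> adj (adj {0} a) b}" using l(1) by (rule line_form)
    note ls = lsub_adj[OF lsub_adj[OF lsub_zero]]
    have AB: "A \<in> S" "B \<in> S" using l by auto
    have v: "C \<in> l \<longleftrightarrow> vec C \<in> adj (adj {0} a) b" if "C \<in> S" for C
      using vec_sub[OF _ ls, of C] that Sp unfolding ab by auto
    have "adj (adj {0} (vec A)) (vec B) = adj (adj {0} a) b"
      using adj_exchange2[OF lsub_zero _ r.vW[OF AB(1)] _ r.dist[OF AB l(5)]] v AB l(3,4) by blast
    then have "k = LL A B" unfolding LL_def l(2) using v by auto
    then show "k \<in> r.lines" using r.L_lines[OF AB l(5)] by simp
  next
    fix k assume "k \<in> r.lines"
    then obtain A B where AB: "A \<in> S" "B \<in> S" "A \<noteq> B" "k = LL A B" unfolding r.lines_def by blast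
    let ?l = "{P \<in> proj_points. P \<subseteq> adj (adj {0} (vec A)) (vec B)}"
    have "is_line ?l" by (rule flat1) (use r.vW[OF AB(1)] r.dist[OF AB(1-3)] in auto)
    moreover have "k = ?l \<inter> S" 
    proof (rule set_eqI)
      fix C
      show "C \<in> k \<longleftrightarrow> C \<in> ?l \<inter> S"
        unfolding AB(4) LL_def using vec_sub[OF subsetD[OF Sp] lsub_adj[OF lsub_adj[OF lsub_zero]], of C] subsetD[OF Sp, of C] by (cases "C \<in> S") simp_all
    qed
    moreover have "A \<in> k" "B \<in> k" using r.L_l[OF AB(1-3)] r.L_r[OF AB(1-3)] AB(4) by auto
    ultimately show "k \<in> {l \<inter> S |l. is_line l \<and> (\<exists>A\<in>l \<inter> S. \<exists>B\<in>l \<inter> S. A \<noteq> B)}" using AB(3) by blast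
  qed
  then show ?thesis unfolding induced_geometry_def by simp
qed

end

section \<open>Triple systems\<close>

context linspace begin

lemma third_unique:
  assumes "x \<in> T" "y \<in> T" "x \<noteq> y" "card (L x y) = 3" shows "\<exists>!z. z \<in> L x y \<and> z \<noteq> x \<and> z \<noteq> y"
proof -
  have "card (L x y - {x, y}) = 1" using assms L_l[OF assms(1-3)] L_r[OF assms(1-3)] lines_fin[OF L_lines[OF assms(1-3)]] by (simp add: card_Diff_subset)
  then obtain z where z: "L x y - {x, y} = {z}" by (rule card_1_singletonE)
  have "w \<in> L x y \<and> w \<noteq> x \<and> w \<noteq> y \<longleftrightarrow> w \<in> L x y - {x, y}" for w by simp
  then have "w \<in> L x y \<and> w \<noteq> x \<and> w \<noteq> y \<longleftrightarrow> w = z" for w unfolding z by simp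
  then show ?thesis by (simp only: ex1_eq)
qed

lemma crossing_seven:
  assumes T7: "card T = 7" and l3: "\<And>l. l \<in> lines \<Longrightarrow> card l = 3"
    and x: "x \<in> T" and l: "l \<in> lines" "x \<notin> l" and m: "m \<in> pen x"
  shows "\<exists>u\<in>l. u \<in> m"
proof (rule full_cross[OF x l _ m])
  have "(\<Sum>k\<in>pen x. card k - 1) = (\<Sum>k\<in>pen x. 2)" by (rule sum.cong) (use l3 pen_lines[OF x] in auto)
  then show "card l = deg x" using card_pen[OF x] T7 l3[OF l(1)] unfolding deg_def by simp
qed

text \<open>In the affine plane of order three the point reflection in \<open>P\<close> maps lines to lines. The lines \<open>A B\<close>, \<open>D E\<close> and the parallel
  through \<open>P\<close> form a parallel class, so \<open>D E\<close> meets \<open>P C\<close>.\<close>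

lemma star_law:
  assumes T9: "card T = 9" and l3: "\<And>l. l \<in> lines \<Longrightarrow> card l = 3"
    and T: "P \<in> T" "A \<in> T" "B \<in> T" and n: "P \<noteq> A" "B \<notin> L P A"
    and D: "D \<in> L P A" "D \<noteq> P" "D \<noteq> A" and E: "E \<in> L P B" "E \<noteq> P" "E \<noteq> B" and C: "C \<in> L A B" "C \<noteq> A" "C \<noteq> B"
  shows "\<exists>G. G \<in> L D E \<and> G \<in> L P C \<and> G \<noteq> P \<and> G \<noteq> C \<and> G \<noteq> D \<and> G \<noteq> E"
proof -
  have dg: "card l + 1 = deg x" if x: "x \<in> T" and "l \<in> lines" for x l
  proof -
    have "(\<Sum>k\<in>pen x. card k - 1) = (\<Sum>k\<in>pen x. 2)" by (rule sum.cong) (use l3 pen_lines[OF x] in auto)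
    then show ?thesis using card_pen[OF x] T9 l3[OF that(2)] unfolding deg_def by simp
  qed
  note par = unique_parallel(2)[OF _ _ _ dg] and parex = unique_parallel(1)[OF _ _ _ dg]
  have PB: "P \<noteq> B" using n L_l[OF T(1,2) n(1)] by auto
  have AB: "A \<noteq> B" using n L_r[OF T(1,2) n(1)] by auto
  define a b c where "a = L P A" and "b = L P B" and "c = L A B"
  have ln: "a \<in> lines" "b \<in> lines" "c \<in> lines" unfolding a_def b_def c_def using L_lines T n(1) PB AB by auto
  have on: "P \<in> a" "A \<in> a" "D \<in> a" "P \<in> b" "B \<in> b" "E \<in> b" "A \<in> c" "B \<in> c" "C \<in> c" "B \<notin> a"
    unfolding a_def b_def c_def using L_l[OF T(1,2) n(1)] L_r[OF T(1,2) n(1)] L_l[OF T(1,3) PB] L_r[OF T(1,3) PB] L_l[OF T(2,3) AB] L_r[OF T(2,3) AB] n D E C by simp_all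
  note un = lines_unique
  have abc: "a \<noteq> b" "a \<noteq> c" using on by auto
  have off: "A \<notin> b" "P \<notin> c" "E \<notin> a" "D \<notin> b"
  proof -
    show "A \<notin> b" using un[OF ln(1,2) n(1) on(1,2,4)] abc(1) by blast
    show "P \<notin> c" using un[OF ln(1,3) n(1) on(1,2) _ on(7)] abc(2) by blast
    show "E \<notin> a" using un[OF ln(1,2) E(2)[symmetric] on(1) _ on(4,6)] abc(1) by blast
    show "D \<notin> b" using un[OF ln(1,2) D(2)[symmetric] on(1,3,4)] abc(1) by blast
  qed
  have mem: "D \<in> T" "E \<in> T" "C \<in> T" using lines_sub[OF ln(1)] lines_sub[OF ln(2)] lines_sub[OF ln(3)] on by auto
  have DE: "D \<noteq> E" "P \<noteq> C" using on off by auto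
  define d where "d = L D E"
  have d: "d \<in> lines" "D \<in> d" "E \<in> d" unfolding d_def using L_lines L_l L_r mem DE by auto
  have offd: "A \<notin> d" "B \<notin> d" "P \<notin> d"
    using un[OF d(1) ln(1), of A D] un[OF d(1) ln(2), of B E] un[OF d(1) ln(1), of P D] d on off D E by auto
  obtain m where m: "m \<in> pen P" "m \<inter> c = {}" using parex[OF T(1) ln(3) off(2) T(1) ln(3)] by blast
  have ml: "m \<in> lines" "P \<in> m" using m pen_lines[OF T(1)] by auto
  have mn: "D \<notin> m" "E \<notin> m"
    using un[OF ml(1) ln(1), of P D] un[OF ml(1) ln(2), of P E] ml m on D E by auto
  have pc: "l \<in> pen x" if "x \<in> l" "l \<in> lines" for x l using pen_lines[of x] lines_sub[OF that(2)] that by auto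
  have dc: "d \<inter> c = {}"
  proof (rule ccontr)
    assume "d \<inter> c \<noteq> {}"
    then obtain Q where Q: "Q \<in> d" "Q \<in> c" by blast
    have Qm: "Q \<notin> m" "Q \<in> T" using m Q lines_sub[OF d(1)] by auto
    have "d \<inter> m = {}"
    proof (rule ccontr)
      assume "d \<inter> m \<noteq> {}"
      then obtain R where R: "R \<in> d" "R \<in> m" by blast
      have "card {Q, R, D, E} = 4" using R Q Qm mn DE on off d by (auto simp: card_insert_if) (use un[OF ln(3,1), of A D] un[OF ln(3,2), of B E] on D E off in auto)
      moreover have "card {Q, R, D, E} \<le> card d" by (rule card_mono[OF lines_fin[OF d(1)]]) (use R Q d in auto)
      ultimately show False using l3[OF d(1)] by simp
    qed
    then have "d = c" using par[OF Qm(2) ml(1) Qm(1) Qm(2) ml(1)] pc[OF Q(1) d(1)] pc[OF Q(2) ln(3)] m by (simp add: Int_commute)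
    then show False using offd on by auto
  qed
  have md: "m \<inter> d = {}"
  proof (rule ccontr)
    assume "m \<inter> d \<noteq> {}"
    then obtain R where R: "R \<in> m" "R \<in> d" by blast
    have Rc: "R \<notin> c" "R \<in> T" using dc R lines_sub[OF ml(1)] by auto
    have "m = d" using par[OF Rc(2) ln(3) Rc(1) Rc(2) ln(3)] pc[OF R(1) ml(1)] pc[OF R(2) d(1)] m dc by simp
    then show False using mn d by auto
  qed
  define g where "g = L P C"
  have g: "g \<in> lines" "P \<in> g" "C \<in> g" unfolding g_def using L_lines L_l L_r T mem DE by auto
  have "g \<inter> d \<noteq> {}"
  proof
    assume "g \<inter> d = {}"
    then have "g = m" using par[OF T(1) d(1) offd(3) T(1) d(1)] pc[OF g(2,1)] m md by simp
    then show False using m g on by auto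
  qed
  then obtain G where G: "G \<in> g" "G \<in> d" by blast
  have "G \<noteq> P" "G \<noteq> C" using G offd dc on by auto
  moreover have "G \<noteq> D"
  proof
    assume "G = D"
    then have "g = a" using un[OF g(1) ln(1), of P D] g G on D by auto
    then have "a = c" using un[OF ln(1,3), of A C] g on C by auto
    then show False using on by auto
  qed
  moreover have "G \<noteq> E"
  proof
    assume "G = E"
    then have "g = b" using un[OF g(1) ln(2), of P E] g G on E by auto
    then have "b = c" using un[OF ln(2,3), of B C] g on C by auto
    then show False using on off by auto
  qed
  ultimately show ?thesis using G unfolding d_def g_def by blast
qed

end

lemma geometry_iso_via:
  assumes h: "bij_betw h M S" and hl: "(`) h ` LM = LS" and g: "bij_betw g M N" and gl: "(`) g ` LM = LN" and sub: "\<And>l. l \<in> LM \<Longrightarrow> l \<subseteq> M"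
  shows "geometry_iso (S, LS) (N, LN)"
proof -
  let ?i = "inv_into M h"
  have b: "bij_betw (g \<circ> ?i) S N" using bij_betw_trans[OF bij_betw_inv_into[OF h] g] .
  have each: "(g \<circ> ?i) ` (h ` l) = g ` l" if "l \<in> LM" for l
  proof -
    have e: "?i ` (h ` l) = l" using inv_into_image_cancel[OF bij_betw_imp_inj_on[OF h] sub[OF that]] .
    have "(g \<circ> ?i) ` (h ` l) = g ` (?i ` (h ` l))" by (rule image_comp[symmetric])
    then show ?thesis unfolding e .
  qed
  have "(`) (g \<circ> ?i) ` ((`) h ` LM) = (\<lambda>l. (g \<circ> ?i) ` (h ` l)) ` LM" by (rule image_image)
  also have "\<dots> = (`) g ` LM" by (rule image_cong[OF refl]) (rule each)
  finally have lines: "(\<lambda>l. (g \<circ> ?i) ` l) ` LS = LN" unfolding hl gl .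
  show ?thesis unfolding geometry_iso_def by (rule exI[of _ "g \<circ> ?i"]) (simp only: fst_conv snd_conv b lines simp_thms)
qed

text \<open>The vectors are scaled so that the three vectors on every line through the base point \<open>P\<close> add up to zero; this
  is consistent, since the third point of \<open>P\<close> and \<open>C\<close> is \<open>A\<close> again.\<close>

locale triples = coloured_points S Red Blue for S Red Blue :: "('a::division_ring^'n) set set" +
  fixes P :: "('a^'n) set" and u :: "('a^'n) set \<Rightarrow> 'a^'n"
  assumes l3: "\<And>l. l \<in> r.lines \<Longrightarrow> card l = 3" and PS: "P \<in> S"
    and u: "\<And>A. A \<in> S \<Longrightarrow> \<exists>k. k \<noteq> 0 \<and> u A = k *s vec A"
    and uP: "\<And>A C. A \<in> S \<Longrightarrow> A \<noteq> P \<Longrightarrow> C \<in> LL P A \<Longrightarrow> C \<noteq> P \<Longrightarrow> C \<noteq> A \<Longrightarrow> u C = - (u P + u A)"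
begin

definition "st A B = (THE C. C \<in> LL A B \<and> C \<noteq> A \<and> C \<noteq> B)"

lemma ex3: "A \<in> S \<Longrightarrow> B \<in> S \<Longrightarrow> A \<noteq> B \<Longrightarrow> \<exists>!C. C \<in> LL A B \<and> C \<noteq> A \<and> C \<noteq> B"
  by (rule r.third_unique) (use l3 r.L_lines in auto)

lemma st: assumes "A \<in> S" "B \<in> S" "A \<noteq> B" shows "st A B \<in> LL A B" "st A B \<noteq> A" "st A B \<noteq> B" "st A B \<in> S" "LL A B = {A, B, st A B}"
proof -
  have t: "st A B \<in> LL A B \<and> st A B \<noteq> A \<and> st A B \<noteq> B" unfolding st_def by (rule theI'[OF ex3[OF assms]])
  then show "st A B \<in> LL A B" "st A B \<noteq> A" "st A B \<noteq> B" by auto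
  show "st A B \<in> S" using t unfolding LL_def by auto
  have "C \<in> {A, B, st A B}" if "C \<in> LL A B" for C using ex3[OF assms] t that by (metis insert_iff)
  then show "LL A B = {A, B, st A B}" using t r.L_l[OF assms] r.L_r[OF assms] by (intro equalityI subsetI) auto
qed

lemma st_eq: "A \<in> S \<Longrightarrow> B \<in> S \<Longrightarrow> A \<noteq> B \<Longrightarrow> C \<in> LL A B \<Longrightarrow> C \<noteq> A \<Longrightarrow> C \<noteq> B \<Longrightarrow> st A B = C"
  unfolding st_def by (rule the1_equality[OF ex3]) simp_all

lemma st_comm: "A \<in> S \<Longrightarrow> B \<in> S \<Longrightarrow> A \<noteq> B \<Longrightarrow> st B A = st A B"
proof -
  assume a: "A \<in> S" "B \<in> S" "A \<noteq> B"
  note s = st[OF a]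
  show "st B A = st A B" by (rule st_eq[OF a(2,1) a(3)[symmetric] _ s(3,2)]) (use s(1) r.L_comm[OF a] in simp)
qed

lemma st_st: "A \<in> S \<Longrightarrow> B \<in> S \<Longrightarrow> A \<noteq> B \<Longrightarrow> st A (st A B) = B"
proof -
  assume a: "A \<in> S" "B \<in> S" "A \<noteq> B"
  note s = st[OF a]
  have "LL A (st A B) = LL A B" using r.L_eq[OF a r.L_l[OF a] s(1)] s(2) by metis
  then show ?thesis using st_eq[OF a(1) s(4) s(2)[symmetric], of B] r.L_r[OF a] a s by auto
qed

definition "nc3 A B C \<longleftrightarrow> A \<in> S \<and> B \<in> S \<and> C \<in> S \<and> A \<noteq> B \<and> C \<notin> LL A B"

lemma nc3_swap: "nc3 A B C \<Longrightarrow> nc3 B A C" unfolding nc3_def using r.L_comm by metis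
lemma nc3_rot: "nc3 A B C \<Longrightarrow> nc3 A C B"
proof -
  assume h: "nc3 A B C"
  then have S: "A \<in> S" "B \<in> S" "C \<in> S" "A \<noteq> B" "C \<notin> LL A B" unfolding nc3_def by auto
  have AC: "A \<noteq> C" using S r.L_l[OF S(1,2,4)] by auto
  have "B \<notin> LL A C"
  proof
    assume "B \<in> LL A C"
    then have "LL A B = LL A C" using r.L_eq[OF S(1,3) AC r.L_l[OF S(1,3) AC], of B] S by auto
    then show False using r.L_r[OF S(1,3) AC] S by auto
  qed
  then show ?thesis unfolding nc3_def using S AC by auto
qed
lemma nc3_st: "nc3 A B C \<Longrightarrow> nc3 A (st A B) C"
proof -
  assume h: "nc3 A B C"
  then have S: "A \<in> S" "B \<in> S" "C \<in> S" "A \<noteq> B" "C \<notin> LL A B" unfolding nc3_def by auto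
  note s = st[OF S(1,2,4)]
  have "LL A (st A B) = LL A B" using r.L_eq[OF S(1,2,4) r.L_l[OF S(1,2,4)] s(1)] s(2) by metis
  then show ?thesis unfolding nc3_def using S s by auto
qed
lemma nc3D: "nc3 A B C \<Longrightarrow> A \<in> S \<and> B \<in> S \<and> C \<in> S \<and> A \<noteq> B \<and> A \<noteq> C \<and> B \<noteq> C"
  using nc3_rot[of A B C] nc3_rot[OF nc3_swap, of A B C] unfolding nc3_def by auto

lemma ind: "nc3 A B C \<Longrightarrow> x *s u A + y *s u B + z *s u C = 0 \<Longrightarrow> x = 0 \<and> y = 0 \<and> z = 0"
proof -
  assume n: "nc3 A B C" and e: "x *s u A + y *s u B + z *s u C = 0"
  then have S: "A \<in> S" "B \<in> S" "C \<in> S" "A \<noteq> B" "C \<notin> LL A B" unfolding nc3_def by auto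
  obtain i j k where k: "i \<noteq> 0" "u A = i *s vec A" "j \<noteq> 0" "u B = j *s vec B" "k \<noteq> 0" "u C = k *s vec C" using u[OF S(1)] u[OF S(2)] u[OF S(3)] by blast
  have "(x * i) *s vec A + (y * j) *s vec B + (z * k) *s vec C = 0" using e unfolding k by (simp only: smult_smult)
  then have m: "(x * i) *s vec A + (y * j) *s vec B + (z * k) *s vec C \<in> {0}" by simp
  show ?thesis using r.ind3[OF S m] k(1,3,5) by simp
qed

lemma u_line: "A \<in> S \<Longrightarrow> B \<in> S \<Longrightarrow> A \<noteq> B \<Longrightarrow> C \<in> LL A B \<Longrightarrow> \<exists>s t. u C = s *s u A + t *s u B"
proof -
  assume S: "A \<in> S" "B \<in> S" "A \<noteq> B" and C: "C \<in> LL A B"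
  have CS: "C \<in> S" using C unfolding LL_def by simp
  obtain i j k where k: "i \<noteq> 0" "u A = i *s vec A" "j \<noteq> 0" "u B = j *s vec B" "u C = k *s vec C" using u[OF S(1)] u[OF S(2)] u[OF CS] by blast
  obtain x y where "vec C - x *s vec A - y *s vec B \<in> {0}" using r.L_E[OF S C] by metis
  then have "vec C = x *s vec A + y *s vec B" by (simp add: algebra_simps)
  then have "u C = (k * x * inverse i) *s u A + (k * y * inverse j) *s u B"
    unfolding k using k(1,3) by (simp add: vec_eq_iff algebra_simps cancel flip: mult.assoc)
  then show ?thesis by blast
qed

lemma uP_st: "A \<in> S \<Longrightarrow> A \<noteq> P \<Longrightarrow> u (st P A) = - (u P + u A)"
  using uP st[of P A] PS by metis

lemma u_inj: "A \<in> S \<Longrightarrow> B \<in> S \<Longrightarrow> A \<noteq> B \<Longrightarrow> u A \<noteq> x *s u B"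
proof
  assume S: "A \<in> S" "B \<in> S" "A \<noteq> B" and e: "u A = x *s u B"
  obtain i j where k: "i \<noteq> 0" "u A = i *s vec A" "u B = j *s vec B" using u[OF S(1)] u[OF S(2)] by blast
  have "vec A = inverse i *s u A" unfolding k(2) by (simp only: inv_smult[OF k(1)])
  also have "\<dots> = (inverse i * x * j) *s vec B" unfolding e k(3) by (simp only: smult_smult mult.assoc)
  finally have "vec A = (inverse i * x * j) *s vec B" .
  then have "vec A - (inverse i * x * j) *s vec B \<in> {0}" by simp
  then have "vec A \<in> adj {0} (vec B)" unfolding in_adj by blast
  then show False using r.dist[OF S(2,1)] S(3) by auto
qed

text \<open>In the plane of seven points the lines \<open>P C\<close> and \<open>A E\<close> meet, where \<open>C\<close> and \<open>E\<close> are third points. Expressing the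
  intersection in two ways determines one coefficient; exchanging \<open>A\<close> and \<open>B\<close> gives the other.\<close>

lemma star7:
  assumes p7: "\<And>\<pi>. sp.plane \<pi> \<Longrightarrow> card \<pi> = 7" and two: "(2::'a) = 0" and n: "nc3 P A B"
  shows "\<exists>s. u (st A B) = s *s u A - u B"
proof -
  have S: "A \<in> S" "B \<in> S" "P \<noteq> A" "P \<noteq> B" "A \<noteq> B" "B \<notin> LL P A" using n nc3D[OF n] unfolding nc3_def by auto
  have pl: "sp.plane (PP P A B)" using sp.planeI[OF PS S(1,2,3,6)] .
  interpret c: chromatic "PP P A B" LL "Red \<inter> PP P A B" "Blue \<inter> PP P A B" "CHAR('a)" by (rule sp.plane_chromatic(1)[OF pl])
  define C where "C = st A B"
  define E where "E = st P B"
  note C = st[OF S(1,2,5), folded C_def] and E = st[OF PS S(2,4), folded E_def]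
  have nE: "nc3 P E A" unfolding E_def by (rule nc3_st[OF nc3_rot[OF n]])
  have PC: "P \<noteq> C"
  proof
    assume "P = C"
    then show False using C(1) nc3_rot[OF nc3_swap[OF n]] nc3_swap[OF nc3_rot[OF n]] nc3_rot[OF nc3_swap[OF nc3_rot[OF n]]] nc3_swap[OF nc3_rot[OF nc3_swap[OF n]]] nc3_rot[OF nc3_swap[OF n]] r.L_comm[OF S(1,2,5)] unfolding nc3_def by auto
  qed
  have m: "P \<in> PP P A B" "A \<in> PP P A B" "B \<in> PP P A B" using sp.Pl_mem[OF PS S(1,2,3,6)] by auto
  have mC: "C \<in> PP P A B" "E \<in> PP P A B" using sp.plane_closed[OF pl m(2,3) S(5)] sp.plane_closed[OF pl m(1,3) S(4)] C(1) E(1) by auto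
  have nE': "A \<noteq> E" "P \<notin> LL A E" using nc3D[OF nE] nc3_rot[OF nc3_swap[OF nc3_rot[OF nE]]] unfolding nc3_def by (auto simp: r.L_comm)
  have "\<exists>G\<in>LL A E. G \<in> LL P C"
  proof (rule c.crossing_seven)
    show "card (PP P A B) = 7" by (rule p7[OF pl])
    show "card l = 3" if l: "l \<in> c.lines" for l
    proof -
      obtain x y where xy: "x \<in> PP P A B" "y \<in> PP P A B" "x \<noteq> y" "l = LL x y" using l unfolding c.lines_def by blast
      show ?thesis unfolding xy(4) by (rule l3[OF r.L_lines[OF subsetD[OF sp.plane_sub[OF pl] xy(1)] subsetD[OF sp.plane_sub[OF pl] xy(2)] xy(3)]])
    qed
    show "P \<in> PP P A B" by (rule m)
    show "LL A E \<in> c.lines" by (rule c.L_lines[OF m(2) mC(2) nE'(1)])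
    show "P \<notin> LL A E" by (rule nE')
    show "LL P C \<in> c.pen P" using mC PC unfolding pencil_def by auto
  qed
  then obtain G where G: "G \<in> LL A E" "G \<in> LL P C" by blast
  have GP: "G \<noteq> P" using G nE' by auto
  obtain s t where st': "u C = s *s u A + t *s u B" using u_line[OF S(1,2,5) C(1)] by blast
  obtain x y where xy: "u G = x *s u A + y *s u E" using u_line[OF S(1) E(4) nE'(1) G(1)] by blast
  have uE: "u E = - (u P + u B)" unfolding E_def by (rule uP_st) (use S in auto)
  have GC: "G \<noteq> C"
  proof
    assume "G = C"
    then have "y *s u P + (s - x) *s u A + (t + y) *s u B = 0" using xy st' unfolding uE by (simp add: vec_eq_iff algebra_simps)
    then have "t = 0" using ind[OF n] by fastforce
    then have "u C = s *s u A" using st' by (simp add: zero_smult)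
    then show False using u_inj[OF C(4) S(1) C(2)] by simp
  qed
  have uG: "u G = - (u P + u C)" by (rule uP[OF C(4) PC[symmetric] G(2) GP GC])
  have "(y - 1) *s u P + (- s - x) *s u A + (y - t) *s u B = 0" using xy uG unfolding uE st' by (simp add: vec_eq_iff algebra_simps)
  then have "y - 1 = 0" "y - t = 0" using ind[OF n] by blast+
  then have "t = 1" by simp
  moreover have "(1::'a) = -1" using two by (metis add_eq_0_iff one_add_one)
  ultimately have "u C = s *s u A - u B" using st' by (metis add_uminus_conv_diff vector_sneg_minus1)
  then show ?thesis unfolding C_def by blast
qed

lemma law9:
  assumes p9: "\<And>\<pi>. sp.plane \<pi> \<Longrightarrow> card \<pi> = 9" and n: "nc3 X A B"
  shows "st (st X A) (st X B) = st X (st A B)" "X \<noteq> st A B" "st X A \<noteq> st X B"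
proof -
  have S: "X \<in> S" "A \<in> S" "B \<in> S" "X \<noteq> A" "X \<noteq> B" "A \<noteq> B" "B \<notin> LL X A" using n nc3D[OF n] unfolding nc3_def by auto
  have pl: "sp.plane (PP X A B)" using sp.planeI[OF S(1,2,3,4,7)] .
  interpret c: chromatic "PP X A B" LL "Red \<inter> PP X A B" "Blue \<inter> PP X A B" "CHAR('a)" by (rule sp.plane_chromatic(1)[OF pl])
  have m: "X \<in> PP X A B" "A \<in> PP X A B" "B \<in> PP X A B" using sp.Pl_mem[OF S(1,2,3,4,7)] by auto
  have c3: "card l = 3" if l: "l \<in> c.lines" for l
  proof -
    obtain x y where xy: "x \<in> PP X A B" "y \<in> PP X A B" "x \<noteq> y" "l = LL x y" using l unfolding c.lines_def by blast
    show ?thesis unfolding xy(4) by (rule l3[OF r.L_lines[OF subsetD[OF sp.plane_sub[OF pl] xy(1)] subsetD[OF sp.plane_sub[OF pl] xy(2)] xy(3)]])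
  qed
  note D = st[OF S(1,2,4)] and E = st[OF S(1,3,5)] and C = st[OF S(2,3,6)]
  obtain G where G: "G \<in> LL (st X A) (st X B)" "G \<in> LL X (st A B)" "G \<noteq> X" "G \<noteq> st A B" "G \<noteq> st X A" "G \<noteq> st X B"
    using c.star_law[OF p9[OF pl] c3 m S(4,7) D(1,2,3) E(1,2,3) C(1,2,3)] by blast
  have "nc3 A B X" using nc3_rot[OF nc3_swap[OF n]] by simp
  then show 1: "X \<noteq> st A B" using C(1) unfolding nc3_def by auto
  have "nc3 X (st X A) (st X B)" using nc3_rot[OF nc3_st[OF nc3_rot[OF nc3_st[OF n]]]] .
  then show 2: "st X A \<noteq> st X B" using nc3D by blast
  show "st (st X A) (st X B) = st X (st A B)"
    using st_eq[OF D(4) E(4) 2 G(1,5,6)] st_eq[OF S(1) C(4) 1 G(2,3,4)] by simp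
qed

text \<open>The law of reflections at \<open>P\<close> shows that the coefficients \<open>s\<close> and \<open>t\<close> of the third point add up to one. Reflections at \<open>A\<close> and \<open>B\<close> give
  \<open>s\<^sup>2 - s + 1 = 0\<close>, which is \<open>(s + 1)\<^sup>2 = 0\<close> in characteristic three.\<close>

lemma star9:
  assumes p9: "\<And>\<pi>. sp.plane \<pi> \<Longrightarrow> card \<pi> = 9" and three: "(3::'a) = 0" and n: "nc3 P A B"
  shows "u (st A B) = - (u A + u B)"
proof -
  have F: "s + t = 1" if n: "nc3 P A B" and e: "u (st A B) = s *s u A + t *s u B" for A B s t
  proof -
    have S: "A \<in> S" "B \<in> S" "P \<noteq> A" "P \<noteq> B" "A \<noteq> B" using nc3D[OF n] by auto
    note l = law9[OF p9 n]
    have uG: "u (st P (st A B)) = - (u P + u (st A B))" by (rule uP_st) (use st[OF S(1,2,5)] l in auto)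
    have "st (st P A) (st P B) \<in> LL (st P A) (st P B)" by (rule st) (use st[OF PS S(1,3)] st[OF PS S(2,4)] l in auto)
    then obtain x y where "u (st P (st A B)) = x *s u (st P A) + y *s u (st P B)"
      using u_line[of "st P A" "st P B"] st[OF PS S(1,3)] st[OF PS S(2,4)] l by metis
    moreover have "u (st P A) = - (u P + u A)" "u (st P B) = - (u P + u B)" using uP_st S by auto
    ultimately have "(x + y - 1) *s u P + (x - s) *s u A + (y - t) *s u B = 0" using uG e by (simp add: vec_eq_iff algebra_simps)
    then have "x + y - 1 = 0" "x - s = 0" "y - t = 0" using ind[OF n] by blast+
    then show ?thesis by simp
  qed
  have S: "A \<in> S" "B \<in> S" "P \<noteq> A" "P \<noteq> B" "A \<noteq> B" using nc3D[OF n] by auto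
  define C D E G H K where "C = st A B" and "D = st P A" and "E = st P B" and "G = st P C" and "H = st D B" and "K = st P H"
  note defs = C_def D_def E_def G_def H_def K_def
  note sA = st[OF PS S(1,3), folded D_def] and sB = st[OF PS S(2,4), folded E_def] and sC = st[OF S(1,2,5), folded C_def]
  have nPDB: "nc3 P D B" unfolding D_def by (rule nc3_st[OF n])
  have nPEA: "nc3 P E A" unfolding E_def by (rule nc3_st[OF nc3_rot[OF n]])
  have AD: "st A P = D" unfolding D_def using st_comm[OF PS S(1,3)] .
  have BE: "st B P = E" unfolding E_def using st_comm[OF PS S(2,4)] .
  have "st A D = P" using st_st[OF S(1) PS S(3)[symmetric]] unfolding AD .
  have "st B E = P" using st_st[OF S(2) PS S(4)[symmetric]] unfolding BE .
  have nADE: "nc3 A D E" using nc3_st[OF nc3_swap[OF nc3_rot[OF nPEA]]] unfolding AD .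
  have nBED: "nc3 B E D" using nc3_st[OF nc3_swap[OF nc3_rot[OF nPDB]]] unfolding BE .
  have nBDE: "nc3 B D E" by (rule nc3_rot[OF nBED])
  note l1 = law9[OF p9 n, folded defs] and l2 = law9[OF p9 nPDB] and l3' = law9[OF p9 nADE] and l4 = law9[OF p9 nBDE]
  have PD: "st P D = A" unfolding D_def by (rule st_st[OF PS S(1,3)])
  have GDE: "G = st D E" using l1 unfolding G_def by simp
  have DBS: "D \<in> S" "D \<noteq> B" "P \<noteq> D" using nc3D[OF nPDB] by auto
  note sH = st[OF DBS(1) S(2) DBS(2), folded H_def]
  have PH: "P \<noteq> H" using l2(2) unfolding H_def .
  have AE: "st A E = K" using l2(1) unfolding PD E_def[symmetric] H_def[symmetric] K_def[symmetric] .
  have PK: "st P K = H" unfolding K_def by (rule st_st[OF PS sH(4) PH])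
  have "st A G = st P K" using l3'(1) unfolding \<open>st A D = P\<close> AE GDE[symmetric] by simp
  then have AGH: "st A G = H" using PK by simp
  have AG: "A \<noteq> G" using l3'(2) unfolding GDE .
  have "st (st B D) P = st B G" using l4(1) unfolding \<open>st B E = P\<close> GDE[symmetric] .
  moreover have "st B D = H" unfolding H_def by (rule st_comm[OF DBS(1) S(2) DBS(2)])
  ultimately have BGK: "st B G = K" unfolding K_def using st_comm[OF PS sH(4) PH] by simp
  have BG: "B \<noteq> G" using l4(2) unfolding GDE .
  have PC: "P \<noteq> C" using l1(2) unfolding C_def .
  note sG = st[OF PS sC(4) PC, folded G_def]
  obtain s t where uC: "u C = s *s u A + t *s u B" using u_line[OF S(1,2,5) sC(1)] by blast
  obtain s' t' where uH: "u H = s' *s u D + t' *s u B" using u_line[OF DBS(1) S(2) DBS(2) sH(1)] by blast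
  have st1: "s + t = 1" "s' + t' = 1" using F[OF n uC[unfolded C_def]] F[OF nPDB uH[unfolded H_def]] by auto
  have uD: "u D = - (u P + u A)" and uG: "u G = - (u P + u C)" and uK: "u K = - (u P + u H)"
    unfolding D_def G_def K_def using uP_st S sC(4) PC sH(4) PH by auto
  obtain x y where xy: "u H = x *s u A + y *s u G" using u_line[OF S(1) sG(4) AG] st(1)[OF S(1) sG(4) AG] AGH by metis
  obtain z w where zw: "u K = z *s u B + w *s u G" using u_line[OF S(2) sG(4) BG] st(1)[OF S(2) sG(4) BG] BGK by metis
  have "(y - s') *s u P + (y * s - s' - x) *s u A + (t' + y * t) *s u B = 0"
    using xy unfolding uH uG uD uC by (simp add: vec_eq_iff algebra_simps)
  from ind[OF n this] have e1: "y = s'" "t' + s' * t = 0" by auto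
  have "(w - (1 - s')) *s u P + (s' + w * s) *s u A + (w * t - t' - z) *s u B = 0"
    using zw unfolding uK uH uG uD uC by (simp add: vec_eq_iff algebra_simps)
  from ind[OF n this] have e2: "w = 1 - s'" "s' + w * s = 0" by auto
  have t: "t = 1 - s" "t' = 1 - s'" using st1 by (simp_all add: algebra_simps)
  have a1: "s' * s = 1" using e1(2) unfolding t by (simp add: algebra_simps)
  have "s' + s - s' * s * s = s' * 1 + s - s' * s * s" by simp
  have "s' + s - s' * s = 0" using e2(2) unfolding e2(1) by (simp add: algebra_simps)
  then have s'e: "s' = 1 - s" using a1 by (simp add: algebra_simps)
  have "(1 - s) * s = 1" using a1 unfolding s'e .
  then have q: "s - s * s = 1" by (simp add: algebra_simps)
  have "(s + 1) * (s + 1) = (s + s + s) + (1 - (s - s * s))" by (simp add: algebra_simps)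
  moreover have "s + s + s = (1 + 1 + 1) * s" by (simp only: distrib_right mult_1_left)
  moreover have "(1 + 1 + 1 :: 'a) = 0" using three by simp
  ultimately have "(s + 1) * (s + 1) = 0" using q by (simp only: diff_self mult_zero_left add_0_left)
  then have "s + 1 = 0" by simp
  then have s1: "s = -1" by (simp add: eq_neg_iff_add_eq_0)
  have "t + 1 = 3" using t(1) s1 by simp
  then have "t = -1" using three by (simp add: eq_neg_iff_add_eq_0)
  then show ?thesis using uC s1 unfolding C_def by (simp add: vec_eq_iff)
qed

end

section \<open>The two extremal geometries\<close>

context coloured_points begin

lemma two_independent: "A \<in> S \<Longrightarrow> B \<in> S \<Longrightarrow> A \<noteq> B \<Longrightarrow> x *s vec A + y *s vec B = 0 \<Longrightarrow> x = 0"
proof (rule ccontr)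
  assume S: "A \<in> S" "B \<in> S" "A \<noteq> B" and e: "x *s vec A + y *s vec B = 0" and x: "x \<noteq> 0"
  have "vec A - (- (inverse x * y)) *s vec B = inverse x *s (x *s vec A + y *s vec B)"
    using x by (simp add: vec_eq_iff algebra_simps flip: mult.assoc)
  also have "\<dots> = 0" unfolding e by (simp add: vec_eq_iff)
  finally have "vec A \<in> adj {0} (vec B)" unfolding in_adj by blast
  then show False using r.dist[OF S(2,1)] S(3) by auto
qed

lemma normalise:
  assumes l3: "\<And>l. l \<in> r.lines \<Longrightarrow> card l = 3" and P: "P \<in> S"
  shows "\<exists>u. triples S Red Blue P u"
proof -
  have ex: "\<exists>w. (\<exists>k. k \<noteq> 0 \<and> w = k *s vec A) \<and> (\<forall>C. C \<in> LL P A \<and> C \<noteq> P \<and> C \<noteq> A \<longrightarrow> (\<exists>m. vec C = m *s (vec P + w)))" if A: "A \<in> S" "A \<noteq> P" for A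
  proof -
    note PA = P A(1) A(2)[symmetric]
    have "\<exists>!C. C \<in> LL P A \<and> C \<noteq> P \<and> C \<noteq> A" by (rule r.third_unique[OF PA l3[OF r.L_lines[OF PA]]])
    then obtain C where C': "C \<in> LL P A \<and> C \<noteq> P \<and> C \<noteq> A" and un0: "\<forall>D. D \<in> LL P A \<and> D \<noteq> P \<and> D \<noteq> A \<longrightarrow> D = C" by (rule ex1E)
    from C' have C: "C \<in> LL P A" "C \<noteq> P" "C \<noteq> A" by simp_all
    have un: "D = C" if "D \<in> LL P A" "D \<noteq> P" "D \<noteq> A" for D
      using un0[THEN spec, of D] that by simp
    have CS: "C \<in> S" using C unfolding LL_def by simp
    obtain x y where "vec C - x *s vec P - y *s vec A \<in> {0}" using r.L_E[OF PA C(1)] by metis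
    then have e: "vec C = x *s vec P + y *s vec A" by (simp add: algebra_simps)
    have x0: "x \<noteq> 0"
    proof
      assume "x = 0"
      then have "1 *s vec C + (- y) *s vec A = 0" using e by (simp add: vec_eq_iff)
      from two_independent[OF CS A(1) C(3) this] show False by simp
    qed
    have y0: "y \<noteq> 0"
    proof
      assume "y = 0"
      then have "1 *s vec C + (- x) *s vec P = 0" using e by (simp add: vec_eq_iff)
      from two_independent[OF CS P C(2) this] show False by simp
    qed
    have "vec C = x *s (vec P + (inverse x * y) *s vec A)" unfolding e using x0 by (simp add: vec_eq_iff algebra_simps flip: mult.assoc)
    moreover have "inverse x * y \<noteq> 0" using x0 y0 by simp
    ultimately have m: "vec C = x *s (vec P + (inverse x * y) *s vec A)" "inverse x * y \<noteq> 0" by simp_all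
    show ?thesis
    proof (intro exI[of _ "(inverse x * y) *s vec A"] conjI allI impI)
      show "\<exists>k. k \<noteq> 0 \<and> (inverse x * y) *s vec A = k *s vec A" by (rule exI[of _ "inverse x * y"]) (rule conjI[OF m(2) refl])
      fix D assume D: "D \<in> LL P A \<and> D \<noteq> P \<and> D \<noteq> A"
      have "D = C" by (rule un) (use D in simp_all)
      then show "\<exists>m. vec D = m *s (vec P + (inverse x * y) *s vec A)" using m(1) by (intro exI[of _ x]) simp
    qed
  qed
  have "\<forall>A\<in>S - {P}. \<exists>w. (\<exists>k. k \<noteq> 0 \<and> w = k *s vec A) \<and> (\<forall>C. C \<in> LL P A \<and> C \<noteq> P \<and> C \<noteq> A \<longrightarrow> (\<exists>m. vec C = m *s (vec P + w)))" using ex by blast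
  from bchoice[OF this] obtain w where w: "\<forall>A\<in>S - {P}. (\<exists>k. k \<noteq> 0 \<and> w A = k *s vec A) \<and> (\<forall>C. C \<in> LL P A \<and> C \<noteq> P \<and> C \<noteq> A \<longrightarrow> (\<exists>m. vec C = m *s (vec P + w A)))" by blast
  define u where "u A = (if A = P then vec P else w A)" for A
  have uk: "\<exists>k. k \<noteq> 0 \<and> u A = k *s vec A" if "A \<in> S" for A
  proof (cases "A = P")
    case True
    then show ?thesis unfolding u_def by (intro exI[of _ 1]) (simp add: vec_eq_iff)
  next
    case False
    then show ?thesis using w that unfolding u_def by auto
  qed
  have um: "\<exists>m. vec C = m *s (vec P + u A)" if "A \<in> S" "A \<noteq> P" "C \<in> LL P A" "C \<noteq> P" "C \<noteq> A" for A C
    using bspec[OF w, of A] that unfolding u_def by simp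
  have "triples S Red Blue P u"
  proof
    show "card l = 3" if "l \<in> r.lines" for l by (rule l3[OF that])
    show "P \<in> S" by (rule P)
    show "\<exists>k. k \<noteq> 0 \<and> u A = k *s vec A" if "A \<in> S" for A by (rule uk[OF that])
    fix A C assume A: "A \<in> S" "A \<noteq> P" and C: "C \<in> LL P A" "C \<noteq> P" "C \<noteq> A"
    note PA = P A(1) A(2)[symmetric]
    have CS: "C \<in> S" using C unfolding LL_def by simp
    have AC: "A \<in> LL P C" using r.L_eq[OF PA r.L_l[OF PA] C(1) C(2)[symmetric]] r.L_r[OF PA] by simp
    obtain m where m: "vec C = m *s (vec P + u A)" using um[OF A C] by blast
    obtain m' where m': "vec A = m' *s (vec P + u C)" using um[OF CS C(2) AC A(2) C(3)[symmetric]] by blast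
    obtain k where k: "k \<noteq> 0" "u C = k *s vec C" using uk[OF CS] by blast
    obtain i where i: "i \<noteq> 0" "u A = i *s vec A" using uk[OF A(1)] by blast
    have uC: "u C = (k * m) *s (vec P + u A)" unfolding k(2) m smult_smult by (rule refl)
    have m'0: "m' \<noteq> 0"
    proof
      assume "m' = 0"
      then have "vec A = 0" using m' by (simp add: zero_smult)
      then show False using r.vW[OF A(1)] by simp
    qed
    have "m' *s (vec P + (k * m) *s (vec P + i *s vec A)) = vec A" using m' unfolding uC i(2) by simp
    then have "(m' * (1 + k * m)) *s vec P + (m' * (k * m) * i - 1) *s vec A = 0" by (simp add: vec_eq_iff algebra_simps)
    then have "m' * (1 + k * m) = 0" by (rule two_independent[OF PA])
    then have "1 + k * m = 0" using m'0 by simp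
    then have "k * m = -1" by (simp add: eq_neg_iff_add_eq_0 add.commute)
    then show "u C = - (u P + u A)" unfolding uC by (simp add: u_def vec_eq_iff)
  qed
  then show ?thesis by blast
qed

end

context triples begin

lemma all_sums:
  assumes star: "\<And>A B. nc3 P A B \<Longrightarrow> u (st A B) = - (u A + u B)" and S: "A \<in> S" "B \<in> S" "A \<noteq> B"
  shows "u (st A B) = - (u A + u B)"
proof -
  consider "A = P" | "B = P" | "A \<noteq> P" "B \<noteq> P" "B \<in> LL P A" | "A \<noteq> P" "B \<noteq> P" "B \<notin> LL P A" by blast
  then show ?thesis
  proof cases
    case 1
    then show ?thesis using uP_st[of B] S by auto
  next
    case 2
    then show ?thesis using uP_st[of A] st_comm[of P A] S by (auto simp: add.commute)
  next
    case 3
    note PA = PS S(1) 3(1)[symmetric]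
    have B: "st P A = B" by (rule st_eq[OF PA 3(3) 3(2) S(3)[symmetric]])
    have "st A B = P" using st_st[OF S(1) PS 3(1)] st_comm[OF PA] B by simp
    moreover have "u B = - (u P + u A)" using uP_st[OF S(1) 3(1)] B by simp
    ultimately show ?thesis by simp
  next
    case 4
    then show ?thesis using star[of A B] S PS unfolding nc3_def by auto
  qed
qed

lemma star7':
  assumes p7: "\<And>\<pi>. sp.plane \<pi> \<Longrightarrow> card \<pi> = 7" and two: "(2::'a) = 0" and n: "nc3 P A B"
  shows "u (st A B) = - (u A + u B)"
proof -
  have S: "A \<in> S" "B \<in> S" "A \<noteq> B" using nc3D[OF n] by auto
  obtain s where s: "u (st A B) = s *s u A - u B" using star7[OF p7 two n] by blast
  obtain t where t: "u (st B A) = t *s u B - u A" using star7[OF p7 two nc3_rot[OF n]] by blast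
  have "0 *s u P + (s + 1) *s u A + (- 1 - t) *s u B = (s *s u A - u B) - (t *s u B - u A)" by (simp add: vec_eq_iff algebra_simps)
  also have "\<dots> = 0" unfolding s[symmetric] t[symmetric] st_comm[OF S] by simp
  finally have "0 *s u P + (s + 1) *s u A + (- 1 - t) *s u B = 0" .
  then have "s + 1 = 0" using ind[OF n] by blast
  then have "s = -1" by (simp add: eq_neg_iff_add_eq_0)
  then show ?thesis using s by (simp add: vec_eq_iff)
qed

lemma frame: "\<exists>A B C. A \<in> S \<and> B \<in> S \<and> C \<in> S \<and>
    (\<forall>x y z w. x *s u P + y *s u A + z *s u B + w *s u C = 0 \<longrightarrow> x = 0 \<and> y = 0 \<and> z = 0 \<and> w = 0)"
proof -
  obtain l m where lm: "l \<in> pencil S LL P" "m \<in> pencil S LL P" "l \<noteq> m" using r.two_pencil_lines[OF PS sp.nt] by blast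
  obtain A where A: "A \<in> S" "A \<noteq> P" "l = LL P A" using r.pen_ex[OF lm(1)] by blast
  obtain B where B: "B \<in> S" "B \<noteq> P" "m = LL P B" using r.pen_ex[OF lm(2)] by blast
  have nB: "B \<notin> LL P A"
  proof
    assume "B \<in> LL P A"
    then have "LL P B = LL P A" using r.L_eq[OF PS A(1) A(2)[symmetric] r.L_l[OF PS A(1) A(2)[symmetric]], of B] B by auto
    then show False using lm A B by simp
  qed
  then have n: "nc3 P A B" unfolding nc3_def using PS A B by auto
  obtain C where C: "C \<in> S" "C \<notin> PP P A B" using sp.dim[OF PS A(1) B(1) A(2)[symmetric] nB] by blast
  let ?M = "adj (adj (adj {0} (vec P)) (vec A)) (vec B)"
  have lM: "lsub ?M" by (intro lsub_adj lsub_zero)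
  have vM: "vec P \<in> ?M" "vec A \<in> ?M" "vec B \<in> ?M" by (simp_all add: adj_self adj_sub lsub_adj lsub_zero)
  have uM: "u X \<in> ?M" if "X \<in> S" "vec X \<in> ?M" for X using u[OF that(1)] lsubD(3)[OF lM that(2)] by auto
  show ?thesis
  proof (rule exI[of _ A], rule exI[of _ B], rule exI[of _ C], rule conjI[OF A(1)], rule conjI[OF B(1)], rule conjI[OF C(1)], intro allI impI)
    fix x y z w assume e: "x *s u P + y *s u A + z *s u B + w *s u C = 0"
    have w0: "w = 0"
    proof (rule ccontr)
      assume w: "w \<noteq> 0"
      obtain k where k: "k \<noteq> 0" "u C = k *s vec C" using u[OF C(1)] by blast
      have M: "x *s u P + y *s u A + z *s u B \<in> ?M"
        using lsubD(2)[OF lM lsubD(2)[OF lM lsubD(3)[OF lM uM[OF PS vM(1)]] lsubD(3)[OF lM uM[OF A(1) vM(2)]]] lsubD(3)[OF lM uM[OF B(1) vM(3)]]] .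
      have "(w * k) *s vec C = (-1) *s (x *s u P + y *s u A + z *s u B)"
        using e unfolding k(2) by (simp add: vec_eq_iff add_eq_0_iff algebra_simps)
      then have "(w * k) *s vec C \<in> ?M" using lsubD(3)[OF lM M] by (simp only:)
      then have "inverse (w * k) *s ((w * k) *s vec C) \<in> ?M" by (rule lsubD(3)[OF lM])
      moreover have wk: "w * k \<noteq> 0" using w k by simp
      ultimately have "vec C \<in> ?M" unfolding inv_smult[OF wk] by blast
      then show False using C unfolding PP_def by simp
    qed
    then have "x *s u P + y *s u A + z *s u B = 0" using e by (simp add: zero_smult)
    then show "x = 0 \<and> y = 0 \<and> z = 0 \<and> w = 0" using ind[OF n] w0 by blast
  qed
qed

lemma u_inj_on: "inj_on u S"
proof (rule inj_onI, rule ccontr)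
  fix A B assume "A \<in> S" "B \<in> S" "u A = u B" "A \<noteq> B"
  then show False using u_inj[of A B 1] by (simp add: vec_eq_iff)
qed

text \<open>An injective map from the model into the scaled vectors that respects the relation \<open>x + y + z = 0\<close> is an isomorphism once
  the numbers of points agree.\<close>

lemma iso_from_map:
  fixes f :: "'b \<Rightarrow> 'a^'n"
  assumes f: "inj_on f M" "\<And>x. x \<in> M \<Longrightarrow> f x \<in> u ` S" and c: "card M = card S" and fM: "finite M"
    and sums: "\<And>A B. A \<in> S \<Longrightarrow> B \<in> S \<Longrightarrow> A \<noteq> B \<Longrightarrow> u (st A B) = - (u A + u B)"
    and LM: "LM = {{x, y, t x y} |x y. x \<in> M \<and> y \<in> M \<and> x \<noteq> y}"
    and t: "\<And>x y. x \<in> M \<Longrightarrow> y \<in> M \<Longrightarrow> x \<noteq> y \<Longrightarrow> t x y \<in> M \<and> f (t x y) = - (f x + f y)"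
  shows "\<exists>h. bij_betw h M S \<and> (`) h ` LM = r.lines"
proof -
  define h where "h x = inv_into S u (f x)" for x
  have h: "h x \<in> S" "u (h x) = f x" if "x \<in> M" for x
    unfolding h_def using inv_into_into[OF f(2)[OF that]] f_inv_into_f[OF f(2)[OF that]] by auto
  have hi: "inj_on h M"
  proof (rule inj_onI)
    fix x y assume x: "x \<in> M" "y \<in> M" and e: "h x = h y"
    have "f x = f y" using h(2)[OF x(1)] h(2)[OF x(2)] e by simp
    then show "x = y" using f(1) x unfolding inj_on_def by blast
  qed
  have hS: "h ` M = S" by (rule card_subset_eq[OF finS]) (use h(1) card_image[OF hi] c in auto)
  have line: "h ` {x, y, t x y} = LL (h x) (h y)" if x: "x \<in> M" "y \<in> M" "x \<noteq> y" for x y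
  proof -
    have n: "h x \<noteq> h y" using hi x unfolding inj_on_def by blast
    have "u (h (t x y)) = u (st (h x) (h y))" using h(2) t[OF x] sums[OF h(1)[OF x(1)] h(1)[OF x(2)] n] x by simp
    then have "h (t x y) = st (h x) (h y)"
      using u_inj_on h(1) t[OF x] st(4)[OF h(1)[OF x(1)] h(1)[OF x(2)] n] unfolding inj_on_def by blast
    then show ?thesis using st(5)[OF h(1)[OF x(1)] h(1)[OF x(2)] n] by simp
  qed
  have "(`) h ` LM = r.lines"
  proof
    show "(`) h ` LM \<subseteq> r.lines"
    proof
      fix k assume "k \<in> (`) h ` LM"
      then obtain x y where x: "x \<in> M" "y \<in> M" "x \<noteq> y" "k = h ` {x, y, t x y}" unfolding LM by blast
      have "h x \<noteq> h y" using hi x unfolding inj_on_def by blast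
      then show "k \<in> r.lines" unfolding x(4) line[OF x(1-3)] by (rule r.L_lines[OF h(1)[OF x(1)] h(1)[OF x(2)]])
    qed
    show "r.lines \<subseteq> (`) h ` LM"
    proof
      fix k assume "k \<in> r.lines"
      then obtain A B where AB: "A \<in> S" "B \<in> S" "A \<noteq> B" "k = LL A B" unfolding r.lines_def by blast
      obtain x y where xy: "x \<in> M" "A = h x" "y \<in> M" "B = h y" using AB hS by blast
      have n: "x \<noteq> y" using xy AB by auto
      have "k = h ` {x, y, t x y}" using line[OF xy(1,3) n] AB xy by simp
      moreover have "{x, y, t x y} \<in> LM" unfolding LM using xy n by blast
      ultimately show "k \<in> (`) h ` LM" by blast
    qed
  qed
  then show ?thesis using hi hS unfolding bij_betw_def by blast
qed

end

lemma bit_smult: "(0::bit) *s x = 0" "(1::bit) *s x = (x :: bit^'n)" "x + x = (0 :: bit^'n)"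
  by (simp_all add: vec_eq_iff)

lemma bit_cases: "(c::bit) = 0 \<or> c = 1" by (metis bit_not_zero_iff)

lemma UNIV_bit_eq: "(UNIV :: bit set) = {0, 1}" using bit_cases by blast

lemma adj_bit: "(x :: bit^'n) \<in> adj W a \<longleftrightarrow> x \<in> W \<or> x + a \<in> W"
proof -
  have "x - c *s a \<in> W \<longleftrightarrow> (if c = 0 then x \<in> W else x + a \<in> W)" for c
  proof (cases "c = 0")
    case False
    then have c1: "c = 1" using bit_cases by blast
    have e: "x - 1 *s a = x + a" by (simp add: vec_eq_iff)
    show ?thesis unfolding c1 e by simp
  qed (simp add: bit_smult)
  then show ?thesis unfolding in_adj by (metis zero_neq_one)
qed

definition pt :: "bit^4 \<Rightarrow> (bit^4) set" where "pt x = {0, x}"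

lemma PG_points: "(proj_points :: (bit^4) set set) = pt ` (UNIV - {0})"
proof -
  have "range (\<lambda>c::bit. c *s v) = pt v" for v :: "bit^4" unfolding UNIV_bit_eq pt_def by (simp add: bit_smult)
  then show ?thesis unfolding proj_points_def by auto
qed

lemma pt_inj: "inj_on pt (UNIV - {0})"
  unfolding inj_on_def pt_def by (auto simp: doubleton_eq_iff)

text \<open>The nonzero vectors with these triples are an intermediate model of \<open>PG(3, 2)\<close>, in which points are vectors instead of
  subspaces.\<close>

definition PM :: "(bit^4) set set" where "PM = {{x, y, x + y} |x y. x \<in> UNIV - {0} \<and> y \<in> UNIV - {0} \<and> x \<noteq> y}"

lemma bit_add_zero: "x + y = 0 \<longleftrightarrow> x = (y :: bit^'n)"
  by (metis add_right_cancel bit_smult(3))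

lemma PM_sub: "l \<in> PM \<Longrightarrow> l \<subseteq> UNIV - {0}"
proof -
  assume "l \<in> PM"
  then obtain x y where "x \<noteq> 0" "y \<noteq> 0" "x \<noteq> y" "l = {x, y, x + y}" unfolding PM_def by blast
  moreover from this have "x + y \<noteq> 0" by (simp add: bit_add_zero)
  ultimately show ?thesis by simp
qed

lemma PG_lines: "{l :: (bit^4) set set. is_line l} = (`) pt ` PM"
proof -
  have span: "x \<in> adj (adj {0} a) b \<longleftrightarrow> x = 0 \<or> x = a \<or> x = b \<or> x = a + b" for x a b :: "bit^4"
  proof -
    have "x + b + a = x + (a + b)" by (simp add: add_ac)
    then show ?thesis by (simp only: adj_bit singleton_iff bit_add_zero disj_assoc)
  qed
  have form: "{P \<in> proj_points. P \<subseteq> adj (adj {0} a) b} = pt ` {a, b, a + b}" if "a \<noteq> 0" "b \<noteq> 0" "a \<noteq> b" for a b :: "bit^4"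
  proof -
    let ?M = "adj (adj {0} a) b"
    have M0: "pt x \<subseteq> ?M \<longleftrightarrow> x \<in> ?M" for x
    proof -
      have "0 \<in> ?M" unfolding span by (rule disjI1) (rule refl)
      then show ?thesis unfolding pt_def by (simp only: insert_subset empty_subsetI simp_thms)
    qed
    have ne: "a + b \<noteq> 0" using that(3) by (simp only: bit_add_zero not_False_eq_True)
    have "{x \<in> UNIV - {0}. pt x \<subseteq> ?M} = {a, b, a + b}" unfolding M0 span using that(1,2) ne by fast
    moreover have "{P \<in> pt ` (UNIV - {0}). P \<subseteq> ?M} = pt ` {x \<in> UNIV - {0}. pt x \<subseteq> ?M}" by blast
    ultimately show ?thesis unfolding PG_points by (simp only:)
  qed
  have one: "b \<notin> adj {0} a \<longleftrightarrow> b \<noteq> 0 \<and> a \<noteq> b" for a b :: "bit^4" unfolding adj_bit by (auto simp: bit_add_zero)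
  show ?thesis
  proof (rule set_eqI, rule iffI)
    fix l :: "(bit^4) set set" assume "l \<in> {l. is_line l}"
    then obtain a b where "a \<noteq> 0" "b \<notin> adj {0} a" "l = {P \<in> proj_points. P \<subseteq> adj (adj {0} a) b}" using line_form[of l] by blast
    then have ab: "a \<noteq> 0" "b \<noteq> 0" "a \<noteq> b" "l = pt ` {a, b, a + b}" using one[of b a] form[of a b] by simp_all
    have "{a, b, a + b} \<in> PM" unfolding PM_def using ab(1-3) by blast
    then show "l \<in> (`) pt ` PM" unfolding ab(4) by (rule imageI)
  next
    fix l :: "(bit^4) set set" assume "l \<in> (`) pt ` PM"
    then obtain a b where ab: "a \<noteq> 0" "b \<noteq> 0" "a \<noteq> b" "l = pt ` {a, b, a + b}" unfolding PM_def by blast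
    have "is_line {P \<in> proj_points. P \<subseteq> adj (adj {0} a) b}" by (rule flat1[OF ab(1)]) (use one[of b a] ab in simp)
    then show "l \<in> {l. is_line l}" unfolding ab(4) form[OF ab(1-3)] by (rule CollectI)
  qed
qed

lemma card_PM: "card (UNIV - {0} :: (bit^4) set) = 15"
proof -
  have "CARD(bit) = 2" unfolding UNIV_bit_eq by simp
  then have "CARD(bit^4) = 16" by simp
  then show ?thesis by (simp add: card_Diff_singleton)
qed

lemma card_PG: "card (proj_points :: (bit^4) set set) = 15"
  unfolding PG_points using card_image[OF pt_inj] card_PM by simp

context coloured_points begin

lemma iso15:
  assumes "card S = 15"
  shows "CHAR('a) = 2 \<and> geometry_iso (induced_geometry S) PG_3_2"
proof -
  note eq = sp.equality15[OF assms]
  have two: "(2::'a) = 0" using of_nat_CHAR[where 'a='a] eq(1) by simp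
  obtain P where P: "P \<in> S" using three_points by blast
  obtain u where "triples S Red Blue P u" using normalise[OF eq(2) P] by blast
  then interpret t: triples S Red Blue P u .
  have sums: "u (t.st X Y) = - (u X + u Y)" if "X \<in> S" "Y \<in> S" "X \<noteq> Y" for X Y
    by (rule t.all_sums[OF _ that]) (rule t.star7'[OF eq(3) two])
  obtain A B C where ABC: "A \<in> S" "B \<in> S" "C \<in> S"
    and ind0: "\<forall>x y z w. x *s u P + y *s u A + z *s u B + w *s u C = 0 \<longrightarrow> x = 0 \<and> y = 0 \<and> z = 0 \<and> w = 0" using t.frame by blast
  have ind: "x = 0 \<and> y = 0 \<and> z = 0 \<and> w = 0" if "x *s u P + y *s u A + z *s u B + w *s u C = 0" for x y z w
    using ind0[THEN spec, THEN spec, THEN spec, THEN spec, THEN mp, OF that] .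
  have m1: "(-1::'a) = 1" using two by (metis add_eq_0_iff one_add_one)
  have neg: "- v = v" for v :: "'a^'n"
  proof -
    have "- v = (-1) *s v" by (simp add: vec_eq_iff)
    then show ?thesis unfolding m1 by (simp add: vec_eq_iff)
  qed
  define bf :: "bit \<Rightarrow> 'a" where "bf c = (if c = 0 then 0 else 1)" for c
  have bf_add: "bf (c + d) = bf c + bf d" for c d using bit_cases[of c] bit_cases[of d] two unfolding bf_def by (elim disjE) simp_all
  define f where "f x = bf (x $ 1) *s u P + bf (x $ 2) *s u A + bf (x $ 3) *s u B + bf (x $ 4) *s u C" for x :: "bit^4"
  have f_add: "f (x + y) = f x + f y" for x y
    unfolding f_def vector_add_component bf_add by (simp add: vec_eq_iff distrib_right add_ac)
  have f0: "x = 0" if "f x = 0" for x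
  proof -
    have "bf (x $ 1) = 0 \<and> bf (x $ 2) = 0 \<and> bf (x $ 3) = 0 \<and> bf (x $ 4) = 0" using ind that unfolding f_def by blast
    then have "x $ 1 = 0 \<and> x $ 2 = 0 \<and> x $ 3 = 0 \<and> x $ 4 = 0" unfolding bf_def by (simp split: if_splits)
    then show ?thesis unfolding vec_eq_iff forall_4 by simp
  qed
  define G where "G = insert 0 (u ` S)"
  have G_add: "v + w \<in> G" if v: "v \<in> G" and w: "w \<in> G" for v w
  proof (cases "v = 0 \<or> w = 0")
    case True
    then show ?thesis using v w by auto
  next
    case False
    then obtain X Y where X: "X \<in> S" "v = u X" and Y: "Y \<in> S" "w = u Y" using v w unfolding G_def by auto
    show ?thesis
    proof (cases "X = Y")
      case True
      then have "v + w = v + - v" using X Y neg by simp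
      then show ?thesis unfolding G_def by simp
    next
      case False
      have "v + w = u (t.st X Y)" using sums[OF X(1) Y(1) False] X Y neg by simp
      then show ?thesis using t.st(4)[OF X(1) Y(1) False] unfolding G_def by simp
    qed
  qed
  have G_bf: "bf c *s u X \<in> G" if "X \<in> S" for c X
    using that unfolding bf_def G_def by (auto simp: zero_smult vec_eq_iff)
  have fG: "f x \<in> G" for x unfolding f_def by (intro G_add G_bf P ABC)
  have fS: "f x \<in> u ` S" if "x \<in> UNIV - {0}" for x using fG[of x] f0[of x] that unfolding G_def by auto
  have f_inj: "inj_on f (UNIV - {0})"
  proof (rule inj_onI)
    fix x y assume "f x = f y"
    then have "f (x + y) = f x + - f x" using f_add neg by simp
    then have "x + y = 0" using f0 by simp
    then show "x = y" by (simp add: bit_add_zero)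
  qed
  have "\<exists>h. bij_betw h (UNIV - {0}) S \<and> (`) h ` PM = r.lines"
  proof (rule t.iso_from_map[OF f_inj fS _ _ sums PM_def])
    show "card (UNIV - {0} :: (bit^4) set) = card S" using card_PM assms by simp
    fix x y :: "bit^4" assume "x \<in> UNIV - {0}" "y \<in> UNIV - {0}" "x \<noteq> y"
    then show "x + y \<in> UNIV - {0} \<and> f (x + y) = - (f x + f y)" using f_add neg by (simp add: bit_add_zero)
  next
    show "finite (UNIV - {0} :: (bit^4) set)" using card_PM by (metis card.infinite zero_neq_numeral)
  qed
  then obtain h where h: "bij_betw h (UNIV - {0}) S" "(`) h ` PM = r.lines" by blast
  have "bij_betw pt (UNIV - {0}) proj_points" unfolding bij_betw_def using pt_inj PG_points by simp
  then have "geometry_iso (S, r.lines) PG_3_2"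
    unfolding PG_3_2_def by (rule geometry_iso_via[OF h _ PG_lines[symmetric] PM_sub])
  then show ?thesis unfolding induced_lines using eq(1) by simp
qed

lemma iso27:
  assumes "CHAR('a) \<noteq> 2" "card S = 27"
  shows "CHAR('a) = 3 \<and> geometry_iso (induced_geometry S) AG_3_3"
proof -
  note eq = sp.equality27[OF assms]
  have three: "(3::'a) = 0" using of_nat_CHAR[where 'a='a] eq(1) by simp
  obtain P where P: "P \<in> S" using three_points by blast
  obtain u where "triples S Red Blue P u" using normalise[OF eq(2) P] by blast
  then interpret t: triples S Red Blue P u .
  have sums: "u (t.st X Y) = - (u X + u Y)" if "X \<in> S" "Y \<in> S" "X \<noteq> Y" for X Y
    by (rule t.all_sums[OF _ that]) (rule t.star9[OF eq(3) three])
  obtain A B C where ABC: "A \<in> S" "B \<in> S" "C \<in> S"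
    and ind0: "\<forall>x y z w. x *s u P + y *s u A + z *s u B + w *s u C = 0 \<longrightarrow> x = 0 \<and> y = 0 \<and> z = 0 \<and> w = 0" using t.frame by blast
  have ind: "x = 0 \<and> y = 0 \<and> z = 0 \<and> w = 0" if "x *s u P + y *s u A + z *s u B + w *s u C = 0" for x y z w
    using ind0[THEN spec, THEN spec, THEN spec, THEN spec, THEN mp, OF that] .
  have triple0: "v + v + v = 0" for v :: "'a^'n"
  proof -
    have "c *s v + d *s v = (c + d) *s v" for c d by (simp add: vec_eq_iff distrib_right)
    moreover have "1 *s v = v" by (simp add: vec_eq_iff)
    ultimately have "v + v + v = (1 + 1 + 1) *s v" by metis
    moreover have "(1 + 1 + 1 :: 'a) = 0" using three by simp
    ultimately show ?thesis by (simp only: zero_smult)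
  qed
  have neg2: "v + v = - v" for v :: "'a^'n" using triple0[of v] by (simp add: eq_neg_iff_add_eq_0)
  have m2: "(1::'a) + 1 = -1" using three by (simp add: eq_neg_iff_add_eq_0)
  have ne: "(1::'a) \<noteq> -1" using m2 by (metis add_cancel_right_right add.inverse_inverse zero_neq_one)
  have ex3: "x = 0 \<or> x = 1 \<or> x = 2" for x :: 3 using exhaust_3[of x] by auto
  define cf :: "3 \<Rightarrow> 'a" where "cf c = (if c = 0 then 0 else if c = 1 then 1 else -1)" for c
  have m2': "(-1::'a) + -1 = 1" using m2 by (metis add.inverse_inverse minus_add_distrib)
  have cf_add: "cf (c + d) = cf c + cf d" for c d
    using ex3[of c] ex3[of d] m2 m2' three unfolding cf_def by (elim disjE) simp_all
  have cf_inj: "c = d" if "cf c = cf d" for c d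
    using that ex3[of c] ex3[of d] ne unfolding cf_def by (auto split: if_splits)
  have cf0: "c = 0" if "cf c = 0" for c using cf_inj[of c 0] that unfolding cf_def by simp
  define f where "f x = cf (x $ 1) *s (u A - u P) + cf (x $ 2) *s (u B - u P) + cf (x $ 3) *s (u C - u P)" for x :: "3^3"
  have f_add: "f (x + y) = f x + f y" for x y
    unfolding f_def vector_add_component cf_add by (simp add: vec_eq_iff algebra_simps)
  have f0: "x = 0" if "f x = 0" for x
  proof -
    have "(- cf (x $ 1) - cf (x $ 2) - cf (x $ 3)) *s u P + cf (x $ 1) *s u A + cf (x $ 2) *s u B + cf (x $ 3) *s u C = f x"
      unfolding f_def by (simp add: vec_eq_iff algebra_simps)
    then have "cf (x $ 1) = 0 \<and> cf (x $ 2) = 0 \<and> cf (x $ 3) = 0" using ind that by metis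
    then have "x $ 1 = 0 \<and> x $ 2 = 0 \<and> x $ 3 = 0" using cf0 by blast
    then show ?thesis unfolding vec_eq_iff forall_3 by simp
  qed
  define G where "G = (\<lambda>X. u X - u P) ` S"
  have G_neg: "- v \<in> G" if v: "v \<in> G" for v
  proof -
    obtain X where X: "X \<in> S" "v = u X - u P" using v unfolding G_def by blast
    show ?thesis
    proof (cases "X = P")
      case True
      then show ?thesis using X v by simp
    next
      case False
      have e: "u (t.st P X) = - (u P + u X)" by (rule sums[OF P X(1)]) (use False in simp)
      have "u (t.st P X) - u P = - u X - (u P + u P)" unfolding e by (simp add: algebra_simps)
      also have "\<dots> = - v" unfolding neg2 X(2) by simp
      finally show ?thesis using t.st(4)[OF P X(1)] False unfolding G_def by (metis image_eqI)
    qed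
  qed
  have G_add: "v + w \<in> G" if v: "v \<in> G" and w: "w \<in> G" for v w
  proof -
    obtain X Y where X: "X \<in> S" "v = u X - u P" and Y: "Y \<in> S" "w = u Y - u P" using v w unfolding G_def by blast
    show ?thesis
    proof (cases "X = Y")
      case True
      then have "w = v" using X(2) Y(2) by simp
      then have "v + w = - v" using neg2[of v] by (simp only:)
      then show ?thesis using G_neg[OF v] by (simp only:)
    next
      case False
      have "- (v + w) = - (u X + u Y) + (u P + u P)" unfolding X(2) Y(2) by simp
      also have "\<dots> = u (t.st X Y) - u P" unfolding neg2 sums[OF X(1) Y(1) False] by simp
      finally have "- (v + w) \<in> G" using t.st(4)[OF X(1) Y(1) False] unfolding G_def by (metis image_eqI)
      then have "- (- (v + w)) \<in> G" by (rule G_neg)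
      then show ?thesis by (simp only: minus_minus)
    qed
  qed
  have G_cf: "cf c *s (u X - u P) \<in> G" if X: "X \<in> S" for c X
  proof -
    have g: "u X - u P \<in> G" "0 \<in> G" using X P unfolding G_def by (auto intro: image_eqI[of _ _ P])
    have "cf c *s (u X - u P) = 0 \<or> cf c *s (u X - u P) = u X - u P \<or> cf c *s (u X - u P) = - (u X - u P)"
      unfolding cf_def by (simp add: zero_smult vec_eq_iff)
    then show ?thesis using g G_neg[OF g(1)] by metis
  qed
  have fG: "f x \<in> G" for x unfolding f_def by (intro G_add G_cf ABC)
  define g where "g x = u P + f x" for x
  have gS: "g x \<in> u ` S" for x using fG[of x] unfolding g_def G_def by auto
  have g_inj: "inj_on g UNIV"
  proof (rule inj_onI)
    fix x y assume "g x = g y"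
    then have e: "f x = f y" unfolding g_def by simp
    have "f (x - y) + f y = f x" using f_add[of "x - y" y, symmetric] by (simp only: diff_add_cancel)
    then have "f (x - y) + f y = 0 + f y" using e by (simp only: add_0_left)
    then have "f (x - y) = 0" by (rule add_right_imp_eq)
    then have "x - y = 0" by (rule f0)
    then show "x = y" by simp
  qed
  have AGl: "snd AG_3_3 = {{x, y, y + y - x} |x y. x \<in> UNIV \<and> y \<in> UNIV \<and> x \<noteq> y}"
  proof -
    have U3: "(UNIV :: 3 set) = {0, 1, 2}" using ex3 by auto
    have r: "range (\<lambda>t::3. p + t *s d) = {p, p + d, (p + d) + (p + d) - p}" for p d :: "3^3"
    proof -
      have "p + 0 *s d = p" "p + 1 *s d = p + d" "p + 2 *s d = (p + d) + (p + d) - p" by (simp_all add: vec_eq_iff algebra_simps)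
      then show ?thesis unfolding U3 by simp
    qed
    show ?thesis
    proof (rule set_eqI, rule iffI)
      fix l assume "l \<in> snd AG_3_3"
      then obtain p d where pd: "d \<noteq> 0" "l = range (\<lambda>t. p + t *s d)" unfolding AG_3_3_def by auto
      have n: "p \<noteq> p + d" using pd(1) by simp
      show "l \<in> {{x, y, y + y - x} |x y. x \<in> UNIV \<and> y \<in> UNIV \<and> x \<noteq> y}" unfolding pd(2) r
        by (rule CollectI, rule exI[of _ p], rule exI[of _ "p + d"], intro conjI refl UNIV_I n)
    next
      fix l assume "l \<in> {{x, y, y + y - x :: 3^3} |x y. x \<in> UNIV \<and> y \<in> UNIV \<and> x \<noteq> y}"
      then obtain x y where xy: "x \<noteq> y" "l = {x, y, y + y - x}" by blast
      have lr: "l = range (\<lambda>t. x + t *s (y - x))" unfolding r xy(2) by simp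
      have n: "y - x \<noteq> 0" using xy by simp
      show "l \<in> snd AG_3_3" unfolding AG_3_3_def snd_conv
        by (rule CollectI, rule exI[of _ x], rule exI[of _ "y - x"], rule conjI[OF lr n])
    qed
  qed
  have "\<exists>h. bij_betw h UNIV S \<and> (`) h ` snd AG_3_3 = r.lines"
  proof (rule t.iso_from_map[OF g_inj gS _ _ sums AGl])
    show "CARD(3^3) = card S" using assms(2) by simp
    fix x y :: "3^3"
    have "f (y + y - x) + f x = f y + f y" using f_add[of "y + y - x" x] f_add[of y y] by simp
    then have "f (y + y - x) = f y + f y - f x" by (simp add: algebra_simps)
    then have "g (y + y - x) = u P - f y - f x" unfolding g_def neg2 by simp
    also have "\<dots> = - (u P + u P) - f y - f x" unfolding neg2 by simp
    also have "\<dots> = - (g x + g y)" unfolding g_def by simp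
    finally show "y + y - x \<in> UNIV \<and> g (y + y - x) = - (g x + g y)" by simp
  qed simp_all
  then obtain h where h: "bij_betw h UNIV S" "(`) h ` snd AG_3_3 = r.lines" by blast
  have b: "bij_betw id (UNIV :: (3^3) set) UNIV" by (rule bij_id)
  have i: "(`) id ` snd AG_3_3 = snd AG_3_3" by simp
  have "geometry_iso (S, r.lines) (UNIV, snd AG_3_3)" by (rule geometry_iso_via[OF h b i]) (rule subset_UNIV)
  moreover have "(UNIV, snd AG_3_3) = AG_3_3" unfolding AG_3_3_def by simp
  ultimately show ?thesis unfolding induced_lines using eq(1) by simp
qed

end

lemma iso_card: "geometry_iso G H \<Longrightarrow> card (fst G) = card (fst H)"
  unfolding geometry_iso_def using bij_betw_same_card by blast

theorem theorem3:
  fixes S Red Blue :: "('a::division_ring^'n) set set"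
  assumes "finite S"
    and "S \<subseteq> proj_points"
    and "S = Red \<union> Blue"
    and "\<forall>A\<in>Blue. \<forall>B\<in>Blue. A \<noteq> B \<longrightarrow>
           (\<exists>C\<in>Red. C \<noteq> A \<and> C \<noteq> B \<and> proj_collinear {A, B, C})"
    and "\<forall>A\<in>Red. \<forall>B\<in>Red. A \<noteq> B \<longrightarrow>
           (\<exists>C\<in>Blue. C \<noteq> A \<and> C \<noteq> B \<and> proj_collinear {A, B, C})"
    and "\<not> proj_coplanar S"
  shows "card S \<ge> 15 \<and>
         (card S = 15 \<longleftrightarrow> CHAR('a) = 2 \<and> geometry_iso (induced_geometry S) PG_3_2) \<and>
         (CHAR('a) \<noteq> 2 \<longrightarrow>
            card S \<ge> 27 \<and>
            (card S = 27 \<longleftrightarrow> CHAR('a) = 3 \<and> geometry_iso (induced_geometry S) AG_3_3)) \<and>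
         (CHAR('a) \<noteq> 2 \<and> CHAR('a) \<noteq> 3 \<longrightarrow> card S \<ge> 51)"
proof -
  interpret coloured_points S Red Blue by (rule coloured_points.intro[OF assms])
  have c15: "card S = 15" if "geometry_iso (induced_geometry S) PG_3_2"
    using iso_card[OF that] card_PG unfolding induced_lines PG_3_2_def by simp
  have c27: "card S = 27" if "geometry_iso (induced_geometry S) AG_3_3"
    using iso_card[OF that] unfolding induced_lines AG_3_3_def by simp
  show ?thesis
  proof (intro conjI impI)
    show "15 \<le> card S" by (rule sp.bound15)
    show "card S = 15 \<longleftrightarrow> CHAR('a) = 2 \<and> geometry_iso (induced_geometry S) PG_3_2"
      by (rule iffI) (use iso15 c15 in simp_all)
    show "27 \<le> card S" if "CHAR('a) \<noteq> 2" by (rule sp.bound27[OF that])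
    show "card S = 27 \<longleftrightarrow> CHAR('a) = 3 \<and> geometry_iso (induced_geometry S) AG_3_3" if "CHAR('a) \<noteq> 2"
      by (rule iffI) (use iso27[OF that] c27 in simp_all)
    show "51 \<le> card S" if "CHAR('a) \<noteq> 2 \<and> CHAR('a) \<noteq> 3"
      by (rule sp.bound51[OF conjunct1[OF that] conjunct2[OF that]])
  qed
qed

end
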